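(* Let $\mathcal{D}=(G,\chi,g,0)$ be a group datum of nilpotent type with $n\ge 2$ the order of $\chi(g)$ and $H=H_{\mathcal D}$. The stable Green ring $r_{st}(H)$ is isomorphic to the quotient ring $r(H)/\mathcal{P}$, where $\mathcal{P}$ is the ideal of the Green ring $r(H)$ generated by the isomorphism classes of indecomposable projective $H$-modules. Precisely, $r_{st}(H)$ is isomorphic to $r(\mathbb{K}G)[z]/(F_n(a,z))$, where $a=[V_{\chi^{-1}}]\in r(\mathbb{K}G)$ and $F_n$ is the Dickson polynomial defined in the context.
   Context: $\mathbb{K}$ is an algebraically closed field of characteristic zero; modules are finite dimensional left modules; $\otimes=\otimes_{\mathbb K}$. Group datum: $G$ is a finite group, $g$ an element of the center of $G$, $\chi:G\to\mathbb{K}^\times$ a linear character, $q=\chi(g)$ has order $n\ge 2$. $H=H_{\mathcal D}$ is the $\mathbb K$-algebra generated by $y$ and the elements $h\in G$, containing $\mathbb{K}G$ as a subalgebra, with relations $y^n=0$ and $yh=\chi(h)hy$ for $h\in G$; it has basis $\{y^ih\mid h\in G,\ 0\le i\le n-1\}$. It is a Hopf algebra with $\Delta(y)=y\otimes g+1\otimes y$, $\varepsilon(y)=0$, $S(y)=-yg^{-1}$, and $\Delta(h)=h\otimes h$, $\varepsilon(h)=1$, $S(h)=h^{-1}$ for $h\in G$. $V_{\chi^{-1}}$ is the one-dimensional $\mathbb{K}G$-module with character $\chi^{-1}$. The Green ring $r(A)$ of a Hopf algebra $A$ is the free abelian group on isomorphism classes $[V]$ of finite dimensional $A$-modules modulo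 $[M\oplus N]=[M]+[N]$, with product $[M][N]=[M\otimes N]$. The stable category $H\text{-}\underline{\mathrm{mod}}$ is the quotient category of $H$-mod (finite dimensional modules) modulo the morphisms factoring through projective modules, with the monoidal structure derived from that of $H$-mod. The stable Green ring $r_{st}(H)$ is the Green ring of $H\text{-}\underline{\mathrm{mod}}$ (free abelian group on isomorphism classes of objects of the stable category modulo $[M\oplus N]=[M]+[N]$, with product induced by $\otimes$). Dickson polynomials: $F_1(y,z)=1$, $F_2(y,z)=z$, $F_i(y,z)=zF_{i-1}(y,z)-yF_{i-2}(y,z)$ for $i\ge 3$. *)

theory Defs
  imports
    "HOL-Algebra.Free_Abelian_Groups"
    "HOL-Algebra.QuotRing"
    "HOL-Algebra.UnivPoly"
    "HOL-Algebra.Multiplicative_Group"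
    "HOL-Library.Poly_Mapping"
    "Jordan_Normal_Form.VS_Connect"
begin

section \<open>Hopf algebras with a finite basis\<close>

text \<open>
  The vector space with basis \<open>S\<close> is the space of functions vanishing outside \<open>S\<close>; its tensor
  square is the space of functions vanishing outside \<open>S \<times> S\<close>.
\<close>

definition bvec :: "'b \<Rightarrow> 'b \<Rightarrow> 'k::zero_neq_one" where
  "bvec b = (\<lambda>c. if c = b then 1 else 0)"

definition lin_ext :: "'b set \<Rightarrow> ('b \<Rightarrow> 'c \<Rightarrow> 'k) \<Rightarrow> ('b \<Rightarrow> 'k) \<Rightarrow> 'c \<Rightarrow> 'k::field" where
  "lin_ext S F x = (\<lambda>c. \<Sum>b\<in>S. x b * F b c)"

definition pure_tensor :: "('b \<Rightarrow> 'k) \<Rightarrow> ('c \<Rightarrow> 'k) \<Rightarrow> 'b \<times> 'c \<Rightarrow> 'k::field" where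
  "pure_tensor x y = (\<lambda>(b, c). x b * y c)"

text \<open>The algebra with basis \<open>S\<close>, products of basis elements \<open>m\<close> and unit \<open>u\<close>.\<close>

definition alg_on :: "'b set \<Rightarrow> ('b \<Rightarrow> 'b \<Rightarrow> 'b \<Rightarrow> 'k) \<Rightarrow> ('b \<Rightarrow> 'k) \<Rightarrow> ('k::field, 'b \<Rightarrow> 'k) module" where
  "alg_on S m u =
    \<lparr>carrier = {x. \<forall>b. b \<notin> S \<longrightarrow> x b = 0},
     monoid.mult = (\<lambda>x y c. \<Sum>a\<in>S. \<Sum>b\<in>S. x a * y b * m a b c),
     one = u,
     zero = (\<lambda>c. 0),
     add = (\<lambda>x y c. x c + y c),
     module.smult = (\<lambda>k x c. k * x c)\<rparr>"

definition tensor_square :: "'b set \<Rightarrow> ('k::field, 'b \<Rightarrow> 'k, 'm) module_scheme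
    \<Rightarrow> ('k, 'b \<times> 'b \<Rightarrow> 'k) module" where
  "tensor_square S A =
     alg_on (S \<times> S)
       (\<lambda>(a, a') (b, b'). pure_tensor (bvec a \<otimes>\<^bsub>A\<^esub> bvec b) (bvec a' \<otimes>\<^bsub>A\<^esub> bvec b'))
       (pure_tensor \<one>\<^bsub>A\<^esub> \<one>\<^bsub>A\<^esub>)"

record ('k, 'b) hopf = "('k, 'b \<Rightarrow> 'k) module" +
  hbasis :: "'b set"
  comult :: "('b \<Rightarrow> 'k) \<Rightarrow> ('b \<times> 'b \<Rightarrow> 'k)"
  counit :: "('b \<Rightarrow> 'k) \<Rightarrow> 'k"
  antipode :: "('b \<Rightarrow> 'k) \<Rightarrow> ('b \<Rightarrow> 'k)"

definition group_alg :: "('g, 'm) monoid_scheme \<Rightarrow> ('k::field, 'g) hopf" where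
  "group_alg G =
     module.extend (alg_on (carrier G) (\<lambda>h k. bvec (h \<otimes>\<^bsub>G\<^esub> k)) (bvec \<one>\<^bsub>G\<^esub>))
       (hopf.fields
         (carrier G)
         (lin_ext (carrier G) (\<lambda>h. bvec (h, h)))
         (\<lambda>x. \<Sum>h\<in>carrier G. x h)
         (lin_ext (carrier G) (\<lambda>h. bvec (inv\<^bsub>G\<^esub> h))))"

subsection \<open>The Hopf algebra of a group datum \<open>(G, \<chi>, g, 0)\<close>\<close>

text \<open>
  The pair \<open>(i, h)\<close> stands for the basis element \<open>y\<^sup>i h\<close>. From \<open>y h = \<chi>(h) h y\<close> one gets
  \<open>(y\<^sup>i h)(y\<^sup>j k) = \<chi>(h)\<^sup>-\<^sup>j y\<^sup>i\<^sup>+\<^sup>j h k\<close>, which is \<open>0\<close> if \<open>i + j \<ge> n\<close>.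
\<close>

definition datum_basis :: "('g, 'm) monoid_scheme \<Rightarrow> nat \<Rightarrow> (nat \<times> 'g) set" where
  "datum_basis G n = {..<n} \<times> carrier G"

definition datum_alg :: "('g, 'm) monoid_scheme \<Rightarrow> ('g \<Rightarrow> 'k) \<Rightarrow> nat
    \<Rightarrow> ('k::field, nat \<times> 'g \<Rightarrow> 'k) module" where
  "datum_alg G \<chi> n =
     alg_on (datum_basis G n)
       (\<lambda>(i, h) (j, k). if i + j < n
          then (\<lambda>c. inverse (\<chi> h) ^ j * bvec (i + j, h \<otimes>\<^bsub>G\<^esub> k) c)
          else (\<lambda>c. 0))
       (bvec (0, \<one>\<^bsub>G\<^esub>))"

definition gen_y :: "('g, 'm) monoid_scheme \<Rightarrow> nat \<times> 'g \<Rightarrow> 'k::field" where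
  "gen_y G = bvec (1, \<one>\<^bsub>G\<^esub>)"

definition gen_grp :: "'g \<Rightarrow> nat \<times> 'g \<Rightarrow> 'k::field" where
  "gen_grp h = bvec (0, h)"

lemma alg_on_bvec_mult:
  assumes "finite S" "a \<in> S" "b \<in> S"
  shows "bvec a \<otimes>\<^bsub>alg_on S m u\<^esub> bvec b = m a b"
proof
  fix c
  have "(\<Sum>a'\<in>S. \<Sum>b'\<in>S. bvec a a' * bvec b b' * m a' b' c)
      = (\<Sum>a'\<in>S. if a' = a then (\<Sum>b'\<in>S. if b' = b then m a b c else 0) else 0)"
    by (intro sum.cong refl) (auto simp: bvec_def intro!: sum.cong)
  also have "\<dots> = m a b c"
    using assms by simp
  finally show "(bvec a \<otimes>\<^bsub>alg_on S m u\<^esub> bvec b) c = m a b c"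
    by (simp add: alg_on_def)
qed

lemma datum_alg_bvec_mult:
  assumes "group G" "finite (carrier G)" "h \<in> carrier G" "k \<in> carrier G" "i < n" "j < n"
  shows "bvec (i, h) \<otimes>\<^bsub>datum_alg G \<chi> n\<^esub> bvec (j, k) =
    (if i + j < n then inverse (\<chi> h) ^ j \<odot>\<^bsub>datum_alg G \<chi> n\<^esub> bvec (i + j, h \<otimes>\<^bsub>G\<^esub> k)
     else \<zero>\<^bsub>datum_alg G \<chi> n\<^esub>)"
proof -
  have "finite (datum_basis G n)" "(i, h) \<in> datum_basis G n" "(j, k) \<in> datum_basis G n"
    using assms by (auto simp: datum_basis_def)
  then show ?thesis
    by (simp add: datum_alg_def alg_on_bvec_mult) (simp add: alg_on_def)
qed

text \<open>The defining relations of the algebra, and its basis \<open>y\<^sup>i h\<close>.\<close>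

lemma datum_alg_relations:
  assumes "group G" "finite (carrier G)" "\<chi> \<in> hom G (units_of (class_ring :: 'k::field ring))"
    and "n \<ge> 2" "h \<in> carrier G" "k \<in> carrier G"
  defines "H \<equiv> datum_alg G \<chi> n"
  shows "gen_grp h \<otimes>\<^bsub>H\<^esub> gen_grp k = gen_grp (h \<otimes>\<^bsub>G\<^esub> k)"
    and "gen_grp \<one>\<^bsub>G\<^esub> = \<one>\<^bsub>H\<^esub>"
    and "gen_y G \<otimes>\<^bsub>H\<^esub> gen_grp h = \<chi> h \<odot>\<^bsub>H\<^esub> (gen_grp h \<otimes>\<^bsub>H\<^esub> gen_y G)"
    and "i < n \<Longrightarrow> gen_y G [^]\<^bsub>H\<^esub> i \<otimes>\<^bsub>H\<^esub> gen_grp h = bvec (i, h)"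
    and "gen_y G [^]\<^bsub>H\<^esub> n = \<zero>\<^bsub>H\<^esub>"
proof -
  interpret G: group G by fact
  note mult = datum_alg_bvec_mult[OF assms(1,2), where n = n and \<chi> = \<chi>, folded H_def]
  have smult: "(1 \<odot>\<^bsub>H\<^esub> x) = x" "(c \<odot>\<^bsub>H\<^esub> x) = (\<lambda>b. c * x b)" for c x
    by (simp_all add: H_def datum_alg_def alg_on_def)
  have one: "\<one>\<^bsub>H\<^esub> = bvec (0, \<one>\<^bsub>G\<^esub>)"
    by (simp add: H_def datum_alg_def alg_on_def)
  have chi: "\<chi> x \<noteq> 0" if "x \<in> carrier G" for x
  proof -
    have "\<chi> x \<in> Units (class_ring :: 'k ring)"
      using hom_carrier[OF assms(3)] that by (auto simp: units_of_def)
    then show ?thesis by (auto simp: Units_def)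
  qed
  have chi_one: "\<chi> \<one>\<^bsub>G\<^esub> = 1"
  proof -
    have "\<chi> (\<one>\<^bsub>G\<^esub> \<otimes>\<^bsub>G\<^esub> \<one>\<^bsub>G\<^esub>) = \<chi> \<one>\<^bsub>G\<^esub> * \<chi> \<one>\<^bsub>G\<^esub>"
      using hom_mult[OF assms(3) G.one_closed G.one_closed] by (simp add: units_of_def)
    then have "\<chi> \<one>\<^bsub>G\<^esub> = \<chi> \<one>\<^bsub>G\<^esub> * \<chi> \<one>\<^bsub>G\<^esub>"
      by (simp only: G.l_one[OF G.one_closed])
    then show ?thesis
      using chi[OF G.one_closed] by (metis mult_cancel_left2)
  qed
  show "gen_grp h \<otimes>\<^bsub>H\<^esub> gen_grp k = gen_grp (h \<otimes>\<^bsub>G\<^esub> k)"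
    using assms(4-6) by (simp add: gen_grp_def mult smult)
  show "gen_grp \<one>\<^bsub>G\<^esub> = \<one>\<^bsub>H\<^esub>"
    by (simp add: gen_grp_def one)
  show "gen_y G \<otimes>\<^bsub>H\<^esub> gen_grp h = \<chi> h \<odot>\<^bsub>H\<^esub> (gen_grp h \<otimes>\<^bsub>H\<^esub> gen_y G)"
    using assms(4-6) chi[OF assms(5)]
    by (simp add: gen_grp_def gen_y_def mult smult fun_eq_iff)
  have pow: "gen_y G [^]\<^bsub>H\<^esub> i = bvec (i, \<one>\<^bsub>G\<^esub>)" if "i < n" for i
    using that assms(4)
    by (induction i) (simp_all add: nat_pow_def one gen_y_def mult smult chi_one)
  show "gen_y G [^]\<^bsub>H\<^esub> i \<otimes>\<^bsub>H\<^esub> gen_grp h = bvec (i, h)" if "i < n"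
    using that assms(4,5) by (simp add: pow gen_grp_def mult smult)
  obtain m where m: "n = Suc m" "m \<ge> 1" using assms(4) by (cases n) auto
  have "gen_y G [^]\<^bsub>H\<^esub> n = gen_y G [^]\<^bsub>H\<^esub> m \<otimes>\<^bsub>H\<^esub> gen_y G"
    by (simp add: m(1) nat_pow_def)
  also have "\<dots> = \<zero>\<^bsub>H\<^esub>"
    using m by (simp add: pow) (simp add: gen_y_def mult)
  finally show "gen_y G [^]\<^bsub>H\<^esub> n = \<zero>\<^bsub>H\<^esub>" .
qed

text \<open>
  \<open>\<Delta>\<close> is multiplicative and \<open>S\<close> antimultiplicative, so that
  \<open>\<Delta>(y\<^sup>i h) = (y \<otimes> g + 1 \<otimes> y)\<^sup>i (h \<otimes> h)\<close> and \<open>S(y\<^sup>i h) = h\<^sup>-\<^sup>1 (-y g\<^sup>-\<^sup>1)\<^sup>i\<close>.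
\<close>

definition datum_hopf :: "('g, 'm) monoid_scheme \<Rightarrow> ('g \<Rightarrow> 'k) \<Rightarrow> 'g \<Rightarrow> nat
    \<Rightarrow> ('k::field, nat \<times> 'g) hopf" where
  "datum_hopf G \<chi> g n =
    (let B = datum_basis G n;
         H = datum_alg G \<chi> n;
         T = tensor_square B H
     in module.extend H
       (hopf.fields
         B
         (lin_ext B (\<lambda>(i, h).
            (pure_tensor (gen_y G) (gen_grp g) \<oplus>\<^bsub>T\<^esub> pure_tensor \<one>\<^bsub>H\<^esub> (gen_y G)) [^]\<^bsub>T\<^esub> i
              \<otimes>\<^bsub>T\<^esub> pure_tensor (gen_grp h) (gen_grp h)))
         (\<lambda>x. \<Sum>(i, h)\<in>B. x (i, h) * (if i = 0 then 1 else 0))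
         (lin_ext B (\<lambda>(i, h).
            gen_grp (inv\<^bsub>G\<^esub> h)
              \<otimes>\<^bsub>H\<^esub> ((- 1) \<odot>\<^bsub>H\<^esub> (gen_y G \<otimes>\<^bsub>H\<^esub> gen_grp (inv\<^bsub>G\<^esub> g))) [^]\<^bsub>H\<^esub> i))))"


section \<open>Finite dimensional modules\<close>

text \<open>
  A finite dimensional left module is given on some \<open>K\<^sup>d\<close>, as a pair of the dimension \<open>d\<close> and the
  algebra homomorphism into the \<open>d \<times> d\<close> matrices; every finite dimensional module is isomorphic to
  one of these. All notions below only depend on the restriction of the second component to
  the carrier of the algebra.
\<close>

type_synonym ('a, 'k) rep = "nat \<times> ('a \<Rightarrow> 'k mat)"

definition is_rep :: "('k::field, 'a, 'm) module_scheme \<Rightarrow> ('a, 'k) rep \<Rightarrow> bool" where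
  "is_rep A M \<longleftrightarrow>
     snd M \<in> Ring.ring_hom A (ring_mat TYPE('k) (fst M) ()) \<and>
     (\<forall>k. \<forall>x\<in>carrier A. snd M (k \<odot>\<^bsub>A\<^esub> x) = k \<cdot>\<^sub>m snd M x)"

definition rep_hom :: "('k::field, 'a, 'm) module_scheme \<Rightarrow> ('a, 'k) rep \<Rightarrow> ('a, 'k) rep
    \<Rightarrow> 'k mat set" where
  "rep_hom A M N =
     {f \<in> carrier_mat (fst N) (fst M). \<forall>x\<in>carrier A. f * snd M x = snd N x * f}"

definition rep_iso :: "('k::field, 'a, 'm) module_scheme \<Rightarrow> ('a, 'k) rep \<Rightarrow> ('a, 'k) rep
    \<Rightarrow> bool" where
  "rep_iso A M N \<longleftrightarrow>
     (\<exists>f\<in>rep_hom A M N. \<exists>f'\<in>rep_hom A N M. f' * f = 1\<^sub>m (fst M) \<and> f * f' = 1\<^sub>m (fst N))"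

definition rep_sum :: "('a, 'k::field) rep \<Rightarrow> ('a, 'k) rep \<Rightarrow> ('a, 'k) rep" where
  "rep_sum M N =
     (fst M + fst N,
      \<lambda>x. four_block_mat (snd M x) (0\<^sub>m (fst M) (fst N)) (0\<^sub>m (fst N) (fst M)) (snd N x))"

definition kron :: "'k::field mat \<Rightarrow> 'k mat \<Rightarrow> 'k mat" where
  "kron A B = mat (dim_row A * dim_row B) (dim_col A * dim_col B)
     (\<lambda>(i, j). A $$ (i div dim_row B, j div dim_col B) * B $$ (i mod dim_row B, j mod dim_col B))"

text \<open>The tensor product over \<open>K\<close>, with \<open>x\<close> acting as \<open>\<Delta>(x) = \<Sum> \<Delta>(x)\<^sub>b\<^sub>c b \<otimes> c\<close>.\<close>

definition rep_tensor :: "('k::field, 'b, 'm) hopf_scheme \<Rightarrow> ('b \<Rightarrow> 'k, 'k) rep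
    \<Rightarrow> ('b \<Rightarrow> 'k, 'k) rep \<Rightarrow> ('b \<Rightarrow> 'k, 'k) rep" where
  "rep_tensor A M N =
     (fst M * fst N,
      \<lambda>x. mat (fst M * fst N) (fst M * fst N) (\<lambda>ij.
            \<Sum>(b, c)\<in>hbasis A \<times> hbasis A.
              comult A x (b, c) * kron (snd M (bvec b)) (snd N (bvec c)) $$ ij))"

definition rep_unit :: "('k::field, 'b, 'm) hopf_scheme \<Rightarrow> ('b \<Rightarrow> 'k, 'k) rep" where
  "rep_unit A = (1, \<lambda>x. mat 1 1 (\<lambda>_. counit A x))"

definition indecomposable :: "('k::field, 'a, 'm) module_scheme \<Rightarrow> ('a, 'k) rep \<Rightarrow> bool" where
  "indecomposable A M \<longleftrightarrow>
     is_rep A M \<and> fst M \<noteq> 0 \<and>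
     (\<forall>N N'. is_rep A N \<and> is_rep A N' \<and> rep_iso A M (rep_sum N N') \<longrightarrow> fst N = 0 \<or> fst N' = 0)"

definition projective :: "('k::field, 'a, 'm) module_scheme \<Rightarrow> ('a, 'k) rep \<Rightarrow> bool" where
  "projective A P \<longleftrightarrow>
     is_rep A P \<and>
     (\<forall>M N. \<forall>p\<in>rep_hom A M N. \<forall>f\<in>rep_hom A P N.
        is_rep A M \<and> is_rep A N \<and>
        (\<lambda>v. p *\<^sub>v v) ` carrier_vec (fst M) = carrier_vec (fst N) \<longrightarrow>
        (\<exists>f'\<in>rep_hom A P M. p * f' = f))"


section \<open>The stable category\<close>

definition factors_proj :: "('k::field, 'a, 'm) module_scheme \<Rightarrow> ('a, 'k) rep \<Rightarrow> ('a, 'k) rep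
    \<Rightarrow> 'k mat set" where
  "factors_proj A M N =
     {f. \<exists>P. projective A P \<and> (\<exists>f1\<in>rep_hom A M P. \<exists>f2\<in>rep_hom A P N. f = f2 * f1)}"

definition st_class :: "('k::field, 'a, 'm) module_scheme \<Rightarrow> ('a, 'k) rep \<Rightarrow> ('a, 'k) rep
    \<Rightarrow> 'k mat \<Rightarrow> 'k mat set" where
  "st_class A M N f = {f' \<in> rep_hom A M N. f' - f \<in> factors_proj A M N}"

definition st_hom :: "('k::field, 'a, 'm) module_scheme \<Rightarrow> ('a, 'k) rep \<Rightarrow> ('a, 'k) rep
    \<Rightarrow> 'k mat set set" where
  "st_hom A M N = st_class A M N ` rep_hom A M N"

text \<open>
  Composition of stable morphisms \<open>\<phi>\<close> from \<open>M\<close> and \<open>\<psi>\<close> to \<open>N\<close>: the class of \<open>f' f\<close> does not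
  depend on the choice of \<open>f' \<in> \<psi>\<close> and \<open>f \<in> \<phi>\<close>, so the union is this class.
\<close>

definition st_comp :: "('k::field, 'a, 'm) module_scheme \<Rightarrow> ('a, 'k) rep \<Rightarrow> ('a, 'k) rep
    \<Rightarrow> 'k mat set \<Rightarrow> 'k mat set \<Rightarrow> 'k mat set" where
  "st_comp A M N \<psi> \<phi> = (\<Union>f'\<in>\<psi>. \<Union>f\<in>\<phi>. st_class A M N (f' * f))"

definition st_iso :: "('k::field, 'a, 'm) module_scheme \<Rightarrow> ('a, 'k) rep \<Rightarrow> ('a, 'k) rep
    \<Rightarrow> bool" where
  "st_iso A M N \<longleftrightarrow>
     (\<exists>\<phi>\<in>st_hom A M N. \<exists>\<psi>\<in>st_hom A N M.
        st_comp A M M \<psi> \<phi> = st_class A M M (1\<^sub>m (fst M)) \<and>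
        st_comp A N N \<phi> \<psi> = st_class A N N (1\<^sub>m (fst N)))"


section \<open>Green rings\<close>

text \<open>
  \<open>E\<close> is the relation of isomorphism between objects: \<^const>\<open>rep_iso\<close> for the module category,
  \<^const>\<open>st_iso\<close> for the stable category. Direct sums and tensor products in the stable
  category are the images of those in the module category.
\<close>

definition iso_class :: "('k::field, 'a, 'm) module_scheme
    \<Rightarrow> (('a, 'k) rep \<Rightarrow> ('a, 'k) rep \<Rightarrow> bool) \<Rightarrow> ('a, 'k) rep \<Rightarrow> ('a, 'k) rep set" where
  "iso_class A E M = {N. is_rep A N \<and> E M N}"

definition class_tensor :: "('k::field, 'b, 'm) hopf_scheme
    \<Rightarrow> (('b \<Rightarrow> 'k, 'k) rep \<Rightarrow> ('b \<Rightarrow> 'k, 'k) rep \<Rightarrow> bool)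
    \<Rightarrow> ('b \<Rightarrow> 'k, 'k) rep set \<Rightarrow> ('b \<Rightarrow> 'k, 'k) rep set \<Rightarrow> ('b \<Rightarrow> 'k, 'k) rep set" where
  "class_tensor A E X Y = (\<Union>M\<in>X. \<Union>N\<in>Y. iso_class A E (rep_tensor A M N))"

definition free_green :: "('k::field, 'b, 'm) hopf_scheme
    \<Rightarrow> (('b \<Rightarrow> 'k, 'k) rep \<Rightarrow> ('b \<Rightarrow> 'k, 'k) rep \<Rightarrow> bool)
    \<Rightarrow> (('b \<Rightarrow> 'k, 'k) rep set \<Rightarrow>\<^sub>0 int) ring" where
  "free_green A E =
     \<lparr>carrier = carrier (free_Abelian_group (iso_class A E ` {M. is_rep A M})),
      monoid.mult = (\<lambda>x y. frag_extend (\<lambda>X. frag_extend (\<lambda>Y. frag_of (class_tensor A E X Y)) y) x),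
      one = frag_of (iso_class A E (rep_unit A)),
      zero = 0,
      add = (+)\<rparr>"

definition sum_relations :: "('k::field, 'b, 'm) hopf_scheme
    \<Rightarrow> (('b \<Rightarrow> 'k, 'k) rep \<Rightarrow> ('b \<Rightarrow> 'k, 'k) rep \<Rightarrow> bool)
    \<Rightarrow> (('b \<Rightarrow> 'k, 'k) rep set \<Rightarrow>\<^sub>0 int) set" where
  "sum_relations A E = generate (add_monoid (free_green A E))
     {frag_of (iso_class A E (rep_sum M N)) - (frag_of (iso_class A E M) + frag_of (iso_class A E N))
       | M N. is_rep A M \<and> is_rep A N}"

definition green_of :: "('k::field, 'b, 'm) hopf_scheme
    \<Rightarrow> (('b \<Rightarrow> 'k, 'k) rep \<Rightarrow> ('b \<Rightarrow> 'k, 'k) rep \<Rightarrow> bool)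
    \<Rightarrow> (('b \<Rightarrow> 'k, 'k) rep set \<Rightarrow>\<^sub>0 int) set ring" where
  "green_of A E = free_green A E Quot sum_relations A E"

definition green_ring :: "('k::field, 'b, 'm) hopf_scheme
    \<Rightarrow> (('b \<Rightarrow> 'k, 'k) rep set \<Rightarrow>\<^sub>0 int) set ring" where
  "green_ring A = green_of A (rep_iso A)"

definition stable_green_ring :: "('k::field, 'b, 'm) hopf_scheme
    \<Rightarrow> (('b \<Rightarrow> 'k, 'k) rep set \<Rightarrow>\<^sub>0 int) set ring" where
  "stable_green_ring A = green_of A (st_iso A)"

definition green_class :: "('k::field, 'b, 'm) hopf_scheme \<Rightarrow> ('b \<Rightarrow> 'k, 'k) rep
    \<Rightarrow> (('b \<Rightarrow> 'k, 'k) rep set \<Rightarrow>\<^sub>0 int) set" where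
  "green_class A M =
     sum_relations A (rep_iso A) +>\<^bsub>free_green A (rep_iso A)\<^esub> frag_of (iso_class A (rep_iso A) M)"

definition proj_ideal :: "('k::field, 'b, 'm) hopf_scheme
    \<Rightarrow> (('b \<Rightarrow> 'k, 'k) rep set \<Rightarrow>\<^sub>0 int) set set" where
  "proj_ideal A =
     Idl\<^bsub>green_ring A\<^esub> {green_class A P | P. indecomposable A P \<and> projective A P}"

definition char_rep :: "('g, 'm) monoid_scheme \<Rightarrow> ('g \<Rightarrow> 'k) \<Rightarrow> ('g \<Rightarrow> 'k::field, 'k) rep" where
  "char_rep G \<psi> = (1, \<lambda>x. mat 1 1 (\<lambda>_. \<Sum>h\<in>carrier G. x h * \<psi> h))"


section \<open>Dickson polynomials\<close>

text \<open>The index starts at \<open>1\<close>; the value at \<open>0\<close> is a convention.\<close>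

fun dickson :: "('r, 'm) ring_scheme \<Rightarrow> nat \<Rightarrow> 'r \<Rightarrow> 'r \<Rightarrow> 'r" where
  "dickson R 0 y z = \<zero>\<^bsub>R\<^esub>"
| "dickson R (Suc 0) y z = \<one>\<^bsub>R\<^esub>"
| "dickson R (Suc (Suc 0)) y z = z"
| "dickson R (Suc (Suc (Suc i))) y z =
     z \<otimes>\<^bsub>R\<^esub> dickson R (Suc (Suc i)) y z \<ominus>\<^bsub>R\<^esub> y \<otimes>\<^bsub>R\<^esub> dickson R (Suc i) y z"

end

(*
Over K G every module is semisimple, and an H-module is a direct sum of modules J(i, V) with
1 <= i <= n, where V is a K G-module and y shifts i twisted copies of V.  The summands with i = n
are the projective ones, tensoring with H-modules preserves projectivity, and M and N are stably
isomorphic iff M + Q is isomorphic to N + P for projective P and Q; hence the kernel of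
r(H) -> r_st(H) is the ideal of the projective classes.

J(i, V) is V tensored with J(i, 1), and J(2, 1) J(i, 1) = J(i + 1, 1) + a J(i - 1, 1) for 2 <= i < n,
so z |-> [J(2, 1)] maps F_i(a, z) to [J(i, 1)] and F_n(a, z) to 0, and r(K G)[z] onto r_st(H).
Modulo F_n(a, z) every polynomial is a combination of F_1, ..., F_(n-1) over r(K G), and its
coefficients can be read off in r_st(H): the quotients of ker y \<inter> im y^j by
ker y \<inter> im y^(j+1) for j < n - 1 are additive in the module and vanish on projective modules.
*)
theory Submission
  imports Defs
begin

section \<open>The ring of row-finite matrices\<close>

text \<open>Both kernels are found by an additive one-sided inverse: a map out of r_st(H), known
  only to be a homomorphism of groups and defined by the universal property of the Green group,
  whose composite with the surjection onto r_st(H) is the residue map modulo the expected ideal.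
  This replaces any uniqueness of decompositions into indecomposables. The order n of q enters
  twice. The inner Gaussian binomials of row n vanish at q, which keeps y^n = 0 on tensor products;
  the quantum integers [m] with 0 < m < n do not vanish, which makes J(2, 1) J(i, 1) split for i <
  n. The twist a arises because the smaller summand is generated in degree 1, where G acts by
  \<chi>^-1. H is not cocommutative, so the commutativity of r_st(H), which evaluation of
  polynomials requires, is an issue of its own; it rests on g being central. Matrices of all sizes
  are put into one ring, so that equations between maps of different formats can be rewritten
  freely. In characteristic 0 the trace shows that one-sided inverses of square matrices are
  two-sided, so the main decompositions need only one of the two inverse equations.\<close>

typedef (overloaded) 'k rfm = "{f :: nat \<Rightarrow> nat \<Rightarrow> 'k::zero. \<forall>i. finite {j. f i j \<noteq> 0}}"
  morphisms ent Rfm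
  by (rule exI[of _ "\<lambda>_ _. 0"]) simp

setup_lifting type_definition_rfm

lemma finite_row: "finite {j. ent A i j \<noteq> 0}"
  using ent[of A] by simp

lemma rfm_eqI: "(\<And>i j. ent A i j = ent B i j) \<Longrightarrow> A = B"
  by transfer blast

instantiation rfm :: (field) ab_group_add
begin
lift_definition zero_rfm :: "'a rfm" is "\<lambda>_ _. 0" by simp
lift_definition plus_rfm :: "'a rfm \<Rightarrow> 'a rfm \<Rightarrow> 'a rfm" is "\<lambda>f g i j. f i j + g i j"
  subgoal for f g i
    by (rule finite_subset[of _ "{j. f i j \<noteq> 0} \<union> {j. g i j \<noteq> 0}"]) auto
  done
lift_definition uminus_rfm :: "'a rfm \<Rightarrow> 'a rfm" is "\<lambda>f i j. - f i j" by simp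
lift_definition minus_rfm :: "'a rfm \<Rightarrow> 'a rfm \<Rightarrow> 'a rfm" is "\<lambda>f g i j. f i j - g i j"
  subgoal for f g i
    by (rule finite_subset[of _ "{j. f i j \<noteq> 0} \<union> {j. g i j \<noteq> 0}"]) auto
  done
instance by (standard; transfer; auto simp: fun_eq_iff)
end

lemma finite_row_mult:
  fixes f :: "nat \<Rightarrow> nat \<Rightarrow> 'a::field"
  assumes "\<forall>i. finite {j. f i j \<noteq> 0}" "\<forall>i. finite {j. g i j \<noteq> 0}"
  shows "finite {k. (\<Sum>j\<in>{j. f i j \<noteq> 0}. f i j * g j k) \<noteq> 0}"
proof (rule finite_subset)
  show "finite (\<Union>j\<in>{j. f i j \<noteq> 0}. {k. g j k \<noteq> 0})"
    using assms by blast
  show "{k. (\<Sum>j\<in>{j. f i j \<noteq> 0}. f i j * g j k) \<noteq> 0} \<subseteq> (\<Union>j\<in>{j. f i j \<noteq> 0}. {k. g j k \<noteq> 0})"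
    by (auto intro!: sum.neutral)
qed

instantiation rfm :: (field) ring_1
begin
lift_definition one_rfm :: "'a rfm" is "\<lambda>i j. if i = j then 1 else 0" by simp
lift_definition times_rfm :: "'a rfm \<Rightarrow> 'a rfm \<Rightarrow> 'a rfm"
  is "\<lambda>f g i k. \<Sum>j\<in>{j. f i j \<noteq> 0}. f i j * g j k"
  using finite_row_mult by blast

text \<open>The product sums over the exact support of a row; a larger finite index set gives the
  same value and lets sums for different matrices run over a common range.\<close>

lemma ent_mult_sup:
  assumes "finite S" "\<And>j. j \<notin> S \<Longrightarrow> ent A i j = 0"
  shows "ent (A * B) i k = (\<Sum>j\<in>S. ent A i j * ent B j k)"
  unfolding times_rfm.rep_eq by (rule sum.mono_neutral_left) (use assms in auto)

instance
proof
  fix A B C :: "'a rfm"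
  show "A * B * C = A * (B * C)"
  proof (rule rfm_eqI)
    fix i l
    let ?S = "{j. ent A i j \<noteq> 0}" and ?T = "\<Union>j\<in>{j. ent A i j \<noteq> 0}. {k. ent B j k \<noteq> 0}"
    have fin: "finite ?S" "finite ?T" using finite_row by blast+
    have AB: "ent (A * B) i k = (\<Sum>j\<in>?S. ent A i j * ent B j k)" for k
      by (rule ent_mult_sup) (use fin in auto)
    have "ent (A * B * C) i l = (\<Sum>k\<in>?T. ent (A * B) i k * ent C k l)"
      by (rule ent_mult_sup) (use fin in \<open>auto simp: AB intro!: sum.neutral\<close>)
    also have "\<dots> = (\<Sum>k\<in>?T. \<Sum>j\<in>?S. ent A i j * ent B j k * ent C k l)"
      by (simp add: AB sum_distrib_right)
    also have "\<dots> = (\<Sum>j\<in>?S. \<Sum>k\<in>?T. ent A i j * ent B j k * ent C k l)"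
      by (rule sum.swap)
    also have "\<dots> = (\<Sum>j\<in>?S. ent A i j * ent (B * C) j l)"
    proof (rule sum.cong[OF refl])
      fix j assume j: "j \<in> ?S"
      have "ent (B * C) j l = (\<Sum>k\<in>?T. ent B j k * ent C k l)"
        by (rule ent_mult_sup) (use fin j in auto)
      then show "(\<Sum>k\<in>?T. ent A i j * ent B j k * ent C k l) = ent A i j * ent (B * C) j l"
        by (simp add: sum_distrib_left mult.assoc)
    qed
    also have "\<dots> = ent (A * (B * C)) i l"
      by (rule ent_mult_sup[symmetric]) (use fin in auto)
    finally show "ent (A * B * C) i l = ent (A * (B * C)) i l" .
  qed
  show "1 * A = A"
  proof (rule rfm_eqI)
    fix i k show "ent (1 * A) i k = ent A i k"
      by (subst ent_mult_sup[of "{i}"]) (auto simp: one_rfm.rep_eq)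
  qed
  show "A * 1 = A"
  proof (rule rfm_eqI)
    fix i k
    have "ent (A * 1) i k = (\<Sum>j\<in>{j. ent A i j \<noteq> 0}. if k = j then ent A i j else 0)"
      unfolding times_rfm.rep_eq by (rule sum.cong) (auto simp: one_rfm.rep_eq)
    then show "ent (A * 1) i k = ent A i k" by (simp add: finite_row)
  qed
  show "(A + B) * C = A * C + B * C"
  proof (rule rfm_eqI)
    fix i k
    let ?S = "{j. ent A i j \<noteq> 0} \<union> {j. ent B i j \<noteq> 0}"
    have fin: "finite ?S" using finite_row by blast
    have "ent ((A + B) * C) i k = (\<Sum>j\<in>?S. ent (A + B) i j * ent C j k)"
      by (rule ent_mult_sup) (use fin in \<open>auto simp: plus_rfm.rep_eq\<close>)
    moreover have "ent (A * C) i k = (\<Sum>j\<in>?S. ent A i j * ent C j k)"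
      by (rule ent_mult_sup) (use fin in auto)
    moreover have "ent (B * C) i k = (\<Sum>j\<in>?S. ent B i j * ent C j k)"
      by (rule ent_mult_sup) (use fin in auto)
    ultimately show "ent ((A + B) * C) i k = ent (A * C + B * C) i k"
      by (simp add: plus_rfm.rep_eq distrib_right sum.distrib)
  qed
  show "A * (B + C) = A * B + A * C"
    by (rule rfm_eqI) (simp add: plus_rfm.rep_eq times_rfm.rep_eq distrib_left sum.distrib)
  show "(0::'a rfm) \<noteq> 1"
    by transfer (metis zero_neq_one)
qed
end

lift_definition scl :: "'k::field \<Rightarrow> 'k rfm \<Rightarrow> 'k rfm" (infixr "*\<^sub>c" 75)
  is "\<lambda>c f i j. c * f i j"
  subgoal for c f i
    by (rule finite_subset[of _ "{j. f i j \<noteq> 0}"]) auto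
  done

lemma ent_simps [simp]:
  "ent 0 i j = 0" "ent (A + B) i j = ent A i j + ent B i j" "ent (- A) i j = - ent A i j"
  "ent (A - B) i j = ent A i j - ent B i j" "ent (c *\<^sub>c A) i j = c * ent A i j"
  "ent 1 i j = (if i = j then 1 else 0)"
  by (transfer; simp)+

lemma ent_sum: "ent (sum f S) i j = (\<Sum>s\<in>S. ent (f s) i j)"
  by (induction S rule: infinite_finite_induct) auto

lemma scl_scl [simp]: "a *\<^sub>c b *\<^sub>c A = (a * b) *\<^sub>c A"
  and scl_one [simp]: "1 *\<^sub>c A = A"
  and scl_zero [simp]: "0 *\<^sub>c A = 0" "a *\<^sub>c 0 = 0"
  and scl_add_left: "(a + b) *\<^sub>c A = a *\<^sub>c A + b *\<^sub>c A"
  and scl_diff_left: "(a - b) *\<^sub>c A = a *\<^sub>c A - b *\<^sub>c A"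
  and scl_add: "a *\<^sub>c (A + B) = a *\<^sub>c A + a *\<^sub>c B"
  and scl_diff: "a *\<^sub>c (A - B) = a *\<^sub>c A - a *\<^sub>c B"
  and scl_minus [simp]: "a *\<^sub>c (- A) = - (a *\<^sub>c A)" "(- a) *\<^sub>c A = - (a *\<^sub>c A)"
  by (rule rfm_eqI; simp add: algebra_simps)+

lemma scl_mult_left [simp]: "(a *\<^sub>c A) * B = a *\<^sub>c (A * B)"
proof (rule rfm_eqI)
  fix i k
  have "ent ((a *\<^sub>c A) * B) i k = (\<Sum>j\<in>{j. ent A i j \<noteq> 0}. ent (a *\<^sub>c A) i j * ent B j k)"
    by (rule ent_mult_sup) (auto simp: finite_row)
  then show "ent ((a *\<^sub>c A) * B) i k = ent (a *\<^sub>c (A * B)) i k"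
    by (simp add: times_rfm.rep_eq sum_distrib_left mult.assoc)
qed

lemma scl_mult_right [simp]: "A * (a *\<^sub>c B) = a *\<^sub>c (A * B)"
  by (rule rfm_eqI) (simp add: times_rfm.rep_eq sum_distrib_left algebra_simps)

lemma scl_sum: "a *\<^sub>c sum f S = (\<Sum>s\<in>S. a *\<^sub>c f s)"
  by (induction S rule: infinite_finite_induct) (auto simp: scl_add)

lemma scl_sum_left: "sum f S *\<^sub>c A = (\<Sum>s\<in>S. f s *\<^sub>c A)"
  by (induction S rule: infinite_finite_induct) (auto simp: scl_add_left)

section \<open>Matrix units and identity blocks\<close>

lift_definition mu :: "nat \<Rightarrow> nat \<Rightarrow> 'k::field rfm"
  is "\<lambda>a b i j. if i = a \<and> j = b then 1 else 0"
  by simp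

lift_definition idm :: "nat \<Rightarrow> 'k::field rfm" is "\<lambda>d i j. if i = j \<and> i < d then 1 else 0"
  by simp

lemma ent_mu [simp]: "ent (mu a b) i j = (if i = a \<and> j = b then 1 else 0)"
  and ent_idm [simp]: "ent (idm d) i j = (if i = j \<and> i < d then 1 else 0)"
  by (transfer; simp)+

lemma ent_idm_left [simp]: "ent (idm r * A) i j = (if i < r then ent A i j else 0)"
  by (subst ent_mult_sup[of "{i}"]) auto

lemma ent_idm_right [simp]: "ent (A * idm c) i j = (if j < c then ent A i j else 0)"
proof -
  have "ent (A * idm c) i j = (\<Sum>k\<in>{k. ent A i k \<noteq> 0}. if k = j then (if j < c then ent A i j else 0) else 0)"
    unfolding times_rfm.rep_eq by (rule sum.cong) auto
  then show ?thesis by (simp add: finite_row)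
qed

lemma idm_0 [simp]: "idm 0 = 0"
  by (rule rfm_eqI) simp

lemma mu_mult [simp]: "mu i j * mu k l = (if j = k then mu i l else 0)"
proof (rule rfm_eqI)
  fix a b show "ent (mu i j * mu k l) a b = ent (if j = k then mu i l else 0) a b"
    by (subst ent_mult_sup[of "{j}"]) auto
qed

lemma mu_mult3 [simp]: "mu i j * (mu k l * A) = (if j = k then mu i l * A else 0)"
  by (simp add: mult.assoc[symmetric])

lemma idm_sum_mu: "idm d = (\<Sum>i<d. mu i i)"
  by (rule rfm_eqI) (auto simp: ent_sum if_distrib[of "\<lambda>x. x = _"] cong: if_cong)

text \<open>Matrices of all sizes live in one ring, so that products need no side conditions:
  an \<open>r \<times> c\<close> matrix is an \<open>A\<close> with \<open>idm r * A * idm c = A\<close>.\<close>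

definition dm :: "nat \<Rightarrow> nat \<Rightarrow> 'k::field rfm \<Rightarrow> bool" where
  "dm r c A \<longleftrightarrow> (\<forall>i j. \<not> (i < r \<and> j < c) \<longrightarrow> ent A i j = 0)"

lemma dm_iff: "dm r c A \<longleftrightarrow> idm r * A = A \<and> A * idm c = A"
proof
  assume "dm r c A"
  then show "idm r * A = A \<and> A * idm c = A"
    by (auto simp: dm_def intro!: rfm_eqI)
next
  assume *: "idm r * A = A \<and> A * idm c = A"
  have "ent A i j = ent (idm r * A) i j" "ent A i j = ent (A * idm c) i j" for i j
    using * by simp_all
  then show "dm r c A" unfolding dm_def ent_idm_left ent_idm_right by metis
qed

lemma dm_left: "dm r c A \<Longrightarrow> idm r * A = A" and dm_right: "dm r c A \<Longrightarrow> A * idm c = A"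
  by (simp_all add: dm_iff)

lemma dm_left3: "dm r c A \<Longrightarrow> idm r * (A * B) = A * B"
  by (simp add: dm_left mult.assoc[symmetric])

lemma dm_right3: "dm r c A \<Longrightarrow> A * (idm c * B) = A * B"
  by (simp add: dm_right mult.assoc[symmetric])

lemma dm_0 [simp, intro]: "dm r c 0"
  and dm_add [intro]: "dm r c A \<Longrightarrow> dm r c B \<Longrightarrow> dm r c (A + B)"
  and dm_diff [intro]: "dm r c A \<Longrightarrow> dm r c B \<Longrightarrow> dm r c (A - B)"
  and dm_minus [intro]: "dm r c A \<Longrightarrow> dm r c (- A)"
  and dm_scl [intro]: "dm r c A \<Longrightarrow> dm r c (a *\<^sub>c A)"
  and dm_mu [intro]: "i < r \<Longrightarrow> j < c \<Longrightarrow> dm r c (mu i j)"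
  and dm_idm [simp, intro]: "dm d d (idm d)"
  by (auto simp: dm_def)

lemma dm_mult [intro]: "dm r s A \<Longrightarrow> dm s c B \<Longrightarrow> dm r c (A * B)"
  unfolding dm_iff by (metis mult.assoc)

lemma dm_sum [intro]: "(\<And>s. s \<in> S \<Longrightarrow> dm r c (f s)) \<Longrightarrow> dm r c (sum f S)"
  by (induction S rule: infinite_finite_induct) auto

lemma dm_0_left: "dm 0 c A \<Longrightarrow> A = 0" and dm_0_right: "dm r 0 A \<Longrightarrow> A = 0"
  by (auto simp: dm_def intro: rfm_eqI)

lemma dm_mono: "dm r c A \<Longrightarrow> r \<le> r' \<Longrightarrow> c \<le> c' \<Longrightarrow> dm r' c' A"
  by (auto simp: dm_def)

lemma idm_idm [simp]: "idm r * idm s = idm (min r s)"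
  by (rule rfm_eqI) auto

lemma mu_idm [simp]: "mu i j * idm d = (if j < d then mu i j else 0)"
    "idm d * mu i j = (if i < d then mu i j else 0)"
  by (rule rfm_eqI; simp)+

text \<open>Supplies the pivot of \<open>rank_factorization\<close>: a unit vector on which a
  nonzero row does not vanish.\<close>

lemma mu_cover:
  assumes "dm 1 c t" "t \<noteq> 0"
  obtains j a where "j < c" "a \<noteq> 0" "t * mu j 0 = a *\<^sub>c mu 0 0"
proof -
  obtain j where j: "ent t 0 j \<noteq> 0" "j < c"
    using assms unfolding dm_def by (metis ent_simps(1) less_one rfm_eqI)
  have "t * mu j 0 = ent t 0 j *\<^sub>c mu 0 0"
  proof (rule rfm_eqI)
    fix a b
    have "ent (t * mu j 0) a b = (\<Sum>k\<in>{k. ent t a k \<noteq> 0}. if k = j then (if b = 0 then ent t a j else 0) else 0)"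
      unfolding times_rfm.rep_eq by (rule sum.cong) auto
    then show "ent (t * mu j 0) a b = ent (ent t 0 j *\<^sub>c mu 0 0) a b"
      using assms(1) by (auto simp: finite_row dm_def)
  qed
  with j that show ?thesis by blast
qed

lemma idm_Suc: "idm (Suc d) = idm d + mu d d"
  by (rule rfm_eqI) auto

text \<open>Elimination row by row. The inverses \<open>A'\<close> and \<open>B'\<close> express
  that \<open>A\<close> has independent rows and \<open>B\<close> independent columns without
  mentioning spans, so idempotents split and images acquire coordinates by cancellation
  alone.\<close>

lemma rank_factorization:
  assumes "dm a b (T :: 'k::field rfm)"
  obtains r A B A' B' where "dm r b A" "dm a r B" "dm b r A'" "dm r a B'"
    "T = B * A" "A * A' = idm r" "B' * B = idm r"
proof -
  have "\<exists>r A B A' B'. dm r b A \<and> dm a r B \<and> dm b r A' \<and> dm r a B' \<and>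
    T = B * A \<and> A * A' = idm r \<and> B' * B = idm r"
    using assms
  proof (induction a arbitrary: T)
    case 0
    then have "T = 0" by (rule dm_0_left)
    then show ?case by (intro exI[of _ 0]) simp
  next
    case (Suc a)
    \<comment> \<open>\<open>T1\<close> keeps the first \<open>a\<close> rows of \<open>T\<close>;
      \<open>t\<close> is the last row, moved to row 0.\<close>
    define T1 where "T1 = idm a * T"
    define t where "t = mu 0 a * T"
    have T1: "dm a b T1" unfolding T1_def dm_iff using Suc.prems
      by (simp add: dm_iff mult.assoc) (simp add: mult.assoc[symmetric])
    have t: "dm 1 b t" unfolding t_def by (rule dm_mult[OF dm_mu Suc.prems]) auto
    have T: "T = T1 + mu a 0 * t"
      using dm_left[OF Suc.prems] by (simp add: T1_def t_def idm_Suc distrib_right)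
    from Suc.IH[OF T1] obtain r A1 B1 A1' B1' where
      d: "dm r b A1" "dm a r B1" "dm b r A1'" "dm r a B1'"
      and e: "T1 = B1 * A1" "A1 * A1' = idm r" "B1' * B1 = idm r" by blast
    have B1'mu: "B1' * (mu a k * X) = 0" "A * mu a k = 0 \<or> A \<noteq> B1'" for k X A
    proof -
      have "B1' * mu a k = B1' * (idm a * mu a k)" for k
        by (simp only: dm_right3[OF d(4)])
      then have 0: "B1' * mu a k = 0" for k by simp
      show "B1' * (mu a k * X) = 0" by (simp add: mult.assoc[symmetric] 0)
      show "A * mu a k = 0 \<or> A \<noteq> B1'" using 0 by auto
    qed
    have B1mu: "B1 * (mu r k * X) = 0" "B1 * mu r k = 0" for k X
    proof -
      have "B1 * mu r k = B1 * (idm r * mu r k)" for k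
        by (simp only: dm_right3[OF d(2)])
      then have 0: "B1 * mu r k = 0" for k by simp
      show "B1 * (mu r k * X) = 0" by (simp add: mult.assoc[symmetric] 0)
      show "B1 * mu r k = 0" by (rule 0)
    qed
    have muA1: "mu k r * A1 = 0" "mu k a * B1 = 0" for k
    proof -
      have "mu k r * A1 = mu k r * (idm r * A1)" "mu k a * B1 = mu k a * (idm a * B1)"
        by (simp_all only: dm_left[OF d(1)] dm_left[OF d(2)])
      then show "mu k r * A1 = 0" "mu k a * B1 = 0"
        by (simp_all add: mult.assoc[symmetric])
    qed
    \<comment> \<open>\<open>t * A1' * A1\<close> is the part of the last row in the row space of
      \<open>A1\<close>; the rank grows exactly when the remainder \<open>u\<close> is
      nonzero.\<close>
    define u where "u = t - t * A1' * A1"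
    have u: "dm 1 b u" unfolding u_def using t d by blast
    show ?case
    proof (cases "u = 0")
      case True
      then have t_eq: "t = t * A1' * A1" by (simp add: u_def)
      let ?B = "B1 + mu a 0 * (t * A1')"
      have "dm (Suc a) r ?B"
        using d(2) t d(3) by (intro dm_add dm_mult[of _ 1] dm_mult[of _ b] dm_mu) (auto intro: dm_mono)
      moreover have "T = ?B * A1"
        using t_eq by (simp add: T e(1) distrib_right mult.assoc)
      moreover have "B1' * ?B = idm r" by (simp add: distrib_left e(3) B1'mu)
      moreover have "dm r (Suc a) B1'" using d(4) by (rule dm_mono) auto
      ultimately show ?thesis using d(1,3) e(2) by blast
    next
      case False
      then obtain j c where j: "j < b" and c: "c \<noteq> 0" and uj: "u * mu j 0 = c *\<^sub>c mu 0 0"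
        using mu_cover[OF u] by blast
      \<comment> \<open>The unit vector of the pivot, corrected to lie in the kernel of
        \<open>A1\<close> and scaled so that \<open>t\<close> takes the value 1 on it.\<close>
      define v where "v = inverse c *\<^sub>c (mu j 0 - A1' * (A1 * mu j 0))"
      have v: "dm b 1 v" unfolding v_def
        using d j by (intro dm_scl dm_diff dm_mult[OF d(3)] dm_mult[OF d(1)] dm_mu) auto
      have A1v: "A1 * v = 0"
        unfolding v_def by (simp add: right_diff_distrib mult.assoc[symmetric] e(2) dm_left[OF d(1)])
      have tv: "t * v = mu 0 0"
        using uj c by (simp add: v_def u_def algebra_simps)
      define A where "A = A1 + mu r 0 * t"
      define B where "B = B1 + mu a r"
      \<comment> \<open>Subtracting \<open>v * (t * A1')\<close> makes \<open>t\<close> vanish on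
        the old columns of the right inverse, and \<open>v\<close> becomes its new column.\<close>
      define A' where "A' = A1' - v * (t * A1') + v * mu 0 r"
      define B' where "B' = B1' + mu r a"
      have "dm (Suc r) b A"
        unfolding A_def using d(1) t by (intro dm_add dm_mult[OF dm_mu t]) (auto intro: dm_mono)
      moreover have "dm (Suc a) (Suc r) B"
        unfolding B_def using d(2) by (intro dm_add dm_mu) (auto intro: dm_mono)
      moreover have "dm b (Suc r) A'"
        unfolding A'_def using d(3) t v
        by (intro dm_add dm_diff dm_mult[OF v] dm_mult[OF t] dm_mu) (auto intro: dm_mono)
      moreover have "dm (Suc r) (Suc a) B'"
        unfolding B'_def using d(4) by (intro dm_add dm_mu) (auto intro: dm_mono)
      moreover have "T = B * A"
        by (simp add: T e(1) A_def B_def distrib_left distrib_right B1mu muA1)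
      moreover have "B' * B = idm (Suc r)"
      proof -
        have "B1' * mu a r = 0" using B1'mu(2)[of B1' r] by simp
        then show ?thesis
          by (simp add: B_def B'_def distrib_left distrib_right e(3) muA1 idm_Suc)
      qed
      moreover have "A * A' = idm (Suc r)"
      proof -
        have A1v': "A1 * (v * X) = 0" for X by (simp add: mult.assoc[symmetric] A1v)
        have tv': "t * (v * X) = mu 0 0 * X" for X by (simp add: mult.assoc[symmetric] tv)
        have "mu 0 0 * (t * A1') = t * A1'"
        proof -
          have "(mu 0 0 :: 'k rfm) = idm 1" by (rule rfm_eqI) auto
          then show ?thesis using t by (simp only: dm_left3)
        qed
        then show ?thesis
          by (simp add: A_def A'_def distrib_left distrib_right right_diff_distrib mult.assoc e(2) A1v' tv' idm_Suc)
      qed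
      ultimately show ?thesis by blast
    qed
  qed
  with that show ?thesis by blast
qed

section \<open>Trace, rank and one-sided inverses\<close>

definition trc :: "nat \<Rightarrow> 'k::field rfm \<Rightarrow> 'k" where
  "trc d A = (\<Sum>i<d. ent A i i)"

lemma trc_idm: "trc d (idm d) = of_nat d"
  by (simp add: trc_def)

lemma trc_diff: "trc d (A - B) = trc d A - trc d B"
  by (simp add: trc_def sum_subtractf)

lemma trc_mult_comm:
  assumes "dm r c A" "dm c r B"
  shows "trc r (A * B) = trc c (B * A)"
proof -
  have "ent (A * B) i i = (\<Sum>j<c. ent A i j * ent B j i)" for i
    by (rule ent_mult_sup) (use assms in \<open>auto simp: dm_def\<close>)
  moreover have "ent (B * A) i i = (\<Sum>j<r. ent B i j * ent A j i)" for i
    by (rule ent_mult_sup) (use assms in \<open>auto simp: dm_def\<close>)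
  ultimately show ?thesis
    by (simp add: trc_def) (subst sum.swap, simp add: mult.commute)
qed

text \<open>The idempotent \<open>idm d - A * B\<close> has trace d - d = 0. Its rank factorization
  turns the trace into the rank, so in characteristic 0 the rank is 0 and the idempotent
  vanishes.\<close>

lemma right_inverse_of_left_inverse:
  fixes A :: "'k::field_char_0 rfm"
  assumes A: "dm d d A" "dm d d B" and BA: "B * A = idm d"
  shows "A * B = idm d"
proof -
  let ?e = "idm d - A * B"
  have e: "dm d d ?e" using A by blast
  have ABAB: "A * (B * (A * B)) = A * B"
    by (metis A(2) BA dm_left mult.assoc)
  have idem: "?e * ?e = ?e"
    using dm_left[of d d "A * B"] dm_right[of d d "A * B"] dm_mult[OF A]
    by (simp add: left_diff_distrib right_diff_distrib mult.assoc ABAB)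
  obtain r X Y X' Y' where f: "dm r d X" "dm d r Y" "dm d r X'" "dm r d Y'"
    "?e = Y * X" "X * X' = idm r" "Y' * Y = idm r"
    by (rule rank_factorization[OF e])
  \<comment> \<open>The one-sided inverses cancel the outer factors in the idempotent equation
    \<open>Y * X * (Y * X) = Y * X\<close>.\<close>
  have XY: "X * Y = idm r"
  proof -
    have "Y' * (Y * X * (Y * X)) * X' = Y' * (Y * X) * X'" using idem f(5) by simp
    moreover have "Y' * (Y * X * (Y * X)) * X' = (Y' * Y) * (X * Y) * (X * X')" by (simp add: mult.assoc)
    moreover have "Y' * (Y * X) * X' = (Y' * Y) * (X * X')" by (simp add: mult.assoc)
    ultimately show ?thesis using f dm_mult[OF f(1,2)] dm_left[of r r "X * Y"] dm_right[of r r "X * Y"] by simp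
  qed
  have "of_nat r = (0::'k)"
  proof -
    have "of_nat r = trc d (Y * X)" using trc_mult_comm[OF f(2,1)] XY by (simp add: trc_idm)
    also have "\<dots> = trc d (idm d) - trc d (A * B)" by (simp only: f(5)[symmetric] trc_diff)
    also have "trc d (A * B) = trc d (idm d)" using trc_mult_comm[OF A] BA by simp
    finally show ?thesis by simp
  qed
  then have "Y = 0" using f(2) by (auto intro: dm_0_right)
  then show ?thesis using f(5) by simp
qed

text \<open>Comparison of the traces of \<open>A * B\<close> and \<open>B * A\<close>; in
  characteristic 0 the field sees the dimension.\<close>

lemma iso_dims_eq:
  fixes A :: "'k::field_char_0 rfm"
  assumes "dm c d A" "dm d c B" "B * A = idm d" "A * B = idm c"
  shows "c = d"
  using trc_mult_comm[OF assms(1,2)] assms(3,4) by (simp add: trc_idm)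

section \<open>Matrices as row-finite matrices\<close>

lift_definition fm :: "'k::field mat \<Rightarrow> 'k rfm"
  is "\<lambda>A i j. if i < dim_row A \<and> j < dim_col A then A $$ (i, j) else 0"
  subgoal for A i by (rule finite_subset[of _ "{..<dim_col A}"]) (auto split: if_splits)
  done

definition unfm :: "nat \<Rightarrow> nat \<Rightarrow> 'k::field rfm \<Rightarrow> 'k mat" where
  "unfm r c F = mat r c (\<lambda>(i, j). ent F i j)"

lemma ent_fm: "ent (fm A) i j = (if i < dim_row A \<and> j < dim_col A then A $$ (i, j) else 0)"
  by (simp add: fm.rep_eq)

lemma dm_fm: "A \<in> carrier_mat r c \<Longrightarrow> dm r c (fm A)"
  by (auto simp: dm_def ent_fm)

lemma unfm_carrier [simp]: "unfm r c F \<in> carrier_mat r c"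
  by (simp add: unfm_def)

lemma dim_unfm [simp]: "dim_row (unfm r c F) = r" "dim_col (unfm r c F) = c"
  by (simp_all add: unfm_def)

lemma fm_unfm: "dm r c F \<Longrightarrow> fm (unfm r c F) = F"
  by (rule rfm_eqI) (auto simp: ent_fm unfm_def dm_def)

lemma unfm_fm: "A \<in> carrier_mat r c \<Longrightarrow> unfm r c (fm A) = A"
  by (rule eq_matI) (auto simp: ent_fm unfm_def)

lemma fm_inj: "A \<in> carrier_mat r c \<Longrightarrow> B \<in> carrier_mat r c \<Longrightarrow> fm A = fm B \<longleftrightarrow> A = B"
  by (metis unfm_fm)

lemma fm_mult: "dim_col A = dim_row B \<Longrightarrow> fm (A * B) = fm A * fm B"
proof (rule rfm_eqI)
  fix i j assume eq: "dim_col A = dim_row B"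
  have "ent (fm A * fm B) i j = (\<Sum>k<dim_row B. ent (fm A) i k * ent (fm B) k j)"
    by (rule ent_mult_sup) (auto simp: ent_fm eq)
  also have "\<dots> = ent (fm (A * B)) i j"
    by (simp add: ent_fm eq scalar_prod_def atLeast0LessThan)
  finally show "ent (fm (A * B)) i j = ent (fm A * fm B) i j" by simp
qed

lemma fm_add: "A \<in> carrier_mat r c \<Longrightarrow> B \<in> carrier_mat r c \<Longrightarrow> fm (A + B) = fm A + fm B"
  and fm_diff: "A \<in> carrier_mat r c \<Longrightarrow> B \<in> carrier_mat r c \<Longrightarrow> fm (A - B) = fm A - fm B"
  and fm_smult: "fm (a \<cdot>\<^sub>m A) = a *\<^sub>c fm A"
  and fm_one: "fm (1\<^sub>m d) = idm d"
  by (rule rfm_eqI; auto simp: ent_fm)+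

lemma unfm_mult: "dm r s A \<Longrightarrow> dm s c B \<Longrightarrow> unfm r c (A * B) = unfm r s A * unfm s c B"
  by (rule fm_inj[THEN iffD1, of _ r c]) (auto simp: fm_mult fm_unfm dm_mult intro!: mult_carrier_mat)

lemma unfm_idm: "unfm d d (idm d) = 1\<^sub>m d"
  by (rule eq_matI; auto simp: unfm_def)

section \<open>Kronecker products\<close>

text \<open>The format \<open>p\<close> x \<open>q\<close> of the right factor is a parameter
  because an element of the ring does not know its own format. For \<open>q = 0\<close> the
  conventions j div 0 = 0 and j mod 0 = j still leave the rows finite.\<close>

lift_definition kr :: "nat \<Rightarrow> nat \<Rightarrow> 'k::field rfm \<Rightarrow> 'k rfm \<Rightarrow> 'k rfm"
  is "\<lambda>p q f g i j. f (i div p) (j div q) * g (i mod p) (j mod q)"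
  subgoal premises prems for p q f g i
  proof (cases "q = 0")
    case True
    have "{j. f (i div p) (j div q) * g (i mod p) (j mod q) \<noteq> 0} \<subseteq> {j. g (i mod p) j \<noteq> 0}"
      using True by auto
    then show ?thesis using prems(2) finite_subset by blast
  next
    case False
    have "{j. f (i div p) (j div q) * g (i mod p) (j mod q) \<noteq> 0}
        \<subseteq> (\<Union>a\<in>{j. f (i div p) j \<noteq> 0}. (\<lambda>b. a * q + b) ` {..<q})"
    proof
      fix j assume "j \<in> {j. f (i div p) (j div q) * g (i mod p) (j mod q) \<noteq> 0}"
      then have "f (i div p) (j div q) \<noteq> 0" by auto
      moreover have "j = j div q * q + j mod q" "j mod q < q" using False by auto
      ultimately show "j \<in> (\<Union>a\<in>{j. f (i div p) j \<noteq> 0}. (\<lambda>b. a * q + b) ` {..<q})"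
        by blast
    qed
    moreover have "finite (\<Union>a\<in>{j. f (i div p) j \<noteq> 0}. (\<lambda>b. a * q + b) ` {..<q})"
      using prems(1) by blast
    ultimately show ?thesis using finite_subset by blast
  qed
  done

lemma ent_kr [simp]: "ent (kr p q A B) i j = ent A (i div p) (j div q) * ent B (i mod p) (j mod q)"
  by transfer simp

lemma kr_add_left: "kr p q (A + A') B = kr p q A B + kr p q A' B"
  and kr_add_right: "kr p q A (B + B') = kr p q A B + kr p q A B'"
  and kr_diff_left: "kr p q (A - A') B = kr p q A B - kr p q A' B"
  and kr_diff_right: "kr p q A (B - B') = kr p q A B - kr p q A B'"
  and kr_scl_left [simp]: "kr p q (a *\<^sub>c A) B = a *\<^sub>c kr p q A B"
  and kr_scl_right [simp]: "kr p q A (a *\<^sub>c B) = a *\<^sub>c kr p q A B"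
  and kr_0_left [simp]: "kr p q 0 B = 0"
  and kr_0_right [simp]: "kr p q A 0 = 0"
  by (rule rfm_eqI; simp add: algebra_simps)+

lemma kr_sum_left: "kr p q (sum f S) B = (\<Sum>s\<in>S. kr p q (f s) B)"
  by (induction S rule: infinite_finite_induct) (auto simp: kr_add_left)

lemma kr_sum_right: "kr p q A (sum f S) = (\<Sum>s\<in>S. kr p q A (f s))"
  by (induction S rule: infinite_finite_induct) (auto simp: kr_add_right)

lemma sum_shift_lessThan: "(\<Sum>k = m..<m + q. f k) = (\<Sum>k<q. f (k + m))"
  for f :: "nat \<Rightarrow> 'a::comm_monoid_add"
  using sum.shift_bounds_nat_ivl[of f 0 m q] by (simp add: atLeast0LessThan add.commute)

text \<open>The summation index is split into a block number and a position in a block of length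
  \<open>q\<close>, and the double sum factors. The format of \<open>B\<close> is assumed because
  \<open>kr\<close> reads only its first \<open>q\<close> columns.\<close>

lemma kr_mult:
  assumes "dm p q B"
  shows "kr p q A B * kr q s C D = kr p s (A * C) (B * D)"
proof (cases "q = 0")
  case True
  then have "B = 0" using assms dm_0_right by blast
  then show ?thesis by simp
next
  case False
  show ?thesis
  proof (rule rfm_eqI)
    fix i l
    obtain N where N: "\<And>j. j \<ge> N \<Longrightarrow> ent A (i div p) j = 0"
    proof -
      obtain N where "\<forall>j\<in>{j. ent A (i div p) j \<noteq> 0}. j < N"
        using finite_row[of A "i div p"] finite_nat_set_iff_bounded by blast
      then have "ent A (i div p) j = 0" if "j \<ge> N" for j using that by force
      then show ?thesis using that by blast
    qed
    let ?f = "\<lambda>k. ent (kr p q A B) i k * ent (kr q s C D) k l"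
    have "ent (kr p q A B * kr q s C D) i l = (\<Sum>k<N * q. ?f k)"
    proof (rule ent_mult_sup)
      fix j assume "j \<notin> {..<N * q}"
      then have "j div q \<ge> N" using False by (simp add: less_eq_div_iff_mult_less_eq)
      then show "ent (kr p q A B) i j = 0" by (simp add: N)
    qed simp
    also have "\<dots> = (\<Sum>m<N. \<Sum>k = m * q..<m * q + q. ?f k)"
      by (rule sum.nat_group[symmetric])
    also have "\<dots> = (\<Sum>m<N. \<Sum>k<q. ?f (k + m * q))"
      by (simp only: sum_shift_lessThan)
    also have "\<dots> = (\<Sum>m<N. \<Sum>k<q. (ent A (i div p) m * ent C m (l div s)) * (ent B (i mod p) k * ent D k (l mod s)))"
      by (intro sum.cong refl) (simp add: mult_ac)
    also have "\<dots> = (\<Sum>m<N. ent A (i div p) m * ent C m (l div s)) * (\<Sum>k<q. ent B (i mod p) k * ent D k (l mod s))"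
      by (simp add: sum_product)
    also have "(\<Sum>m<N. ent A (i div p) m * ent C m (l div s)) = ent (A * C) (i div p) (l div s)"
      by (rule ent_mult_sup[symmetric]) (auto simp: N)
    also have "(\<Sum>k<q. ent B (i mod p) k * ent D k (l mod s)) = ent (B * D) (i mod p) (l mod s)"
      by (rule ent_mult_sup[symmetric]) (use assms in \<open>auto simp: dm_def\<close>)
    finally show "ent (kr p q A B * kr q s C D) i l = ent (kr p s (A * C) (B * D)) i l" by simp
  qed
qed

lemma div_mod_less_iff: "i div p < a \<and> i mod p < p \<longleftrightarrow> i < a * p" for p :: nat
  by (metis div_less_iff_less_mult less_nat_zero_code mod_less_divisor mult_0_right neq0_conv)

lemma dm_kr:
  assumes "dm a b A" "dm p q B"
  shows "dm (a * p) (b * q) (kr p q A B)"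
  unfolding dm_def
proof (intro allI impI)
  fix i j assume "\<not> (i < a * p \<and> j < b * q)"
  then have "\<not> (i div p < a \<and> j div q < b) \<or> \<not> (i mod p < p \<and> j mod q < q)"
    unfolding div_mod_less_iff[symmetric] by blast
  then show "ent (kr p q A B) i j = 0"
    using assms by (auto simp: dm_def)
qed

lemma fm_kron: "fm (kron A B) = kr (dim_row B) (dim_col B) (fm A) (fm B)"
proof (rule rfm_eqI)
  fix i j
  show "ent (fm (kron A B)) i j = ent (kr (dim_row B) (dim_col B) (fm A) (fm B)) i j"
    using div_mod_less_iff[of i "dim_row B" "dim_row A"] div_mod_less_iff[of j "dim_col B" "dim_col A"]
    by (auto simp: ent_fm kron_def)
qed

lemma kron_carrier: "A \<in> carrier_mat a b \<Longrightarrow> B \<in> carrier_mat p q \<Longrightarrow> kron A B \<in> carrier_mat (a * p) (b * q)"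
  by (auto simp: kron_def)

lemma kr_idm: "kr p p (idm a) (idm p) = idm (a * p)"
proof (rule rfm_eqI)
  fix i j
  have "i div p = j div p \<Longrightarrow> i mod p = j mod p \<Longrightarrow> i = j" by (metis div_mult_mod_eq)
  then show "ent (kr p p (idm a) (idm p)) i j = ent (idm (a * p)) i j"
    using div_mod_less_iff[of i p a] by auto
qed

text \<open>Both sides read an index as the same three digits in mixed radix. Associativity is thus
  an equality of matrices, and the two triple tensor products of modules have equal, not just
  isomorphic, actions.\<close>

lemma kr_assoc: "kr p q (kr p' q' A B) C = kr (p' * p) (q' * q) A (kr p q B C)"
proof -
  have "i mod (a * b) mod b = i mod b" for i a b :: nat
    by (simp add: mod_mod_cancel)
  moreover have "i div (a * b) = i div b div a" "i mod (a * b) div b = i div b mod a" for i a b :: nat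
  proof -
    show "i div (a * b) = i div b div a" by (metis div_mult2_eq mult.commute)
    show "i mod (a * b) div b = i div b mod a"
      by (cases "b = 0") (simp_all add: mod_mult2_eq mult.commute[of a b])
  qed
  ultimately show ?thesis by (intro rfm_eqI) (simp add: mult.assoc)
qed

lemma idm_1: "idm (Suc 0) = mu 0 0"
  by (rule rfm_eqI) auto

lemma kr_unit_right: "kr (Suc 0) (Suc 0) A (mu 0 0) = A"
  by (rule rfm_eqI) simp

lemma kr_unit_left:
  assumes "dm p q B" shows "kr p q (mu 0 0) B = B"
proof (rule rfm_eqI)
  fix i j
  consider "i < p" "j < q" | "p = 0" | "q = 0" | "p > 0" "i \<ge> p" | "q > 0" "j \<ge> q" by linarith
  then show "ent (kr p q (mu 0 0) B) i j = ent B i j"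
    using assms by cases (auto simp: dm_def Euclidean_Rings.div_eq_0_iff)
qed

text \<open>The flip of the tensor factors K^a and K^b: column y codes a pair as first * b + second,
  and row x codes it as second * a + first.\<close>

lift_definition fl :: "nat \<Rightarrow> nat \<Rightarrow> 'k::field rfm"
  is "\<lambda>a b x y. if x < a * b \<and> y < a * b \<and> x div a = y mod b \<and> x mod a = y div b then 1 else 0"
  subgoal for a b i by (rule finite_subset[of _ "{..<a * b}"]) (auto split: if_splits)
  done

lemma ent_fl: "ent (fl a b) x y =
    (if x < a * b \<and> y < a * b \<and> x div a = y mod b \<and> x mod a = y div b then 1 else 0)"
  by transfer simp

lemma fl_index:
  fixes a b x y :: nat
  assumes "x < a * b"
  shows "(x < a * b \<and> y < a * b \<and> x div a = y mod b \<and> x mod a = y div b) \<longleftrightarrow> y = (x mod a) * b + x div a"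
proof -
  have pos: "a > 0" "b > 0" using assms by (auto intro: ccontr)
  have xb: "x div a < b" using assms by (intro less_mult_imp_div_less) (simp add: mult.commute)
  have "(x mod a) * b + x div a < a * b"
  proof -
    have "(x mod a) * b + x div a < (x mod a + 1) * b" using xb by simp
    also have "\<dots> \<le> a * b" using pos by (intro mult_right_mono) (auto simp: Suc_le_eq)
    finally show ?thesis .
  qed
  moreover have "((x mod a) * b + x div a) mod b = x div a" "((x mod a) * b + x div a) div b = x mod a"
    using xb pos by simp_all
  ultimately show ?thesis using assms by (metis div_mult_mod_eq)
qed

lemma fl_index':
  fixes a b x y :: nat
  assumes "y < a * b"
  shows "(x < a * b \<and> y < a * b \<and> x div a = y mod b \<and> x mod a = y div b) \<longleftrightarrow> x = (y mod b) * a + y div b"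
  using fl_index[of y b a x] assms by (auto simp: mult.commute)

lemma dm_fl: "dm (a * b) (a * b) (fl a b)"
  by (auto simp: dm_def ent_fl)

lemma dm_fl': "dm (a * b) (b * a) (fl a b)" "dm (b * a) (a * b) (fl a b)"
  using dm_fl[of a b] by (simp_all add: mult.commute)

lemma ent_fl_mult: "ent (fl a b * A) x y = (if x < a * b then ent A ((x mod a) * b + x div a) y else 0)"
  for A :: "'k::field rfm"
proof (cases "x < a * b")
  case True
  have "ent (fl a b * A) x y = (\<Sum>k\<in>{(x mod a) * b + x div a}. ent (fl a b) x k * ent A k y)"
  proof (rule ent_mult_sup)
    fix j assume "j \<notin> {x mod a * b + x div a}"
    then show "ent (fl a b) x j = 0" unfolding ent_fl using fl_index[OF True, of j] by auto
  qed simp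
  moreover have "ent (fl a b) x ((x mod a) * b + x div a) = (1::'k)"
    unfolding ent_fl using fl_index[OF True, of "(x mod a) * b + x div a"] by auto
  ultimately show ?thesis using True by (simp only: sum.insert finite.emptyI empty_iff not_False_eq_True sum.empty add_0_right if_True mult_1_left)
next
  case False
  have "ent (fl a b * A) x y = (\<Sum>k\<in>{}. ent (fl a b) x k * ent A k y)"
    by (rule ent_mult_sup) (auto simp: ent_fl False)
  then show ?thesis using False by simp
qed

lemma ent_mult_fl:
  assumes "dm r (a * b) A"
  shows "ent (A * fl a b) x y = (if y < a * b then ent A x ((y mod b) * a + y div b) else 0)"
proof -
  have *: "ent (A * fl a b) x y = (\<Sum>k<a * b. ent A x k * ent (fl a b) k y)"
    by (rule ent_mult_sup) (use assms in \<open>auto simp: dm_def\<close>)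
  show ?thesis
  proof (cases "y < a * b")
    case True
    have e: "ent (fl a b) k y = (if k = (y mod b) * a + y div b then 1 else 0)" for k
      unfolding ent_fl using fl_index'[OF True, of k] by auto
    have "(\<Sum>k<a * b. ent A x k * ent (fl a b) k y)
        = (\<Sum>k<a * b. if k = (y mod b) * a + y div b then ent A x k else 0)"
      unfolding e by (rule sum.cong) auto
    moreover have "(y mod b) * a + y div b < a * b"
      using fl_index'[OF True, of "(y mod b) * a + y div b"] by auto
    ultimately show ?thesis using True by (simp add: *)
  next
    case False
    then show ?thesis by (simp add: * ent_fl)
  qed
qed

lemma fl_kr:
  assumes A: "dm r c A" and B: "dm p q B"
  shows "fl r p * kr p q A B = kr r c B A * fl c q"
proof (rule rfm_eqI)
  fix x y
  have d1: "dm (r * p) (c * q) (kr p q A B)" using dm_kr[OF A B] .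
  have d2: "dm (p * r) (c * q) (kr r c B A)" using dm_kr[OF B A] by (simp add: mult.commute)
  have m: "dm (r * p) (c * q) (fl r p * kr p q A B)" "dm (r * p) (c * q) (kr r c B A * fl c q)"
    using dm_mult[OF dm_fl d1] dm_mult[OF d2 dm_fl] by (simp_all add: mult.commute)
  show "ent (fl r p * kr p q A B) x y = ent (kr r c B A * fl c q) x y"
  proof (cases "x < r * p \<and> y < c * q")
    case True
    then have pos: "r > 0" "p > 0" "c > 0" "q > 0" by (auto intro: ccontr)
    have "x div r < p" "y div q < c" using True by (auto intro!: less_mult_imp_div_less simp: mult.commute)
    then have "((x mod r) * p + x div r) div p = x mod r" "((x mod r) * p + x div r) mod p = x div r"
      "((y mod q) * c + y div q) div c = y mod q" "((y mod q) * c + y div q) mod c = y div q"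
      using pos by simp_all
    then show ?thesis
      unfolding ent_fl_mult ent_mult_fl[OF d2] using True by simp
  next
    case False
    then show ?thesis using m unfolding dm_def by metis
  qed
qed

lemma fl_fl: "fl b a * fl a b = (idm (a * b) :: 'k::field rfm)"
proof (rule rfm_eqI)
  fix x y
  show "ent (fl b a * fl a b) x y = ent (idm (a * b) :: 'k rfm) x y"
  proof (cases "x < b * a")
    case True
    then have "x div b < a" by (intro less_mult_imp_div_less) (simp add: mult.commute)
    have "b > 0" using True by (auto intro: ccontr)
    let ?x = "(x mod b) * a + x div b"
    have lt: "?x < a * b"
      using fl_index'[of x a b ?x] True by (simp add: mult.commute)
    have "(?x mod a) * b + ?x div a = x"
      using \<open>x div b < a\<close> by simp
    then have "ent (fl a b) ?x y = (if y = x then 1 else (0::'k))"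
      unfolding ent_fl fl_index[OF lt] by simp
    then show ?thesis using True by (simp add: ent_fl_mult mult.commute)
  next
    case False
    then show ?thesis by (simp add: ent_fl_mult mult.commute)
  qed
qed

section \<open>Block sums\<close>

text \<open>The second summand occupies the indices from d to d + e - 1: \<open>up\<close> includes
  it and \<open>dn\<close> projects to it. For the first summand \<open>idm d\<close> does both,
  since all formats share one index range.\<close>

lift_definition up :: "nat \<Rightarrow> nat \<Rightarrow> 'k::field rfm"
  is "\<lambda>d e i j. if i = d + j \<and> j < e then 1 else 0"
  subgoal for d e i by (rule finite_subset[of _ "{..<e}"]) (auto split: if_splits)
  done

lift_definition dn :: "nat \<Rightarrow> nat \<Rightarrow> 'k::field rfm"
  is "\<lambda>d e i j. if j = d + i \<and> i < e then 1 else 0"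
  subgoal for d e i by (rule finite_subset[of _ "{d + i}"]) (auto split: if_splits)
  done

lemma ent_up: "ent (up d e) i j = (if i = d + j \<and> j < e then 1 else 0)"
  and ent_dn: "ent (dn d e) i j = (if j = d + i \<and> i < e then 1 else 0)"
  by (transfer; simp)+

lemma ent_up_mult: "ent (up d e * A) i j = (if d \<le> i \<and> i < d + e then ent A (i - d) j else 0)"
proof -
  have "ent (up d e * A) i j = (\<Sum>k\<in>{i - d}. ent (up d e) i k * ent A k j)"
    by (rule ent_mult_sup) (auto simp: ent_up)
  then show ?thesis by (auto simp: ent_up)
qed

lemma ent_dn_mult: "ent (dn d e * A) i j = (if i < e then ent A (d + i) j else 0)"
proof -
  have "ent (dn d e * A) i j = (\<Sum>k\<in>{d + i}. ent (dn d e) i k * ent A k j)"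
    by (rule ent_mult_sup) (auto simp: ent_dn)
  then show ?thesis by (auto simp: ent_dn)
qed

lemma ent_mult_dn:
  assumes "dm r e A"
  shows "ent (A * dn d e) i j = (if d \<le> j \<and> j < d + e then ent A i (j - d) else 0)"
proof -
  have "ent (A * dn d e) i j = (\<Sum>k<e. ent A i k * ent (dn d e) k j)"
    by (rule ent_mult_sup) (use assms in \<open>auto simp: dm_def\<close>)
  also have "\<dots> = (\<Sum>k<e. if k = j - d then (if d \<le> j then ent A i k else 0) else 0)"
    by (rule sum.cong) (auto simp: ent_dn)
  finally show ?thesis by auto
qed

lemma dm_up: "dm (d + e) e (up d e)" and dm_dn: "dm e (d + e) (dn d e)"
  by (auto simp: dm_def ent_up ent_dn)

lemma dm_idm_add: "dm (d + e) d (idm d)" "dm d (d + e) (idm d)"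
  by (auto simp: dm_def)

lemma dn_up: "dn d e * up d e = idm e"
  and idm_up: "idm d * up d e = 0"
  and up_dn: "idm d + up d e * dn d e = idm (d + e)"
  by (rule rfm_eqI; auto simp: ent_dn_mult ent_up_mult ent_up ent_dn)+

lemma dn_idm: "dn d e * idm d = 0"
  by (rule rfm_eqI) (auto simp: ent_dn)

lemma fm_four_block:
  assumes "A \<in> carrier_mat r r" "D \<in> carrier_mat e e"
  shows "fm (four_block_mat A (0\<^sub>m r e) (0\<^sub>m e r) D) = fm A + up r e * fm D * dn r e"
proof (rule rfm_eqI)
  fix i j
  have "dm e e (fm D)" using assms dm_fm by blast
  then show "ent (fm (four_block_mat A (0\<^sub>m r e) (0\<^sub>m e r) D)) i j = ent (fm A + up r e * fm D * dn r e) i j"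
    using assms by (auto simp: ent_fm mult.assoc ent_up_mult ent_mult_dn)
qed

section \<open>Representations and their homomorphisms\<close>

definition ac :: "('a, 'k::field) rep \<Rightarrow> 'a \<Rightarrow> 'k rfm" where
  "ac M x = fm (snd M x)"

definition mkrep :: "nat \<Rightarrow> ('a \<Rightarrow> 'k::field rfm) \<Rightarrow> ('a, 'k) rep" where
  "mkrep d F = (d, \<lambda>x. unfm d d (F x))"

definition Hm :: "('k::field, 'a, 'm) module_scheme \<Rightarrow> ('a, 'k) rep \<Rightarrow> ('a, 'k) rep \<Rightarrow> 'k rfm set" where
  "Hm A M N = {f. dm (fst N) (fst M) f \<and> (\<forall>x\<in>carrier A. f * ac M x = ac N x * f)}"

lemma fst_mkrep [simp]: "fst (mkrep d F) = d"
  by (simp add: mkrep_def)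

lemma fst_rep_sum [simp]: "fst (rep_sum M N) = fst M + fst N"
  by (simp add: rep_sum_def)

lemma fst_rep_tensor [simp]: "fst (rep_tensor H M N) = fst M * fst N"
  and fst_rep_unit [simp]: "fst (rep_unit H) = 1"
  by (simp_all add: rep_tensor_def rep_unit_def)

lemma Hm_dm: "f \<in> Hm A M N \<Longrightarrow> dm (fst N) (fst M) f"
  and Hm_comm: "f \<in> Hm A M N \<Longrightarrow> x \<in> carrier A \<Longrightarrow> f * ac M x = ac N x * f"
  by (auto simp: Hm_def)

lemma Hm_comp: "g \<in> Hm A N P \<Longrightarrow> f \<in> Hm A M N \<Longrightarrow> g * f \<in> Hm A M P"
  by (auto simp: Hm_def dm_mult mult.assoc) (simp add: mult.assoc[symmetric])

lemma Hm_add: "f \<in> Hm A M N \<Longrightarrow> g \<in> Hm A M N \<Longrightarrow> f + g \<in> Hm A M N"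
  and Hm_diff: "f \<in> Hm A M N \<Longrightarrow> g \<in> Hm A M N \<Longrightarrow> f - g \<in> Hm A M N"
  and Hm_minus: "f \<in> Hm A M N \<Longrightarrow> - f \<in> Hm A M N"
  and Hm_0: "0 \<in> Hm A M N"
  by (auto simp: Hm_def algebra_simps dm_add dm_diff dm_minus)

lemma Hm_sum: "(\<And>s. s \<in> S \<Longrightarrow> f s \<in> Hm A M N) \<Longrightarrow> sum f S \<in> Hm A M N"
  by (induction S rule: infinite_finite_induct) (auto intro: Hm_add Hm_0)

text \<open>The columns of a linear section are preimages of the unit vectors. This turns
  surjectivity on vectors, as it occurs in \<open>projective\<close>, into a matrix
  equation.\<close>

lemma mat_surj_iff:
  fixes p :: "'k::field mat"
  assumes p: "p \<in> carrier_mat r c"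
  shows "(\<lambda>v. p *\<^sub>v v) ` carrier_vec c = carrier_vec r \<longleftrightarrow> (\<exists>t\<in>carrier_mat c r. p * t = 1\<^sub>m r)"
proof
  assume surj: "(\<lambda>v. p *\<^sub>v v) ` carrier_vec c = carrier_vec r"
  have "\<exists>v\<in>carrier_vec c. p *\<^sub>v v = unit_vec r i" for i
  proof -
    have "unit_vec r i \<in> (\<lambda>v. p *\<^sub>v v) ` carrier_vec c" unfolding surj by simp
    then show ?thesis by force
  qed
  then obtain v where v: "\<And>i. v i \<in> carrier_vec c" "\<And>i. p *\<^sub>v v i = unit_vec r i" by metis
  define t where "t = mat c r (\<lambda>(i, j). v j $ i)"
  have t: "t \<in> carrier_mat c r" by (simp add: t_def)
  have col: "col t j = v j" if "j < r" for j
    using that v(1)[of j] by (intro eq_vecI) (auto simp: t_def)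
  have "p * t = 1\<^sub>m r"
  proof (rule eq_matI)
    fix i j assume "i < dim_row (1\<^sub>m r :: 'k mat)" "j < dim_col (1\<^sub>m r :: 'k mat)"
    then have ij: "i < r" "j < r" by auto
    have "(p * t) $$ (i, j) = (p *\<^sub>v v j) $ i"
      using ij p t col[OF ij(2)] by simp
    then show "(p * t) $$ (i, j) = 1\<^sub>m r $$ (i, j)" using ij v(2) by (simp add: unit_vec_def)
  qed (use p t in auto)
  with t show "\<exists>t\<in>carrier_mat c r. p * t = 1\<^sub>m r" by blast
next
  assume "\<exists>t\<in>carrier_mat c r. p * t = 1\<^sub>m r"
  then obtain t where t: "t \<in> carrier_mat c r" "p * t = 1\<^sub>m r" by blast
  have "v \<in> (\<lambda>v. p *\<^sub>v v) ` carrier_vec c" if v: "v \<in> carrier_vec r" for v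
  proof
    show "v = p *\<^sub>v (t *\<^sub>v v)" using p t v assoc_mult_mat_vec[OF p t(1) v] by simp
    show "t *\<^sub>v v \<in> carrier_vec c" using t v by simp
  qed
  then show "(\<lambda>v. p *\<^sub>v v) ` carrier_vec c = carrier_vec r" using p by auto
qed

locale alg =
  fixes A :: "('k::field_char_0, 'a, 'm) module_scheme"
  assumes add_closed: "x \<in> carrier A \<Longrightarrow> y \<in> carrier A \<Longrightarrow> x \<oplus>\<^bsub>A\<^esub> y \<in> carrier A"
    and mult_closed: "x \<in> carrier A \<Longrightarrow> y \<in> carrier A \<Longrightarrow> x \<otimes>\<^bsub>A\<^esub> y \<in> carrier A"
    and one_closed: "\<one>\<^bsub>A\<^esub> \<in> carrier A"
    and smult_closed: "x \<in> carrier A \<Longrightarrow> k \<odot>\<^bsub>A\<^esub> x \<in> carrier A"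
begin

lemma is_rep_iff:
  "is_rep A M \<longleftrightarrow>
    (\<forall>x\<in>carrier A. snd M x \<in> carrier_mat (fst M) (fst M)) \<and>
    (\<forall>x\<in>carrier A. \<forall>y\<in>carrier A. ac M (x \<otimes>\<^bsub>A\<^esub> y) = ac M x * ac M y) \<and>
    (\<forall>x\<in>carrier A. \<forall>y\<in>carrier A. ac M (x \<oplus>\<^bsub>A\<^esub> y) = ac M x + ac M y) \<and>
    ac M \<one>\<^bsub>A\<^esub> = idm (fst M) \<and>
    (\<forall>k. \<forall>x\<in>carrier A. ac M (k \<odot>\<^bsub>A\<^esub> x) = k *\<^sub>c ac M x)" (is "_ \<longleftrightarrow> ?R")
proof -
  let ?d = "fst M"
  have *: "ac M x = fm X \<longleftrightarrow> snd M x = X"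
    if "snd M x \<in> carrier_mat ?d ?d" "X \<in> carrier_mat ?d ?d" for x X
    using that by (simp add: ac_def fm_inj)
  show ?thesis
  proof
    assume L: "is_rep A M"
    then have c: "\<And>x. x \<in> carrier A \<Longrightarrow> snd M x \<in> carrier_mat ?d ?d"
      by (auto simp: is_rep_def Ring.ring_hom_def ring_mat_simps)
    then have dims: "\<And>x. x \<in> carrier A \<Longrightarrow> dim_row (snd M x) = ?d \<and> dim_col (snd M x) = ?d" by fastforce
    show ?R
      using L c fm_add[OF c c] by (auto simp: is_rep_def Ring.ring_hom_def ring_mat_simps ac_def fm_one fm_smult fm_mult dims)
  next
    assume R: ?R
    then have c: "\<And>x. x \<in> carrier A \<Longrightarrow> snd M x \<in> carrier_mat ?d ?d" by blast
    then have dims: "\<And>x. x \<in> carrier A \<Longrightarrow> dim_row (snd M x) = ?d \<and> dim_col (snd M x) = ?d" by fastforce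
    have "snd M (x \<otimes>\<^bsub>A\<^esub> y) = snd M x * snd M y" if "x \<in> carrier A" "y \<in> carrier A" for x y
      using that R c[OF that(1)] c[OF that(2)] c[OF mult_closed[OF that]]
      by (subst *[symmetric]) (auto simp: fm_mult dims ac_def)
    moreover have "snd M (x \<oplus>\<^bsub>A\<^esub> y) = snd M x + snd M y" if "x \<in> carrier A" "y \<in> carrier A" for x y
      using that R c[OF that(1)] c[OF that(2)] c[OF add_closed[OF that]]
      by (subst *[symmetric]) (auto simp: fm_add[OF c[OF that(1)] c[OF that(2)]] ac_def)
    moreover have "snd M (k \<odot>\<^bsub>A\<^esub> x) = k \<cdot>\<^sub>m snd M x" if "x \<in> carrier A" for x k
      using that R c[OF that(1)] c[OF smult_closed[OF that]]
      by (subst *[symmetric]) (auto simp: fm_smult ac_def)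
    moreover have "snd M \<one>\<^bsub>A\<^esub> = 1\<^sub>m ?d"
      using R c[OF one_closed] by (subst *[symmetric]) (auto simp: fm_one ac_def)
    ultimately show "is_rep A M"
      using c by (auto simp: is_rep_def Ring.ring_hom_def ring_mat_simps)
  qed
qed

lemma rep_carrier: "is_rep A M \<Longrightarrow> x \<in> carrier A \<Longrightarrow> snd M x \<in> carrier_mat (fst M) (fst M)"
  and ac_mult: "is_rep A M \<Longrightarrow> x \<in> carrier A \<Longrightarrow> y \<in> carrier A \<Longrightarrow> ac M (x \<otimes>\<^bsub>A\<^esub> y) = ac M x * ac M y"
  and ac_add: "is_rep A M \<Longrightarrow> x \<in> carrier A \<Longrightarrow> y \<in> carrier A \<Longrightarrow> ac M (x \<oplus>\<^bsub>A\<^esub> y) = ac M x + ac M y"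
  and ac_one: "is_rep A M \<Longrightarrow> ac M \<one>\<^bsub>A\<^esub> = idm (fst M)"
  and ac_smult: "is_rep A M \<Longrightarrow> x \<in> carrier A \<Longrightarrow> ac M (k \<odot>\<^bsub>A\<^esub> x) = k *\<^sub>c ac M x"
  by (auto simp: is_rep_iff)

lemma ac_dm: "is_rep A M \<Longrightarrow> x \<in> carrier A \<Longrightarrow> dm (fst M) (fst M) (ac M x)"
  unfolding ac_def by (rule dm_fm) (rule rep_carrier)

lemma ac_mkrep: "dm d d (F x) \<Longrightarrow> ac (mkrep d F) x = F x"
  by (simp add: ac_def mkrep_def fm_unfm)

lemma mkrep_rep:
  assumes "\<And>x. x \<in> carrier A \<Longrightarrow> dm d d (F x)"
    and "\<And>x y. x \<in> carrier A \<Longrightarrow> y \<in> carrier A \<Longrightarrow> F (x \<otimes>\<^bsub>A\<^esub> y) = F x * F y"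
    and "\<And>x y. x \<in> carrier A \<Longrightarrow> y \<in> carrier A \<Longrightarrow> F (x \<oplus>\<^bsub>A\<^esub> y) = F x + F y"
    and "F \<one>\<^bsub>A\<^esub> = idm d"
    and "\<And>k x. x \<in> carrier A \<Longrightarrow> F (k \<odot>\<^bsub>A\<^esub> x) = k *\<^sub>c F x"
  shows "is_rep A (mkrep d F)"
proof -
  have "ac (mkrep d F) x = F x" if "x \<in> carrier A" for x
    using assms(1)[OF that] by (rule ac_mkrep)
  then show ?thesis
    unfolding is_rep_iff using assms(2-)
    by (auto simp: one_closed mult_closed add_closed smult_closed) (simp add: mkrep_def)
qed

lemma rep_hom_fm: "is_rep A M \<Longrightarrow> is_rep A N \<Longrightarrow> f \<in> rep_hom A M N \<Longrightarrow> fm f \<in> Hm A M N"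
proof -
  assume M: "is_rep A M" and N: "is_rep A N" and f: "f \<in> rep_hom A M N"
  then have fc: "f \<in> carrier_mat (fst N) (fst M)" by (simp add: rep_hom_def)
  have "fm f * ac M x = ac N x * fm f" if x: "x \<in> carrier A" for x
  proof -
    have "fm (f * snd M x) = fm (snd N x * f)" using f x by (simp add: rep_hom_def)
    then show ?thesis
      using rep_carrier[OF M x] rep_carrier[OF N x] fc by (simp add: fm_mult ac_def)
  qed
  then show ?thesis by (simp add: Hm_def dm_fm[OF fc])
qed

lemma rep_hom_unfm: "is_rep A M \<Longrightarrow> is_rep A N \<Longrightarrow> f \<in> Hm A M N \<Longrightarrow> unfm (fst N) (fst M) f \<in> rep_hom A M N"
proof -
  assume M: "is_rep A M" and N: "is_rep A N" and f: "f \<in> Hm A M N"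
  let ?f = "unfm (fst N) (fst M) f"
  have "?f * snd M x = snd N x * ?f" if x: "x \<in> carrier A" for x
  proof -
    have "fm (?f * snd M x) = fm (snd N x * ?f)"
      using rep_carrier[OF M x] rep_carrier[OF N x] Hm_comm[OF f x] Hm_dm[OF f]
      by (simp add: fm_mult fm_unfm ac_def)
    then show ?thesis
      using rep_carrier[OF M x] rep_carrier[OF N x]
      by (subst (asm) fm_inj[where r = "fst N" and c = "fst M"]) (auto intro!: mult_carrier_mat)
  qed
  then show ?thesis by (simp add: rep_hom_def)
qed

lemma Hm_id: "is_rep A M \<Longrightarrow> idm (fst M) \<in> Hm A M M"
  by (auto simp: Hm_def dm_left[OF ac_dm] dm_right[OF ac_dm])

lemma rep_iso_iff:
  assumes M: "is_rep A M" and N: "is_rep A N"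
  shows "rep_iso A M N \<longleftrightarrow>
    (\<exists>f\<in>Hm A M N. \<exists>g\<in>Hm A N M. g * f = idm (fst M) \<and> f * g = idm (fst N))" (is "_ = ?R")
proof
  assume "rep_iso A M N"
  then obtain f g where fg: "f \<in> rep_hom A M N" "g \<in> rep_hom A N M"
    "g * f = 1\<^sub>m (fst M)" "f * g = 1\<^sub>m (fst N)" by (auto simp: rep_iso_def)
  then have c: "f \<in> carrier_mat (fst N) (fst M)" "g \<in> carrier_mat (fst M) (fst N)"
    by (auto simp: rep_hom_def)
  have "fm (g * f) = idm (fst M)" "fm (f * g) = idm (fst N)" unfolding fg by (rule fm_one)+
  then have "fm g * fm f = idm (fst M)" "fm f * fm g = idm (fst N)"
    using c by (auto simp: fm_mult)
  then show ?R using rep_hom_fm[OF M N fg(1)] rep_hom_fm[OF N M fg(2)] by blast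
next
  assume ?R
  then obtain f g where fg: "f \<in> Hm A M N" "g \<in> Hm A N M"
    "g * f = idm (fst M)" "f * g = idm (fst N)" by blast
  let ?f = "unfm (fst N) (fst M) f" and ?g = "unfm (fst M) (fst N) g"
  have "?g * ?f = 1\<^sub>m (fst M)" "?f * ?g = 1\<^sub>m (fst N)"
    using unfm_mult[OF Hm_dm[OF fg(2)] Hm_dm[OF fg(1)]] unfm_mult[OF Hm_dm[OF fg(1)] Hm_dm[OF fg(2)]]
    by (simp_all add: fg unfm_idm)
  then show "rep_iso A M N"
    using rep_hom_unfm[OF M N fg(1)] rep_hom_unfm[OF N M fg(2)] unfolding rep_iso_def by blast
qed

lemma rep_isoI:
  "is_rep A M \<Longrightarrow> is_rep A N \<Longrightarrow> f \<in> Hm A M N \<Longrightarrow> g \<in> Hm A N M \<Longrightarrow> g * f = idm (fst M)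
    \<Longrightarrow> f * g = idm (fst N) \<Longrightarrow> rep_iso A M N"
  using rep_iso_iff by blast

lemma rep_iso_refl: "is_rep A M \<Longrightarrow> rep_iso A M M"
  by (rule rep_isoI[where f = "idm (fst M)" and g = "idm (fst M)"]) (auto intro: Hm_id)

lemma rep_iso_sym: "is_rep A M \<Longrightarrow> is_rep A N \<Longrightarrow> rep_iso A M N \<Longrightarrow> rep_iso A N M"
  using rep_iso_iff by blast

lemma rep_iso_trans:
  assumes "is_rep A M" "is_rep A N" "is_rep A P" "rep_iso A M N" "rep_iso A N P"
  shows "rep_iso A M P"
proof -
  obtain f g where fg: "f \<in> Hm A M N" "g \<in> Hm A N M" "g * f = idm (fst M)" "f * g = idm (fst N)"
    using assms rep_iso_iff by blast
  obtain f' g' where fg': "f' \<in> Hm A N P" "g' \<in> Hm A P N" "g' * f' = idm (fst N)" "f' * g' = idm (fst P)"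
    using assms rep_iso_iff by blast
  have "(g * g') * (f' * f) = g * ((g' * f') * f)" "(f' * f) * (g * g') = f' * ((f * g) * g')"
    by (simp_all add: mult.assoc)
  then have "(g * g') * (f' * f) = idm (fst M)" "(f' * f) * (g * g') = idm (fst P)"
    using fg fg' by (simp_all add: dm_left[OF Hm_dm])
  then show ?thesis using Hm_comp fg fg' assms rep_isoI by meson
qed

lemma rep_iso_act:
  assumes "is_rep A M" "is_rep A N" "fst M = fst N" "\<And>x. x \<in> carrier A \<Longrightarrow> ac M x = ac N x"
  shows "rep_iso A M N"
proof -
  have "idm (fst M) \<in> Hm A M N" "idm (fst M) \<in> Hm A N M"
    using Hm_id[OF assms(1)] assms(3,4) by (auto simp: Hm_def)
  then show ?thesis using rep_isoI[OF assms(1,2)] assms(3) by force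
qed

lemma rep_iso_dim:
  assumes "is_rep A M" "is_rep A N" "rep_iso A M N" shows "fst M = fst N"
  using assms iso_dims_eq Hm_dm unfolding rep_iso_iff[OF assms(1,2)] by metis

text \<open>The equations of a biproduct. They describe a direct sum decomposition without fixing
  coordinates, so they survive tensoring with a further module, and they determine \<open>M\<close>
  up to isomorphism.\<close>

definition bip :: "('a, 'k) rep \<Rightarrow> ('a, 'k) rep \<Rightarrow> ('a, 'k) rep \<Rightarrow> 'k rfm \<Rightarrow> 'k rfm \<Rightarrow> 'k rfm \<Rightarrow> 'k rfm \<Rightarrow> bool" where
  "bip M N P i j p q \<longleftrightarrow> i \<in> Hm A N M \<and> j \<in> Hm A P M \<and> p \<in> Hm A M N \<and> q \<in> Hm A M P \<and>
    p * i = idm (fst N) \<and> q * j = idm (fst P) \<and> p * j = 0 \<and> q * i = 0 \<and> i * p + j * q = idm (fst M)"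

lemma ac_rep_sum:
  assumes "is_rep A M" "is_rep A N" "x \<in> carrier A"
  shows "ac (rep_sum M N) x = ac M x + up (fst M) (fst N) * ac N x * dn (fst M) (fst N)"
  unfolding ac_def rep_sum_def using rep_carrier assms by (simp add: fm_four_block)

lemma rep_sum_bip':
  assumes M: "is_rep A M" and N: "is_rep A N"
  shows "bip (rep_sum M N) M N (idm (fst M)) (up (fst M) (fst N)) (idm (fst M)) (dn (fst M) (fst N))"
proof -
  let ?m = "fst M" and ?n = "fst N"
  have X: "X * up ?m ?n = 0" "dn ?m ?n * X = 0" if "dm ?m ?m X" for X
    using dm_right3[OF that, of "up ?m ?n"] that
    by (simp_all add: idm_up) (metis dn_idm dm_left mult.assoc mult_zero_left that)
  have Y: "X * (dn ?m ?n * idm ?m) = 0" "idm ?m * (up ?m ?n * X) = 0" for X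
    by (simp_all add: dn_idm mult.assoc[symmetric] idm_up)
  have Z: "dn ?m ?n * (up ?m ?n * X) = idm ?n * X" "X * (dn ?m ?n * up ?m ?n) = X * idm ?n" for X
    by (simp_all add: mult.assoc[symmetric] dn_up)
  have V: "idm ?n * X = X" "X * idm ?n = X" if "dm ?n ?n X" for X using that by (simp_all add: dm_left dm_right)
  have V': "idm ?n * (X * Z) = X * Z" if "dm ?n ?n X" for X Z using that by (simp add: dm_left3)
  have a: "dm ?m ?m (ac M x)" "dm ?n ?n (ac N x)" if "x \<in> carrier A" for x
    using ac_dm M N that by auto
  have W: "idm ?m * X = X" "X * idm ?m = X" if "dm ?m ?m X" for X using that by (simp_all add: dm_left dm_right)
  show ?thesis unfolding bip_def
    using a dm_idm_add dm_up dm_dn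
    by (auto simp: Hm_def ac_rep_sum[OF M N] distrib_left distrib_right mult.assoc X Y Z W V V' dn_up idm_up dn_idm up_dn)
qed

lemma rep_sum_rep:
  assumes M: "is_rep A M" and N: "is_rep A N"
  shows "is_rep A (rep_sum M N)"
proof -
  let ?m = "fst M" and ?n = "fst N"
  have X: "X * up ?m ?n = 0" "dn ?m ?n * X = 0" if "dm ?m ?m X" for X
    using dm_right3[OF that, of "up ?m ?n"] that
    by (simp_all add: idm_up) (metis dn_idm dm_left mult.assoc mult_zero_left that)
  have X': "X * (up ?m ?n * Z) = 0" if "dm ?m ?m X" for X Z
    using X(1)[OF that] by (simp add: mult.assoc[symmetric])
  have Z: "dn ?m ?n * (up ?m ?n * X) = idm ?n * X" for X
    by (simp add: mult.assoc[symmetric] dn_up)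
  have Y: "X * (idm ?n * Z) = X * Z" if "dm ?n ?n X" for X Z
    using that by (rule dm_right3)
  have a: "dm ?m ?m (ac M x)" "dm ?n ?n (ac N x)" if "x \<in> carrier A" for x
    using ac_dm M N that by auto
  have c: "snd (rep_sum M N) x \<in> carrier_mat (?m + ?n) (?m + ?n)" if "x \<in> carrier A" for x
    unfolding rep_sum_def using rep_carrier[OF M that] rep_carrier[OF N that] by auto
  show ?thesis
    unfolding is_rep_iff
    by (auto simp: c ac_rep_sum[OF M N] mult_closed one_closed add_closed smult_closed
        ac_mult[OF M] ac_mult[OF N] ac_add[OF M] ac_add[OF N] ac_one[OF M] ac_one[OF N] ac_smult[OF M] ac_smult[OF N]
        distrib_left distrib_right mult.assoc X X' Z Y a scl_add dm_left[OF dm_dn] up_dn)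
qed

lemma bip_iso:
  assumes "bip M N P i j p q" "bip M' N' P' i' j' p' q'"
    "is_rep A M" "is_rep A M'" "f \<in> Hm A N N'" "f' \<in> Hm A N' N" "g \<in> Hm A P P'" "g' \<in> Hm A P' P"
    "f' * f = idm (fst N)" "f * f' = idm (fst N')" "g' * g = idm (fst P)" "g * g' = idm (fst P')"
  shows "rep_iso A M M'"
proof -
  have "i' * f * p + j' * g * q \<in> Hm A M M'" "i * f' * p' + j * g' * q' \<in> Hm A M' M"
    using assms unfolding bip_def by (meson Hm_add Hm_comp)+
  moreover
  have d: "dm (fst N) (fst M) p" "dm (fst P) (fst M) q" "dm (fst N') (fst M') p'" "dm (fst P') (fst M') q'"
    "dm (fst N') (fst N) f" "dm (fst P') (fst P) g" "dm (fst N) (fst N') f'" "dm (fst P) (fst P') g'"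
    using assms unfolding bip_def by (auto dest: Hm_dm)
  have e: "p * (i * X) = idm (fst N) * X" "p * (j * X) = 0" "q * (i * X) = 0" "q * (j * X) = idm (fst P) * X"
    "f' * (f * X) = idm (fst N) * X" "g' * (g * X) = idm (fst P) * X"
    "p' * (i' * X) = idm (fst N') * X" "p' * (j' * X) = 0" "q' * (i' * X) = 0" "q' * (j' * X) = idm (fst P') * X"
    "f * (f' * X) = idm (fst N') * X" "g * (g' * X) = idm (fst P') * X" for X
    using assms unfolding bip_def by (simp_all add: mult.assoc[symmetric])
  have "i * p + j * q = idm (fst M)" "i' * p' + j' * q' = idm (fst M')"
    using assms(1,2) by (auto simp: bip_def)
  then have "(i * f' * p' + j * g' * q') * (i' * f * p + j' * g * q) = idm (fst M)"
    "(i' * f * p + j' * g * q) * (i * f' * p' + j * g' * q') = idm (fst M')"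
    by (simp_all add: distrib_left distrib_right mult.assoc e dm_left3[OF d(5)] dm_left3[OF d(6)] dm_left3[OF d(7)]
        dm_left3[OF d(8)] dm_left[OF d(1)] dm_left[OF d(2)] dm_left[OF d(3)] dm_left[OF d(4)])
  ultimately show ?thesis using rep_isoI assms(3,4) by blast
qed

lemma bip_rep_sum_iso:
  assumes "bip M N P i j p q" "is_rep A M" "is_rep A N" "is_rep A P"
  shows "rep_iso A M (rep_sum N P)"
  by (rule bip_iso[OF assms(1) rep_sum_bip' assms(2) rep_sum_rep Hm_id Hm_id Hm_id Hm_id]) (use assms in auto)

text \<open>The idempotent 1 - s r commutes with the action. Splitting it as k l by the rank
  factorization gives a complement on which x acts by l x k.\<close>

lemma retract_complement:
  assumes M: "is_rep A M" and N: "is_rep A N" and s: "s \<in> Hm A N M" and r: "r \<in> Hm A M N"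
    and rs: "r * s = idm (fst N)"
  obtains Q k l where "is_rep A Q" "bip M N Q s k r l"
proof -
  let ?m = "fst M" and ?n = "fst N"
  define e where "e = idm ?m - s * r"
  have d: "dm ?m ?n s" "dm ?n ?m r" using s r Hm_dm by blast+
  have eH: "e \<in> Hm A M M" unfolding e_def using Hm_diff Hm_id[OF M] Hm_comp[OF s r] by blast
  have rs': "r * (s * X) = idm ?n * X" for X by (simp add: mult.assoc[symmetric] rs)
  have er: "r * e = 0" "e * s = 0"
    using d by (simp_all add: e_def left_diff_distrib right_diff_distrib rs' mult.assoc rs dm_left dm_right)
  have em: "dm ?m ?m e" using Hm_dm[OF eH] .
  have ee: "e * e = e"
    using er em by (subst (1) e_def) (simp add: left_diff_distrib mult.assoc dm_left)
  obtain c l k l' k' where f: "dm c ?m l" "dm ?m c k" "dm ?m c l'" "dm c ?m k'"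
    "e = k * l" "l * l' = idm c" "k' * k = idm c"
    by (rule rank_factorization[OF em])
  have lk: "l * k = idm c"
  proof -
    have "k' * (k * l * (k * l)) * l' = k' * (k * l) * l'" using ee f(5) by simp
    moreover have "k' * (k * l * (k * l)) * l' = (k' * k) * (l * k) * (l * l')" by (simp add: mult.assoc)
    moreover have "k' * (k * l) * l' = (k' * k) * (l * l')" by (simp add: mult.assoc)
    ultimately show ?thesis using f dm_mult[OF f(1,2)] dm_left[of c c "l * k"] dm_right[of c c "l * k"] by simp
  qed
  have lk': "l * (k * X) = idm c * X" for X by (simp add: mult.assoc[symmetric] lk)
  have ec: "k * (l * ac M x) = ac M x * (k * l)" if "x \<in> carrier A" for x
    using Hm_comm[OF eH that] by (simp add: f(5) mult.assoc)
  have le: "k * (l * k) = k" "l * (k * l) = l" using f by (simp_all add: lk lk' dm_left dm_right)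
  define Q where "Q = mkrep c (\<lambda>x. l * ac M x * k)"
  have Qd: "dm c c (l * ac M x * k)" if "x \<in> carrier A" for x
    using f ac_dm[OF M that] by blast
  have acQ: "ac Q x = l * ac M x * k" if "x \<in> carrier A" for x
    unfolding Q_def by (rule ac_mkrep) (rule Qd[OF that])
  have Q: "is_rep A Q" unfolding Q_def
  proof (rule mkrep_rep)
    fix x y assume xy: "x \<in> carrier A" "y \<in> carrier A"
    have "l * ac M x * k * (l * ac M y * k) = l * (ac M x * (k * l)) * (ac M y * k)" by (simp add: mult.assoc)
    also have "\<dots> = l * (k * (l * ac M x)) * (ac M y * k)" using ec[OF xy(1)] by simp
    also have "\<dots> = l * (ac M x * ac M y) * k"
    proof -
      have "l * (k * (l * ac M x)) = l * ac M x" using le(2) by (metis mult.assoc)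
      then show ?thesis by (simp add: mult.assoc)
    qed
    finally show "l * ac M (x \<otimes>\<^bsub>A\<^esub> y) * k = l * ac M x * k * (l * ac M y * k)"
      using ac_mult[OF M xy] by simp
  next
    show "l * ac M \<one>\<^bsub>A\<^esub> * k = idm c" using f by (simp add: ac_one[OF M] dm_right lk)
  qed (use Qd in \<open>auto simp: ac_add[OF M] ac_smult[OF M] algebra_simps\<close>)
  have "k \<in> Hm A Q M"
  proof -
    have "k * (l * ac M x * k) = ac M x * k" if "x \<in> carrier A" for x
    proof -
      have "k * (l * ac M x * k) = k * (l * ac M x) * k" by (simp add: mult.assoc)
      also have "\<dots> = ac M x * (k * l) * k" using ec[OF that] by simp
      also have "\<dots> = ac M x * k" by (metis le(1) mult.assoc)
      finally show ?thesis .
    qed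
    then show ?thesis using f(2) acQ by (simp add: Hm_def Q_def)
  qed
  moreover have "l \<in> Hm A M Q"
  proof -
    have "l * ac M x = l * ac M x * k * l" if "x \<in> carrier A" for x
    proof -
      have "l * ac M x * k * l = l * (ac M x * (k * l))" by (simp add: mult.assoc)
      also have "\<dots> = l * k * (l * ac M x)" using ec[OF that] by (simp add: mult.assoc)
      also have "\<dots> = l * ac M x" using f by (simp add: lk dm_left3)
      finally show ?thesis by simp
    qed
    then show ?thesis using f(1) acQ by (simp add: Hm_def Q_def)
  qed
  moreover have "r * k = 0"
  proof -
    have "r * k = r * (k * l) * k" using le(1) by (simp add: mult.assoc)
    then show ?thesis using er f(5) by simp
  qed
  moreover have "l * s = 0"
  proof -
    have "l * s = l * ((k * l) * s)" by (metis le(2) mult.assoc)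
    then show ?thesis using er f(5) by simp
  qed
  moreover have "s * r + k * l = idm ?m" using f(5) by (simp add: e_def diff_eq_eq add.commute)
  ultimately have "bip M N Q s k r l" using s r rs lk by (simp add: bip_def Q_def)
  with Q that show ?thesis by blast
qed

definition zrep :: "('a, 'k) rep" where "zrep = mkrep 0 (\<lambda>_. 0)"

lemma fst_zrep [simp]: "fst zrep = 0"
  by (simp add: zrep_def)

lemma zrep_rep: "is_rep A zrep"
  unfolding zrep_def by (rule mkrep_rep) auto

lemma zero_dim_iso: "is_rep A M \<Longrightarrow> is_rep A N \<Longrightarrow> fst M = 0 \<Longrightarrow> fst N = 0 \<Longrightarrow> rep_iso A M N"
  by (rule rep_isoI[where f = 0 and g = 0]) (auto intro: Hm_0)

section \<open>Projective modules\<close>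

lemma projective_rep: "projective A P \<Longrightarrow> is_rep A P"
  by (simp add: projective_def)

text \<open>The linear section \<open>t\<close> stands for the surjectivity of \<open>p\<close>; it
  is not assumed to be a map of modules.\<close>

lemma projective_lift:
  assumes P: "projective A P" and M: "is_rep A M" and N: "is_rep A N" and p: "p \<in> Hm A M N"
    and t: "dm (fst M) (fst N) t" "p * t = idm (fst N)" and f: "f \<in> Hm A P N"
  obtains f' where "f' \<in> Hm A P M" "p * f' = f"
proof -
  note Pr = projective_rep[OF P]
  let ?p = "unfm (fst N) (fst M) p" and ?f = "unfm (fst N) (fst P) f" and ?t = "unfm (fst M) (fst N) t"
  have ph: "?p \<in> rep_hom A M N" and fh: "?f \<in> rep_hom A P N"
    using rep_hom_unfm M N Pr p f by blast+
  have "?p * ?t = 1\<^sub>m (fst N)"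
    using unfm_mult[OF Hm_dm[OF p] t(1)] t(2) by (simp add: unfm_idm)
  then have "(\<lambda>v. ?p *\<^sub>v v) ` carrier_vec (fst M) = carrier_vec (fst N)"
    using mat_surj_iff[of ?p "fst N" "fst M"] unfm_carrier by blast
  then obtain f' where f': "f' \<in> rep_hom A P M" "?p * f' = ?f"
    using P ph fh M N unfolding projective_def by blast
  have "p * fm f' = f"
  proof -
    have "fm (?p * f') = f" using f'(2) Hm_dm[OF f] by (simp add: fm_unfm)
    moreover have "fm (?p * f') = fm ?p * fm f'"
      using f'(1) by (intro fm_mult) (auto simp: rep_hom_def)
    ultimately show ?thesis using Hm_dm[OF p] by (simp add: fm_unfm)
  qed
  then show ?thesis using that rep_hom_fm[OF Pr M f'(1)] by blast
qed

lemma projectiveI: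
  assumes P: "is_rep A P"
    and lift: "\<And>M N p t f. is_rep A M \<Longrightarrow> is_rep A N \<Longrightarrow> p \<in> Hm A M N \<Longrightarrow> dm (fst M) (fst N) t \<Longrightarrow>
      p * t = idm (fst N) \<Longrightarrow> f \<in> Hm A P N \<Longrightarrow> \<exists>f'\<in>Hm A P M. p * f' = f"
  shows "projective A P"
  unfolding projective_def
proof (intro conjI allI ballI impI P)
  fix M N p f
  assume p: "p \<in> rep_hom A M N" and f: "f \<in> rep_hom A P N"
    and *: "is_rep A M \<and> is_rep A N \<and> (\<lambda>v. p *\<^sub>v v) ` carrier_vec (fst M) = carrier_vec (fst N)"
  then have M: "is_rep A M" and N: "is_rep A N" by auto
  have pc: "p \<in> carrier_mat (fst N) (fst M)" and fc: "f \<in> carrier_mat (fst N) (fst P)"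
    using p f by (auto simp: rep_hom_def)
  obtain t where t: "t \<in> carrier_mat (fst M) (fst N)" "p * t = 1\<^sub>m (fst N)"
    using mat_surj_iff[OF pc] * by blast
  have "fm p * fm t = idm (fst N)"
    using t pc by (metis carrier_matD fm_mult fm_one)
  then obtain f' where f': "f' \<in> Hm A P M" "fm p * f' = fm f"
    using lift[OF M N rep_hom_fm[OF M N p] dm_fm[OF t(1)] _ rep_hom_fm[OF P N f]] by blast
  let ?f' = "unfm (fst M) (fst P) f'"
  have "fm (p * ?f') = fm f" using f' pc by (simp add: fm_mult fm_unfm Hm_dm)
  moreover have "p * ?f' \<in> carrier_mat (fst N) (fst P)" using pc by (auto intro: mult_carrier_mat)
  ultimately have "p * ?f' = f" using fc by (subst (asm) fm_inj)
  then show "\<exists>f'\<in>rep_hom A P M. p * f' = f" using rep_hom_unfm[OF P M f'(1)] by blast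
qed

lemma projective_retract:
  assumes P: "projective A P" and Q: "is_rep A Q" and s: "s \<in> Hm A Q P" and r: "r \<in> Hm A P Q"
    and rs: "r * s = idm (fst Q)"
  shows "projective A Q"
proof (rule projectiveI[OF Q])
  fix M N p t f
  assume *: "is_rep A M" "is_rep A N" "p \<in> Hm A M N" "dm (fst M) (fst N) t" "p * t = idm (fst N)"
    and f: "f \<in> Hm A Q N"
  obtain f' where f': "f' \<in> Hm A P M" "p * f' = f * r"
    using projective_lift[OF P * Hm_comp[OF f r]] by blast
  have "p * (f' * s) = f * (r * s)" by (simp add: mult.assoc[symmetric] f'(2))
  then have "p * (f' * s) = f" using Hm_dm[OF f] by (simp add: rs dm_right)
  then show "\<exists>f'\<in>Hm A Q M. p * f' = f" using Hm_comp[OF f'(1) s] by blast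
qed

lemma projective_iso:
  assumes "projective A P" "is_rep A Q" "rep_iso A Q P" shows "projective A Q"
  using assms(3) projective_retract[OF assms(1,2)]
  unfolding rep_iso_iff[OF assms(2) projective_rep[OF assms(1)]] by blast

lemma projective_bip:
  assumes "bip M P Q i j p q" "is_rep A M" "projective A P" "projective A Q"
  shows "projective A M"
proof (rule projectiveI[OF assms(2)])
  fix X N h t f
  assume *: "is_rep A X" "is_rep A N" "h \<in> Hm A X N" "dm (fst X) (fst N) t" "h * t = idm (fst N)"
    and f: "f \<in> Hm A M N"
  have b: "i \<in> Hm A P M" "j \<in> Hm A Q M" "p \<in> Hm A M P" "q \<in> Hm A M Q" "i * p + j * q = idm (fst M)"
    using assms(1) by (auto simp: bip_def)
  obtain u where u: "u \<in> Hm A P X" "h * u = f * i" using projective_lift[OF assms(3) * Hm_comp[OF f b(1)]] by blast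
  obtain v where v: "v \<in> Hm A Q X" "h * v = f * j" using projective_lift[OF assms(4) * Hm_comp[OF f b(2)]] by blast
  have "h * (u * p + v * q) = f * (i * p + j * q)"
    by (simp add: distrib_left mult.assoc[symmetric] u v)
  then have "h * (u * p + v * q) = f" using Hm_dm[OF f] by (simp add: b(5) dm_right)
  then show "\<exists>f'\<in>Hm A M X. h * f' = f" using Hm_add[OF Hm_comp[OF u(1) b(3)] Hm_comp[OF v(1) b(4)]] by blast
qed

lemma projective_sum: "projective A P \<Longrightarrow> projective A Q \<Longrightarrow> projective A (rep_sum P Q)"
  using projective_bip[OF rep_sum_bip'] rep_sum_rep projective_rep by blast

lemma projective_zero_dim: "is_rep A M \<Longrightarrow> fst M = 0 \<Longrightarrow> projective A M"
proof (rule projectiveI)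
  fix N X p t f assume "fst M = 0" "f \<in> Hm A M N"
  then have "f = 0" using Hm_dm dm_0_right by metis
  then show "\<exists>f'\<in>Hm A M X. p * f' = f" by (intro bexI[of _ 0] Hm_0) simp
qed

section \<open>Stable isomorphism\<close>

definition fproj :: "('a, 'k) rep \<Rightarrow> ('a, 'k) rep \<Rightarrow> 'k rfm \<Rightarrow> bool" where
  "fproj M N f \<longleftrightarrow> (\<exists>P. projective A P \<and> (\<exists>a\<in>Hm A M P. \<exists>b\<in>Hm A P N. f = b * a))"

lemma fproj_0: "fproj M N 0"
  unfolding fproj_def
  by (intro exI[of _ zrep] conjI projective_zero_dim[OF zrep_rep fst_zrep] bexI[of _ 0] Hm_0) simp

text \<open>The sum factors through the direct sum of the two projective modules.\<close>

lemma fproj_add: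
  assumes "fproj M N f" "fproj M N g" shows "fproj M N (f + g)"
proof -
  obtain P a b where P: "projective A P" "a \<in> Hm A M P" "b \<in> Hm A P N" "f = b * a"
    using assms(1) unfolding fproj_def by blast
  obtain Q c d where Q: "projective A Q" "c \<in> Hm A M Q" "d \<in> Hm A Q N" "g = d * c"
    using assms(2) unfolding fproj_def by blast
  obtain i j p q where s: "bip (rep_sum P Q) P Q i j p q"
    using rep_sum_bip' projective_rep P(1) Q(1) by blast
  have e: "p * (i * X) = idm (fst P) * X" "p * (j * X) = 0" "q * (i * X) = 0" "q * (j * X) = idm (fst Q) * X" for X
    using s unfolding bip_def by (simp_all add: mult.assoc[symmetric])
  have "f + g = (b * p + d * q) * (i * a + j * c)"
    using Hm_dm[OF P(2)] Hm_dm[OF Q(2)] by (simp add: distrib_left distrib_right mult.assoc e P Q dm_left)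
  moreover have "b * p + d * q \<in> Hm A (rep_sum P Q) N" "i * a + j * c \<in> Hm A M (rep_sum P Q)"
    using s P Q unfolding bip_def by (meson Hm_add Hm_comp)+
  ultimately show ?thesis unfolding fproj_def using projective_sum[OF P(1) Q(1)] by blast
qed

lemma fproj_left: "fproj M N f \<Longrightarrow> g \<in> Hm A N X \<Longrightarrow> fproj M X (g * f)"
  unfolding fproj_def by (metis Hm_comp mult.assoc)

lemma fproj_right: "fproj M N f \<Longrightarrow> g \<in> Hm A X M \<Longrightarrow> fproj X N (f * g)"
  unfolding fproj_def by (metis Hm_comp mult.assoc)

lemma fproj_minus: "fproj M N f \<Longrightarrow> fproj M N (- f)"
  unfolding fproj_def by (metis Hm_minus mult_minus_left)

lemma fproj_diff: "fproj M N f \<Longrightarrow> fproj M N g \<Longrightarrow> fproj M N (f - g)"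
  using fproj_add[OF _ fproj_minus, of M N f g] by simp

lemma factors_proj_fm:
  assumes M: "is_rep A M" and N: "is_rep A N" and f: "f \<in> carrier_mat (fst N) (fst M)"
  shows "f \<in> factors_proj A M N \<longleftrightarrow> fproj M N (fm f)"
proof
  assume "f \<in> factors_proj A M N"
  then obtain P a b where P: "projective A P" "a \<in> rep_hom A M P" "b \<in> rep_hom A P N" "f = b * a"
    unfolding factors_proj_def by blast
  have "fm f = fm b * fm a" unfolding P(4) using P(2,3) by (intro fm_mult) (auto simp: rep_hom_def)
  then show "fproj M N (fm f)"
    unfolding fproj_def using P rep_hom_fm projective_rep M N by metis
next
  assume "fproj M N (fm f)"
  then obtain P a b where P: "projective A P" "a \<in> Hm A M P" "b \<in> Hm A P N" "fm f = b * a"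
    unfolding fproj_def by blast
  have "f = unfm (fst N) (fst P) b * unfm (fst P) (fst M) a"
    using unfm_fm[OF f] P(4) unfm_mult[OF Hm_dm[OF P(3)] Hm_dm[OF P(2)]] by simp
  then show "f \<in> factors_proj A M N"
    unfolding factors_proj_def using P rep_hom_unfm projective_rep M N by blast
qed

definition st :: "('a, 'k) rep \<Rightarrow> ('a, 'k) rep \<Rightarrow> 'k rfm \<Rightarrow> 'k rfm \<Rightarrow> bool" where
  "st M N f g \<longleftrightarrow> f \<in> Hm A M N \<and> g \<in> Hm A N M \<and>
    fproj M M (g * f - idm (fst M)) \<and> fproj N N (f * g - idm (fst N))"

lemma st_class_mem:
  assumes M: "is_rep A M" and N: "is_rep A N" and f: "f \<in> carrier_mat (fst N) (fst M)"
  shows "f' \<in> st_class A M N f \<longleftrightarrow> f' \<in> rep_hom A M N \<and> fproj M N (fm f' - fm f)"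
proof (cases "f' \<in> rep_hom A M N")
  case True
  then have c: "f' \<in> carrier_mat (fst N) (fst M)" by (simp add: rep_hom_def)
  then have "f' - f \<in> carrier_mat (fst N) (fst M)" using f by (intro minus_carrier_mat) auto
  then show ?thesis using True factors_proj_fm[OF M N] fm_diff[OF c f] by (simp add: st_class_def)
qed (simp add: st_class_def)

lemma st_class_eq:
  assumes M: "is_rep A M" and N: "is_rep A N" and f: "f \<in> carrier_mat (fst N) (fst M)"
    and g: "g \<in> carrier_mat (fst N) (fst M)" and fg: "fproj M N (fm f - fm g)"
  shows "st_class A M N f = st_class A M N g"
proof -
  have "fproj M N (h - fm f) \<longleftrightarrow> fproj M N (h - fm g)" for h
    using fproj_add[OF _ fg, of "h - fm f"] fproj_diff[OF _ fg, of "h - fm g"] by auto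
  then show ?thesis by (auto simp: st_class_mem[OF M N f] st_class_mem[OF M N g])
qed

text \<open>\<open>st_comp\<close> ranges over all representatives. Changing them alters a composite
  only by a map through a projective module, so a single pair of matrices decides.\<close>

lemma st_iso_iff:
  assumes M: "is_rep A M" and N: "is_rep A N"
  shows "st_iso A M N \<longleftrightarrow> (\<exists>f g. st M N f g)"
proof
  assume "st_iso A M N"
  then obtain f g where f: "f \<in> rep_hom A M N" and g: "g \<in> rep_hom A N M"
    and 1: "st_comp A M M (st_class A N M g) (st_class A M N f) = st_class A M M (1\<^sub>m (fst M))"
    and 2: "st_comp A N N (st_class A M N f) (st_class A N M g) = st_class A N N (1\<^sub>m (fst N))"
    unfolding st_iso_def st_hom_def by blast
  have c: "f \<in> carrier_mat (fst N) (fst M)" "g \<in> carrier_mat (fst M) (fst N)" using f g by (auto simp: rep_hom_def)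
  note F = rep_hom_fm[OF M N f] rep_hom_fm[OF N M g]
  have m: "f \<in> st_class A M N f" "g \<in> st_class A N M g"
    using f g c by (simp_all add: st_class_mem M N fproj_0)
  have gf: "g * f \<in> carrier_mat (fst M) (fst M)" "f * g \<in> carrier_mat (fst N) (fst N)"
    using c by (auto intro: mult_carrier_mat)
  have h: "g * f \<in> rep_hom A M M" "f * g \<in> rep_hom A N N"
    using rep_hom_unfm[OF M M Hm_comp[OF F(2,1)]] rep_hom_unfm[OF N N Hm_comp[OF F]] unfm_fm[OF gf(1)] unfm_fm[OF gf(2)]
      c by (simp_all add: fm_mult)
  have "g * f \<in> st_class A M M (g * f)" "f * g \<in> st_class A N N (f * g)"
    using gf h by (simp_all add: st_class_mem M N fproj_0)
  then have "g * f \<in> st_class A M M (1\<^sub>m (fst M))" "f * g \<in> st_class A N N (1\<^sub>m (fst N))"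
    using 1 2 m unfolding st_comp_def by blast+
  then have "st M N (fm f) (fm g)"
    unfolding st_def using F c by (auto simp: st_class_mem M N fm_one fm_mult)
  then show "\<exists>f g. st M N f g" by blast
next
  assume "\<exists>f g. st M N f g"
  then obtain f g where fg: "st M N f g" by blast
  let ?f = "unfm (fst N) (fst M) f" and ?g = "unfm (fst M) (fst N) g"
  have F: "f \<in> Hm A M N" "g \<in> Hm A N M" using fg by (auto simp: st_def)
  have H: "?f \<in> rep_hom A M N" "?g \<in> rep_hom A N M" using rep_hom_unfm M N F by blast+
  have comp: "st_comp A X X (st_class A Y X v) (st_class A X Y u) = st_class A X X (1\<^sub>m (fst X))"
    if X: "is_rep A X" and Y: "is_rep A Y" and u: "u \<in> rep_hom A X Y" and v: "v \<in> rep_hom A Y X"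
      and uv: "fproj X X (fm v * fm u - idm (fst X))" for X Y u v
  proof -
    have c: "u \<in> carrier_mat (fst Y) (fst X)" "v \<in> carrier_mat (fst X) (fst Y)" using u v by (auto simp: rep_hom_def)
    have m: "u \<in> st_class A X Y u" "v \<in> st_class A Y X v"
      using u v c by (simp_all add: st_class_mem X Y fproj_0)
    have "st_class A X X (v' * u') = st_class A X X (1\<^sub>m (fst X))"
      if "v' \<in> st_class A Y X v" "u' \<in> st_class A X Y u" for u' v'
    proof -
      have 1: "u' \<in> rep_hom A X Y" "v' \<in> rep_hom A Y X" "fproj X Y (fm u' - fm u)" "fproj Y X (fm v' - fm v)"
        using that c by (simp_all add: st_class_mem X Y)
      then have c': "u' \<in> carrier_mat (fst Y) (fst X)" "v' \<in> carrier_mat (fst X) (fst Y)" by (auto simp: rep_hom_def)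
      \<comment> \<open>The deviation is split so that each summand contains one difference known to
        factor through a projective module.\<close>
      have "fm (v' * u') - fm (1\<^sub>m (fst X)) =
          fm v' * (fm u' - fm u) + ((fm v' - fm v) * fm u + (fm v * fm u - idm (fst X)))"
        using c' by (simp add: fm_mult fm_one algebra_simps)
      then have "fproj X X (fm (v' * u') - fm (1\<^sub>m (fst X)))"
        using fproj_add[OF fproj_left[OF 1(3) rep_hom_fm[OF Y X 1(2)]]
            fproj_add[OF fproj_right[OF 1(4) rep_hom_fm[OF X Y u]] uv]] by simp
      then show ?thesis using c' by (intro st_class_eq[OF X X]) (auto intro: mult_carrier_mat)
    qed
    then show ?thesis unfolding st_comp_def using m by blast
  qed
  have "st_comp A M M (st_class A N M ?g) (st_class A M N ?f) = st_class A M M (1\<^sub>m (fst M))"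
    using fg F by (intro comp[OF M N H]) (simp add: fm_unfm Hm_dm st_def)
  moreover have "st_comp A N N (st_class A M N ?f) (st_class A N M ?g) = st_class A N N (1\<^sub>m (fst N))"
    using fg F by (intro comp[OF N M H(2,1)]) (simp_all add: fm_unfm Hm_dm st_def)
  ultimately show "st_iso A M N" unfolding st_iso_def st_hom_def using H by blast
qed

lemma st_sym: "st M N f g \<Longrightarrow> st N M g f"
  by (simp add: st_def)

lemma st_trans:
  assumes "st M N f g" "st N P f' g'" "is_rep A M" "is_rep A P" shows "st M P (f' * f) (g * g')"
proof -
  have H: "f \<in> Hm A M N" "g \<in> Hm A N M" "f' \<in> Hm A N P" "g' \<in> Hm A P N" using assms by (auto simp: st_def)
  have "g * g' * (f' * f) - idm (fst M) = g * (g' * f' - idm (fst N)) * f + (g * f - idm (fst M))"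
    using dm_right[OF Hm_dm[OF H(2)]] by (simp add: left_diff_distrib right_diff_distrib mult.assoc[symmetric])
  moreover have "f' * f * (g * g') - idm (fst P) = f' * (f * g - idm (fst N)) * g' + (f' * g' - idm (fst P))"
    using dm_right[OF Hm_dm[OF H(3)]] by (simp add: left_diff_distrib right_diff_distrib mult.assoc[symmetric])
  moreover have "fproj M M (g * (g' * f' - idm (fst N)) * f + (g * f - idm (fst M)))"
    "fproj P P (f' * (f * g - idm (fst N)) * g' + (f' * g' - idm (fst P)))"
    using assms H unfolding st_def by (blast intro: fproj_add fproj_left fproj_right)+
  ultimately show ?thesis unfolding st_def using H Hm_comp by metis
qed

lemma rep_iso_st:
  assumes "is_rep A M" "is_rep A N" "rep_iso A M N" shows "st_iso A M N"
  unfolding st_iso_iff[OF assms(1,2)] st_def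
  using assms(3)[unfolded rep_iso_iff[OF assms(1,2)]] by (metis cancel_comm_monoid_add_class.diff_cancel fproj_0)

lemma st_iso_refl: "is_rep A M \<Longrightarrow> st_iso A M M"
  using rep_iso_st rep_iso_refl by blast

lemma st_iso_sym: "is_rep A M \<Longrightarrow> is_rep A N \<Longrightarrow> st_iso A M N \<Longrightarrow> st_iso A N M"
  using st_iso_iff st_sym by blast

lemma st_iso_trans:
  "is_rep A M \<Longrightarrow> is_rep A N \<Longrightarrow> is_rep A P \<Longrightarrow> st_iso A M N \<Longrightarrow> st_iso A N P \<Longrightarrow> st_iso A M P"
  using st_trans[of M N _ _ P] by (simp add: st_iso_iff) blast

lemma projective_st_zero:
  assumes "projective A P" shows "st_iso A P zrep"
proof -
  have P: "is_rep A P" using projective_rep assms .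
  have "fproj P P (- idm (fst P))"
    unfolding fproj_def using assms
    by (intro exI[of _ P] conjI bexI[OF _ Hm_id[OF P]] bexI[OF _ Hm_minus[OF Hm_id[OF P]]]) simp_all
  then show ?thesis
    unfolding st_iso_iff[OF P zrep_rep] st_def
    by (intro exI[of _ 0]) (simp add: Hm_0 fproj_0)
qed

lemma fproj_id_projective:
  assumes "is_rep A Q" "fproj Q Q (idm (fst Q))" shows "projective A Q"
  using assms(2) projective_retract[OF _ assms(1)] unfolding fproj_def by metis

text \<open>Write g f - 1 = b a with a from M to P. Then (f, a) embeds M into N + P with retraction
  (g, -b), and the complement Q is projective because its identity factors through a projective
  module.\<close>

lemma st_iso_sums:
  assumes M: "is_rep A M" and N: "is_rep A N" and st: "st_iso A M N"
  obtains P Q where "projective A P" "projective A Q" "rep_iso A (rep_sum M Q) (rep_sum N P)"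
proof -
  obtain f g where fg: "f \<in> Hm A M N" "g \<in> Hm A N M" "fproj M M (g * f - idm (fst M))"
    "fproj N N (f * g - idm (fst N))" using st st_iso_iff[OF M N] unfolding st_def by blast
  obtain P a b where P: "projective A P" "a \<in> Hm A M P" "b \<in> Hm A P M" "g * f - idm (fst M) = b * a"
    using fg(3) unfolding fproj_def by blast
  note Pr = projective_rep[OF P(1)]
  obtain i j p q where s: "bip (rep_sum N P) N P i j p q"
    using rep_sum_bip' Pr N by blast
  then have sH: "i \<in> Hm A N (rep_sum N P)" "j \<in> Hm A P (rep_sum N P)" "p \<in> Hm A (rep_sum N P) N" "q \<in> Hm A (rep_sum N P) P"
    by (auto simp: bip_def)
  have e: "p * (i * X) = idm (fst N) * X" "p * (j * X) = 0" "q * (i * X) = 0" "q * (j * X) = idm (fst P) * X" for X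
    using s unfolding bip_def by (simp_all add: mult.assoc[symmetric])
  let ?s = "i * f + j * a" and ?r = "g * p - b * q"
  have "?r * ?s = g * f - b * a"
    using Hm_dm[OF P(2)] Hm_dm[OF fg(1)] by (simp add: distrib_left left_diff_distrib mult.assoc e dm_left)
  then have rs: "?r * ?s = idm (fst M)" using P(4)[symmetric] by simp
  have sr: "?s \<in> Hm A M (rep_sum N P)" "?r \<in> Hm A (rep_sum N P) M"
    using sH P fg by (auto intro!: Hm_add Hm_diff Hm_comp)
  obtain Q k l where Q: "is_rep A Q" and b': "bip (rep_sum N P) M Q ?s k ?r l"
    using retract_complement[OF rep_sum_rep[OF N Pr] M sr rs] by blast
  have kl: "k \<in> Hm A Q (rep_sum N P)" "l \<in> Hm A (rep_sum N P) Q" "l * k = idm (fst Q)" "l * ?s = 0"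
    using b' by (auto simp: bip_def)
  \<comment> \<open>\<open>l\<close> kills the embedded copy of M, so what comes from
    \<open>f\<close> equals, up to sign, a map that passes through \<open>P\<close>.\<close>
  have ls: "l * (i * f) = - (l * (j * a))" using kl(4) by (simp add: distrib_left eq_neg_iff_add_eq_0)
  have "projective A Q"
  proof (rule fproj_id_projective[OF Q])
    have fP: "fproj X Y (v * u)" if "u \<in> Hm A X P" "v \<in> Hm A P Y" for X Y u v
      unfolding fproj_def using P(1) that by blast
    have lq: "l * j * (q * k) = l * (j * q) * k" "(l * i) * (p * k) = l * (i * p) * k" by (simp_all add: mult.assoc)
    have "idm (fst Q) = l * (i * p + j * q) * k"
      using s kl Hm_dm[OF kl(2)] by (simp add: bip_def dm_right)
    also have "\<dots> = (l * j) * (q * k) + (l * i) * (p * k)"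
      by (simp add: distrib_left distrib_right mult.assoc)
    \<comment> \<open>Here 1 is replaced by f g minus the difference f g - 1: the first term passes
      through \<open>P\<close> by \<open>ls\<close>, the second through a projective module by the
      choice of f and g.\<close>
    also have "(l * i) * (p * k) = (l * i) * (f * g) * (p * k) - (l * i) * (f * g - idm (fst N)) * (p * k)"
      using dm_right[OF Hm_dm[OF Hm_comp[OF kl(2) sH(1)]]] by (simp add: right_diff_distrib left_diff_distrib)
    also have "(l * i) * (f * g) * (p * k) = (l * (i * f)) * (g * (p * k))" by (simp add: mult.assoc)
    also have "\<dots> = - ((l * j) * (a * (g * (p * k))))" by (simp add: ls) (simp add: mult.assoc)
    finally have "idm (fst Q) = (l * j) * (q * k) + (- ((l * j) * (a * (g * (p * k))))
       - (l * i) * (f * g - idm (fst N)) * (p * k))" .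
    moreover have "fproj Q Q ((l * j) * (q * k) + (- ((l * j) * (a * (g * (p * k))))
       - (l * i) * (f * g - idm (fst N)) * (p * k)))"
      by (intro fproj_add fproj_diff fproj_minus fP fproj_right[OF fproj_left[OF fg(4)]] Hm_comp[OF sH(4)] Hm_comp[OF kl(2)]
          Hm_comp[OF P(2)] Hm_comp[OF fg(2)] Hm_comp[OF sH(3)] kl sH P fg)
    ultimately show "fproj Q Q (idm (fst Q))" by simp
  qed
  moreover have "rep_iso A (rep_sum M Q) (rep_sum N P)"
    using bip_rep_sum_iso[OF b' rep_sum_rep[OF N Pr] M Q] rep_iso_sym rep_sum_rep N Pr M Q by blast
  ultimately show ?thesis using that P(1) by blast
qed

text \<open>Reduces claims about all projectives to the generators of the ideal: a decomposable
  projective module splits into projectives of smaller dimension.\<close>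

lemma projective_indecomposables:
  assumes "projective A P"
    and zero: "\<And>Q. is_rep A Q \<Longrightarrow> fst Q = 0 \<Longrightarrow> X Q"
    and ind: "\<And>Q. indecomposable A Q \<Longrightarrow> projective A Q \<Longrightarrow> X Q"
    and sum: "\<And>P Q R. is_rep A P \<Longrightarrow> is_rep A Q \<Longrightarrow> is_rep A R \<Longrightarrow> X Q \<Longrightarrow> X R \<Longrightarrow> rep_iso A P (rep_sum Q R) \<Longrightarrow> X P"
  shows "X P"
  using assms(1)
proof (induction "fst P" arbitrary: P rule: less_induct)
  case less
  note P = projective_rep[OF less.prems]
  show ?case
  proof (cases "fst P = 0 \<or> indecomposable A P")
    case True
    then show ?thesis using P zero ind less.prems by blast
  next
    case False
    then obtain Q R where QR: "is_rep A Q" "is_rep A R" "rep_iso A P (rep_sum Q R)" "fst Q \<noteq> 0" "fst R \<noteq> 0"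
      using P unfolding indecomposable_def by blast
    then have dim: "fst P = fst Q + fst R"
      using rep_iso_dim[OF P rep_sum_rep[OF QR(1,2)] QR(3)] by simp
    have S: "projective A (rep_sum Q R)"
      using projective_iso[OF less.prems rep_sum_rep] rep_iso_sym[OF P rep_sum_rep] QR by blast
    have "projective A Q" "projective A R"
      using projective_retract[OF S QR(1)] projective_retract[OF S QR(2)] rep_sum_bip'[OF QR(1,2)]
      unfolding bip_def by blast+
    then show ?thesis using less.hyps dim QR sum[OF P QR(1,2) _ _ QR(3)] by simp
  qed
qed

end

section \<open>Tensor products\<close>

text \<open>Associativity and the unit laws are required as equalities of actions on the same K^d.
  Kronecker products make them strict, so no coherence isomorphisms have to be carried
  along.\<close>

locale tens = alg A for A :: "('k::field_char_0, 'b, 'm) hopf_scheme" +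
  assumes finite_basis: "finite (hbasis A)"
    and bvec_closed: "b \<in> hbasis A \<Longrightarrow> bvec b \<in> carrier A"
    and tens_rep: "is_rep A M \<Longrightarrow> is_rep A N \<Longrightarrow> is_rep A (rep_tensor A M N)"
    and unit_rep: "is_rep A (rep_unit A)"
    and tens_assoc_act: "is_rep A M \<Longrightarrow> is_rep A N \<Longrightarrow> is_rep A P \<Longrightarrow> x \<in> carrier A \<Longrightarrow>
      ac (rep_tensor A (rep_tensor A M N) P) x = ac (rep_tensor A M (rep_tensor A N P)) x"
    and unit_left_act: "is_rep A M \<Longrightarrow> x \<in> carrier A \<Longrightarrow> ac (rep_tensor A (rep_unit A) M) x = ac M x"
    and unit_right_act: "is_rep A M \<Longrightarrow> x \<in> carrier A \<Longrightarrow> ac (rep_tensor A M (rep_unit A)) x = ac M x"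

lemma ac_rep_tensor:
  fixes A :: "('k::field, 'b, 'm) hopf_scheme"
  assumes fin: "finite (hbasis A)"
    and M: "\<And>b. b \<in> hbasis A \<Longrightarrow> snd M (bvec b) \<in> carrier_mat (fst M) (fst M)"
    and N: "\<And>b. b \<in> hbasis A \<Longrightarrow> snd N (bvec b) \<in> carrier_mat (fst N) (fst N)"
  shows "ac (rep_tensor A M N) x = (\<Sum>(b, c)\<in>hbasis A \<times> hbasis A.
    comult A x (b, c) *\<^sub>c kr (fst N) (fst N) (ac M (bvec b)) (ac N (bvec c)))"
proof (rule rfm_eqI)
  fix i j
  let ?d = "fst M * fst N"
  have kc: "kron (snd M (bvec b)) (snd N (bvec c)) \<in> carrier_mat ?d ?d"
    "fm (kron (snd M (bvec b)) (snd N (bvec c))) = kr (fst N) (fst N) (ac M (bvec b)) (ac N (bvec c))"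
    if "b \<in> hbasis A" "c \<in> hbasis A" for b c
    using kron_carrier[OF M[OF that(1)] N[OF that(2)]] N[OF that(2)] by (auto simp: fm_kron ac_def)
  have "ent (\<Sum>(b, c)\<in>hbasis A \<times> hbasis A.
      comult A x (b, c) *\<^sub>c kr (fst N) (fst N) (ac M (bvec b)) (ac N (bvec c))) i j
    = (\<Sum>bc\<in>hbasis A \<times> hbasis A. comult A x bc *
        (if i < ?d \<and> j < ?d then kron (snd M (bvec (fst bc))) (snd N (bvec (snd bc))) $$ (i, j) else 0))"
    unfolding ent_sum
  proof (rule sum.cong[OF refl])
    fix bc assume "bc \<in> hbasis A \<times> hbasis A"
    then obtain b c where bc: "bc = (b, c)" "b \<in> hbasis A" "c \<in> hbasis A" by auto
    have "ent (kr (fst N) (fst N) (ac M (bvec b)) (ac N (bvec c))) i j =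
      (if i < ?d \<and> j < ?d then kron (snd M (bvec b)) (snd N (bvec c)) $$ (i, j) else 0)"
      using kc[OF bc(2,3)] ent_fm[of "kron (snd M (bvec b)) (snd N (bvec c))" i j] by auto
    then show "ent (case bc of (b, c) \<Rightarrow> comult A x (b, c) *\<^sub>c kr (fst N) (fst N) (ac M (bvec b)) (ac N (bvec c))) i j
      = comult A x bc * (if i < ?d \<and> j < ?d then kron (snd M (bvec (fst bc))) (snd N (bvec (snd bc))) $$ (i, j) else 0)"
      unfolding bc(1) case_prod_conv fst_conv snd_conv ent_simps by (rule arg_cong)
  qed
  also have "\<dots> = ent (ac (rep_tensor A M N) x) i j"
    by (auto simp: ac_def rep_tensor_def ent_fm case_prod_unfold intro!: sum.neutral)
  finally show "ent (ac (rep_tensor A M N) x) i j = ent (\<Sum>(b, c)\<in>hbasis A \<times> hbasis A.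
      comult A x (b, c) *\<^sub>c kr (fst N) (fst N) (ac M (bvec b)) (ac N (bvec c))) i j" by simp
qed

context tens
begin

lemma ac_tens:
  assumes "is_rep A M" "is_rep A N"
  shows "ac (rep_tensor A M N) x = (\<Sum>(b, c)\<in>hbasis A \<times> hbasis A.
    comult A x (b, c) *\<^sub>c kr (fst N) (fst N) (ac M (bvec b)) (ac N (bvec c)))"
  by (rule ac_rep_tensor) (use finite_basis rep_carrier bvec_closed assms in auto)

lemma Hm_tens:
  assumes "is_rep A M" "is_rep A N" "is_rep A M'" "is_rep A N'" and f: "f \<in> Hm A M M'" and g: "g \<in> Hm A N N'"
  shows "kr (fst N') (fst N) f g \<in> Hm A (rep_tensor A M N) (rep_tensor A M' N')"
proof -
  have "kr (fst N') (fst N) f g * (c *\<^sub>c kr (fst N) (fst N) (ac M (bvec a)) (ac N (bvec b))) =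
      c *\<^sub>c kr (fst N') (fst N') (ac M' (bvec a)) (ac N' (bvec b)) * kr (fst N') (fst N) f g"
    if "a \<in> hbasis A" "b \<in> hbasis A" for a b c
    using that assms bvec_closed
    by (simp add: kr_mult[OF Hm_dm[OF g]] kr_mult[OF ac_dm] Hm_comm[OF f] Hm_comm[OF g])
  then show ?thesis
    unfolding Hm_def using dm_kr[OF Hm_dm[OF f] Hm_dm[OF g]] assms
    by (auto simp: ac_tens sum_distrib_left sum_distrib_right case_prod_unfold intro!: sum.cong)
qed

lemma rep_tensor_cong:
  assumes "is_rep A M" "is_rep A N" "is_rep A M'" "is_rep A N'" "rep_iso A M M'" "rep_iso A N N'"
  shows "rep_iso A (rep_tensor A M N) (rep_tensor A M' N')"
proof -
  obtain f f' where f: "f \<in> Hm A M M'" "f' \<in> Hm A M' M" "f' * f = idm (fst M)" "f * f' = idm (fst M')"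
    using assms rep_iso_iff by blast
  obtain g g' where g: "g \<in> Hm A N N'" "g' \<in> Hm A N' N" "g' * g = idm (fst N)" "g * g' = idm (fst N')"
    using assms rep_iso_iff by blast
  show ?thesis
    by (rule rep_isoI[where f = "kr (fst N') (fst N) f g" and g = "kr (fst N) (fst N') f' g'"])
      (use assms f g in \<open>simp_all add: tens_rep Hm_tens kr_mult[OF Hm_dm[OF g(1)]] kr_mult[OF Hm_dm[OF g(2)]] kr_idm\<close>)
qed

lemma rep_tensor_assoc:
  assumes "is_rep A M" "is_rep A N" "is_rep A P"
  shows "rep_iso A (rep_tensor A (rep_tensor A M N) P) (rep_tensor A M (rep_tensor A N P))"
  by (rule rep_iso_act) (use assms tens_rep tens_assoc_act in \<open>auto simp: mult.assoc\<close>)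

lemma rep_tensor_unit:
  assumes "is_rep A M"
  shows "rep_iso A (rep_tensor A (rep_unit A) M) M" "rep_iso A (rep_tensor A M (rep_unit A)) M"
  by (rule rep_iso_act; use assms tens_rep unit_rep unit_left_act unit_right_act in auto)+

lemma bip_tens_right:
  assumes b: "bip M N P i j p q" and "is_rep A L" "is_rep A M" "is_rep A N" "is_rep A P"
  shows "bip (rep_tensor A L M) (rep_tensor A L N) (rep_tensor A L P)
    (kr (fst M) (fst N) (idm (fst L)) i) (kr (fst M) (fst P) (idm (fst L)) j)
    (kr (fst N) (fst M) (idm (fst L)) p) (kr (fst P) (fst M) (idm (fst L)) q)"
proof -
  have h: "i \<in> Hm A N M" "j \<in> Hm A P M" "p \<in> Hm A M N" "q \<in> Hm A M P"
    and e: "p * i = idm (fst N)" "q * j = idm (fst P)" "p * j = 0" "q * i = 0" "i * p + j * q = idm (fst M)"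
    using b by (auto simp: bip_def)
  note d = h[THEN Hm_dm]
  note H = Hm_tens[OF \<open>is_rep A L\<close> _ \<open>is_rep A L\<close> _ Hm_id[OF \<open>is_rep A L\<close>]]
  show ?thesis
    unfolding bip_def
    by (intro conjI H h assms)
      (simp_all only: kr_mult[OF d(1)] kr_mult[OF d(2)] kr_mult[OF d(3)] kr_mult[OF d(4)] e idm_idm min.idem
        kr_add_right[symmetric] kr_idm fst_rep_tensor kr_0_right)
qed

lemma bip_tens_left:
  assumes b: "bip M N P i j p q" and "is_rep A L" "is_rep A M" "is_rep A N" "is_rep A P"
  shows "bip (rep_tensor A M L) (rep_tensor A N L) (rep_tensor A P L)
    (kr (fst L) (fst L) i (idm (fst L))) (kr (fst L) (fst L) j (idm (fst L)))
    (kr (fst L) (fst L) p (idm (fst L))) (kr (fst L) (fst L) q (idm (fst L)))"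
proof -
  have h: "i \<in> Hm A N M" "j \<in> Hm A P M" "p \<in> Hm A M N" "q \<in> Hm A M P"
    and e: "p * i = idm (fst N)" "q * j = idm (fst P)" "p * j = 0" "q * i = 0" "i * p + j * q = idm (fst M)"
    using b by (auto simp: bip_def)
  note H = Hm_tens[OF _ \<open>is_rep A L\<close> _ \<open>is_rep A L\<close> _ Hm_id[OF \<open>is_rep A L\<close>]]
  show ?thesis
    unfolding bip_def
    by (intro conjI H h assms)
      (simp_all only: kr_mult[OF dm_idm] e idm_idm min.idem kr_add_left[symmetric] kr_idm fst_rep_tensor kr_0_left)
qed

lemma rep_tensor_distrib:
  assumes "is_rep A L" "is_rep A M" "is_rep A N"
  shows "rep_iso A (rep_tensor A L (rep_sum M N)) (rep_sum (rep_tensor A L M) (rep_tensor A L N))"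
    "rep_iso A (rep_tensor A (rep_sum M N) L) (rep_sum (rep_tensor A M L) (rep_tensor A N L))"
  by (rule bip_rep_sum_iso[OF bip_tens_right[OF rep_sum_bip']] bip_rep_sum_iso[OF bip_tens_left[OF rep_sum_bip']],
      intro assms rep_sum_rep tens_rep, (intro assms rep_sum_rep tens_rep)+)+

end

section \<open>Green rings\<close>

lemma frag_extend_fun_diff: "frag_extend (\<lambda>X. f X - g X) c = frag_extend f c - frag_extend g c"
  for f :: "'a \<Rightarrow> 'b \<Rightarrow>\<^sub>0 int"
proof -
  have "frag_cmul k (a - b) = frag_cmul k a - frag_cmul k b" for k and a b :: "'b \<Rightarrow>\<^sub>0 int"
    by (rule poly_mapping_eqI) (simp add: lookup_minus algebra_simps)
  then show ?thesis by (simp add: frag_extend_def sum_subtractf)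
qed

lemma ring_diff_distr:
  assumes "ring R" "a \<in> carrier R" "b \<in> carrier R" "x \<in> carrier R"
  shows "x \<otimes>\<^bsub>R\<^esub> (a \<ominus>\<^bsub>R\<^esub> b) = x \<otimes>\<^bsub>R\<^esub> a \<ominus>\<^bsub>R\<^esub> x \<otimes>\<^bsub>R\<^esub> b"
    "(a \<ominus>\<^bsub>R\<^esub> b) \<otimes>\<^bsub>R\<^esub> x = a \<otimes>\<^bsub>R\<^esub> x \<ominus>\<^bsub>R\<^esub> b \<otimes>\<^bsub>R\<^esub> x"
proof -
  interpret ring R by fact
  show "x \<otimes>\<^bsub>R\<^esub> (a \<ominus>\<^bsub>R\<^esub> b) = x \<otimes>\<^bsub>R\<^esub> a \<ominus>\<^bsub>R\<^esub> x \<otimes>\<^bsub>R\<^esub> b"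
    "(a \<ominus>\<^bsub>R\<^esub> b) \<otimes>\<^bsub>R\<^esub> x = a \<otimes>\<^bsub>R\<^esub> x \<ominus>\<^bsub>R\<^esub> b \<otimes>\<^bsub>R\<^esub> x"
    using assms by (simp_all add: a_minus_def r_distr l_distr r_minus l_minus)
qed

text \<open>One construction serves r(KG), r(H) and r_st(H): \<open>E\<close> is isomorphism or
  stable isomorphism. The assumptions make \<open>E\<close> an equivalence coarser than isomorphism
  and compatible with tensor products.\<close>

locale green = tens A for A :: "('k::field_char_0, 'b, 'm) hopf_scheme" +
  fixes E :: "('b \<Rightarrow> 'k, 'k) rep \<Rightarrow> ('b \<Rightarrow> 'k, 'k) rep \<Rightarrow> bool"
  assumes E_iso: "is_rep A M \<Longrightarrow> is_rep A N \<Longrightarrow> rep_iso A M N \<Longrightarrow> E M N"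
    and E_sym: "is_rep A M \<Longrightarrow> is_rep A N \<Longrightarrow> E M N \<Longrightarrow> E N M"
    and E_trans: "is_rep A M \<Longrightarrow> is_rep A N \<Longrightarrow> is_rep A P \<Longrightarrow> E M N \<Longrightarrow> E N P \<Longrightarrow> E M P"
    and E_tens: "is_rep A M \<Longrightarrow> is_rep A N \<Longrightarrow> is_rep A M' \<Longrightarrow> is_rep A N' \<Longrightarrow> E M M' \<Longrightarrow> E N N' \<Longrightarrow>
      E (rep_tensor A M N) (rep_tensor A M' N')"
begin

abbreviation "cl M \<equiv> iso_class A E M"
abbreviation "S \<equiv> iso_class A E ` {M. is_rep A M}"
abbreviation "F \<equiv> free_green A E"
abbreviation "I \<equiv> sum_relations A E"
abbreviation "\<Gamma> \<equiv> green_of A E"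

lemma cl_eq: "is_rep A M \<Longrightarrow> is_rep A N \<Longrightarrow> cl M = cl N \<longleftrightarrow> E M N"
  using E_iso[OF _ _ rep_iso_refl] E_sym E_trans unfolding iso_class_def by blast

lemma cl_iso: "is_rep A M \<Longrightarrow> is_rep A N \<Longrightarrow> rep_iso A M N \<Longrightarrow> cl M = cl N"
  using cl_eq E_iso by blast

lemma cl_tens: "is_rep A M \<Longrightarrow> is_rep A N \<Longrightarrow> class_tensor A E (cl M) (cl N) = cl (rep_tensor A M N)"
proof -
  assume M: "is_rep A M" and N: "is_rep A N"
  have "cl (rep_tensor A M' N') = cl (rep_tensor A M N)" if "M' \<in> cl M" "N' \<in> cl N" for M' N'
    using that M N E_tens E_sym tens_rep by (auto simp: iso_class_def[of A E M] iso_class_def[of A E N] cl_eq)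
  moreover have "M \<in> cl M" "N \<in> cl N" using M N E_iso rep_iso_refl by (auto simp: iso_class_def)
  ultimately show ?thesis unfolding class_tensor_def by blast
qed

lemma cl_assoc: "is_rep A M \<Longrightarrow> is_rep A N \<Longrightarrow> is_rep A P \<Longrightarrow>
    cl (rep_tensor A (rep_tensor A M N) P) = cl (rep_tensor A M (rep_tensor A N P))"
  by (intro cl_iso rep_tensor_assoc tens_rep)

lemma cl_unit: "is_rep A M \<Longrightarrow> cl (rep_tensor A (rep_unit A) M) = cl M"
    "is_rep A M \<Longrightarrow> cl (rep_tensor A M (rep_unit A)) = cl M"
  by (intro cl_iso rep_tensor_unit tens_rep unit_rep; assumption)+

section \<open>The free ring on the classes of modules\<close>

definition mm where
  "mm x y = frag_extend (\<lambda>X. frag_extend (\<lambda>Y. frag_of (class_tensor A E X Y)) y) x"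

lemma F_simps: "carrier F = {c. Poly_Mapping.keys c \<subseteq> S}" "x \<otimes>\<^bsub>F\<^esub> y = mm x y" "\<one>\<^bsub>F\<^esub> = frag_of (cl (rep_unit A))"
  "\<zero>\<^bsub>F\<^esub> = 0" "x \<oplus>\<^bsub>F\<^esub> y = x + y"
  by (simp_all add: free_green_def mm_def free_Abelian_group_def)

lemma mm_simps: "mm (frag_of X) (frag_of Y) = frag_of (class_tensor A E X Y)"
    "mm 0 y = 0" "mm x 0 = 0" "mm (a - b) y = mm a y - mm b y" "mm x (a - b) = mm x a - mm x b"
  by (simp_all add: mm_def frag_extend_diff frag_extend_fun_diff)
    (simp add: frag_extend_def)

lemma mm_add: "mm (a + b) y = mm a y + mm b y" "mm x (a + b) = mm x a + mm x b"
  using mm_simps(4)[of a "- b"] mm_simps(5)[of x a "- b"] mm_simps(4)[of 0 b y] mm_simps(5)[of x 0 b]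
  by (simp_all add: mm_simps(2,3))

lemma F_induct [consumes 1, case_names zero one diff]:
  assumes "x \<in> carrier F" "P 0" "\<And>M. is_rep A M \<Longrightarrow> P (frag_of (cl M))" "\<And>a b. P a \<Longrightarrow> P b \<Longrightarrow> P (a - b)"
  shows "P x"
  using assms by (intro frag_induction[of x S P]) (auto simp: F_simps)

lemma keys_diff: "Poly_Mapping.keys (a - b) \<subseteq> Poly_Mapping.keys a \<union> Poly_Mapping.keys b"
  for a b :: "'x \<Rightarrow>\<^sub>0 int"
  by (metis add_uminus_conv_diff keys_add keys_minus)

lemma F_closed: "is_rep A M \<Longrightarrow> frag_of (cl M) \<in> carrier F" "0 \<in> carrier F"
  "a \<in> carrier F \<Longrightarrow> b \<in> carrier F \<Longrightarrow> a - b \<in> carrier F"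
  "a \<in> carrier F \<Longrightarrow> b \<in> carrier F \<Longrightarrow> a + b \<in> carrier F"
  "a \<in> carrier F \<Longrightarrow> - a \<in> carrier F"
  using keys_diff[of a b] keys_add[of a b] by (auto simp: F_simps)

lemma mm_closed: "x \<in> carrier F \<Longrightarrow> y \<in> carrier F \<Longrightarrow> mm x y \<in> carrier F"
proof (induction x rule: F_induct)
  case (one M)
  from one(2,1) show ?case
    by (induction y rule: F_induct) (auto simp: mm_simps cl_tens F_closed tens_rep)
qed (auto simp: mm_simps F_closed)

lemma mm_assoc: "x \<in> carrier F \<Longrightarrow> y \<in> carrier F \<Longrightarrow> z \<in> carrier F \<Longrightarrow> mm (mm x y) z = mm x (mm y z)"
proof (induction x rule: F_induct)
  case (one M)
  from one(2,3,1) show ?case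
  proof (induction y rule: F_induct)
    case (one N)
    from one(2,1,3) show ?case
      by (induction z rule: F_induct) (auto simp: mm_simps cl_tens tens_rep cl_assoc)
  qed (auto simp: mm_simps F_closed)
qed (auto simp: mm_simps F_closed)

lemma mm_unit: "x \<in> carrier F \<Longrightarrow> mm (frag_of (cl (rep_unit A))) x = x \<and> mm x (frag_of (cl (rep_unit A))) = x"
  by (induction x rule: F_induct)
    (auto simp: mm_simps cl_tens unit_rep tens_rep cl_unit)

lemma ring_F: "ring F"
proof (rule ringI)
  show "abelian_group F"
    by (rule abelian_groupI) (auto simp: F_simps(2-) F_closed intro!: bexI[of _ "- x" for x])
  show "monoid F"
    by (rule monoidI) (auto simp: F_simps(2-) mm_closed mm_assoc mm_unit F_closed unit_rep)
qed (auto simp: F_simps(2-) mm_add)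

section \<open>The ideal of direct sum relations\<close>

definition rel where
  "rel M N = frag_of (cl (rep_sum M N)) - (frag_of (cl M) + frag_of (cl N))"

lemma I_def: "I = generate (add_monoid F) {rel M N | M N. is_rep A M \<and> is_rep A N}"
  by (simp add: sum_relations_def rel_def)

lemma rel_closed: "is_rep A M \<Longrightarrow> is_rep A N \<Longrightarrow> rel M N \<in> carrier F"
  by (simp add: rel_def F_closed rep_sum_rep)

lemma F_minus: "x \<in> carrier F \<Longrightarrow> inv\<^bsub>add_monoid F\<^esub> x = - x"
proof -
  interpret ring F by (rule ring_F)
  assume x: "x \<in> carrier F"
  show ?thesis unfolding a_inv_def[symmetric] by (rule minus_equality) (auto simp: x F_simps(2-) F_closed)
qed

lemma subgroup_I: "subgroup I (add_monoid F)"
proof -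
  interpret ring F by (rule ring_F)
  show ?thesis unfolding I_def by (rule add.generate_is_subgroup) (use rel_closed in auto)
qed

lemma I_carrier: "x \<in> I \<Longrightarrow> x \<in> carrier F"
  using subgroup.subset[OF subgroup_I] by auto

lemma I_closed: "0 \<in> I" "x \<in> I \<Longrightarrow> y \<in> I \<Longrightarrow> x + y \<in> I" "x \<in> I \<Longrightarrow> - x \<in> I" "x \<in> I \<Longrightarrow> y \<in> I \<Longrightarrow> x - y \<in> I"
proof -
  have add: "x + y \<in> I" if "x \<in> I" "y \<in> I" for x y
    using subgroup.m_closed[OF subgroup_I that] by (simp add: F_simps)
  have minus: "- x \<in> I" if "x \<in> I" for x
    using subgroup.m_inv_closed[OF subgroup_I that] F_minus[OF I_carrier[OF that]] by simp
  show "0 \<in> I" using subgroup.one_closed[OF subgroup_I] by (simp add: F_simps)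
  show "x \<in> I \<Longrightarrow> y \<in> I \<Longrightarrow> x + y \<in> I" "x \<in> I \<Longrightarrow> - x \<in> I" by (fact add minus)+
  show "x \<in> I \<Longrightarrow> y \<in> I \<Longrightarrow> x - y \<in> I"
    using add[OF _ minus, of x y] by simp
qed

lemma rel_I: "is_rep A M \<Longrightarrow> is_rep A N \<Longrightarrow> rel M N \<in> I"
  unfolding I_def by (rule generate.incl) blast

lemma I_induct [consumes 1, case_names zero rel diff]:
  assumes "x \<in> I" "P 0" "\<And>M N. is_rep A M \<Longrightarrow> is_rep A N \<Longrightarrow> P (rel M N)"
    "\<And>a b. a \<in> carrier F \<Longrightarrow> b \<in> carrier F \<Longrightarrow> P a \<Longrightarrow> P b \<Longrightarrow> P (a - b)"
  shows "P x"
proof -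
  from assms(1) have "x \<in> carrier F \<and> P x"
    unfolding I_def
  proof (induction rule: generate.induct)
    case one
    then show ?case using assms(2) by (simp add: F_simps(2-) F_closed)
  next
    case (incl h)
    then show ?case using assms(3) rel_closed by auto
  next
    case (inv h)
    then have h: "h \<in> carrier F" "P h" using assms(3) rel_closed by auto
    then show ?case using assms(4)[OF F_closed(2) h(1) assms(2) h(2)] unfolding F_minus[OF h(1)] by (simp add: F_closed)
  next
    case (eng x y)
    then have "P (x - (0 - y))" using assms(2) by (intro assms(4) F_closed) auto
    then show ?case using eng by (simp add: F_simps(2-) F_closed)
  qed
  then show ?thesis by simp
qed

text \<open>The tensor product distributes over direct sums on both sides, so multiplication by a
  class carries each relation to a relation.\<close>

lemma ideal_I: "ideal I F"
proof (rule idealI[OF ring_F subgroup_I])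
  have "mm x a \<in> I \<and> mm a x \<in> I" if "a \<in> I" "x \<in> carrier F" for a x
    using that(1)
  proof (induction a rule: I_induct)
    case (rel M N)
    note MN = rel
    from that(2) show ?case
    proof (induction x rule: F_induct)
      case (one L)
      have "mm (frag_of (cl L)) (rel M N) = rel (rep_tensor A L M) (rep_tensor A L N)"
        "mm (rel M N) (frag_of (cl L)) = rel (rep_tensor A M L) (rep_tensor A N L)"
        unfolding rel_def using MN one rep_tensor_distrib[OF one MN]
        by (simp_all add: mm_simps mm_add cl_tens rep_sum_rep tens_rep frag_of_eq cl_iso)
      then show ?case using one MN tens_rep rel_I by simp
    qed (auto simp: mm_simps I_closed)
  qed (auto simp: mm_simps I_closed)
  then show "x \<otimes>\<^bsub>F\<^esub> a \<in> I" "a \<otimes>\<^bsub>F\<^esub> x \<in> I" if "a \<in> I" "x \<in> carrier F" for a x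
    using that by (simp_all add: F_simps(2))
qed

section \<open>Classes in the Green ring and its universal properties\<close>

definition gc where "gc M = I +>\<^bsub>F\<^esub> frag_of (cl M)"

lemma ring_G: "ring \<Gamma>"
  unfolding green_of_def by (rule ideal.quotient_is_ring[OF ideal_I])

lemma proj_hom: "(+>\<^bsub>F\<^esub>) I \<in> Ring.ring_hom F \<Gamma>"
  unfolding green_of_def by (rule ideal.rcos_ring_hom[OF ideal_I])

lemma G_carrier: "X \<in> carrier \<Gamma> \<longleftrightarrow> (\<exists>x\<in>carrier F. X = I +>\<^bsub>F\<^esub> x)"
  unfolding green_of_def FactRing_def A_RCOSETS_def' by auto

lemma coset_eq:
  assumes "x \<in> carrier F" "y \<in> carrier F" "x - y \<in> I" shows "I +>\<^bsub>F\<^esub> x = I +>\<^bsub>F\<^esub> y"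
proof -
  interpret ring F by (rule ring_F)
  have "x \<in> I +>\<^bsub>F\<^esub> y"
    unfolding a_r_coset_def' using assms by (intro UN_I[of "x - y"]) (auto simp: F_simps)
  then show ?thesis using a_repr_independence[OF _ assms(2) subgroup_I] by simp
qed

lemma gc_closed [simp]: "is_rep A M \<Longrightarrow> gc M \<in> carrier \<Gamma>"
  unfolding gc_def G_carrier using F_closed by blast

lemma gc_cong: "is_rep A M \<Longrightarrow> is_rep A N \<Longrightarrow> E M N \<Longrightarrow> gc M = gc N"
  using cl_eq[of M N] by (simp add: gc_def)

lemma gc_iso: "is_rep A M \<Longrightarrow> is_rep A N \<Longrightarrow> rep_iso A M N \<Longrightarrow> gc M = gc N"
  using gc_cong E_iso by blast

lemma gc_tens: "is_rep A M \<Longrightarrow> is_rep A N \<Longrightarrow> gc (rep_tensor A M N) = gc M \<otimes>\<^bsub>\<Gamma>\<^esub> gc N"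
  unfolding gc_def using ring_hom_mult[OF proj_hom F_closed(1) F_closed(1), of M N]
  by (simp add: F_simps(2-) mm_simps cl_tens)

lemma gc_unit: "gc (rep_unit A) = \<one>\<^bsub>\<Gamma>\<^esub>"
  unfolding gc_def using ring_hom_one[OF proj_hom] by (simp add: F_simps(2-))

lemma gc_sum: "is_rep A M \<Longrightarrow> is_rep A N \<Longrightarrow> gc (rep_sum M N) = gc M \<oplus>\<^bsub>\<Gamma>\<^esub> gc N"
  unfolding gc_def using ring_hom_add[OF proj_hom F_closed(1) F_closed(1), of M N]
  by (simp add: F_simps(2-))
    (rule trans[OF coset_eq], auto simp: F_closed rep_sum_rep rel_I[unfolded rel_def])

lemma gc_zero_dim: "is_rep A M \<Longrightarrow> fst M = 0 \<Longrightarrow> gc M = \<zero>\<^bsub>\<Gamma>\<^esub>"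
proof -
  interpret ring \<Gamma> by (rule ring_G)
  assume M: "is_rep A M" "fst M = 0"
  then have "gc M \<oplus>\<^bsub>\<Gamma>\<^esub> gc M = gc M"
    using gc_sum[OF M(1) M(1)] gc_iso[OF rep_sum_rep[OF M(1) M(1)] M(1) zero_dim_iso[OF rep_sum_rep[OF M(1) M(1)] M(1)]] by simp
  then show ?thesis using gc_closed[OF M(1)] by (metis add.l_cancel_one)
qed

lemma G_induct [consumes 1, case_names zero gc diff]:
  assumes "x \<in> carrier \<Gamma>" "P \<zero>\<^bsub>\<Gamma>\<^esub>" "\<And>M. is_rep A M \<Longrightarrow> P (gc M)"
    "\<And>a b. a \<in> carrier \<Gamma> \<Longrightarrow> b \<in> carrier \<Gamma> \<Longrightarrow> P a \<Longrightarrow> P b \<Longrightarrow> P (a \<ominus>\<^bsub>\<Gamma>\<^esub> b)"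
  shows "P x"
proof -
  interpret \<Gamma>: ring \<Gamma> by (rule ring_G)
  interpret F: ring F by (rule ring_F)
  interpret ring_hom_ring F \<Gamma> "(+>\<^bsub>F\<^esub>) I"
    by (rule ring_hom_ringI2[OF ring_F ring_G proj_hom])
  obtain y where y: "y \<in> carrier F" "x = I +>\<^bsub>F\<^esub> y" using assms(1) G_carrier by blast
  have "y \<in> carrier F \<and> P (I +>\<^bsub>F\<^esub> y)" using y(1)
  proof (induction y rule: F_induct)
    case zero
    then show ?case using assms(2) hom_zero by (simp add: F_simps(2-) F_closed)
  next
    case (one M)
    then show ?case using assms(3)[OF one] by (simp add: gc_def F_closed)
  next
    case (diff a b)
    have "a - b = a \<ominus>\<^bsub>F\<^esub> b"
      using diff F_minus[of b] by (simp add: a_minus_def a_inv_def F_simps(2-))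
    then have "I +>\<^bsub>F\<^esub> (a - b) = (I +>\<^bsub>F\<^esub> a) \<ominus>\<^bsub>\<Gamma>\<^esub> (I +>\<^bsub>F\<^esub> b)"
      using diff by (simp add: a_minus_def)
    then show ?case using diff assms(4) F_closed by simp
  qed
  with y show ?thesis by simp
qed

text \<open>The target is only an abelian group, because the one-sided inverses that bound the
  kernels are constructed from functions known to be additive but not to be multiplicative.\<close>

lemma G_universal:
  assumes B: "abelian_group B"
    and f: "\<And>M. is_rep A M \<Longrightarrow> f M \<in> carrier B"
    and cong: "\<And>M N. is_rep A M \<Longrightarrow> is_rep A N \<Longrightarrow> E M N \<Longrightarrow> f M = f N"
    and sum: "\<And>M N. is_rep A M \<Longrightarrow> is_rep A N \<Longrightarrow> f (rep_sum M N) = f M \<oplus>\<^bsub>B\<^esub> f N"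
  obtains h where "h \<in> carrier \<Gamma> \<rightarrow> carrier B" "\<And>x y. x \<in> carrier \<Gamma> \<Longrightarrow> y \<in> carrier \<Gamma> \<Longrightarrow> h (x \<oplus>\<^bsub>\<Gamma>\<^esub> y) = h x \<oplus>\<^bsub>B\<^esub> h y"
    "\<And>M. is_rep A M \<Longrightarrow> h (gc M) = f M"
proof -
  interpret B: abelian_group B by fact
  interpret F: ring F by (rule ring_F)
  \<comment> \<open>A representative is chosen in each class; \<open>cong\<close> makes the value
    independent of the choice.\<close>
  define f' where "f' X = f (SOME M. is_rep A M \<and> cl M = X)" for X
  have f': "f' (cl M) = f M" if "is_rep A M" for M
  proof -
    have "is_rep A (SOME N. is_rep A N \<and> cl N = cl M) \<and> cl (SOME N. is_rep A N \<and> cl N = cl M) = cl M"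
      by (rule someI[of _ M]) (use that in auto)
    then show ?thesis unfolding f'_def using cong[OF _ that] that cl_eq by blast
  qed
  have "f' ` S \<subseteq> carrier (add_monoid B)" using f f' by auto
  then obtain h where h: "h \<in> hom (free_Abelian_group S) (add_monoid B)" "\<And>x. x \<in> S \<Longrightarrow> h (frag_of x) = f' x"
    using comm_group.free_Abelian_group_universal[OF B.a_comm_group] by blast
  have hc: "h x \<in> carrier B" if "x \<in> carrier F" for x
    using h(1) that by (auto simp: hom_def F_simps)
  have hadd: "h (x + y) = h x \<oplus>\<^bsub>B\<^esub> h y" if "x \<in> carrier F" "y \<in> carrier F" for x y
    using h(1) that by (auto simp: hom_def F_simps)
  have h0: "h 0 = \<zero>\<^bsub>B\<^esub>"
    using hadd[OF F_closed(2) F_closed(2)] hc[OF F_closed(2)] by (metis B.add.l_cancel_one add_0)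
  have hdiff: "h (x - y) = h x \<ominus>\<^bsub>B\<^esub> h y" if "x \<in> carrier F" "y \<in> carrier F" for x y
    using hadd[of "x - y" y] hc that F_closed(3)[OF that] by (metis B.add.inv_solve_right B.minus_eq a_inv_def diff_add_cancel)
  have hcl: "h (frag_of (cl M)) = f M" if "is_rep A M" for M
    using h(2) f' that by auto
  have hI: "h x = \<zero>\<^bsub>B\<^esub>" if "x \<in> I" for x
    using that
  proof (induction x rule: I_induct)
    case (rel M N)
    then have "h (rel M N) = f (rep_sum M N) \<ominus>\<^bsub>B\<^esub> (f M \<oplus>\<^bsub>B\<^esub> f N)"
      unfolding rel_def by (simp add: hdiff hadd F_closed rep_sum_rep hcl)
    then show ?case using sum rel f by (simp add: B.r_neg B.minus_eq)
  qed (auto simp: h0 hdiff B.minus_eq)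
  \<comment> \<open>\<open>h\<close> kills the relations, so it is constant on each coset and the
    image is a singleton.\<close>
  define k where "k X = the_elem (h ` X)" for X
  have k: "k (I +>\<^bsub>F\<^esub> x) = h x" if "x \<in> carrier F" for x
  proof -
    have "h ` (I +>\<^bsub>F\<^esub> x) = (\<lambda>i. h (i + x)) ` I" unfolding a_r_coset_def' by (auto simp: F_simps)
    also have "\<dots> = {h x}"
      using I_closed(1) that by (auto simp: hadd I_carrier hI hc intro!: image_eqI[of _ _ 0])
    finally show ?thesis by (simp add: k_def)
  qed
  show ?thesis
  proof (rule that[of k])
    show "k \<in> carrier \<Gamma> \<rightarrow> carrier B" using k hc by (auto simp: G_carrier)
    show "k (gc M) = f M" if "is_rep A M" for M unfolding gc_def by (simp add: k F_closed hcl that)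
    fix x y assume "x \<in> carrier \<Gamma>" "y \<in> carrier \<Gamma>"
    then obtain a b where ab: "a \<in> carrier F" "b \<in> carrier F" "x = I +>\<^bsub>F\<^esub> a" "y = I +>\<^bsub>F\<^esub> b" by (auto simp: G_carrier)
    have "x \<oplus>\<^bsub>\<Gamma>\<^esub> y = I +>\<^bsub>F\<^esub> (a + b)"
      using ring_hom_add[OF proj_hom ab(1,2)] by (simp add: ab F_simps(5))
    then show "k (x \<oplus>\<^bsub>\<Gamma>\<^esub> y) = k x \<oplus>\<^bsub>B\<^esub> k y"
      using ab by (simp add: k hadd F_closed)
  qed
qed

lemma G_ring_universal:
  assumes B: "ring B"
    and f: "\<And>M. is_rep A M \<Longrightarrow> f M \<in> carrier B"
    and cong: "\<And>M N. is_rep A M \<Longrightarrow> is_rep A N \<Longrightarrow> E M N \<Longrightarrow> f M = f N"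
    and sum: "\<And>M N. is_rep A M \<Longrightarrow> is_rep A N \<Longrightarrow> f (rep_sum M N) = f M \<oplus>\<^bsub>B\<^esub> f N"
    and mult: "\<And>M N. is_rep A M \<Longrightarrow> is_rep A N \<Longrightarrow> f (rep_tensor A M N) = f M \<otimes>\<^bsub>B\<^esub> f N"
    and unit: "f (rep_unit A) = \<one>\<^bsub>B\<^esub>"
  obtains h where "h \<in> Ring.ring_hom \<Gamma> B" "\<And>M. is_rep A M \<Longrightarrow> h (gc M) = f M"
proof -
  interpret B: ring B by fact
  interpret \<Gamma>: ring \<Gamma> by (rule ring_G)
  obtain h where h: "h \<in> carrier \<Gamma> \<rightarrow> carrier B"
    "\<And>x y. x \<in> carrier \<Gamma> \<Longrightarrow> y \<in> carrier \<Gamma> \<Longrightarrow> h (x \<oplus>\<^bsub>\<Gamma>\<^esub> y) = h x \<oplus>\<^bsub>B\<^esub> h y"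
    "\<And>M. is_rep A M \<Longrightarrow> h (gc M) = f M"
    using G_universal[OF B.is_abelian_group f cong sum] by blast
  have hc: "x \<in> carrier \<Gamma> \<Longrightarrow> h x \<in> carrier B" for x using h(1) by auto
  interpret ah: abelian_group_hom \<Gamma> B h
    by (rule abelian_group_homI[OF \<Gamma>.is_abelian_group B.is_abelian_group])
      (intro group_hom.intro group_hom_axioms.intro \<Gamma>.a_group B.a_group homI, use h in auto)
  have hdiff: "h (x \<ominus>\<^bsub>\<Gamma>\<^esub> y) = h x \<ominus>\<^bsub>B\<^esub> h y" if "x \<in> carrier \<Gamma>" "y \<in> carrier \<Gamma>" for x y
    using that by (simp add: a_minus_def)
  have hmult: "h (x \<otimes>\<^bsub>\<Gamma>\<^esub> y) = h x \<otimes>\<^bsub>B\<^esub> h y" if "x \<in> carrier \<Gamma>" "y \<in> carrier \<Gamma>" for x y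
    using that(1)
  proof (induction x rule: G_induct)
    case (gc M)
    from that(2) show ?case
    proof (induction y rule: G_induct)
      case (gc N)
      then show ?case using \<open>is_rep A M\<close> by (simp add: gc_tens[symmetric] h(3) mult tens_rep)
    next
      case (diff a b)
      then show ?case using \<open>is_rep A M\<close> hc by (simp add: ring_diff_distr[OF ring_G] hdiff ring_diff_distr[OF B])
    qed (use gc hc in auto)
  next
    case (diff a b)
    then show ?case using that(2) hc by (simp add: ring_diff_distr[OF ring_G] hdiff ring_diff_distr[OF B])
  qed (use that(2) hc in auto)
  have "h \<in> Ring.ring_hom \<Gamma> B"
    by (rule ring_hom_memI) (use h hc hmult unit gc_unit unit_rep in \<open>auto simp flip: gc_unit\<close>)
  with h(3) that show ?thesis by blast
qed

end

section \<open>The stable Green ring as a quotient\<close>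

context tens
begin

lemma green_iso: "green A (rep_iso A)"
  by unfold_locales (fact rep_iso_sym rep_iso_trans rep_tensor_cong | assumption)+

end

text \<open>The projective modules form a tensor ideal; this lets the tensor product descend to
  stable isomorphism classes.\<close>

locale stab = tens A for A :: "('k::field_char_0, 'b, 'm) hopf_scheme" +
  assumes proj_tens_left: "projective A P \<Longrightarrow> is_rep A M \<Longrightarrow> projective A (rep_tensor A P M)"
    and proj_tens_right: "projective A P \<Longrightarrow> is_rep A M \<Longrightarrow> projective A (rep_tensor A M P)"
begin

lemma fproj_tens_left:
  assumes "fproj M M' f" "g \<in> Hm A N N'" "is_rep A M" "is_rep A M'" "is_rep A N" "is_rep A N'"
  shows "fproj (rep_tensor A M N) (rep_tensor A M' N') (kr (fst N') (fst N) f g)"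
proof -
  obtain P a b where P: "projective A P" "a \<in> Hm A M P" "b \<in> Hm A P M'" "f = b * a"
    using assms(1) unfolding fproj_def by blast
  note Pr = projective_rep[OF P(1)]
  have "kr (fst N') (fst N) f g = kr (fst N') (fst N) b g * kr (fst N) (fst N) a (idm (fst N))"
    using Hm_dm[OF assms(2)] by (simp add: kr_mult P(4) dm_right)
  moreover have "kr (fst N') (fst N) b g \<in> Hm A (rep_tensor A P N) (rep_tensor A M' N')"
    by (rule Hm_tens) (use assms P Pr in auto)
  moreover have "kr (fst N) (fst N) a (idm (fst N)) \<in> Hm A (rep_tensor A M N) (rep_tensor A P N)"
    by (rule Hm_tens) (use assms P Pr Hm_id in auto)
  ultimately show ?thesis unfolding fproj_def using proj_tens_left[OF P(1) assms(5)] by blast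
qed

lemma fproj_tens_right:
  assumes "fproj N N' g" "f \<in> Hm A M M'" "is_rep A M" "is_rep A M'" "is_rep A N" "is_rep A N'"
  shows "fproj (rep_tensor A M N) (rep_tensor A M' N') (kr (fst N') (fst N) f g)"
proof -
  obtain P a b where P: "projective A P" "a \<in> Hm A N P" "b \<in> Hm A P N'" "g = b * a"
    using assms(1) unfolding fproj_def by blast
  note Pr = projective_rep[OF P(1)]
  have "kr (fst N') (fst N) f g = kr (fst N') (fst P) f b * kr (fst P) (fst N) (idm (fst M)) a"
    using Hm_dm[OF P(3)] Hm_dm[OF assms(2)] by (simp add: kr_mult P(4) dm_right)
  moreover have "kr (fst N') (fst P) f b \<in> Hm A (rep_tensor A M P) (rep_tensor A M' N')"
    by (rule Hm_tens) (use assms P Pr in auto)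
  moreover have "kr (fst P) (fst N) (idm (fst M)) a \<in> Hm A (rep_tensor A M N) (rep_tensor A M P)"
    by (rule Hm_tens) (use assms P Pr Hm_id in auto)
  ultimately show ?thesis unfolding fproj_def using proj_tens_right[OF P(1) assms(3)] by blast
qed

text \<open>Telescoping: u tensor u' - 1 tensor 1 = (u - 1) tensor u' + 1 tensor (u' - 1), where one
  factor of each term passes through a projective module.\<close>

lemma st_tens_half:
  assumes "f \<in> Hm A M M'" "g \<in> Hm A M' M" "f' \<in> Hm A N N'" "g' \<in> Hm A N' N"
    "fproj M M (g * f - idm (fst M))" "fproj N N (g' * f' - idm (fst N))"
    "is_rep A M" "is_rep A M'" "is_rep A N" "is_rep A N'"
  shows "fproj (rep_tensor A M N) (rep_tensor A M N)
    (kr (fst N) (fst N') g g' * kr (fst N') (fst N) f f' - idm (fst M * fst N))"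
proof -
  have "kr (fst N) (fst N') g g' * kr (fst N') (fst N) f f' - idm (fst M * fst N) =
      kr (fst N) (fst N) (g * f - idm (fst M)) (g' * f') + kr (fst N) (fst N) (idm (fst M)) (g' * f' - idm (fst N))"
    by (simp add: kr_mult[OF Hm_dm[OF assms(4)]] kr_diff_left kr_diff_right kr_idm)
  then show ?thesis
    using fproj_add[OF fproj_tens_left[OF assms(5) Hm_comp[OF assms(4,3)]] fproj_tens_right[OF assms(6) Hm_id]] assms
    by simp
qed

lemma st_iso_tens:
  assumes M: "is_rep A M" "is_rep A M'" and N: "is_rep A N" "is_rep A N'" and "st_iso A M M'" "st_iso A N N'"
  shows "st_iso A (rep_tensor A M N) (rep_tensor A M' N')"
proof -
  obtain f g f' g' where h: "st M M' f g" "st N N' f' g'"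
    using assms st_iso_iff by meson
  then have "st (rep_tensor A M N) (rep_tensor A M' N') (kr (fst N') (fst N) f f') (kr (fst N) (fst N') g g')"
    using st_tens_half[of f M M' g f' N N' g'] st_tens_half[of g M' M f g' N' N f'] M N
    unfolding st_def fst_rep_tensor by (intro conjI Hm_tens) simp_all
  then show ?thesis using st_iso_iff tens_rep M N by blast
qed

lemma green_st: "green A (st_iso A)"
  by unfold_locales (fact rep_iso_st st_iso_sym st_iso_trans | rule st_iso_tens; assumption)+

sublocale U: green A "rep_iso A" by (rule green_iso)
sublocale T: green A "st_iso A" by (rule green_st)

lemma T_projective_zero: "projective A P \<Longrightarrow> T.gc P = \<zero>\<^bsub>T.\<Gamma>\<^esub>"
  by (rule trans[OF T.gc_cong[OF projective_rep zrep_rep projective_st_zero] T.gc_zero_dim[OF zrep_rep fst_zrep]])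

text \<open>The class map \<open>h\<close> from r(H) to r_st(H) is onto and kills the projectives.
  That its kernel is no larger follows from an additive map \<open>k\<close> into r(H) modulo the
  ideal for which \<open>k\<close> after \<open>h\<close> is the residue map.\<close>

theorem stable_green_ring_iso: "stable_green_ring A \<simeq> green_ring A Quot proj_ideal A"
proof -
  interpret UR: ring U.\<Gamma> by (rule U.ring_G)
  interpret TR: ring T.\<Gamma> by (rule T.ring_G)
  obtain h where h: "h \<in> Ring.ring_hom U.\<Gamma> T.\<Gamma>" "\<And>M. is_rep A M \<Longrightarrow> h (U.gc M) = T.gc M"
  proof (rule U.G_ring_universal[OF T.ring_G T.gc_closed T.gc_iso T.gc_sum T.gc_tens T.gc_unit])
    fix h assume "h \<in> Ring.ring_hom U.\<Gamma> T.\<Gamma>" "\<And>M. is_rep A M \<Longrightarrow> h (U.gc M) = T.gc M"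
    then show thesis by (rule that)
  qed
  interpret h: ring_hom_ring U.\<Gamma> T.\<Gamma> h
    by (rule ring_hom_ringI2[OF U.ring_G T.ring_G h(1)])
  have hdiff: "h (x \<ominus>\<^bsub>U.\<Gamma>\<^esub> y) = h x \<ominus>\<^bsub>T.\<Gamma>\<^esub> h y" if "x \<in> carrier U.\<Gamma>" "y \<in> carrier U.\<Gamma>" for x y
    using that by (simp add: a_minus_def)
  have surj: "h ` carrier U.\<Gamma> = carrier T.\<Gamma>"
  proof
    show "h ` carrier U.\<Gamma> \<subseteq> carrier T.\<Gamma>" by auto
    show "carrier T.\<Gamma> \<subseteq> h ` carrier U.\<Gamma>"
    proof
      fix x assume "x \<in> carrier T.\<Gamma>"
      then show "x \<in> h ` carrier U.\<Gamma>"
      proof (induction x rule: T.G_induct)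
        case zero
        show ?case by (rule image_eqI[of _ _ "\<zero>\<^bsub>U.\<Gamma>\<^esub>"]) auto
      next
        case (gc M)
        then show ?case by (intro image_eqI[of _ _ "U.gc M"]) (auto simp: h(2))
      next
        case (diff a b)
        then obtain u v where "u \<in> carrier U.\<Gamma>" "v \<in> carrier U.\<Gamma>" "a = h u" "b = h v" by blast
        then show ?case by (intro image_eqI[of _ _ "u \<ominus>\<^bsub>U.\<Gamma>\<^esub> v"]) (auto simp: hdiff)
      qed
    qed
  qed
  define J where "J = proj_ideal A"
  let ?G = "{green_class A P | P. indecomposable A P \<and> projective A P}"
  have gcl: "green_class A P = U.gc P" for P
    by (simp add: green_class_def U.gc_def)
  have Gc: "?G \<subseteq> carrier U.\<Gamma>" using projective_rep by (auto simp: gcl)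
  have J: "J = Idl\<^bsub>U.\<Gamma>\<^esub> ?G" by (simp add: J_def proj_ideal_def green_ring_def)
  have idJ: "ideal J U.\<Gamma>" unfolding J by (rule UR.genideal_ideal[OF Gc])
  interpret J: ideal J U.\<Gamma> by (rule idJ)
  interpret Q: ring "U.\<Gamma> Quot J" by (rule J.quotient_is_ring)
  interpret p: ring_hom_ring U.\<Gamma> "U.\<Gamma> Quot J" "(+>\<^bsub>U.\<Gamma>\<^esub>) J" by (rule J.rcos_ring_hom_ring)
  have projJ: "U.gc P \<in> J" if "projective A P" for P
    using that
  proof (rule projective_indecomposables[where X = "\<lambda>P. U.gc P \<in> J"])
    show "U.gc Q \<in> J" if "is_rep A Q" "fst Q = 0" for Q
      using U.gc_zero_dim[OF that] by simp
    show "U.gc Q \<in> J" if "indecomposable A Q" "projective A Q" for Q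
      using that gcl UR.genideal_self[OF Gc] unfolding J by blast
    show "U.gc P \<in> J" if "is_rep A P" "is_rep A Q" "is_rep A R" "U.gc Q \<in> J" "U.gc R \<in> J" "rep_iso A P (rep_sum Q R)" for P Q R
      using that U.gc_iso[of P "rep_sum Q R"] U.gc_sum[of Q R] rep_sum_rep by simp
  qed
  let ?p = "\<lambda>x. J +>\<^bsub>U.\<Gamma>\<^esub> x"
  have Q0: "\<zero>\<^bsub>U.\<Gamma> Quot J\<^esub> = J" unfolding FactRing_def by simp
  have pJ: "?p x = \<zero>\<^bsub>U.\<Gamma> Quot J\<^esub>" if "x \<in> J" for x
    unfolding Q0 by (rule J.a_rcos_const[OF that])
  obtain k where k: "k \<in> carrier T.\<Gamma> \<rightarrow> carrier (U.\<Gamma> Quot J)"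
    "\<And>x y. x \<in> carrier T.\<Gamma> \<Longrightarrow> y \<in> carrier T.\<Gamma> \<Longrightarrow> k (x \<oplus>\<^bsub>T.\<Gamma>\<^esub> y) = k x \<oplus>\<^bsub>U.\<Gamma> Quot J\<^esub> k y"
    "\<And>M. is_rep A M \<Longrightarrow> k (T.gc M) = ?p (U.gc M)"
  proof (rule T.G_universal[OF Q.is_abelian_group, of "\<lambda>M. ?p (U.gc M)"])
    fix k assume "k \<in> carrier T.\<Gamma> \<rightarrow> carrier (U.\<Gamma> Quot J)"
      "\<And>x y. x \<in> carrier T.\<Gamma> \<Longrightarrow> y \<in> carrier T.\<Gamma> \<Longrightarrow> k (x \<oplus>\<^bsub>T.\<Gamma>\<^esub> y) = k x \<oplus>\<^bsub>U.\<Gamma> Quot J\<^esub> k y"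
      "\<And>M. is_rep A M \<Longrightarrow> k (T.gc M) = ?p (U.gc M)"
    then show thesis by (rule that)
  next
    \<comment> \<open>Stably isomorphic modules become isomorphic after adding projectives, whose
      classes vanish in the quotient.\<close>
    fix M N assume M: "is_rep A M" and N: "is_rep A N" and MN: "st_iso A M N"
    obtain P Q where PQ: "projective A P" "projective A Q" "rep_iso A (rep_sum M Q) (rep_sum N P)"
      using st_iso_sums[OF M N MN] by blast
    note r = projective_rep[OF PQ(1)] projective_rep[OF PQ(2)]
    have "U.gc M \<oplus>\<^bsub>U.\<Gamma>\<^esub> U.gc Q = U.gc N \<oplus>\<^bsub>U.\<Gamma>\<^esub> U.gc P"
      using U.gc_iso[OF rep_sum_rep rep_sum_rep PQ(3)] U.gc_sum M N r by simp
    then have "?p (U.gc M \<oplus>\<^bsub>U.\<Gamma>\<^esub> U.gc Q) = ?p (U.gc N \<oplus>\<^bsub>U.\<Gamma>\<^esub> U.gc P)" by simp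
    then have "?p (U.gc M) \<oplus>\<^bsub>U.\<Gamma> Quot J\<^esub> ?p (U.gc Q) = ?p (U.gc N) \<oplus>\<^bsub>U.\<Gamma> Quot J\<^esub> ?p (U.gc P)"
      using M N r by (metis p.hom_add U.gc_closed)
    then show "?p (U.gc M) = ?p (U.gc N)"
      unfolding pJ[OF projJ[OF PQ(1)]] pJ[OF projJ[OF PQ(2)]]
      using p.hom_closed[OF U.gc_closed[OF M]] p.hom_closed[OF U.gc_closed[OF N]] by (metis Q.r_zero)
  next
    show "?p (U.gc (rep_sum M N)) = ?p (U.gc M) \<oplus>\<^bsub>U.\<Gamma> Quot J\<^esub> ?p (U.gc N)" if "is_rep A M" "is_rep A N" for M N
      using that U.gc_sum by (metis p.hom_add U.gc_closed)
  next
    show "?p (U.gc M) \<in> carrier (U.\<Gamma> Quot J)" if "is_rep A M" for M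
      by (rule p.hom_closed[OF U.gc_closed[OF that]])
  qed
  have k0: "k \<zero>\<^bsub>T.\<Gamma>\<^esub> = \<zero>\<^bsub>U.\<Gamma> Quot J\<^esub>"
  proof -
    have "k \<zero>\<^bsub>T.\<Gamma>\<^esub> \<oplus>\<^bsub>U.\<Gamma> Quot J\<^esub> k \<zero>\<^bsub>T.\<Gamma>\<^esub> = k \<zero>\<^bsub>T.\<Gamma>\<^esub>"
      using k(2)[OF TR.zero_closed TR.zero_closed] unfolding TR.l_zero[OF TR.zero_closed] by (rule sym)
    then show ?thesis
      using Q.add.l_cancel_one[OF funcset_mem[OF k(1) TR.zero_closed] funcset_mem[OF k(1) TR.zero_closed]] by (rule iffD1[rotated])
  qed
  have kdiff: "k (x \<ominus>\<^bsub>T.\<Gamma>\<^esub> y) = k x \<ominus>\<^bsub>U.\<Gamma> Quot J\<^esub> k y" if "x \<in> carrier T.\<Gamma>" "y \<in> carrier T.\<Gamma>" for x y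
  proof -
    have "k (x \<ominus>\<^bsub>T.\<Gamma>\<^esub> y) \<oplus>\<^bsub>U.\<Gamma> Quot J\<^esub> k y = k x"
    proof -
      have "x \<ominus>\<^bsub>T.\<Gamma>\<^esub> y \<oplus>\<^bsub>T.\<Gamma>\<^esub> y = x"
        unfolding a_minus_def TR.a_assoc[OF that(1) TR.a_inv_closed[OF that(2)] that(2)] TR.l_neg[OF that(2)]
        by (rule TR.r_zero[OF that(1)])
      then show ?thesis using k(2)[OF TR.minus_closed[OF that] that(2)] by (simp only:)
    qed
    moreover have "k (x \<ominus>\<^bsub>T.\<Gamma>\<^esub> y) \<in> carrier (U.\<Gamma> Quot J)" "k y \<in> carrier (U.\<Gamma> Quot J)"
      by (rule funcset_mem[OF k(1)], rule TR.minus_closed[OF that], rule funcset_mem[OF k(1) that(2)])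
    ultimately show ?thesis
      by (metis Q.a_assoc Q.a_inv_closed Q.minus_eq Q.r_neg Q.r_zero)
  qed
  have kh: "k (h x) = ?p x" if "x \<in> carrier U.\<Gamma>" for x
    using that
  proof (induction x rule: U.G_induct)
    case zero
    show ?case using k0 by (metis h.hom_zero p.hom_zero)
  next
    case (gc M)
    then show ?case by (simp add: h(2) k(3))
  next
    case (diff a b)
    then have "k (h (a \<ominus>\<^bsub>U.\<Gamma>\<^esub> b)) = ?p a \<ominus>\<^bsub>U.\<Gamma> Quot J\<^esub> ?p b" by (simp add: hdiff kdiff)
    also have "\<dots> = ?p (a \<ominus>\<^bsub>U.\<Gamma>\<^esub> b)" using diff(1,2) by (simp only: a_minus_def p.hom_add p.hom_a_inv UR.a_inv_closed)
    finally show ?case .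
  qed
  have "a_kernel U.\<Gamma> T.\<Gamma> h = J"
  proof
    show "a_kernel U.\<Gamma> T.\<Gamma> h \<subseteq> J"
    proof
      fix x assume "x \<in> a_kernel U.\<Gamma> T.\<Gamma> h"
      then have x: "x \<in> carrier U.\<Gamma>" "h x = \<zero>\<^bsub>T.\<Gamma>\<^esub>"
        unfolding a_kernel_def' by blast+
      have "?p x = J" using kh[OF x(1)] unfolding x(2) k0 Q0 by (rule sym)
      with J.a_rcos_self[OF x(1)] show "x \<in> J" by (rule subst[rotated])
    qed
    have "U.gc P \<in> a_kernel U.\<Gamma> T.\<Gamma> h" if "projective A P" for P
      unfolding a_kernel_def' using h(2)[OF projective_rep[OF that]] T_projective_zero[OF that]
        U.gc_closed[OF projective_rep[OF that]] by (intro CollectI conjI) (simp_all only:)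
    then have "?G \<subseteq> a_kernel U.\<Gamma> T.\<Gamma> h" unfolding gcl by blast
    then show "J \<subseteq> a_kernel U.\<Gamma> T.\<Gamma> h"
      unfolding J by (rule UR.genideal_minimal[OF h.kernel_is_ideal])
  qed
  then have "U.\<Gamma> Quot J \<simeq> T.\<Gamma>" using h.FactRing_iso[OF surj] by (simp only:)
  then have "T.\<Gamma> \<simeq> U.\<Gamma> Quot J" by (rule ring_iso_sym[OF J.quotient_is_ring])
  then show ?thesis unfolding stable_green_ring_def green_ring_def J_def .
qed

end

section \<open>Algebras with a finite basis\<close>

definition ext :: "'b set \<Rightarrow> ('b \<Rightarrow> 'k rfm) \<Rightarrow> ('b \<Rightarrow> 'k) \<Rightarrow> 'k::field rfm" where
  "ext S F x = (\<Sum>b\<in>S. x b *\<^sub>c F b)"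

lemma ext_bvec: "finite S \<Longrightarrow> b \<in> S \<Longrightarrow> ext S F (bvec b) = F b"
proof -
  assume "finite S" "b \<in> S"
  have "ext S F (bvec b) = (\<Sum>c\<in>S. if c = b then F c else 0)"
    unfolding ext_def bvec_def by (rule sum.cong) auto
  then show ?thesis using \<open>finite S\<close> \<open>b \<in> S\<close> by simp
qed

lemma ext_add: "ext S F (\<lambda>c. x c + y c) = ext S F x + ext S F y"
  and ext_smult: "ext S F (\<lambda>c. k * x c) = k *\<^sub>c ext S F x"
  and ext_zero: "ext S F (\<lambda>c. 0) = 0"
  by (simp_all add: ext_def scl_add_left sum.distrib scl_sum)

lemma ext_sum: "ext S F (\<lambda>c. \<Sum>t\<in>T. f t c) = (\<Sum>t\<in>T. ext S F (f t))"
  unfolding ext_def by (simp add: scl_sum_left) (rule sum.swap)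

lemma ext_alg_on_mult:
  assumes "\<And>a b. a \<in> S \<Longrightarrow> b \<in> S \<Longrightarrow> F a * F b = ext S F (m a b)"
  shows "ext S F (\<lambda>c. \<Sum>a\<in>S. \<Sum>b\<in>S. x a * y b * m a b c) = ext S F x * ext S F y"
proof -
  have "ext S F (\<lambda>c. \<Sum>a\<in>S. \<Sum>b\<in>S. x a * y b * m a b c) = (\<Sum>a\<in>S. \<Sum>b\<in>S. (x a * y b) *\<^sub>c (F a * F b))"
    unfolding ext_sum ext_smult using assms by (intro sum.cong refl) simp
  also have "\<dots> = ext S F x * ext S F y"
    by (simp add: ext_def sum_product mult.commute)
  finally show ?thesis .
qed

lemma dm_ext: "(\<And>b. b \<in> S \<Longrightarrow> dm d d (F b)) \<Longrightarrow> dm d d (ext S F x)"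
  unfolding ext_def by (intro dm_sum dm_scl) auto

text \<open>The common ground of \<open>group_alg\<close> and \<open>datum_hopf\<close>: modules are
  verified on products of basis elements and homomorphisms on basis elements.\<close>

locale basis_alg =
  fixes A :: "('k::field_char_0, 'b \<Rightarrow> 'k, 'm) module_scheme" and S m u
  assumes fin: "finite S"
    and carr: "carrier A = {x. \<forall>b. b \<notin> S \<longrightarrow> x b = 0}"
    and mult: "x \<otimes>\<^bsub>A\<^esub> y = (\<lambda>c. \<Sum>a\<in>S. \<Sum>b\<in>S. x a * y b * m a b c)"
    and add: "x \<oplus>\<^bsub>A\<^esub> y = (\<lambda>c. x c + y c)"
    and smult: "k \<odot>\<^bsub>A\<^esub> x = (\<lambda>c. k * x c)"
    and one: "\<one>\<^bsub>A\<^esub> = u"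
    and m_supp: "a \<in> S \<Longrightarrow> b \<in> S \<Longrightarrow> c \<notin> S \<Longrightarrow> m a b c = 0"
    and u_supp: "c \<notin> S \<Longrightarrow> u c = 0"
begin

sublocale alg A
  by unfold_locales (auto simp: carr mult add smult one u_supp m_supp intro!: sum.neutral)

lemma bvec_carrier: "b \<in> S \<Longrightarrow> bvec b \<in> carrier A"
  by (auto simp: carr bvec_def)

lemma bvec_mult: "a \<in> S \<Longrightarrow> b \<in> S \<Longrightarrow> bvec a \<otimes>\<^bsub>A\<^esub> bvec b = m a b"
  using alg_on_bvec_mult[OF fin, of a b m] by (simp add: alg_on_def mult)

lemma ac_expand:
  assumes M: "is_rep A M" and x: "x \<in> carrier A"
  shows "ac M x = ext S (\<lambda>b. ac M (bvec b)) x"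
proof -
  have "finite T \<Longrightarrow> T \<subseteq> S \<Longrightarrow> ac M (\<lambda>c. if c \<in> T then x c else 0) = (\<Sum>b\<in>T. x b *\<^sub>c ac M (bvec b))" for T
  proof (induction T rule: finite_induct)
    case empty
    have "(\<lambda>c. 0) = (0::'k) \<odot>\<^bsub>A\<^esub> x" by (simp add: smult)
    then have "ac M (\<lambda>c. 0) = 0 *\<^sub>c ac M x" using ac_smult[OF M x] by metis
    then show ?case by simp
  next
    case (insert a T)
    let ?y = "\<lambda>c. if c \<in> T then x c else 0"
    have y: "?y \<in> carrier A" using insert by (auto simp: carr)
    have a: "bvec a \<in> carrier A" using insert by (auto intro: bvec_carrier)
    have "(\<lambda>c. if c \<in> insert a T then x c else 0) = (x a \<odot>\<^bsub>A\<^esub> bvec a) \<oplus>\<^bsub>A\<^esub> ?y"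
      using insert by (auto simp: fun_eq_iff add smult bvec_def)
    then show ?case
      using insert ac_add[OF M smult_closed[OF a] y] ac_smult[OF M a] by simp
  qed
  from this[OF fin subset_refl]
  have "ac M (\<lambda>c. if c \<in> S then x c else 0) = (\<Sum>b\<in>S. x b *\<^sub>c ac M (bvec b))" .
  moreover have "(\<lambda>c. if c \<in> S then x c else 0) = x" using x by (auto simp: carr)
  ultimately show ?thesis by (simp add: ext_def)
qed

lemma is_repI:
  assumes "\<And>x. x \<in> carrier A \<Longrightarrow> snd M x \<in> carrier_mat (fst M) (fst M)"
    and ac: "\<And>x. x \<in> carrier A \<Longrightarrow> ac M x = ext S F x"
    and F: "\<And>a b. a \<in> S \<Longrightarrow> b \<in> S \<Longrightarrow> F a * F b = ext S F (m a b)"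
    and u: "ext S F u = idm (fst M)"
  shows "is_rep A M"
  unfolding is_rep_iff
proof (intro conjI ballI allI)
  show "ac M (x \<otimes>\<^bsub>A\<^esub> y) = ac M x * ac M y" if "x \<in> carrier A" "y \<in> carrier A" for x y
    using ac[OF mult_closed[OF that]] ac[OF that(1)] ac[OF that(2)] ext_alg_on_mult[OF F, of x y] by (simp add: mult)
  show "ac M (x \<oplus>\<^bsub>A\<^esub> y) = ac M x + ac M y" if "x \<in> carrier A" "y \<in> carrier A" for x y
    using ac[OF add_closed[OF that]] ac[OF that(1)] ac[OF that(2)] by (simp add: add ext_add)
  show "ac M (k \<odot>\<^bsub>A\<^esub> x) = k *\<^sub>c ac M x" if "x \<in> carrier A" for k x
    using ac[OF smult_closed[OF that]] ac[OF that(1)] by (simp add: smult ext_smult)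
  show "ac M \<one>\<^bsub>A\<^esub> = idm (fst M)"
    using ac[OF one_closed] u by (simp add: one)
qed (use assms(1) in auto)

lemma Hm_iff:
  assumes "is_rep A M" "is_rep A N"
  shows "f \<in> Hm A M N \<longleftrightarrow> dm (fst N) (fst M) f \<and> (\<forall>b\<in>S. f * ac M (bvec b) = ac N (bvec b) * f)"
proof -
  have "f * ac M x = ac N x * f" if "\<forall>b\<in>S. f * ac M (bvec b) = ac N (bvec b) * f" "x \<in> carrier A" for x
    unfolding ac_expand[OF assms(1) that(2)] ac_expand[OF assms(2) that(2)] ext_def
    using that(1) by (simp add: sum_distrib_left sum_distrib_right)
  then show ?thesis using bvec_carrier unfolding Hm_def by blast
qed

end

lemma finite_datum_basis: "finite (carrier G) \<Longrightarrow> finite (datum_basis G n)"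
  by (simp add: datum_basis_def)

section \<open>Modules over the group algebra\<close>

locale fin_group = group G for G :: "('g, 'l) monoid_scheme" (structure) +
  assumes fin_G: "finite (carrier G)"
begin

lemma KG_simps:
  fixes H :: "('k::field, 'g) hopf" defines "H \<equiv> group_alg G"
  shows "carrier H = {x. \<forall>b. b \<notin> carrier G \<longrightarrow> x b = 0}"
    "x \<otimes>\<^bsub>H\<^esub> y = (\<lambda>c. \<Sum>a\<in>carrier G. \<Sum>b\<in>carrier G. x a * y b * bvec (a \<otimes> b) c)"
    "\<one>\<^bsub>H\<^esub> = bvec \<one>"
    "x \<oplus>\<^bsub>H\<^esub> y = (\<lambda>c. x c + y c)"
    "k \<odot>\<^bsub>H\<^esub> x = (\<lambda>c. k * x c)"
    "hbasis H = carrier G"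
    "comult H = lin_ext (carrier G) (\<lambda>h. bvec (h, h))"
    "counit H x = (\<Sum>h\<in>carrier G. x h)"
  by (simp_all add: H_def group_alg_def module.extend_def hopf.fields_def alg_on_def)

end

locale KG = fin_group G for G :: "('g, 'l) monoid_scheme" (structure) +
  fixes K :: "('k::field_char_0, 'g) hopf"
  defines K_def: "K \<equiv> group_alg G"
begin

sublocale K: basis_alg K "carrier G" "\<lambda>a b. bvec (a \<otimes> b)" "bvec \<one>"
  by unfold_locales (auto simp: K_def KG_simps fin_G bvec_def)

definition ga :: "('g \<Rightarrow> 'k, 'k) rep \<Rightarrow> 'g \<Rightarrow> 'k rfm" where "ga V h = ac V (bvec h)"

lemma ga_dm: "is_rep K V \<Longrightarrow> h \<in> carrier G \<Longrightarrow> dm (fst V) (fst V) (ga V h)"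
  unfolding ga_def by (rule K.ac_dm[OF _ K.bvec_carrier])

lemma ga_mult: "is_rep K V \<Longrightarrow> h \<in> carrier G \<Longrightarrow> k \<in> carrier G \<Longrightarrow> ga V (h \<otimes> k) = ga V h * ga V k"
  unfolding ga_def using K.ac_mult[OF _ K.bvec_carrier K.bvec_carrier, of V h k] K.bvec_mult[of h k] by simp

lemma ga_one: "is_rep K V \<Longrightarrow> ga V \<one> = idm (fst V)"
  unfolding ga_def using K.ac_one[of V] by (simp add: K.one)

lemma ga_expand: "is_rep K V \<Longrightarrow> x \<in> carrier K \<Longrightarrow> ac V x = ext (carrier G) (ga V) x"
  unfolding ga_def by (rule K.ac_expand)

lemma K_hom_iff:
  assumes "is_rep K V" "is_rep K W"
  shows "f \<in> Hm K V W \<longleftrightarrow> dm (fst W) (fst V) f \<and> (\<forall>h\<in>carrier G. f * ga V h = ga W h * f)"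
  unfolding ga_def by (rule K.Hm_iff[OF assms])

lemma K_repI:
  assumes "\<And>x. x \<in> carrier K \<Longrightarrow> snd V x \<in> carrier_mat (fst V) (fst V)"
    and ac: "\<And>x. x \<in> carrier K \<Longrightarrow> ac V x = ext (carrier G) \<rho> x"
    and "\<And>h k. h \<in> carrier G \<Longrightarrow> k \<in> carrier G \<Longrightarrow> \<rho> (h \<otimes> k) = \<rho> h * \<rho> k" "\<rho> \<one> = idm (fst V)"
  shows "is_rep K V" "h \<in> carrier G \<Longrightarrow> ga V h = \<rho> h"
proof -
  show "is_rep K V" by (rule K.is_repI[OF assms(1,2)]) (use assms(3,4) in \<open>auto simp: ext_bvec fin_G\<close>)
  show "h \<in> carrier G \<Longrightarrow> ga V h = \<rho> h"
    unfolding ga_def by (simp add: ac K.bvec_carrier ext_bvec fin_G)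
qed

definition mkG :: "nat \<Rightarrow> ('g \<Rightarrow> 'k rfm) \<Rightarrow> ('g \<Rightarrow> 'k, 'k) rep" where
  "mkG d \<rho> = mkrep d (ext (carrier G) \<rho>)"

lemma fst_mkG [simp]: "fst (mkG d \<rho>) = d"
  by (simp add: mkG_def)

lemma mkG:
  assumes "\<And>h. h \<in> carrier G \<Longrightarrow> dm d d (\<rho> h)"
    and "\<And>h k. h \<in> carrier G \<Longrightarrow> k \<in> carrier G \<Longrightarrow> \<rho> (h \<otimes> k) = \<rho> h * \<rho> k" "\<rho> \<one> = idm d"
  shows "is_rep K (mkG d \<rho>)" "h \<in> carrier G \<Longrightarrow> ga (mkG d \<rho>) h = \<rho> h"
proof -
  have "ac (mkG d \<rho>) x = ext (carrier G) \<rho> x" for x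
    unfolding mkG_def by (rule K.ac_mkrep) (rule dm_ext, rule assms(1))
  moreover have "snd (mkG d \<rho>) x \<in> carrier_mat d d" for x by (simp add: mkG_def mkrep_def)
  ultimately show "is_rep K (mkG d \<rho>)" "h \<in> carrier G \<Longrightarrow> ga (mkG d \<rho>) h = \<rho> h"
    using K_repI[of "mkG d \<rho>" \<rho>] assms by auto
qed

lemma comult_KG: "comult K x (b, c) = (if b = c \<and> b \<in> carrier G then x b else 0)"
proof -
  have "comult K x (b, c) = (\<Sum>h\<in>carrier G. if h = b then (if b = c then x b else 0) else 0)"
    unfolding K_def KG_simps lin_ext_def by (rule sum.cong) (auto simp: bvec_def)
  then show ?thesis using fin_G by auto
qed

lemma K_tens:
  assumes V: "is_rep K V" and W: "is_rep K W"
  shows "is_rep K (rep_tensor K V W)"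
    "h \<in> carrier G \<Longrightarrow> ga (rep_tensor K V W) h = kr (fst W) (fst W) (ga V h) (ga W h)"
proof -
  let ?F = "\<lambda>h. kr (fst W) (fst W) (ga V h) (ga W h)"
  have b: "hbasis K = carrier G" by (simp add: K_def KG_simps)
  have ac: "ac (rep_tensor K V W) x = ext (carrier G) ?F x" for x
  proof -
    have "ac (rep_tensor K V W) x = (\<Sum>(b, c)\<in>carrier G \<times> carrier G.
        comult K x (b, c) *\<^sub>c kr (fst W) (fst W) (ga V b) (ga W c))"
      unfolding ga_def b[symmetric]
      by (rule ac_rep_tensor) (auto simp: b fin_G intro!: K.rep_carrier V W K.bvec_carrier)
    also have "\<dots> = (\<Sum>b\<in>carrier G. \<Sum>c\<in>carrier G. if c = b then x b *\<^sub>c ?F b else 0)"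
      unfolding sum.cartesian_product[symmetric] comult_KG by (intro sum.cong refl) auto
    also have "\<dots> = ext (carrier G) ?F x" by (simp add: fin_G ext_def)
    finally show ?thesis .
  qed
  have c: "snd (rep_tensor K V W) x \<in> carrier_mat (fst V * fst W) (fst V * fst W)" for x
    by (simp add: rep_tensor_def)
  show "is_rep K (rep_tensor K V W)" "h \<in> carrier G \<Longrightarrow> ga (rep_tensor K V W) h = ?F h"
    using K_repI[of "rep_tensor K V W" ?F] c ac V W
    by (simp_all add: ga_mult ga_one kr_mult[OF ga_dm] kr_idm)
qed

lemma K_unit: "is_rep K (rep_unit K)" "h \<in> carrier G \<Longrightarrow> ga (rep_unit K) h = idm 1"
proof -
  have ac: "ac (rep_unit K) x = ext (carrier G) (\<lambda>_. idm 1) x" for x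
    by (rule rfm_eqI) (auto simp: ac_def rep_unit_def ent_fm ext_def ent_sum K_def KG_simps)
  show "is_rep K (rep_unit K)" "h \<in> carrier G \<Longrightarrow> ga (rep_unit K) h = idm 1"
    using K_repI[of "rep_unit K" "\<lambda>_. idm 1"] ac by (simp_all add: rep_unit_def)
qed

lemma K_ac_eqI: "is_rep K V \<Longrightarrow> is_rep K W \<Longrightarrow> (\<And>h. h \<in> carrier G \<Longrightarrow> ga V h = ga W h) \<Longrightarrow> x \<in> carrier K \<Longrightarrow> ac V x = ac W x"
  by (simp add: ga_expand ext_def)

sublocale K: tens K
proof
  show "finite (hbasis K)" by (simp add: K_def KG_simps fin_G)
  show "b \<in> hbasis K \<Longrightarrow> bvec b \<in> carrier K" for b by (auto simp: K_def KG_simps bvec_def)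
  fix V W X :: "('g \<Rightarrow> 'k, 'k) rep" and x
  assume V: "is_rep K V" and x: "x \<in> carrier K"
  show "ac (rep_tensor K (rep_unit K) V) x = ac V x" "ac (rep_tensor K V (rep_unit K)) x = ac V x"
    by (rule K_ac_eqI; use V x K_unit K_tens ga_dm in \<open>simp add: kr_unit_left kr_unit_right idm_1\<close>)+
  assume W: "is_rep K W" and X: "is_rep K X"
  show "ac (rep_tensor K (rep_tensor K V W) X) x = ac (rep_tensor K V (rep_tensor K W X)) x"
    by (rule K_ac_eqI) (use V W X x K_tens in \<open>simp_all add: kr_assoc\<close>)
qed (fact K_tens K_unit)+

text \<open>Group elements act on both factors alike, so the flip of the factors is equivariant;
  this makes r(KG) commutative.\<close>

lemma rep_tensor_comm:
  assumes V: "is_rep K V" and W: "is_rep K W"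
  shows "rep_iso K (rep_tensor K V W) (rep_tensor K W V)"
proof (rule K.rep_isoI[where f = "fl (fst V) (fst W)" and g = "fl (fst W) (fst V)"])
  show "fl (fst V) (fst W) \<in> Hm K (rep_tensor K V W) (rep_tensor K W V)"
    using V W K_tens fl_kr[OF ga_dm[OF V] ga_dm[OF W]] dm_fl'(2)[of "fst W" "fst V"] by (auto simp: K_hom_iff dm_fl')
  show "fl (fst W) (fst V) \<in> Hm K (rep_tensor K W V) (rep_tensor K V W)"
    using V W K_tens fl_kr[OF ga_dm[OF W] ga_dm[OF V]] dm_fl'(2)[of "fst V" "fst W"] by (auto simp: K_hom_iff dm_fl')
qed (use V W K_tens in \<open>auto simp: fl_fl mult.commute\<close>)

end

section \<open>Quantum binomial coefficients\<close>

text \<open>Gaussian binomial coefficients, given by the Pascal rule because it needs no division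
  and so makes sense at roots of unity.\<close>

fun qbin :: "'a::comm_ring_1 \<Rightarrow> nat \<Rightarrow> nat \<Rightarrow> 'a" where
  "qbin q n 0 = 1"
| "qbin q 0 (Suc k) = 0"
| "qbin q (Suc n) (Suc k) = qbin q n k + q ^ Suc k * qbin q n (Suc k)"

lemma qbin_zero: "n < k \<Longrightarrow> qbin q n k = 0"
  by (induction q n k rule: qbin.induct) auto

text \<open>The absorption identity for Gaussian binomials, in a form free of division since its
  factors may vanish at roots of unity.\<close>

lemma qbin_absorb: "(q ^ Suc k - 1) * qbin q (Suc n) (Suc k) = (q ^ Suc n - 1) * qbin q n k"
proof (induction n arbitrary: k)
  case 0
  then show ?case by (cases k) simp_all
next
  case (Suc n)
  show ?case
  proof (cases k)
    case 0
    then show ?thesis using Suc[of 0] by (simp add: algebra_simps)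
  next
    case (Suc j)
    have "(q ^ Suc k - 1) * qbin q (Suc (Suc n)) (Suc k)
      = (q ^ Suc k - 1) * qbin q (Suc n) k + q ^ Suc k * ((q ^ Suc k - 1) * qbin q (Suc n) (Suc k))"
      by (simp add: algebra_simps)
    also have "\<dots> = (q ^ Suc k - 1) * qbin q (Suc n) k + q ^ Suc k * ((q ^ Suc n - 1) * qbin q n k)"
      by (simp only: Suc.IH)
    also have "(q ^ Suc k - 1) * qbin q (Suc n) k = q * ((q ^ k - 1) * qbin q (Suc n) k) + (q - 1) * qbin q (Suc n) k"
      by (simp add: algebra_simps)
    also have "(q ^ k - 1) * qbin q (Suc n) k = (q ^ Suc n - 1) * qbin q n j"
      using Suc.IH[of j] Suc by simp
    also have "q * ((q ^ Suc n - 1) * qbin q n j) + (q - 1) * qbin q (Suc n) k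
        + q ^ Suc k * ((q ^ Suc n - 1) * qbin q n k)
      = (q ^ Suc n - 1) * q * (qbin q n j + q ^ k * qbin q n k) + (q - 1) * qbin q (Suc n) k"
      by (simp add: algebra_simps)
    also have "\<dots> = (q ^ Suc (Suc n) - 1) * qbin q (Suc n) k"
      using Suc by (simp add: algebra_simps)
    finally show ?thesis .
  qed
qed

text \<open>For q^n = 1 the absorption identity says that q^k - 1 times the coefficient is 0, and
  q^k - 1 is nonzero for 0 < k < n.\<close>

lemma qbin_root_of_unity:
  fixes q :: "'a::field"
  assumes "q ^ n = 1" "\<And>j. 0 < j \<Longrightarrow> j < n \<Longrightarrow> q ^ j \<noteq> 1" "0 < k" "k < n"
  shows "qbin q n k = 0"
proof -
  obtain j m where "k = Suc j" "n = Suc m" using assms by (cases k; cases n) auto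
  then have "(q ^ k - 1) * qbin q n k = 0" using qbin_absorb[of q j m] assms(1) by simp
  then show ?thesis using assms by auto
qed

lemma qcomm_power:
  fixes A B :: "'k::field rfm"
  assumes "B * A = q *\<^sub>c (A * B)"
  shows "B * A ^ k = q ^ k *\<^sub>c (A ^ k * B)"
proof (induction k)
  case (Suc k)
  have "B * A ^ Suc k = (B * A) * A ^ k" by (simp add: mult.assoc)
  also have "\<dots> = q *\<^sub>c (A * (B * A ^ k))" by (simp add: assms mult.assoc)
  also have "\<dots> = q ^ Suc k *\<^sub>c (A ^ Suc k * B)" by (simp add: Suc mult.assoc)
  finally show ?case .
qed simp

lemma q_binomial:
  fixes A B :: "'k::field rfm"
  assumes "B * A = q *\<^sub>c (A * B)"
  shows "(A + B) ^ m = (\<Sum>k\<le>m. qbin q m k *\<^sub>c (A ^ k * B ^ (m - k)))"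
proof (induction m)
  case (Suc m)
  let ?t = "\<lambda>c k l. c *\<^sub>c (A ^ k * B ^ l)"
  have "(A + B) ^ Suc m = (\<Sum>k\<le>m. ?t (qbin q m k) (Suc k) (m - k)) + (\<Sum>k\<le>m. ?t (qbin q m k * q ^ k) k (Suc (m - k)))"
  proof -
    have "B * (A ^ k * X) = q ^ k *\<^sub>c (A ^ k * (B * X))" for k X
      using qcomm_power[OF assms, of k] by (simp add: mult.assoc[symmetric])
    then show ?thesis
      by (simp add: Suc sum_distrib_left distrib_right mult.assoc scl_add sum.distrib)
  qed
  also have "(\<Sum>k\<le>m. ?t (qbin q m k * q ^ k) k (Suc (m - k)))
      = (\<Sum>k\<le>m. ?t (q ^ k * qbin q m k) k (Suc m - k))"
    by (rule sum.cong) (auto simp: Suc_diff_le mult.commute)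
  also have "\<dots> = (\<Sum>k\<le>Suc m. ?t (q ^ k * qbin q m k) k (Suc m - k))"
    by (simp add: qbin_zero)
  also have "\<dots> = ?t 1 0 (Suc m) + (\<Sum>k\<le>m. ?t (q ^ Suc k * qbin q m (Suc k)) (Suc k) (m - k))"
    by (simp add: sum.atMost_Suc_shift del: sum.atMost_Suc)
  finally have "(A + B) ^ Suc m = ?t 1 0 (Suc m) + (\<Sum>k\<le>m. ?t (qbin q (Suc m) (Suc k)) (Suc k) (m - k))"
    by (simp add: scl_add_left sum.distrib algebra_simps)
  also have "\<dots> = (\<Sum>k\<le>Suc m. ?t (qbin q (Suc m) k) k (Suc m - k))"
    by (simp add: sum.atMost_Suc_shift del: sum.atMost_Suc qbin.simps(3))
  finally show ?case .
qed simp

text \<open>The power \<open>X ^ 0\<close> is the identity of the whole ring, which no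
  \<open>idm\<close> absorbs; hence the restriction to positive exponents.\<close>

lemma power_absorb: "X * I = X \<Longrightarrow> 0 < n \<Longrightarrow> X ^ n * I = X ^ n" for X I :: "'k::field rfm"
  by (cases n) (simp_all add: power_Suc2 mult.assoc del: power_Suc)

lemma dm_power_mult: "dm d d Y \<Longrightarrow> dm d c X \<Longrightarrow> dm d c (Y ^ i * X)"
  by (induction i) (auto simp: mult.assoc dm_mult)

lemma dm_mult_power: "dm d d Y \<Longrightarrow> dm c d X \<Longrightarrow> dm c d (X * Y ^ i)"
  by (induction i) (auto simp: mult.assoc[symmetric] power_Suc2 dm_mult simp del: power_Suc)

section \<open>Modules over the Hopf algebra of a group datum\<close>

locale datum = fin_group G for G :: "('g, 'l) monoid_scheme" (structure) +
  fixes \<chi> :: "'g \<Rightarrow> 'k::field_char_0" and g :: 'g and n :: nat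
  assumes g_closed: "g \<in> carrier G" and g_central: "h \<in> carrier G \<Longrightarrow> g \<otimes> h = h \<otimes> g"
    and chi_hom: "\<chi> \<in> hom G (units_of (class_ring :: 'k ring))"
    and n_ord: "n = group.ord (units_of (class_ring :: 'k ring)) (\<chi> g)" and n2: "n \<ge> 2"
begin

definition q where "q = \<chi> g"

lemma chi_nz: "h \<in> carrier G \<Longrightarrow> \<chi> h \<noteq> 0"
proof -
  assume "h \<in> carrier G"
  then have "\<chi> h \<in> Units (class_ring :: 'k ring)"
    using hom_carrier[OF chi_hom] by (auto simp: units_of_def)
  then show ?thesis by (auto simp: Units_def)
qed

lemma chi_mult: "h \<in> carrier G \<Longrightarrow> k \<in> carrier G \<Longrightarrow> \<chi> (h \<otimes> k) = \<chi> h * \<chi> k"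
  using hom_mult[OF chi_hom] by (simp add: units_of_def)

lemma chi_one: "\<chi> \<one> = 1"
  using chi_mult[of \<one> \<one>] chi_nz[of \<one>] by simp

text \<open>The order is taken in the group of units of the field, so its powers first have to be
  identified with those of the field.\<close>

lemma q_power: "q ^ j = 1 \<longleftrightarrow> n dvd j"
proof -
  let ?U = "units_of (class_ring :: 'k ring)"
  interpret F: field "class_ring :: 'k ring" by (rule class_field)
  interpret U: group ?U by (rule monoid.units_group) unfold_locales
  have "x [^]\<^bsub>?U\<^esub> (i::nat) = x ^ i" for x :: 'k and i
    by (induction i) (simp_all add: nat_pow_def units_of_def mult.commute)
  moreover have "q \<in> carrier ?U" using hom_carrier[OF chi_hom] g_closed by (auto simp: q_def)
  ultimately show ?thesis using U.pow_eq_id[of q j] n_ord by (simp add: q_def units_of_def)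
qed

lemma q_n: "q ^ n = 1" and q_lt: "0 < j \<Longrightarrow> j < n \<Longrightarrow> q ^ j \<noteq> 1"
  by (auto simp: q_power dest: dvd_imp_le)

lemma q_nz: "q \<noteq> 0" by (simp add: q_def chi_nz g_closed)

definition H :: "('k, nat \<times> 'g) hopf" where "H = datum_hopf G \<chi> g n"

abbreviation "B \<equiv> datum_basis G n"

definition mH :: "nat \<times> 'g \<Rightarrow> nat \<times> 'g \<Rightarrow> nat \<times> 'g \<Rightarrow> 'k" where
  "mH = (\<lambda>(i, h) (j, k). if i + j < n
          then (\<lambda>c. inverse (\<chi> h) ^ j * bvec (i + j, h \<otimes> k) c) else (\<lambda>c. 0))"

abbreviation "TT \<equiv> tensor_square B (datum_alg G \<chi> n)"

definition Dy where
  "Dy = pure_tensor (gen_y G) (gen_grp g) \<oplus>\<^bsub>TT\<^esub> pure_tensor \<one>\<^bsub>datum_alg G \<chi> n\<^esub> (gen_y G)"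

lemma H_simps:
    "carrier H = {x. \<forall>b. b \<notin> B \<longrightarrow> x b = 0}"
    "x \<otimes>\<^bsub>H\<^esub> y = (\<lambda>c. \<Sum>a\<in>B. \<Sum>b\<in>B. x a * y b * mH a b c)"
    "\<one>\<^bsub>H\<^esub> = bvec (0, \<one>)"
    "x \<oplus>\<^bsub>H\<^esub> y = (\<lambda>c. x c + y c)"
    "k \<odot>\<^bsub>H\<^esub> x = (\<lambda>c. k * x c)"
    "hbasis H = B"
    "comult H = lin_ext B (\<lambda>(i, h). Dy [^]\<^bsub>TT\<^esub> i \<otimes>\<^bsub>TT\<^esub> pure_tensor (gen_grp h) (gen_grp h))"
    "counit H x = (\<Sum>(i, h)\<in>B. x (i, h) * (if i = 0 then 1 else 0))"
  by (simp_all add: H_def datum_hopf_def module.extend_def hopf.fields_def Let_def datum_alg_def alg_on_def mH_def Dy_def)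

lemma fin_B: "finite B" using fin_G by (rule finite_datum_basis)

lemma B_iff: "(i, h) \<in> B \<longleftrightarrow> i < n \<and> h \<in> carrier G"
  by (auto simp: datum_basis_def)

sublocale H: basis_alg H B mH "bvec (0, \<one>)"
proof
  show "a \<in> B \<Longrightarrow> b \<in> B \<Longrightarrow> c \<notin> B \<Longrightarrow> mH a b c = 0" for a b c
    by (cases a; cases b; cases c) (auto simp: mH_def bvec_def B_iff)
  show "c \<notin> B \<Longrightarrow> bvec (0, \<one>) c = 0" for c
    using n2 by (cases c) (auto simp: bvec_def B_iff)
qed (auto simp: H_simps fin_B)

section \<open>Modules described by the actions of G and of y\<close>

definition gact :: "(nat \<times> 'g \<Rightarrow> 'k, 'k) rep \<Rightarrow> 'g \<Rightarrow> 'k rfm" where "gact M h = ac M (bvec (0, h))"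
definition yact :: "(nat \<times> 'g \<Rightarrow> 'k, 'k) rep \<Rightarrow> 'k rfm" where "yact M = ac M (bvec (1, \<one>))"

lemma B0: "h \<in> carrier G \<Longrightarrow> (0, h) \<in> B" and B1: "(1, \<one>) \<in> B"
  using n2 by (auto simp: B_iff)

lemma gact_dm: "is_rep H M \<Longrightarrow> h \<in> carrier G \<Longrightarrow> dm (fst M) (fst M) (gact M h)"
  unfolding gact_def by (rule H.ac_dm[OF _ H.bvec_carrier[OF B0]])

lemma yact_dm: "is_rep H M \<Longrightarrow> dm (fst M) (fst M) (yact M)"
  unfolding yact_def by (rule H.ac_dm[OF _ H.bvec_carrier[OF B1]])

lemma ac_mH: "is_rep H M \<Longrightarrow> a \<in> B \<Longrightarrow> b \<in> B \<Longrightarrow> ac M (mH a b) = ac M (bvec a) * ac M (bvec b)"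
  using H.ac_mult[OF _ H.bvec_carrier H.bvec_carrier, of M a b] H.bvec_mult by simp

lemma ac_scaled: "is_rep H M \<Longrightarrow> b \<in> B \<Longrightarrow> ac M (\<lambda>c. k * bvec b c) = k *\<^sub>c ac M (bvec b)"
  using H.ac_smult[OF _ H.bvec_carrier, of M b k] by (simp add: H.smult)

lemma gact_mult: "is_rep H M \<Longrightarrow> h \<in> carrier G \<Longrightarrow> k \<in> carrier G \<Longrightarrow> gact M (h \<otimes> k) = gact M h * gact M k"
  unfolding gact_def using ac_mH[OF _ B0 B0, of M h k] n2 by (simp add: mH_def)

lemma gact_one: "is_rep H M \<Longrightarrow> gact M \<one> = idm (fst M)"
  unfolding gact_def using H.ac_one[of M] by (simp add: H.one)

lemma ac_basis:
  assumes M: "is_rep H M" and h: "h \<in> carrier G" and i: "i < n"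
  shows "ac M (bvec (i, h)) = yact M ^ i * gact M h"
  using i
proof (induction i)
  case 0
  then show ?case by (simp add: gact_def)
next
  case (Suc i)
  then have "(i, h) \<in> B" using h by (simp add: B_iff)
  from ac_mH[OF M B1 this] have "ac M (bvec (Suc i, h)) = yact M * ac M (bvec (i, h))"
    using Suc.prems h by (simp add: mH_def chi_one yact_def)
  then show ?case using Suc by (simp add: mult.assoc)
qed

lemma yact_gact:
  assumes M: "is_rep H M" and h: "h \<in> carrier G"
  shows "yact M * gact M h = \<chi> h *\<^sub>c (gact M h * yact M)"
proof -
  have "gact M h * yact M = inverse (\<chi> h) *\<^sub>c ac M (bvec (1, h))"
    using ac_mH[OF M B0[OF h] B1] ac_scaled[OF M, of "(1, h)" "inverse (\<chi> h)"] h n2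
    by (simp add: gact_def yact_def mH_def B_iff)
  then show ?thesis using ac_basis[OF M h, of 1] n2 chi_nz[OF h] by simp
qed

lemma yact_nilp: "is_rep H M \<Longrightarrow> yact M ^ n = 0"
proof -
  assume M: "is_rep H M"
  have n1: "(n - 1, \<one>) \<in> B" using n2 by (simp add: B_iff)
  have z: "ac M (\<lambda>c. 0) = 0" using ac_scaled[OF M n1, of 0] by simp
  have "0 = yact M ^ (n - 1) * (gact M \<one> * yact M)"
    using ac_mH[OF M n1 B1] ac_basis[OF M one_closed, of "n - 1"] n2
    by (simp add: mH_def z yact_def mult.assoc)
  also have "\<dots> = yact M ^ (n - 1) * yact M" by (simp add: gact_one[OF M] dm_left[OF yact_dm[OF M]])
  also have "\<dots> = yact M ^ n" using n2 by (cases n) (simp_all add: power_commutes)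
  finally show ?thesis by simp
qed

definition actH :: "('g \<Rightarrow> 'k rfm) \<Rightarrow> 'k rfm \<Rightarrow> nat \<times> 'g \<Rightarrow> 'k rfm" where
  "actH \<rho> Y = (\<lambda>(i, h). Y ^ i * \<rho> h)"

lemma H_expand:
  assumes "is_rep H M" "x \<in> carrier H" shows "ac M x = ext B (actH (gact M) (yact M)) x"
  unfolding H.ac_expand[OF assms] ext_def
  by (rule sum.cong) (auto simp: actH_def B_iff ac_basis[OF assms(1)])

lemma Hm_iff:
  assumes "is_rep H M" "is_rep H N"
  shows "f \<in> Hm H M N \<longleftrightarrow> dm (fst N) (fst M) f \<and> (\<forall>h\<in>carrier G. f * gact M h = gact N h * f) \<and>
    f * yact M = yact N * f"
proof
  assume "f \<in> Hm H M N"
  then show "dm (fst N) (fst M) f \<and> (\<forall>h\<in>carrier G. f * gact M h = gact N h * f) \<and> f * yact M = yact N * f"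
    using B0 B1 by (auto simp: H.Hm_iff[OF assms] gact_def yact_def)
next
  assume *: "dm (fst N) (fst M) f \<and> (\<forall>h\<in>carrier G. f * gact M h = gact N h * f) \<and> f * yact M = yact N * f"
  then have "f * yact M ^ i = yact N ^ i * f" for i
    by (induction i) (auto simp: mult.assoc[symmetric], simp add: mult.assoc)
  then have "f * (yact M ^ i * gact M h) = yact N ^ i * gact N h * f" if "h \<in> carrier G" for i h
    using * that by (simp add: mult.assoc[symmetric]) (simp add: mult.assoc)
  then show "f \<in> Hm H M N"
    using * by (auto simp: H.Hm_iff[OF assms] B_iff ac_basis[OF assms(1)] ac_basis[OF assms(2)])
qed

text \<open>The defining relations of H, imposed on matrices of format d x d. Such data amount to an
  H-module structure on K^d.\<close>

definition relH :: "nat \<Rightarrow> ('g \<Rightarrow> 'k rfm) \<Rightarrow> 'k rfm \<Rightarrow> bool" where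
  "relH d \<rho> Y \<longleftrightarrow> (\<forall>h\<in>carrier G. dm d d (\<rho> h)) \<and> dm d d Y \<and> Y ^ n = 0 \<and> \<rho> \<one> = idm d \<and>
    (\<forall>h\<in>carrier G. \<forall>k\<in>carrier G. \<rho> (h \<otimes> k) = \<rho> h * \<rho> k) \<and>
    (\<forall>h\<in>carrier G. Y * \<rho> h = \<chi> h *\<^sub>c (\<rho> h * Y))"

text \<open>The commutation relation moves all powers of \<open>Y\<close> to the left, so products
  of basis elements come out as \<open>mH\<close> prescribes; exponents from n on give 0 on both
  sides.\<close>

lemma H_repI:
  assumes r: "relH (fst M) \<rho> Y"
    and "\<And>x. x \<in> carrier H \<Longrightarrow> snd M x \<in> carrier_mat (fst M) (fst M)"
    and ac: "\<And>x. x \<in> carrier H \<Longrightarrow> ac M x = ext B (actH \<rho> Y) x"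
  shows "is_rep H M" "h \<in> carrier G \<Longrightarrow> gact M h = \<rho> h" "yact M = Y"
proof -
  have comm: "\<rho> h * Y ^ j = inverse (\<chi> h) ^ j *\<^sub>c (Y ^ j * \<rho> h)" if h: "h \<in> carrier G" for h j
  proof -
    have "\<rho> h * Y = inverse (\<chi> h) *\<^sub>c (Y * \<rho> h)" using r h chi_nz[OF h] by (simp add: relH_def)
    then show ?thesis by (rule qcomm_power)
  qed
  have big: "Y ^ i = 0" if "i \<ge> n" for i
    using r that by (metis le_add_diff_inverse mult_zero_left power_add relH_def)
  have "actH \<rho> Y a * actH \<rho> Y b = ext B (actH \<rho> Y) (mH a b)" if ab: "a \<in> B" "b \<in> B" for a b
  proof -
    obtain i h j k where a: "a = (i, h)" and b: "b = (j, k)" by (cases a; cases b)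
    have c: "i < n" "j < n" "h \<in> carrier G" "k \<in> carrier G" using ab by (auto simp: a b B_iff)
    have "actH \<rho> Y a * actH \<rho> Y b = Y ^ i * (\<rho> h * Y ^ j) * \<rho> k" by (simp add: actH_def a b mult.assoc)
    also have "\<dots> = inverse (\<chi> h) ^ j *\<^sub>c (Y ^ i * Y ^ j * (\<rho> h * \<rho> k))"
      by (simp add: comm[OF c(3)] mult.assoc)
    also have "\<dots> = inverse (\<chi> h) ^ j *\<^sub>c (Y ^ (i + j) * \<rho> (h \<otimes> k))"
      using r c by (simp add: relH_def power_add)
    also have "\<dots> = ext B (actH \<rho> Y) (mH a b)"
    proof (cases "i + j < n")
      case True
      then have "(i + j, h \<otimes> k) \<in> B" using c by (simp add: B_iff)
      then show ?thesis using True by (simp add: a b mH_def ext_smult ext_bvec[OF fin_B]) (simp add: actH_def)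
    next
      case False
      then show ?thesis by (simp add: a b mH_def ext_zero big)
    qed
    finally show ?thesis .
  qed
  moreover have "ext B (actH \<rho> Y) (bvec (0, \<one>)) = idm (fst M)"
    using r by (simp add: ext_bvec[OF fin_B B0]) (simp add: actH_def relH_def)
  ultimately show "is_rep H M"
    using H.is_repI[OF assms(2,3)] by blast
  show "h \<in> carrier G \<Longrightarrow> gact M h = \<rho> h"
    by (simp add: gact_def ac H.bvec_carrier B0 ext_bvec fin_B) (simp add: actH_def)
  have "dm (fst M) (fst M) Y" using r by (simp add: relH_def)
  then have "Y * \<rho> \<one> = Y" using r dm_right by (simp add: relH_def)
  then show "yact M = Y"
    unfolding yact_def ac[OF H.bvec_carrier[OF B1]] ext_bvec[OF fin_B B1] by (simp add: actH_def)
qed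

definition mkH :: "nat \<Rightarrow> ('g \<Rightarrow> 'k rfm) \<Rightarrow> 'k rfm \<Rightarrow> (nat \<times> 'g \<Rightarrow> 'k, 'k) rep" where
  "mkH d \<rho> Y = mkrep d (ext B (actH \<rho> Y))"

lemma fst_mkH [simp]: "fst (mkH d \<rho> Y) = d"
  by (simp add: mkH_def)

lemma mkH:
  assumes "relH d \<rho> Y"
  shows "is_rep H (mkH d \<rho> Y)" "h \<in> carrier G \<Longrightarrow> gact (mkH d \<rho> Y) h = \<rho> h" "yact (mkH d \<rho> Y) = Y"
proof -
  have "dm d d (actH \<rho> Y b)" if "b \<in> B" for b
    using assms that by (cases b) (auto simp: actH_def relH_def B_iff intro: dm_power_mult)
  then have "ac (mkH d \<rho> Y) x = ext B (actH \<rho> Y) x" for x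
    unfolding mkH_def by (intro H.ac_mkrep dm_ext)
  moreover have "snd (mkH d \<rho> Y) x \<in> carrier_mat d d" for x by (simp add: mkH_def mkrep_def)
  ultimately show "is_rep H (mkH d \<rho> Y)" "h \<in> carrier G \<Longrightarrow> gact (mkH d \<rho> Y) h = \<rho> h" "yact (mkH d \<rho> Y) = Y"
    using H_repI[of "mkH d \<rho> Y" \<rho> Y] assms by auto
qed

lemma H_ac_eqI:
  assumes "is_rep H M" "is_rep H N" "\<And>h. h \<in> carrier G \<Longrightarrow> gact M h = gact N h" "yact M = yact N" "x \<in> carrier H"
  shows "ac M x = ac N x"
  unfolding H_expand[OF assms(1,5)] H_expand[OF assms(2,5)] ext_def
  by (rule sum.cong) (use assms in \<open>auto simp: actH_def B_iff\<close>)

lemma H_isoI: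
  assumes "is_rep H M" "is_rep H N" "fst M = fst N" "\<And>h. h \<in> carrier G \<Longrightarrow> gact M h = gact N h" "yact M = yact N"
  shows "rep_iso H M N"
  by (rule H.rep_iso_act[OF assms(1-3)], rule H_ac_eqI[OF assms(1,2,4,5)])

subsection \<open>Tensor products\<close>

text \<open>The action of the tensor square of H on M tensor N. Since it is multiplicative, the
  action of y^i h, whose coproduct is a product in the tensor square, reduces to those of y and
  h.\<close>

definition Psi where
  "Psi M N = ext (B \<times> B) (\<lambda>(b, c). kr (fst N) (fst N) (ac M (bvec b)) (ac N (bvec c)))"

lemma Psi_pure:
  assumes M: "is_rep H M" and N: "is_rep H N" and xy: "x \<in> carrier H" "y \<in> carrier H"
  shows "Psi M N (pure_tensor x y) = kr (fst N) (fst N) (ac M x) (ac N y)"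
  unfolding H.ac_expand[OF M xy(1)] H.ac_expand[OF N xy(2)] Psi_def ext_def pure_tensor_def
  by (subst kr_sum_left, subst kr_sum_right)
    (simp add: sum.cartesian_product case_prod_unfold mult.commute)

lemma bvec_datum_mult: "a \<in> B \<Longrightarrow> b \<in> B \<Longrightarrow> bvec a \<otimes>\<^bsub>datum_alg G \<chi> n\<^esub> bvec b = mH a b"
  unfolding datum_alg_def mH_def by (rule alg_on_bvec_mult[OF fin_B])

lemma mH_carrier: "a \<in> B \<Longrightarrow> b \<in> B \<Longrightarrow> mH a b \<in> carrier H"
  using H.m_supp by (auto simp: H_simps)

lemma TT_mult: "s \<otimes>\<^bsub>TT\<^esub> t = (\<lambda>c. \<Sum>a\<in>B \<times> B. \<Sum>b\<in>B \<times> B. s a * t b *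
    (\<lambda>(a, a') (b, b'). pure_tensor (bvec a \<otimes>\<^bsub>datum_alg G \<chi> n\<^esub> bvec b) (bvec a' \<otimes>\<^bsub>datum_alg G \<chi> n\<^esub> bvec b')) a b c)"
  by (simp add: tensor_square_def alg_on_def)

lemma Psi_mult:
  assumes M: "is_rep H M" and N: "is_rep H N"
  shows "Psi M N (s \<otimes>\<^bsub>TT\<^esub> t) = Psi M N s * Psi M N t"
  unfolding Psi_def TT_mult
proof (rule ext_alg_on_mult)
  fix a b assume "a \<in> B \<times> B" "b \<in> B \<times> B"
  then obtain c d e f where ab: "a = (c, d)" "b = (e, f)" "c \<in> B" "d \<in> B" "e \<in> B" "f \<in> B" by auto
  let ?K = "\<lambda>(b, c). kr (fst N) (fst N) (ac M (bvec b)) (ac N (bvec c))"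
  have "?K a * ?K b = kr (fst N) (fst N) (ac M (mH c e)) (ac N (mH d f))"
    using ab M N by (simp add: kr_mult[OF H.ac_dm[OF N H.bvec_carrier]] ac_mH)
  also have "\<dots> = Psi M N (pure_tensor (mH c e) (mH d f))"
    using Psi_pure[OF M N mH_carrier mH_carrier] ab by simp
  finally show "?K a * ?K b = ext (B \<times> B) ?K ((\<lambda>(a, a') (b, b').
      pure_tensor (bvec a \<otimes>\<^bsub>datum_alg G \<chi> n\<^esub> bvec b) (bvec a' \<otimes>\<^bsub>datum_alg G \<chi> n\<^esub> bvec b')) a b)"
    using ab by (simp add: Psi_def bvec_datum_mult)
qed

lemma gen_carrier: "h \<in> carrier G \<Longrightarrow> gen_grp h \<in> carrier H" "gen_y G \<in> carrier H"
  using H.bvec_carrier[OF B0] H.bvec_carrier[OF B1] by (simp_all add: gen_grp_def gen_y_def)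

lemma datum_one: "\<one>\<^bsub>datum_alg G \<chi> n\<^esub> = \<one>\<^bsub>H\<^esub>"
  by (simp add: H_simps datum_alg_def alg_on_def)

definition tY where
  "tY M N = kr (fst N) (fst N) (yact M) (gact N g) + kr (fst N) (fst N) (idm (fst M)) (yact N)"

definition tg where "tg M N h = kr (fst N) (fst N) (gact M h) (gact N h)"

text \<open>The nilpotency of y is the relation that is not formal. With A = y tensor g and B = 1
  tensor y one has B A = q A B, so the mixed terms of (A + B)^n carry vanishing Gaussian binomials,
  while A^n = B^n = 0.\<close>

lemma tens_relH:
  assumes M: "is_rep H M" and N: "is_rep H N"
  shows "relH (fst M * fst N) (tg M N) (tY M N)"
proof -
  let ?n = "fst N"
  note d = gact_dm[OF N] yact_dm[OF N] gact_dm[OF M] yact_dm[OF M]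
  let ?A = "kr ?n ?n (yact M) (gact N g)" and ?B = "kr ?n ?n (idm (fst M)) (yact N)"
  have Agm: "gact N g * gact N h = gact N h * gact N g" if "h \<in> carrier G" for h
    using gact_mult[OF N g_closed that] gact_mult[OF N that g_closed] g_central[OF that] by simp
  have BA: "?B * ?A = q *\<^sub>c (?A * ?B)"
    using yact_gact[OF N g_closed]
    by (simp add: kr_mult[OF d(1)[OF g_closed]] kr_mult[OF d(2)] dm_left[OF d(4)] dm_right[OF d(4)] q_def)
  \<comment> \<open>A right factor is carried along because \<open>?B ^ 0\<close> is the identity of
    the whole ring and not an \<open>idm\<close>.\<close>
  have Bk: "?B ^ k * kr ?n ?n (idm (fst M)) X = kr ?n ?n (idm (fst M)) (yact N ^ k * X)" for k X
    by (induction k) (simp_all add: mult.assoc kr_mult[OF d(2)])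
  have Ak: "?A ^ k * kr ?n ?n X (idm ?n) = kr ?n ?n (yact M ^ k * X) (gact N g ^ k * idm ?n)" for k X
    by (induction k) (simp_all add: mult.assoc kr_mult[OF d(1)[OF g_closed]])
  have BI: "?B * idm (fst M * ?n) = ?B" "?A * idm (fst M * ?n) = ?A"
    using dm_kr[OF dm_idm d(2)] dm_kr[OF d(4) d(1)[OF g_closed]] by (blast intro: dm_right)+
  have Bn: "?B ^ n = 0"
  proof -
    have "?B ^ n = ?B ^ n * idm (fst M * ?n)"
      using power_absorb[OF BI(1), of n] n2 by simp
    also have "\<dots> = 0" unfolding kr_idm[symmetric] Bk yact_nilp[OF N] by simp
    finally show ?thesis .
  qed
  have An: "?A ^ n = 0"
  proof -
    have "?A ^ n = ?A ^ n * idm (fst M * ?n)"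
      using power_absorb[OF BI(2), of n] n2 by simp
    also have "\<dots> = 0" unfolding kr_idm[symmetric] Ak yact_nilp[OF M] by simp
    finally show ?thesis .
  qed
  have "(?A + ?B) ^ n = (\<Sum>k\<le>n. qbin q n k *\<^sub>c (?A ^ k * ?B ^ (n - k)))" by (rule q_binomial[OF BA])
  also have "\<dots> = 0"
  proof (rule sum.neutral, intro ballI)
    fix k assume "k \<in> {..n}"
    then consider "k = 0" | "k = n" | "0 < k" "k < n" by force
    then show "qbin q n k *\<^sub>c (?A ^ k * ?B ^ (n - k)) = 0"
      by cases (auto simp: An Bn qbin_root_of_unity[OF q_n q_lt])
  qed
  finally have nil: "tY M N ^ n = 0" by (simp add: tY_def)
  have "tY M N * tg M N h = \<chi> h *\<^sub>c (tg M N h * tY M N)" if h: "h \<in> carrier G" for h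
    using yact_gact[OF M h] yact_gact[OF N h] Agm[OF h]
    by (simp add: tY_def tg_def distrib_left distrib_right scl_add kr_mult[OF d(1)[OF g_closed]] kr_mult[OF d(2)]
        kr_mult[OF d(1)[OF h]] dm_left[OF d(3)[OF h]] dm_right[OF d(3)[OF h]])
  moreover have "dm (fst M * ?n) (fst M * ?n) (tY M N)"
    unfolding tY_def by (intro dm_add dm_kr d g_closed dm_idm)
  moreover have "dm (fst M * ?n) (fst M * ?n) (tg M N h)" if "h \<in> carrier G" for h
    unfolding tg_def using that by (intro dm_kr d)
  ultimately show ?thesis
    unfolding relH_def using nil M N
    by (auto simp: tg_def gact_one kr_idm gact_mult kr_mult[OF d(1)])
qed

lemma H_tens:
  assumes M: "is_rep H M" and N: "is_rep H N"
  shows "is_rep H (rep_tensor H M N)" "h \<in> carrier G \<Longrightarrow> gact (rep_tensor H M N) h = tg M N h"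
    "yact (rep_tensor H M N) = tY M N"
proof -
  note r = tens_relH[OF M N]
  have PD: "Psi M N Dy = tY M N"
  proof -
    have "Psi M N Dy = Psi M N (pure_tensor (gen_y G) (gen_grp g)) + Psi M N (pure_tensor \<one>\<^bsub>H\<^esub> (gen_y G))"
      unfolding Dy_def Psi_def ext_add[symmetric] by (simp add: tensor_square_def alg_on_def datum_one)
    then show ?thesis
      using Psi_pure[OF M N] gen_carrier g_closed H.one_closed
      by (simp add: tY_def yact_def gact_def H.ac_one[OF M]) (simp add: gen_y_def gen_grp_def)
  qed
  have P1: "Psi M N \<one>\<^bsub>TT\<^esub> = idm (fst M * fst N)"
  proof -
    have "\<one>\<^bsub>TT\<^esub> = pure_tensor \<one>\<^bsub>H\<^esub> \<one>\<^bsub>H\<^esub>" by (simp add: tensor_square_def alg_on_def datum_one)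
    then show ?thesis using Psi_pure[OF M N H.one_closed H.one_closed] by (simp add: H.ac_one M N kr_idm)
  qed
  have Ppow: "Psi M N (Dy [^]\<^bsub>TT\<^esub> i) = idm (fst M * fst N) * tY M N ^ i" for i :: nat
    by (induction i) (simp_all add: nat_pow_def P1 Psi_mult[OF M N] PD mult.assoc power_commutes)
  have Pg: "Psi M N (pure_tensor (gen_grp h) (gen_grp h)) = tg M N h" if "h \<in> carrier G" for h
    using Psi_pure[OF M N] gen_carrier that by (simp add: tg_def gact_def) (simp add: gen_grp_def)
  have ac: "ac (rep_tensor H M N) x = ext B (actH (tg M N) (tY M N)) x" for x
  proof -
    have "ac (rep_tensor H M N) x = Psi M N (comult H x)"
      unfolding Psi_def ext_def case_prod_unfold
      by (subst ac_rep_tensor) (auto simp: H_simps(6) fin_B case_prod_unfold intro!: H.rep_carrier M N H.bvec_carrier)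
    also have "\<dots> = (\<Sum>b\<in>B. x b *\<^sub>c Psi M N (case b of (i, h) \<Rightarrow> Dy [^]\<^bsub>TT\<^esub> i \<otimes>\<^bsub>TT\<^esub> pure_tensor (gen_grp h) (gen_grp h)))"
      unfolding H_simps(7) lin_ext_def Psi_def ext_sum ext_smult by (rule refl)
    also have "\<dots> = ext B (actH (tg M N) (tY M N)) x"
      unfolding ext_def
    proof (rule sum.cong[OF refl])
      fix b assume "b \<in> B"
      then obtain i h where b: "b = (i, h)" "i < n" "h \<in> carrier G" by (cases b) (auto simp: B_iff)
      have "dm (fst M * fst N) (fst M * fst N) (tY M N ^ i * tg M N h)"
        using r b by (auto simp: relH_def intro: dm_power_mult)
      then show "x b *\<^sub>c Psi M N (case b of (i, h) \<Rightarrow> Dy [^]\<^bsub>TT\<^esub> i \<otimes>\<^bsub>TT\<^esub> pure_tensor (gen_grp h) (gen_grp h))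
        = x b *\<^sub>c actH (tg M N) (tY M N) b"
        by (simp add: b actH_def Psi_mult[OF M N] Ppow Pg mult.assoc dm_left)
    qed
    finally show ?thesis .
  qed
  have c: "snd (rep_tensor H M N) x \<in> carrier_mat (fst M * fst N) (fst M * fst N)" for x
    by (simp add: rep_tensor_def)
  show "is_rep H (rep_tensor H M N)" "h \<in> carrier G \<Longrightarrow> gact (rep_tensor H M N) h = tg M N h"
    "yact (rep_tensor H M N) = tY M N"
    using H_repI[of "rep_tensor H M N" "tg M N" "tY M N"] r c ac by simp_all
qed

lemma unit_relH: "relH (Suc 0) (\<lambda>_. idm (Suc 0)) 0"
  using n2 by (simp add: relH_def power_0_left)

lemma H_unit: "is_rep H (rep_unit H)" "h \<in> carrier G \<Longrightarrow> gact (rep_unit H) h = idm (Suc 0)"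
    "yact (rep_unit H) = 0"
proof -
  have p: "(0::'k rfm) ^ i = (if i = 0 then 1 else 0)" for i by (cases i) auto
  have ac: "ac (rep_unit H) x = ext B (actH (\<lambda>_. idm (Suc 0)) 0) x" for x
    by (rule rfm_eqI)
      (auto simp: ac_def rep_unit_def ent_fm ext_def ent_sum H_simps(8) actH_def p case_prod_unfold intro!: sum.cong sum.neutral)
  have "snd (rep_unit H) x \<in> carrier_mat 1 1" for x by (simp add: rep_unit_def)
  then show "is_rep H (rep_unit H)" "h \<in> carrier G \<Longrightarrow> gact (rep_unit H) h = idm (Suc 0)"
    "yact (rep_unit H) = 0"
    using H_repI[of "rep_unit H" "\<lambda>_. idm (Suc 0)" 0] ac unit_relH by simp_all
qed

sublocale H: tens H
proof
  show "finite (hbasis H)" by (simp add: H_simps fin_B)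
  show "b \<in> hbasis H \<Longrightarrow> bvec b \<in> carrier H" for b by (simp add: H_simps(6) H.bvec_carrier)
  fix V W X :: "(nat \<times> 'g \<Rightarrow> 'k, 'k) rep" and x
  assume V: "is_rep H V" and x: "x \<in> carrier H"
  note d = gact_dm[OF V] yact_dm[OF V]
  show "ac (rep_tensor H (rep_unit H) V) x = ac V x"
    by (rule H_ac_eqI) (use V x H_unit H_tens g_closed d in
      \<open>simp_all add: tg_def tY_def idm_1 kr_unit_left\<close>)
  show "ac (rep_tensor H V (rep_unit H)) x = ac V x"
    by (rule H_ac_eqI) (use V x H_unit H_tens g_closed d in
      \<open>simp_all add: tg_def tY_def idm_1 kr_unit_right\<close>)
  assume W: "is_rep H W" and X: "is_rep H X"
  show "ac (rep_tensor H (rep_tensor H V W) X) x = ac (rep_tensor H V (rep_tensor H W X)) x"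
    by (rule H_ac_eqI)
      (use V W X x H_tens g_closed in \<open>simp_all add: tg_def tY_def kr_assoc kr_add_left kr_add_right kr_idm[symmetric] add.assoc\<close>)
qed (fact H_tens H_unit)+

end

section \<open>Averaging over the group\<close>

context fin_group
begin

text \<open>Maschke's averaging operator: it turns a linear map from the space of \<sigma> to that
  of \<rho> into an intertwiner.\<close>

definition av :: "('g \<Rightarrow> 'k::field_char_0 rfm) \<Rightarrow> ('g \<Rightarrow> 'k rfm) \<Rightarrow> 'k rfm \<Rightarrow> 'k rfm" where
  "av \<rho> \<sigma> X = inverse (of_nat (card (carrier G))) *\<^sub>c (\<Sum>h\<in>carrier G. \<rho> h * X * \<sigma> (inv h))"

lemma card_G: "of_nat (card (carrier G)) \<noteq> (0::'k::field_char_0)"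
  using fin_G one_closed by auto

text \<open>When the sandwiched conjugates do not depend on h, their mean is the common value. In
  this way averaging a linear section, retraction or lift keeps its defining equation.\<close>

lemma av_const:
  assumes "\<And>h. h \<in> carrier G \<Longrightarrow> L * (\<rho> h * X * \<sigma> (inv h)) * R = Z"
  shows "L * av \<rho> \<sigma> X * R = Z"
proof -
  have "L * av \<rho> \<sigma> X * R = inverse (of_nat (card (carrier G))) *\<^sub>c (\<Sum>h\<in>carrier G. L * (\<rho> h * X * \<sigma> (inv h)) * R)"
    by (simp add: av_def sum_distrib_left sum_distrib_right)
  also have "(\<Sum>h\<in>carrier G. L * (\<rho> h * X * \<sigma> (inv h)) * R) = (\<Sum>h\<in>carrier G. 1 *\<^sub>c Z)"
    using assms by simp
  also have "\<dots> = of_nat (card (carrier G)) *\<^sub>c Z" by (simp only: scl_sum_left[symmetric]) simp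
  finally show ?thesis by (simp only: scl_scl left_inverse[OF card_G] scl_one)
qed

lemma av_equivariant:
  assumes \<rho>: "\<And>h k. h \<in> carrier G \<Longrightarrow> k \<in> carrier G \<Longrightarrow> \<rho> (h \<otimes> k) = \<rho> h * \<rho> k"
    and \<sigma>: "\<And>h k. h \<in> carrier G \<Longrightarrow> k \<in> carrier G \<Longrightarrow> \<sigma> (h \<otimes> k) = \<sigma> h * \<sigma> k"
    and k: "k \<in> carrier G"
  shows "\<rho> k * av \<rho> \<sigma> X = av \<rho> \<sigma> X * \<sigma> k"
proof -
  have "(\<Sum>h\<in>carrier G. \<rho> k * (\<rho> h * X * \<sigma> (inv h))) = (\<Sum>h\<in>carrier G. \<rho> (k \<otimes> h) * X * \<sigma> (inv h))"
    using \<rho> k by (intro sum.cong) (auto simp: mult.assoc)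
  also have "\<dots> = (\<Sum>h\<in>carrier G. \<rho> h * X * \<sigma> (inv h \<otimes> k))"
  proof (rule sum.reindex_bij_witness[of _ "\<lambda>h. inv k \<otimes> h" "\<lambda>h. k \<otimes> h"])
    show "\<rho> (k \<otimes> h) * X * \<sigma> (inv (k \<otimes> h) \<otimes> k) = \<rho> (k \<otimes> h) * X * \<sigma> (inv h)" if "h \<in> carrier G" for h
      using k that by (simp add: inv_mult_group m_assoc)
  qed (use k in \<open>auto simp: m_assoc[symmetric]\<close>)
  also have "\<dots> = (\<Sum>h\<in>carrier G. (\<rho> h * X * \<sigma> (inv h)) * \<sigma> k)"
    using \<sigma> k by (intro sum.cong) (auto simp: mult.assoc)
  finally show ?thesis
    by (simp add: av_def sum_distrib_left sum_distrib_right)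
qed

lemma dm_av:
  assumes "\<And>h. h \<in> carrier G \<Longrightarrow> dm r r (\<rho> h)" "\<And>h. h \<in> carrier G \<Longrightarrow> dm c c (\<sigma> h)" "dm r c X"
  shows "dm r c (av \<rho> \<sigma> X)"
  unfolding av_def using assms by (intro dm_scl dm_sum dm_mult[of _ c] dm_mult[of _ r]) auto

end

section \<open>The modules induced from the group algebra\<close>

text \<open>Slot \<open>j\<close> of K^d tensor K^i, with the slot number as the second and faster
  index. In this order \<open>Jm i V\<close> has literally the same action as the inflation of V
  tensored with \<open>L i\<close>.\<close>

definition sinj :: "nat \<Rightarrow> nat \<Rightarrow> nat \<Rightarrow> 'k::field rfm" where "sinj d i j = kr i (Suc 0) (idm d) (mu j 0)"
definition sprj :: "nat \<Rightarrow> nat \<Rightarrow> nat \<Rightarrow> 'k::field rfm" where "sprj d i j = kr (Suc 0) i (idm d) (mu 0 j)"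

lemma dm_inj: "j < i \<Longrightarrow> dm (d * i) d (sinj d i j)"
  unfolding sinj_def using dm_kr[OF dm_idm, of i "Suc 0" "mu j 0" d] by (simp add: dm_mu)

lemma dm_prj: "j < i \<Longrightarrow> dm d (d * i) (sprj d i j)"
  unfolding sprj_def using dm_kr[OF dm_idm, of "Suc 0" i "mu 0 j" d] by (simp add: dm_mu)

lemma prj_inj: "j < i \<Longrightarrow> sprj d i j * sinj d i k = (if j = k then idm d else 0)"
  by (simp add: sinj_def sprj_def kr_mult dm_mu kr_unit_right)

lemma prj_inj3: "j < i \<Longrightarrow> sprj d i j * (sinj d i k * X) = (if j = k then idm d * X else 0)"
  by (simp add: mult.assoc[symmetric] prj_inj)

lemma sum_inj_prj: "(\<Sum>j<i. sinj d i j * sprj d i j) = idm (d * i)"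
proof -
  have "(\<Sum>j<i. sinj d i j * sprj d i j) = (\<Sum>j<i. kr i i (idm d) (mu j j))"
    by (rule sum.cong) (auto simp: sinj_def sprj_def kr_mult dm_mu)
  then show ?thesis by (simp add: kr_sum_right[symmetric] idm_sum_mu[symmetric] kr_idm)
qed

lemma idm_expand: "A * idm (d * i) * Z = (\<Sum>j<i. (A * sinj d i j) * (sprj d i j * Z))"
  by (simp add: sum_inj_prj[symmetric] sum_distrib_left sum_distrib_right mult.assoc)

lemma inj_ext:
  assumes "dm r (d * i) X" "dm r (d * i) Y" "\<And>j. j < i \<Longrightarrow> X * sinj d i j = Y * sinj d i j"
  shows "X = Y"
proof -
  have "X * idm (d * i) = Y * idm (d * i)"
    unfolding sum_inj_prj[symmetric] sum_distrib_left mult.assoc[symmetric]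
    by (rule sum.cong) (use assms(3) in auto)
  then show ?thesis using assms(1,2) by (simp add: dm_right)
qed

lemma prj_ext:
  assumes "dm (d * i) c X" "dm (d * i) c Y" "\<And>j. j < i \<Longrightarrow> sprj d i j * X = sprj d i j * Y"
  shows "X = Y"
proof -
  have "idm (d * i) * X = idm (d * i) * Y"
    unfolding sum_inj_prj[symmetric] sum_distrib_right mult.assoc
    by (rule sum.cong) (use assms(3) in auto)
  then show ?thesis using assms(1,2) by (simp add: dm_left)
qed

lemma sum_prj_inj: "k < i \<Longrightarrow> (\<Sum>j<i. f j * sprj d i j) * sinj d i k = f k * idm d"
  by (simp add: sum_distrib_right mult.assoc prj_inj if_distrib[of "\<lambda>x. f _ * x"] cong: if_cong)

lemma prj_sum_inj: "k < i \<Longrightarrow> sprj d i k * (\<Sum>j<i. sinj d i j * f j) = idm d * f k"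
proof -
  assume "k < i"
  then have "sprj d i k * (\<Sum>j<i. sinj d i j * f j) = (\<Sum>j<i. if j = k then idm d * f k else 0)"
    unfolding sum_distrib_left by (intro sum.cong) (auto simp: prj_inj3)
  then show ?thesis using \<open>k < i\<close> by simp
qed

context datum
begin

sublocale C: KG G "group_alg G :: ('k, 'g) hopf"
  by unfold_locales

abbreviation "KA \<equiv> (group_alg G :: ('k, 'g) hopf)"

text \<open>\<open>Jm i V\<close> consists of \<open>i\<close> copies of \<open>V\<close>, the \<open>j\<close>-th one twisted by \<open>\<chi>\<^sup>-\<^sup>j\<close>, which \<open>y\<close> shifts.\<close>

definition mY :: "nat \<Rightarrow> nat \<Rightarrow> 'k rfm" where
  "mY d i = (\<Sum>j<i. (if Suc j < i then sinj d i (Suc j) else 0) * sprj d i j)"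

definition mg :: "nat \<Rightarrow> ('g \<Rightarrow> 'k, 'k) rep \<Rightarrow> 'g \<Rightarrow> 'k rfm" where
  "mg i V h = (\<Sum>j<i. (inverse (\<chi> h) ^ j *\<^sub>c (sinj (fst V) i j * C.ga V h)) * sprj (fst V) i j)"

definition Jm :: "nat \<Rightarrow> ('g \<Rightarrow> 'k, 'k) rep \<Rightarrow> (nat \<times> 'g \<Rightarrow> 'k, 'k) rep" where
  "Jm i V = mkH (fst V * i) (mg i V) (mY (fst V) i)"

lemma fst_Jm [simp]: "fst (Jm i V) = fst V * i"
  by (simp add: Jm_def)

lemma dm_inj_if: "dm (d * i) d (if Suc j < i then sinj d i (Suc j) else 0)"
  using dm_inj by auto

lemma dm_mY: "dm (d * i) (d * i) (mY d i)"
  unfolding mY_def by (intro dm_sum dm_mult[OF dm_inj_if] dm_prj) auto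

lemma mY_inj: "k < i \<Longrightarrow> mY d i * sinj d i k = (if Suc k < i then sinj d i (Suc k) else 0)"
  unfolding mY_def by (simp add: sum_prj_inj dm_right[OF dm_inj])

lemma mY_pow_inj: "k < i \<Longrightarrow> mY d i ^ m * sinj d i k = (if m + k < i then sinj d i (m + k) else 0)"
  by (induction m) (auto simp: mult.assoc mY_inj)

lemma dm_mg: "is_rep KA V \<Longrightarrow> h \<in> carrier G \<Longrightarrow> dm (fst V * i) (fst V * i) (mg i V h)"
  unfolding mg_def by (intro dm_sum dm_mult[of _ "fst V"] dm_scl dm_inj dm_prj C.ga_dm) auto

lemma mg_inj: "is_rep KA V \<Longrightarrow> h \<in> carrier G \<Longrightarrow> k < i \<Longrightarrow>
    mg i V h * sinj (fst V) i k = inverse (\<chi> h) ^ k *\<^sub>c (sinj (fst V) i k * C.ga V h)"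
  unfolding mg_def by (subst sum_prj_inj, assumption) (simp add: mult.assoc dm_right[OF C.ga_dm])

lemma mg_inj3: "is_rep KA V \<Longrightarrow> h \<in> carrier G \<Longrightarrow> k < i \<Longrightarrow>
    mg i V h * (sinj (fst V) i k * X) = inverse (\<chi> h) ^ k *\<^sub>c (sinj (fst V) i k * (C.ga V h * X))"
  by (simp add: mult.assoc[symmetric] mg_inj)

lemma sprj_mY: "k < i \<Longrightarrow> sprj d i k * mY d i = (case k of 0 \<Rightarrow> 0 | Suc j \<Rightarrow> sprj d i j)"
  by (rule inj_ext[of d d i])
    (auto intro: dm_mult[OF dm_prj dm_mY] dm_prj simp: mult.assoc mY_inj prj_inj split: nat.split)

lemma sprj_mg: "is_rep KA V \<Longrightarrow> h \<in> carrier G \<Longrightarrow> k < i \<Longrightarrow>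
    sprj (fst V) i k * mg i V h = inverse (\<chi> h) ^ k *\<^sub>c (C.ga V h * sprj (fst V) i k)"
  by (rule inj_ext[of "fst V" "fst V" i])
    (auto intro: dm_mult[OF dm_prj dm_mg] dm_prj dm_mult[OF C.ga_dm] dm_scl
      simp: mult.assoc mg_inj prj_inj prj_inj3 dm_left[OF C.ga_dm] dm_right[OF C.ga_dm])

lemma Jm_relH:
  assumes V: "is_rep KA V" and i: "i \<le> n"
  shows "relH (fst V * i) (mg i V) (mY (fst V) i)"
proof -
  let ?d = "fst V"
  have "mY ?d i ^ n * idm (?d * i) = 0"
    by (rule inj_ext[of "?d * i" ?d i]) (use dm_power_mult[OF dm_mY] i in \<open>auto simp: mult.assoc dm_left[OF dm_inj] mY_pow_inj\<close>)
  then have "mY ?d i ^ n = 0" using power_absorb[OF dm_right[OF dm_mY], of n ?d i] n2 by simp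
  moreover have "mg i V \<one> = idm (?d * i)"
    by (rule inj_ext[OF dm_mg]) (use V in \<open>auto simp: mg_inj C.ga_one chi_one dm_left[OF dm_inj] dm_right[OF dm_inj]\<close>)
  moreover have "mg i V (h \<otimes> k) = mg i V h * mg i V k" if "h \<in> carrier G" "k \<in> carrier G" for h k
    by (rule inj_ext[OF dm_mg dm_mult[OF dm_mg dm_mg]])
      (use V that in \<open>auto simp: mg_inj mult.assoc mg_inj3 C.ga_mult chi_mult power_mult_distrib mult.commute\<close>)
  moreover have "mY ?d i * mg i V h = \<chi> h *\<^sub>c (mg i V h * mY ?d i)" if "h \<in> carrier G" for h
  proof (rule inj_ext[OF dm_mult[OF dm_mY dm_mg] dm_scl[OF dm_mult[OF dm_mg dm_mY]]])
    fix j assume "j < i"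
    then show "mY ?d i * mg i V h * sinj ?d i j = (\<chi> h *\<^sub>c (mg i V h * mY ?d i)) * sinj ?d i j"
      using V that chi_nz[OF that]
      by (simp add: mult.assoc mg_inj mY_inj) (simp add: mult.assoc[symmetric] mY_inj mg_inj)
  qed (use V that in auto)
  ultimately show ?thesis
    unfolding relH_def using dm_mg[OF V] dm_mY by blast
qed

context
  fixes V i assumes V: "is_rep KA V" and i: "i \<le> n"
begin

lemma Jm_rep: "is_rep H (Jm i V)"
  and gact_Jm: "h \<in> carrier G \<Longrightarrow> gact (Jm i V) h = mg i V h"
  and yact_Jm: "yact (Jm i V) = mY (fst V) i"
  unfolding Jm_def using mkH[OF Jm_relH[OF V i]] by simp_all

end

section \<open>Homomorphisms between Jm i V and arbitrary modules\<close>

lemma gact_ypow: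
  assumes "is_rep H M" "h \<in> carrier G"
  shows "gact M h * yact M ^ j = inverse (\<chi> h) ^ j *\<^sub>c (yact M ^ j * gact M h)"
  using yact_gact[OF assms] chi_nz[OF assms(2)] by (intro qcomm_power) simp

text \<open>Slot j of \<open>Jm i V\<close> is y^j applied to slot 0, so a homomorphism is
  determined by its restriction \<iota> to slot 0, and the only condition that y adds is y^i \<iota>
  = 0.\<close>

definition intoM :: "nat \<Rightarrow> (nat \<times> 'g \<Rightarrow> 'k, 'k) rep \<Rightarrow> nat \<Rightarrow> 'k rfm \<Rightarrow> 'k rfm" where
  "intoM i M d \<iota> = (\<Sum>j<i. (yact M ^ j * \<iota>) * sprj d i j)"

text \<open>Dual to \<open>intoM\<close>: the coordinate \<open>p\<close> in the last slot
  determines the one in slot k as p y^(i-1-k). As slot i - 1 carries the twist \<chi>^-(i-1),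
  \<open>p\<close> has to be equivariant for that twist.\<close>

definition ontoM :: "nat \<Rightarrow> (nat \<times> 'g \<Rightarrow> 'k, 'k) rep \<Rightarrow> nat \<Rightarrow> 'k rfm \<Rightarrow> 'k rfm" where
  "ontoM i M d p = (\<Sum>j<i. sinj d i j * (p * yact M ^ (i - Suc j)))"

lemma intoM_inj: "dm r d \<iota> \<Longrightarrow> k < i \<Longrightarrow> intoM i M d \<iota> * sinj d i k = yact M ^ k * \<iota>"
  unfolding intoM_def by (subst sum_prj_inj, assumption) (simp add: mult.assoc dm_right)

lemma prj_ontoM: "dm d r p \<Longrightarrow> k < i \<Longrightarrow> sprj d i k * ontoM i M d p = p * yact M ^ (i - Suc k)"
  unfolding ontoM_def by (subst prj_sum_inj, assumption) (simp add: mult.assoc[symmetric] dm_left)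

lemma intoM_Hm:
  assumes M: "is_rep H M" and V: "is_rep KA V" and i: "i \<le> n"
    and \<iota>: "dm (fst M) (fst V) \<iota>" "\<And>h. h \<in> carrier G \<Longrightarrow> gact M h * \<iota> = \<iota> * C.ga V h"
    and z: "yact M ^ i * \<iota> = 0"
  shows "intoM i M (fst V) \<iota> \<in> Hm H (Jm i V) M"
proof -
  let ?d = "fst V" and ?a = "intoM i M (fst V) \<iota>"
  have d: "dm (fst M) (?d * i) ?a"
    unfolding intoM_def using \<iota>(1) by (intro dm_sum dm_mult[of _ ?d] dm_power_mult yact_dm M dm_prj) auto
  note a = intoM_inj[OF \<iota>(1), of _ i M]
  have a3: "?a * (sinj ?d i k * X) = yact M ^ k * (\<iota> * X)" if "k < i" for k X
    using a[OF that] by (simp add: mult.assoc[symmetric])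
  have "?a * mY ?d i = yact M * ?a"
  proof (rule inj_ext[OF dm_mult[OF d dm_mY] dm_mult[OF yact_dm[OF M] d]])
    fix k assume k: "k < i"
    have "yact M ^ Suc k * \<iota> = 0" if "\<not> Suc k < i"
    proof -
      have "Suc k = i" using k that by simp
      then show ?thesis using z by simp
    qed
    then show "?a * mY ?d i * sinj ?d i k = yact M * ?a * sinj ?d i k"
      using k by (simp add: mult.assoc mY_inj a)
  qed
  moreover have "?a * mg i V h = gact M h * ?a" if h: "h \<in> carrier G" for h
  proof (rule inj_ext[OF dm_mult[OF d dm_mg[OF V h]] dm_mult[OF gact_dm[OF M h] d]])
    fix k assume k: "k < i"
    have "gact M h * (yact M ^ k * \<iota>) = inverse (\<chi> h) ^ k *\<^sub>c (yact M ^ k * (\<iota> * C.ga V h))"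
      using gact_ypow[OF M h, of k] \<iota>(2)[OF h] by (simp add: mult.assoc[symmetric]) (simp add: mult.assoc \<iota>(2)[OF h])
    then show "?a * mg i V h * sinj ?d i k = gact M h * ?a * sinj ?d i k"
      using k V h by (simp add: mult.assoc mg_inj a a3)
  qed
  ultimately show ?thesis
    using Jm_rep[OF V i] M d by (simp add: Hm_iff yact_Jm[OF V i] gact_Jm[OF V i])
qed

lemma ontoM_Hm:
  assumes M: "is_rep H M" and V: "is_rep KA V" and i: "i \<le> n"
    and p: "dm (fst V) (fst M) p"
      "\<And>h. h \<in> carrier G \<Longrightarrow> p * gact M h = inverse (\<chi> h) ^ (i - 1) *\<^sub>c (C.ga V h * p)"
    and z: "p * yact M ^ i = 0"
  shows "ontoM i M (fst V) p \<in> Hm H M (Jm i V)"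
proof -
  let ?d = "fst V" and ?b = "ontoM i M (fst V) p"
  have d: "dm (?d * i) (fst M) ?b"
    unfolding ontoM_def using p(1) by (intro dm_sum dm_mult[of _ ?d] dm_mult_power yact_dm M dm_inj) auto
  note b = prj_ontoM[OF p(1), of _ i M]
  have "?b * yact M = mY ?d i * ?b"
  proof (rule prj_ext[OF dm_mult[OF d yact_dm[OF M]] dm_mult[OF dm_mY d]])
    fix k assume k: "k < i"
    have "sprj ?d i k * (?b * yact M) = p * (yact M ^ Suc (i - Suc k))"
      using b[OF k] by (simp add: mult.assoc[symmetric] power_Suc2 del: power_Suc)
    also have "\<dots> = sprj ?d i k * (mY ?d i * ?b)"
    proof (cases k)
      case 0
      then show ?thesis using k z sprj_mY[OF k] by (simp add: mult.assoc[symmetric] del: power_Suc)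
    next
      case (Suc j)
      then have "sprj ?d i k * (mY ?d i * ?b) = p * yact M ^ (i - k)"
        using sprj_mY[OF k] k b[of j] by (simp add: mult.assoc[symmetric])
      moreover have "Suc (i - Suc k) = i - k" using k by simp
      ultimately show ?thesis by simp
    qed
    finally show "sprj ?d i k * (?b * yact M) = sprj ?d i k * (mY ?d i * ?b)" .
  qed
  moreover have "?b * gact M h = mg i V h * ?b" if h: "h \<in> carrier G" for h
  proof (rule prj_ext[OF dm_mult[OF d gact_dm[OF M h]] dm_mult[OF dm_mg[OF V h] d]])
    fix k assume k: "k < i"
    let ?m = "i - Suc k"
    have "yact M ^ ?m * gact M h = \<chi> h ^ ?m *\<^sub>c (gact M h * yact M ^ ?m)"
      using gact_ypow[OF M h, of ?m] chi_nz[OF h] by (simp add: power_mult_distrib[symmetric])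
    then have "sprj ?d i k * (?b * gact M h) = \<chi> h ^ ?m *\<^sub>c (p * gact M h * yact M ^ ?m)"
      using b[OF k] by (simp add: mult.assoc[symmetric]) (simp add: mult.assoc)
    also have "\<dots> = (\<chi> h ^ ?m * inverse (\<chi> h) ^ (i - 1)) *\<^sub>c (C.ga V h * (p * yact M ^ ?m))"
      by (simp add: p(2)[OF h] mult.assoc)
    also have "\<chi> h ^ ?m * inverse (\<chi> h) ^ (i - 1) = inverse (\<chi> h) ^ k"
    proof -
      have "i - 1 = ?m + k" using k by simp
      then show ?thesis using chi_nz[OF h] by (simp add: power_add power_mult_distrib[symmetric] mult.assoc[symmetric])
    qed
    also have "inverse (\<chi> h) ^ k *\<^sub>c (C.ga V h * (p * yact M ^ ?m)) = sprj ?d i k * (mg i V h * ?b)"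
      using sprj_mg[OF V h k] b[OF k] by (simp add: mult.assoc[symmetric]) (simp add: mult.assoc)
    finally show "sprj ?d i k * (?b * gact M h) = sprj ?d i k * (mg i V h * ?b)" .
  qed
  ultimately show ?thesis
    using Jm_rep[OF V i] M d by (simp add: Hm_iff yact_Jm[OF V i] gact_Jm[OF V i])
qed

lemma prj_onto_into_inj:
  assumes "dm r d \<iota>" "dm d' r p" "j < i" "k < i'"
  shows "sprj d' i' k * (ontoM i' M d' p * intoM i M d \<iota>) * sinj d i j = p * yact M ^ (i' - Suc k + j) * \<iota>"
proof -
  have "sprj d' i' k * (ontoM i' M d' p * intoM i M d \<iota>) * sinj d i j =
     (sprj d' i' k * ontoM i' M d' p) * (intoM i M d \<iota> * sinj d i j)" by (simp add: mult.assoc)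
  then show ?thesis by (simp add: prj_ontoM[OF assms(2,4)] intoM_inj[OF assms(1,3)] power_add mult.assoc)
qed

lemma geometric_sum: "(\<Sum>s<m. N ^ s) * (1 - N) = 1 - N ^ m" for N :: "'a::ring_1"
  by (induction m) (simp_all add: distrib_right, simp add: right_diff_distrib power_commutes)

text \<open>The composite of \<open>intoM\<close> with \<open>ontoM\<close> is unipotent for the filtration of
  \<open>Jm i V\<close> by its slots, hence invertible.\<close>

lemma Jm_retract:
  assumes M: "is_rep H M" and V: "is_rep KA V" and i: "0 < i" "i \<le> n"
    and \<iota>: "dm (fst M) (fst V) \<iota>" "\<And>h. h \<in> carrier G \<Longrightarrow> gact M h * \<iota> = \<iota> * C.ga V h"
    and p: "dm (fst V) (fst M) p"
      "\<And>h. h \<in> carrier G \<Longrightarrow> p * gact M h = inverse (\<chi> h) ^ (i - 1) *\<^sub>c (C.ga V h * p)"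
    and z: "yact M ^ i * \<iota> = 0" "p * yact M ^ i = 0" and one: "p * yact M ^ (i - 1) * \<iota> = idm (fst V)"
  obtains s r where "s \<in> Hm H (Jm i V) M" "r \<in> Hm H M (Jm i V)" "r * s = idm (fst (Jm i V))"
proof -
  let ?d = "fst V" and ?a = "intoM i M (fst V) \<iota>" and ?b = "ontoM i M (fst V) p"
  note a = intoM_Hm[OF M V i(2) \<iota> z(1)] and b = ontoM_Hm[OF M V i(2) p z(2)]
  note Mr = Jm_rep[OF V i(2)]
  define T where "T = ?b * ?a"
  have T: "T \<in> Hm H (Jm i V) (Jm i V)" unfolding T_def by (rule Hm_comp[OF b a])
  have Td: "dm (?d * i) (?d * i) T" using Hm_dm[OF T] by simp
  have pz: "p * yact M ^ m * \<iota> = 0" if "m \<ge> i" for m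
  proof -
    have "yact M ^ m = yact M ^ i * yact M ^ (m - i)" using that by (simp add: power_add[symmetric])
    then show ?thesis using z(2) by (simp add: mult.assoc[symmetric])
  qed
  define N where "N = idm (?d * i) - T"
  have NH: "N \<in> Hm H (Jm i V) (Jm i V)" unfolding N_def using Hm_diff[OF H.Hm_id[OF Mr] T] by simp
  have Nd: "dm (?d * i) (?d * i) N" using Hm_dm[OF NH] by simp
  \<comment> \<open>The component of \<open>T\<close> from slot j to slot k is p y^(i-1-k+j)
    \<iota>: the identity for j = k and 0 for j > k. Hence \<open>N\<close> strictly raises the slot
    number.\<close>
  have Nkj: "sprj ?d i k * N * sinj ?d i j = 0" if "k < i" "j < i" "k \<le> j" for j k
  proof -
    have 1: "sprj ?d i k * T * sinj ?d i j = (if j = k then idm ?d else 0)"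
      unfolding T_def prj_onto_into_inj[OF \<iota>(1) p(1) that(2,1)]
    proof (cases "j = k")
      case True
      then have "i - Suc k + j = i - 1" using that by simp
      then show "p * yact M ^ (i - Suc k + j) * \<iota> = (if j = k then idm ?d else 0)" using one True by simp
    next
      case False
      then have "i \<le> i - Suc k + j" using that by simp
      then show "p * yact M ^ (i - Suc k + j) * \<iota> = (if j = k then idm ?d else 0)" using pz False by simp
    qed
    show ?thesis
      using 1 that by (simp add: N_def right_diff_distrib left_diff_distrib dm_right[OF dm_prj] prj_inj)
  qed
  have pN: "sprj ?d i k * N ^ s * idm (?d * i) = 0" if "k < s" "k < i" for s k
    using that
  proof (induction s arbitrary: k)
    case (Suc s)
    have "sprj ?d i k * N ^ Suc s * idm (?d * i) = sprj ?d i k * N * idm (?d * i) * (N ^ s * idm (?d * i))"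
      using dm_right3[OF Nd] by (simp add: mult.assoc)
    also have "\<dots> = (\<Sum>j<i. (sprj ?d i k * N * sinj ?d i j) * (sprj ?d i j * N ^ s * idm (?d * i)))"
      unfolding idm_expand[of "sprj ?d i k * N" ?d i] by (simp add: mult.assoc)
    also have "\<dots> = 0"
    proof (rule sum.neutral, intro ballI)
      fix j assume j: "j \<in> {..<i}"
      show "(sprj ?d i k * N * sinj ?d i j) * (sprj ?d i j * N ^ s * idm (?d * i)) = 0"
        using j Suc by (cases "k \<le> j") (auto simp: Nkj)
    qed
    finally show ?case .
  qed simp
  have "N ^ i * idm (?d * i) = 0"
    by (rule prj_ext[of ?d i]) (use dm_power_mult[OF Nd dm_idm] pN in \<open>auto simp: mult.assoc\<close>)
  then have Ni: "N ^ i = 0" using power_absorb[OF dm_right[OF Nd] i(1)] by simp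
  \<comment> \<open>The geometric series for the inverse of 1 - N; the factor
    \<open>idm (?d * i)\<close> cuts the term N^0 = 1 down to the right format.\<close>
  define U where "U = (\<Sum>s<i. N ^ s * idm (?d * i))"
  have "N ^ s * idm (?d * i) \<in> Hm H (Jm i V) (Jm i V)" for s
    by (induction s) (use H.Hm_id[OF Mr] Hm_comp[OF NH] in \<open>auto simp: mult.assoc\<close>)
  then have UH: "U \<in> Hm H (Jm i V) (Jm i V)" unfolding U_def by (rule Hm_sum)
  have "U * T = idm (?d * i)"
  proof -
    have "U * T = (\<Sum>s<i. N ^ s) * (idm (?d * i) * T)" by (simp add: U_def sum_distrib_right mult.assoc)
    also have "idm (?d * i) * T = (1 - N) * idm (?d * i)"
      by (simp add: N_def left_diff_distrib dm_left[OF Td] dm_right[OF Td])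
    also have "(\<Sum>s<i. N ^ s) * ((1 - N) * idm (?d * i)) = idm (?d * i)"
      by (simp add: mult.assoc[symmetric] geometric_sum Ni)
    finally show ?thesis .
  qed
  then show ?thesis using that[OF a Hm_comp[OF UH b]] by (simp add: T_def mult.assoc)
qed

text \<open>Equal dimensions make the split embedding of \<open>Jm_retract\<close> bijective, so the
  second inverse equation comes for free.\<close>

lemma Jm_iso:
  assumes M: "is_rep H M" and V: "is_rep KA V" and i: "0 < i" "i \<le> n" and dim: "fst M = fst V * i"
    and "dm (fst M) (fst V) \<iota>" "\<And>h. h \<in> carrier G \<Longrightarrow> gact M h * \<iota> = \<iota> * C.ga V h"
    and "dm (fst V) (fst M) p"
      "\<And>h. h \<in> carrier G \<Longrightarrow> p * gact M h = inverse (\<chi> h) ^ (i - 1) *\<^sub>c (C.ga V h * p)"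
    and "yact M ^ i * \<iota> = 0" "p * yact M ^ i = 0" "p * yact M ^ (i - 1) * \<iota> = idm (fst V)"
  shows "rep_iso H (Jm i V) M"
proof -
  obtain s r where sr: "s \<in> Hm H (Jm i V) M" "r \<in> Hm H M (Jm i V)" "r * s = idm (fst (Jm i V))"
    by (rule Jm_retract[OF assms(1-4,6-)])
  have "s * r = idm (fst M)"
    using right_inverse_of_left_inverse[of "fst M" s r] Hm_dm[OF sr(1)] Hm_dm[OF sr(2)] sr(3) dim by simp
  then show ?thesis using H.rep_isoI[OF Jm_rep[OF V i(2)] M sr(1,2,3)] by simp
qed

text \<open>Let i be the nilpotency index of y on M. The chains of full length i split off: V is M
  modulo ker y^(i-1), and averaging yields an equivariant section of M -> V and an equivariant
  retraction of M onto the image of y^(i-1), as \<open>Jm_retract\<close> demands.\<close>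

lemma Jm_summand:
  assumes M: "is_rep H M" "fst M \<noteq> 0"
  obtains i V Q where "0 < i" "i \<le> n" "is_rep KA V" "is_rep H Q" "fst Q < fst M" "rep_iso H M (rep_sum (Jm i V) Q)"
proof -
  let ?d = "fst M" and ?Y = "yact M"
  have nz: "idm ?d \<noteq> (0 :: 'k rfm)"
  proof
    assume "idm ?d = (0 :: 'k rfm)"
    then have "ent (idm ?d) 0 0 = (0::'k)" by simp
    then show False using M(2) by simp
  qed
  define i where "i = (LEAST k. ?Y ^ k * idm ?d = 0)"
  have ex: "?Y ^ n * idm ?d = 0" using yact_nilp[OF M(1)] by simp
  have i: "?Y ^ i * idm ?d = 0" "i \<le> n" "\<And>k. k < i \<Longrightarrow> ?Y ^ k * idm ?d \<noteq> 0"
    unfolding i_def using LeastI[of "\<lambda>k. ?Y ^ k * idm ?d = 0", OF ex] Least_le[of "\<lambda>k. ?Y ^ k * idm ?d = 0", OF ex]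
      not_less_Least[of _ "\<lambda>k. ?Y ^ k * idm ?d = 0"] by auto
  have i0: "0 < i" using i(1) nz by (cases i) auto
  have Yi: "?Y ^ i = 0" using power_absorb[OF dm_right[OF yact_dm[OF M(1)]] i0] i(1) by simp
  define m where "m = i - 1"
  define T where "T = ?Y ^ m * idm ?d"
  have T: "dm ?d ?d T" "T \<noteq> 0" unfolding T_def using dm_power_mult[OF yact_dm[OF M(1)]] i(3)[of m] i0 by (auto simp: m_def)
  \<comment> \<open>\<open>A\<close> is the projection of M to V in coordinates, and
    \<open>B\<close> embeds V as the image of y^m.\<close>
  obtain r A B A' B' where f: "dm r ?d A" "dm ?d r B" "dm ?d r A'" "dm r ?d B'"
    "T = B * A" "A * A' = idm r" "B' * B = idm r" by (rule rank_factorization[OF T(1)])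
  have r0: "r \<noteq> 0"
  proof
    assume "r = 0"
    then have "B = 0" using f(2) dm_0_right by blast
    then show False using f(5) T(2) by simp
  qed
  let ?\<rho> = "gact M"
  note \<rho>d = gact_dm[OF M(1)]
  \<comment> \<open>The action on V for which \<open>A\<close> is equivariant. Since y^m shifts
    characters by \<chi>^-m, the action read off through \<open>B\<close> is corrected by
    \<chi>^m.\<close>
  define \<sigma> where "\<sigma> h = \<chi> h ^ m *\<^sub>c (B' * ?\<rho> h * B)" for h
  have \<sigma>d: "dm r r (\<sigma> h)" if "h \<in> carrier G" for h
    unfolding \<sigma>_def using f \<rho>d[OF that] by blast
  have T\<rho>: "T * ?\<rho> h = \<chi> h ^ m *\<^sub>c (?\<rho> h * T)" if h: "h \<in> carrier G" for h
    using gact_ypow[OF M(1) h, of m] chi_nz[OF h]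
    by (simp add: T_def mult.assoc dm_left[OF \<rho>d[OF h]]) (simp add: mult.assoc[symmetric] power_mult_distrib[symmetric], simp add: mult.assoc dm_right[OF \<rho>d[OF h]])
  have A\<rho>: "A * ?\<rho> h = \<sigma> h * A" if h: "h \<in> carrier G" for h
  proof -
    have "A * ?\<rho> h = B' * (B * A) * ?\<rho> h" using f(7) dm_left[OF f(1)] by (simp add: mult.assoc[symmetric])
    also have "\<dots> = B' * (T * ?\<rho> h)" by (simp add: f(5) mult.assoc)
    also have "\<dots> = \<sigma> h * A" by (simp add: T\<rho>[OF h] \<sigma>_def) (simp add: f(5) mult.assoc)
    finally show ?thesis .
  qed
  have \<rho>B: "?\<rho> h * B = inverse (\<chi> h) ^ m *\<^sub>c (B * \<sigma> h)" if h: "h \<in> carrier G" for h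
  proof -
    have "?\<rho> h * B = ?\<rho> h * (B * A) * A'" using f(6) dm_right[OF f(2)] by (simp add: mult.assoc)
    also have "\<dots> = inverse (\<chi> h) ^ m *\<^sub>c (T * ?\<rho> h) * A'"
      using T\<rho>[OF h] chi_nz[OF h] by (simp add: f(5) power_mult_distrib[symmetric])
    also have "\<dots> = inverse (\<chi> h) ^ m *\<^sub>c (B * (A * ?\<rho> h) * A')" by (simp add: f(5) mult.assoc)
    also have "\<dots> = inverse (\<chi> h) ^ m *\<^sub>c (B * (\<sigma> h * (A * A')))" by (simp add: A\<rho>[OF h] mult.assoc)
    finally show ?thesis using f(6) dm_right[OF \<sigma>d[OF h]] by simp
  qed
  have canc: "X = Z" if "X * A = Z * A" "dm c r X" "dm c r Z" for X Z c
    using arg_cong[OF that(1), of "\<lambda>x. x * A'"] that(2,3) by (simp add: mult.assoc f(6) dm_right)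
  have \<sigma>m: "\<sigma> (h \<otimes> k) = \<sigma> h * \<sigma> k" if hk: "h \<in> carrier G" "k \<in> carrier G" for h k
  proof (rule canc)
    have "\<sigma> h * \<sigma> k * A = \<sigma> h * A * ?\<rho> k" by (simp add: mult.assoc A\<rho>[OF hk(2)])
    also have "\<dots> = \<sigma> (h \<otimes> k) * A"
      using A\<rho>[of "h \<otimes> k"] gact_mult[OF M(1) hk] A\<rho>[OF hk(1)] hk by (simp add: mult.assoc[symmetric])
    finally show "\<sigma> (h \<otimes> k) * A = \<sigma> h * \<sigma> k * A" by simp
  qed (use \<sigma>d hk in auto)
  have \<sigma>1: "\<sigma> \<one> = idm r"
  proof (rule canc)
    show "\<sigma> \<one> * A = idm r * A"
      using A\<rho>[of \<one>] by (simp add: gact_one[OF M(1)] dm_right[OF f(1)] dm_left[OF f(1)])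
  qed (use \<sigma>d[of \<one>] in auto)
  have \<sigma>i: "\<sigma> h * \<sigma> (inv h) = idm r" if "h \<in> carrier G" for h
    using \<sigma>m[of h "inv h"] that \<sigma>1 by simp
  define V where "V = C.mkG r \<sigma>"
  have V: "is_rep KA V" "\<And>h. h \<in> carrier G \<Longrightarrow> C.ga V h = \<sigma> h" "fst V = r"
    unfolding V_def using C.mkG[of r \<sigma>] \<sigma>d \<sigma>m \<sigma>1 by auto
  define \<iota> where "\<iota> = av ?\<rho> \<sigma> A'"
  \<comment> \<open>The action that V has as the image of y^m, for which \<open>B\<close> is
    equivariant.\<close>
  define \<tau> where "\<tau> h = inverse (\<chi> h) ^ m *\<^sub>c \<sigma> h" for h
  have \<tau>m: "\<tau> (h \<otimes> k) = \<tau> h * \<tau> k" if "h \<in> carrier G" "k \<in> carrier G" for h k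
    using that by (simp add: \<tau>_def \<sigma>m chi_mult power_mult_distrib mult.commute)
  have \<tau>d: "dm r r (\<tau> h)" if "h \<in> carrier G" for h unfolding \<tau>_def using \<sigma>d[OF that] by blast
  have \<tau>i: "\<tau> h * \<tau> (inv h) = idm r" if "h \<in> carrier G" for h
    using that \<tau>m[of h "inv h"] by (simp add: \<tau>_def \<sigma>1 chi_one)
  define p where "p = av \<tau> ?\<rho> B'"
  note \<rho>m = gact_mult[OF M(1)]
  have \<iota>d: "dm ?d r \<iota>" unfolding \<iota>_def by (rule dm_av[OF \<rho>d \<sigma>d f(3)])
  have pd: "dm r ?d p" unfolding p_def by (rule dm_av[OF \<tau>d \<rho>d f(4)])
  have A\<iota>: "A * \<iota> * 1 = idm r" unfolding \<iota>_def
  proof (rule av_const)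
    fix h assume h: "h \<in> carrier G"
    have "A * (?\<rho> h * A' * \<sigma> (inv h)) = (A * ?\<rho> h) * A' * \<sigma> (inv h)" by (simp add: mult.assoc)
    also have "\<dots> = \<sigma> h * (A * A') * \<sigma> (inv h)" by (simp add: A\<rho>[OF h] mult.assoc)
    finally show "A * (?\<rho> h * A' * \<sigma> (inv h)) * 1 = idm r" using \<sigma>i[OF h] dm_right[OF \<sigma>d[OF h]] f(6) by simp
  qed
  have pB: "1 * p * B = idm r" unfolding p_def
  proof (rule av_const)
    fix h assume h: "h \<in> carrier G"
    have "\<tau> h * B' * ?\<rho> (inv h) * B = \<tau> h * B' * (?\<rho> (inv h) * B)" by (simp add: mult.assoc)
    also have "\<dots> = \<tau> h * (B' * B) * \<tau> (inv h)" using h by (simp add: \<rho>B \<tau>_def mult.assoc)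
    finally show "1 * (\<tau> h * B' * ?\<rho> (inv h)) * B = idm r" using \<tau>i[OF h] dm_right[OF \<tau>d[OF h]] f(7) by simp
  qed
  have pYi: "p * ?Y ^ (i - 1) * \<iota> = idm r"
  proof -
    have "p * ?Y ^ (i - 1) * \<iota> = p * T * \<iota>" using dm_left[OF \<iota>d] by (simp add: T_def m_def mult.assoc)
    also have "\<dots> = (1 * p * B) * (A * \<iota> * 1)" by (simp add: f(5) mult.assoc)
    finally show ?thesis using A\<iota> pB by simp
  qed
  obtain s t where st: "s \<in> Hm H (Jm i V) M" "t \<in> Hm H M (Jm i V)" "t * s = idm (fst (Jm i V))"
  proof (rule Jm_retract[OF M(1) V(1) i0 i(2)])
    show "dm (fst M) (fst V) \<iota>" "dm (fst V) (fst M) p" using \<iota>d pd V by simp_all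
    show "gact M h * \<iota> = \<iota> * C.ga V h" if "h \<in> carrier G" for h
      unfolding \<iota>_def V(2)[OF that] by (rule av_equivariant[OF \<rho>m \<sigma>m that])
    show "p * gact M h = inverse (\<chi> h) ^ (i - 1) *\<^sub>c (C.ga V h * p)" if h: "h \<in> carrier G" for h
    proof -
      have "\<tau> h * p = p * gact M h" unfolding p_def by (rule av_equivariant[OF \<tau>m \<rho>m h])
      then show ?thesis by (simp add: \<tau>_def V(2)[OF h] m_def)
    qed
    show "?Y ^ i * \<iota> = 0" "p * ?Y ^ i = 0" using Yi by simp_all
    show "p * ?Y ^ (i - 1) * \<iota> = idm (fst V)" using pYi V by simp
  qed
  note Mr = Jm_rep[OF V(1) i(2)]
  obtain Q k l where Q: "is_rep H Q" "H.bip M (Jm i V) Q s k t l"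
    using H.retract_complement[OF M(1) Mr st] by blast
  have iso: "rep_iso H M (rep_sum (Jm i V) Q)" by (rule H.bip_rep_sum_iso[OF Q(2) M(1) Mr Q(1)])
  have "fst M = fst V * i + fst Q"
    using H.rep_iso_dim[OF M(1) H.rep_sum_rep[OF Mr Q(1)] iso] by simp
  then have "fst Q < fst M" using i0 r0 V(3) by simp
  then show ?thesis using that i0 i(2) V(1) Q(1) iso by blast
qed

text \<open>The decomposition of H-modules in the form of an induction principle: V runs over
  arbitrary KG-modules, and the dimension decreases because the summand split off by
  \<open>Jm_summand\<close> is nonzero.\<close>

theorem H_rep_induct [consumes 1, case_names iso zero jm sum]:
  assumes "is_rep H M"
    and iso: "\<And>M N. is_rep H M \<Longrightarrow> is_rep H N \<Longrightarrow> rep_iso H M N \<Longrightarrow> P N \<Longrightarrow> P M"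
    and zero: "\<And>M. is_rep H M \<Longrightarrow> fst M = 0 \<Longrightarrow> P M"
    and jm: "\<And>i V. 0 < i \<Longrightarrow> i \<le> n \<Longrightarrow> is_rep KA V \<Longrightarrow> P (Jm i V)"
    and sum: "\<And>M N. is_rep H M \<Longrightarrow> is_rep H N \<Longrightarrow> P M \<Longrightarrow> P N \<Longrightarrow> P (rep_sum M N)"
  shows "P M"
  using assms(1)
proof (induction "fst M" arbitrary: M rule: less_induct)
  case less
  show ?case
  proof (cases "fst M = 0")
    case True
    then show ?thesis using zero less.prems by blast
  next
    case False
    obtain i V Q where *: "0 < i" "i \<le> n" "is_rep KA V" "is_rep H Q" "fst Q < fst M" "rep_iso H M (rep_sum (Jm i V) Q)"
      by (rule Jm_summand[OF less.prems False])
    note Mr = Jm_rep[OF *(3,2)]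
    show ?thesis
      by (rule iso[OF less.prems H.rep_sum_rep[OF Mr *(4)] *(6)], rule sum[OF Mr *(4)], rule jm[OF *(1-3)],
          rule less.hyps[OF *(5,4)])
  qed
qed

end

context datum
begin

section \<open>Projective modules and the tensor product\<close>

lemma chi_inv_cancel: "h \<in> carrier G \<Longrightarrow> \<chi> h ^ k * inverse (\<chi> h) ^ k = 1"
  by (simp add: chi_nz power_mult_distrib[symmetric])

text \<open>As y^n acts by 0 on every module, homomorphisms out of \<open>Jm n V\<close> correspond
  to G-equivariant maps out of V, and these lift along surjections by averaging.\<close>

lemma Jm_projective:
  assumes V: "is_rep KA V"
  shows "projective H (Jm n V)"
proof (rule H.projectiveI[OF Jm_rep[OF V order_refl]])
  fix X N p t f
  assume X: "is_rep H X" and N: "is_rep H N" and p: "p \<in> Hm H X N" and t: "dm (fst X) (fst N) t" "p * t = idm (fst N)"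
    and f: "f \<in> Hm H (Jm n V) N"
  let ?d = "fst V"
  note Mr = Jm_rep[OF V order_refl]
  have n0: "0 < n" using n2 by simp
  define \<iota> where "\<iota> = f * sinj ?d n 0"
  have fd: "dm (fst N) (?d * n) f" using Hm_dm[OF f] by simp
  have \<iota>: "dm (fst N) ?d \<iota>" unfolding \<iota>_def by (rule dm_mult[OF fd dm_inj[OF n0]])
  have \<iota>G: "gact N h * \<iota> = \<iota> * C.ga V h" if h: "h \<in> carrier G" for h
  proof -
    have "f * mg n V h = gact N h * f" using f h by (simp add: Hm_iff[OF Mr N] gact_Jm[OF V order_refl])
    then have "gact N h * \<iota> = f * (mg n V h * sinj ?d n 0)" by (simp add: \<iota>_def mult.assoc[symmetric])
    then show ?thesis using mg_inj[OF V h n0] by (simp add: \<iota>_def mult.assoc)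
  qed
  \<comment> \<open>The average of the linear lift \<open>t * \<iota>\<close> is equivariant, and it
    is still a lift because \<open>p\<close> and \<iota> are equivariant.\<close>
  define u where "u = av (gact X) (C.ga V) (t * \<iota>)"
  have u: "dm (fst X) ?d u" unfolding u_def by (rule dm_av[OF gact_dm[OF X] C.ga_dm[OF V] dm_mult[OF t(1) \<iota>]])
  have uG: "gact X h * u = u * C.ga V h" if "h \<in> carrier G" for h
    unfolding u_def by (rule av_equivariant[OF gact_mult[OF X] C.ga_mult[OF V] that])
  have pu: "p * u * 1 = \<iota>" unfolding u_def
  proof (rule av_const)
    fix h assume h: "h \<in> carrier G"
    have pG: "p * gact X h = gact N h * p" using p h by (simp add: Hm_iff[OF X N])
    have "p * (gact X h * (t * \<iota>) * C.ga V (inv h)) = (p * gact X h) * t * \<iota> * C.ga V (inv h)" by (simp add: mult.assoc)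
    also have "\<dots> = gact N h * ((p * t) * \<iota>) * C.ga V (inv h)" by (simp add: pG mult.assoc)
    also have "\<dots> = \<iota> * (C.ga V h * C.ga V (inv h))" using \<iota> by (simp add: t(2) dm_left \<iota>G[OF h] mult.assoc)
    also have "C.ga V h * C.ga V (inv h) = idm ?d" using C.ga_mult[OF V h, of "inv h"] h C.ga_one[OF V] by simp
    finally show "p * (gact X h * (t * \<iota>) * C.ga V (inv h)) * 1 = \<iota>" using \<iota> by (simp add: dm_right)
  qed
  have fY: "f * mY ?d n = yact N * f" using f by (simp add: Hm_iff[OF Mr N] yact_Jm[OF V order_refl])
  have pY: "p * yact X = yact N * p" using p by (simp add: Hm_iff[OF X N])
  have pYk: "p * yact X ^ k = yact N ^ k * p" for k
    by (induction k) (auto simp: mult.assoc[symmetric] pY, simp add: mult.assoc)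
  let ?f = "intoM n X ?d u"
  have f': "?f \<in> Hm H (Jm n V) X" by (rule intoM_Hm[OF X V order_refl u uG]) (simp_all add: yact_nilp[OF X])
  have "p * ?f = f"
  proof (rule inj_ext[OF dm_mult[OF Hm_dm[OF p]] fd])
    show "dm (fst X) (?d * n) ?f" using Hm_dm[OF f'] by simp
    fix k assume k: "k < n"
    have "f * sinj ?d n k = yact N ^ k * \<iota>"
      using k
    proof (induction k)
      case (Suc k)
      then have "f * sinj ?d n (Suc k) = f * (mY ?d n * sinj ?d n k)" by (simp add: mY_inj)
      also have "\<dots> = yact N * (f * sinj ?d n k)" using fY by (simp add: mult.assoc[symmetric])
      finally show ?case using Suc by (simp add: mult.assoc)
    qed (simp add: \<iota>_def)
    then show "p * ?f * sinj ?d n k = f * sinj ?d n k"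
      using intoM_inj[OF u k] pYk[of k] pu by (simp add: mult.assoc) (simp add: mult.assoc[symmetric], simp add: mult.assoc)
  qed
  then show "\<exists>f'\<in>Hm H (Jm n V) X. p * f' = f" using f' by blast
qed

definition res :: "(nat \<times> 'g \<Rightarrow> 'k, 'k) rep \<Rightarrow> ('g \<Rightarrow> 'k, 'k) rep" where
  "res M = C.mkG (fst M) (gact M)"

lemma res:
  assumes "is_rep H M"
  shows "is_rep KA (res M)" "fst (res M) = fst M" "h \<in> carrier G \<Longrightarrow> C.ga (res M) h = gact M h"
  unfolding res_def using C.mkG[of "fst M" "gact M"] gact_dm[OF assms] gact_mult[OF assms] gact_one[OF assms] by auto

text \<open>The canonical map to P from the module induced by its restriction is the identity on
  slot 0, hence onto, and it splits because P is projective.\<close>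

lemma projective_Jm_retract:
  assumes P: "projective H P"
  obtains V s r where "is_rep KA V" "s \<in> Hm H P (Jm n V)" "r \<in> Hm H (Jm n V) P" "r * s = idm (fst P)"
proof -
  note Pr = H.projective_rep[OF P]
  let ?V = "res P"
  note V = res[OF Pr]
  note Mr = Jm_rep[OF V(1) order_refl]
  have n0: "0 < n" using n2 by simp
  let ?r = "intoM n P (fst ?V) (idm (fst P))"
  have r: "?r \<in> Hm H (Jm n ?V) P"
    by (rule intoM_Hm[OF Pr V(1) order_refl])
      (use V gact_dm[OF Pr] in \<open>auto simp: dm_left[OF gact_dm[OF Pr]] dm_right[OF gact_dm[OF Pr]] yact_nilp[OF Pr]\<close>)
  have "?r * sinj (fst ?V) n 0 = idm (fst P)"
    by (subst intoM_inj[OF _ n0, of "fst P"]) (auto simp: V(2))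
  moreover have "dm (fst (Jm n ?V)) (fst P) (sinj (fst ?V) n 0)" using dm_inj[OF n0, of "fst ?V"] V(2) by simp
  ultimately obtain s where "s \<in> Hm H P (Jm n ?V)" "?r * s = idm (fst P)"
    using H.projective_lift[OF P Mr Pr r _ _ H.Hm_id[OF Pr]] by blast
  then show ?thesis using that V(1) r by blast
qed

text \<open>In \<open>Jm n V\<close> the kernel of y is the last slot, which is y^(n-1) applied to
  slot 0, and the property passes to retracts. The columns of \<open>X\<close> play the role of
  vectors.\<close>

lemma projective_kernel:
  assumes P: "projective H P" and X: "dm (fst P) c X" "yact P * X = 0"
  shows "\<exists>Z. dm (fst P) c Z \<and> X = yact P ^ (n - 1) * Z"
proof -
  obtain V s r where V: "is_rep KA V" and sr: "s \<in> Hm H P (Jm n V)" "r \<in> Hm H (Jm n V) P" "r * s = idm (fst P)"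
    by (rule projective_Jm_retract[OF P])
  note Pr = H.projective_rep[OF P] and Mr = Jm_rep[OF V order_refl]
  let ?d = "fst V"
  have sY: "s * yact P = mY ?d n * s" and rY: "r * mY ?d n = yact P * r"
    using sr by (simp_all add: Hm_iff[OF Pr Mr] Hm_iff[OF Mr Pr] yact_Jm[OF V order_refl])
  have sd: "dm (?d * n) (fst P) s" and rd: "dm (fst P) (?d * n) r" using Hm_dm[OF sr(1)] Hm_dm[OF sr(2)] by auto
  define X1 where "X1 = s * X"
  have X1: "dm (?d * n) c X1" "mY ?d n * X1 = 0"
    unfolding X1_def using dm_mult[OF sd X(1)] sY X(2) by (simp_all add: mult.assoc[symmetric]) (metis mult.assoc mult_zero_right)
  have z: "sprj ?d n j * X1 = 0" if "Suc j < n" for j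
  proof -
    have "sprj ?d n (Suc j) * (mY ?d n * X1) = sprj ?d n (Suc j) * (\<Sum>k<n. (if Suc k < n then sinj ?d n (Suc k) else 0) * (sprj ?d n k * X1))"
      by (simp add: mY_def sum_distrib_right mult.assoc)
    also have "\<dots> = (\<Sum>k<n. if k = j then idm ?d * (sprj ?d n j * X1) else 0)"
      unfolding sum_distrib_left by (rule sum.cong) (use that in \<open>auto simp: prj_inj3\<close>)
    also have "\<dots> = sprj ?d n j * X1" using that by (simp add: dm_left3[OF dm_prj])
    finally show ?thesis using X1(2) by simp
  qed
  have n1: "n - 1 < n" using n2 by simp
  have "X1 = (\<Sum>j<n. sinj ?d n j * sprj ?d n j) * X1" using X1(1) by (simp add: sum_inj_prj dm_left)
  also have "\<dots> = (\<Sum>j<n. if j = n - 1 then sinj ?d n (n - 1) * (sprj ?d n (n - 1) * X1) else 0)"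
    unfolding sum_distrib_right by (rule sum.cong) (auto simp: mult.assoc z)
  also have "\<dots> = sinj ?d n (n - 1) * (sprj ?d n (n - 1) * X1)" using n1 by simp
  also have "sinj ?d n (n - 1) = mY ?d n ^ (n - 1) * sinj ?d n 0" using n1 by (subst mY_pow_inj) auto
  finally have X1e: "X1 = mY ?d n ^ (n - 1) * (sinj ?d n 0 * (sprj ?d n (n - 1) * X1))" by (simp add: mult.assoc)
  have rYk: "r * mY ?d n ^ k = yact P ^ k * r" for k
    by (induction k) (auto simp: mult.assoc[symmetric] rY, simp add: mult.assoc)
  have "X = r * X1" using sr(3) X(1) by (simp add: X1_def mult.assoc[symmetric] dm_left)
  also have "\<dots> = yact P ^ (n - 1) * (r * (sinj ?d n 0 * (sprj ?d n (n - 1) * X1)))"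
    by (subst X1e) (simp add: mult.assoc[symmetric] rYk)
  finally show ?thesis
    using dm_mult[OF rd dm_mult[OF dm_inj dm_mult[OF dm_prj[OF n1] X1(1)]], of 0] n1 by (intro exI conjI) auto
qed

text \<open>N tensored with an induced module is induced from the restriction of N tensored with V.
  The generating copy is N in slot 0, and the point is to compute the last slot of y^(n-1) applied
  to it.\<close>

lemma tensor_Jm_projective_right:
  assumes N: "is_rep H N" and V: "is_rep KA V"
  shows "projective H (rep_tensor H N (Jm n V))"
proof -
  let ?N = "fst N" and ?d = "fst V" and ?M = "rep_tensor H N (Jm n V)"
  let ?e = "?d * n"
  note J = Jm_rep[OF V order_refl] and Jg = gact_Jm[OF V order_refl] and Jy = yact_Jm[OF V order_refl]
  note T = H_tens[OF N J]
  let ?W = "rep_tensor KA (res N) V"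
  note W = C.K_tens[OF res(1)[OF N] V]
  have n0: "0 < n" and n1: "n - 1 < n" using n2 by auto
  let ?i = "kr ?e ?d (idm ?N) (sinj ?d n 0)" and ?p = "kr ?d ?e (idm ?N) (sprj ?d n (n - 1))"
  have tY: "tY N (Jm n V) = kr ?e ?e (yact N) (mg n V g) + kr ?e ?e (idm ?N) (mY ?d n)"
    by (simp add: tY_def Jg[OF g_closed] Jy)
  \<comment> \<open>Only the summand 1 tensor y moves on to the next slot. Within s \<le> k steps
    slot k is reached only for s = k with this summand taken every time, so the terms containing y
    tensor g drop out.\<close>
  have key: "kr ?d ?e X (sprj ?d n k) * (tY N (Jm n V) ^ s * ?i) = (if s = k then kr ?d ?d X (idm ?d) else 0)"
    if "k < n" "s \<le> k" "dm ?N ?N X" for k s X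
    using that
  proof (induction s arbitrary: k X)
    case 0
    then show ?case by (simp add: kr_mult[OF dm_prj] prj_inj dm_right)
  next
    case (Suc s)
    then obtain j where j: "k = Suc j" "s \<le> j" by (cases k) auto
    have "kr ?d ?e X (sprj ?d n k) * tY N (Jm n V) =
        inverse q ^ k *\<^sub>c kr ?d ?e (X * yact N) (C.ga V g * sprj ?d n k) + kr ?d ?e X (sprj ?d n j)"
      using Suc.prems sprj_mY[of k n ?d] sprj_mg[OF V, of g k n] g_closed j
      by (simp add: tY distrib_left kr_mult[OF dm_prj] q_def dm_right)
    also have "kr ?d ?e (X * yact N) (C.ga V g * sprj ?d n k) = kr ?d ?d (idm ?N) (C.ga V g) * kr ?d ?e (X * yact N) (sprj ?d n k)"
      using Suc.prems dm_mult[OF Suc.prems(3) yact_dm[OF N]] by (simp add: kr_mult[OF C.ga_dm[OF V g_closed]] dm_left)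
    finally have "kr ?d ?e X (sprj ?d n k) * (tY N (Jm n V) ^ Suc s * ?i) =
        inverse q ^ k *\<^sub>c (kr ?d ?d (idm ?N) (C.ga V g) * (kr ?d ?e (X * yact N) (sprj ?d n k) * (tY N (Jm n V) ^ s * ?i)))
        + kr ?d ?e X (sprj ?d n j) * (tY N (Jm n V) ^ s * ?i)"
      by (simp add: mult.assoc[symmetric] distrib_right)
    also have "\<dots> = (if Suc s = k then kr ?d ?d X (idm ?d) else 0)"
      using Suc.IH[of k "X * yact N"] Suc.IH[of j X] Suc.prems j dm_mult[OF Suc.prems(3) yact_dm[OF N]] by simp
    finally show ?case .
  qed
  have iso: "rep_iso H (Jm n ?W) ?M"
  proof (rule Jm_iso[OF T(1) W(1) n0 order_refl])
    show "fst ?M = fst ?W * n" by (simp add: res(2)[OF N] mult.assoc)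
    show "dm (fst ?M) (fst ?W) ?i" using dm_kr[OF dm_idm dm_inj[OF n0]] by (simp add: res(2)[OF N])
    show "dm (fst ?W) (fst ?M) ?p" using dm_kr[OF dm_idm dm_prj[OF n1]] by (simp add: res(2)[OF N])
    show "gact ?M h * ?i = ?i * C.ga ?W h" if h: "h \<in> carrier G" for h
      using mg_inj[OF V h n0] h gact_dm[OF N h]
      by (simp add: T(2)[OF h] tg_def Jg[OF h] W(2)[OF h] res(3)[OF N h] kr_mult[OF dm_mg[OF V h]] kr_mult[OF dm_inj[OF n0]] dm_left dm_right)
    show "?p * gact ?M h = inverse (\<chi> h) ^ (n - 1) *\<^sub>c (C.ga ?W h * ?p)" if h: "h \<in> carrier G" for h
      using sprj_mg[OF V h n1] h gact_dm[OF N h]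
      by (simp add: T(2)[OF h] tg_def Jg[OF h] W(2)[OF h] res(3)[OF N h] kr_mult[OF dm_prj[OF n1]] kr_mult[OF C.ga_dm[OF V h]] dm_left dm_right del: One_nat_def)
    show "yact ?M ^ n * ?i = 0" "?p * yact ?M ^ n = 0" by (simp_all add: yact_nilp[OF T(1)])
    show "?p * yact ?M ^ (n - 1) * ?i = idm (fst ?W)"
      using key[OF n1 order_refl dm_idm] by (simp add: T(3) mult.assoc kr_idm res(2)[OF N])
  qed
  then show ?thesis
    using H.projective_iso[OF Jm_projective[OF W(1)] T(1)] H.rep_iso_sym[OF Jm_rep[OF W(1) order_refl] T(1)] by blast
qed

text \<open>Here y tensor g is the summand that moves the slot, and n - 1 moves multiply the second
  factor by g^(n-1). The retraction compensates for this by \<open>z\<close>, which commutes with G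
  because g is central.\<close>

lemma tensor_Jm_projective_left:
  assumes N: "is_rep H N" and V: "is_rep KA V"
  shows "projective H (rep_tensor H (Jm n V) N)"
proof -
  let ?N = "fst N" and ?d = "fst V" and ?M = "rep_tensor H (Jm n V) N"
  let ?e = "?d * n"
  note J = Jm_rep[OF V order_refl] and Jg = gact_Jm[OF V order_refl] and Jy = yact_Jm[OF V order_refl]
  note T = H_tens[OF J N]
  let ?W = "rep_tensor KA V (res N)"
  note W = C.K_tens[OF V res(1)[OF N]]
  have n0: "0 < n" and n1: "n - 1 < n" using n2 by auto
  define z where "z = inv (g [^] (n - 1))"
  have z: "z \<in> carrier G" by (simp add: z_def g_closed)
  have zc: "gact N z * gact N h = gact N h * gact N z" if h: "h \<in> carrier G" for h
  proof -
    have "h \<otimes> g [^] k = g [^] k \<otimes> h" for k :: nat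
      by (induction k) (use h g_closed g_central[OF h] in \<open>auto simp: m_assoc[symmetric] nat_pow_Suc\<close>,
        simp add: m_assoc g_closed h g_central[OF h])
    then have w: "h \<otimes> g [^] (n - 1) = g [^] (n - 1) \<otimes> h" .
    have gw: "g [^] (n - 1) \<in> carrier G" by (simp add: g_closed)
    have "z \<otimes> h = z \<otimes> (h \<otimes> (g [^] (n - 1) \<otimes> z))" unfolding z_def using gw h by simp
    also have "\<dots> = z \<otimes> ((h \<otimes> g [^] (n - 1)) \<otimes> z)" using gw h z by (simp only: m_assoc)
    also have "\<dots> = (z \<otimes> g [^] (n - 1)) \<otimes> (h \<otimes> z)" unfolding w using gw h z by (simp only: m_assoc m_closed)
    also have "\<dots> = h \<otimes> z" unfolding z_def using gw h by simp
    finally have "z \<otimes> h = h \<otimes> z" .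
    then show ?thesis using gact_mult[OF N z h] gact_mult[OF N h z] by simp
  qed
  have gp: "idm ?N * gact N g ^ k = gact N (g [^] k)" for k :: nat
  proof (induction k)
    case 0
    then show ?case by (simp add: gact_one[OF N])
  next
    case (Suc k)
    have "idm ?N * gact N g ^ Suc k = (idm ?N * gact N g ^ k) * gact N g" by (simp add: power_commutes mult.assoc)
    then show ?case using Suc gact_mult[OF N nat_pow_closed[OF g_closed] g_closed] by simp
  qed
  have zg: "gact N z * gact N g ^ (n - 1) = idm ?N"
  proof -
    have "gact N z * gact N g ^ (n - 1) = gact N z * (idm ?N * gact N g ^ (n - 1))"
      by (simp add: mult.assoc[symmetric] dm_right[OF gact_dm[OF N z]])
    also have "\<dots> = gact N (z \<otimes> g [^] (n - 1))" using gact_mult[OF N z, of "g [^] (n - 1)"] g_closed by (simp add: gp)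
    finally show ?thesis using g_closed by (simp add: z_def gact_one[OF N])
  qed
  let ?i = "kr ?N ?N (sinj ?d n 0) (idm ?N)" and ?p = "kr ?N ?N (sprj ?d n (n - 1)) (gact N z)"
  have tY: "tY (Jm n V) N = kr ?N ?N (mY ?d n) (gact N g) + kr ?N ?N (idm ?e) (yact N)"
    by (simp add: tY_def Jy)
  have key: "kr ?N ?N (sprj ?d n k) X * (tY (Jm n V) N ^ s * ?i) = (if s = k then kr ?N ?N (idm ?d) (X * gact N g ^ k) else 0)"
    if "k < n" "s \<le> k" "dm ?N ?N X" for k s X
    using that
  proof (induction s arbitrary: k X)
    case 0
    then show ?case by (simp add: kr_mult prj_inj dm_right)
  next
    case (Suc s)
    then obtain j where j: "k = Suc j" "s \<le> j" by (cases k) auto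
    have "kr ?N ?N (sprj ?d n k) X * tY (Jm n V) N = kr ?N ?N (sprj ?d n j) (X * gact N g) + kr ?N ?N (sprj ?d n k) (X * yact N)"
      using Suc.prems sprj_mY[of k n ?d] j by (simp add: tY distrib_left kr_mult dm_right[OF dm_prj])
    then have "kr ?N ?N (sprj ?d n k) X * (tY (Jm n V) N ^ Suc s * ?i) =
        kr ?N ?N (sprj ?d n j) (X * gact N g) * (tY (Jm n V) N ^ s * ?i)
        + kr ?N ?N (sprj ?d n k) (X * yact N) * (tY (Jm n V) N ^ s * ?i)"
      by (simp add: mult.assoc[symmetric] distrib_right)
    also have "\<dots> = (if Suc s = k then kr ?N ?N (idm ?d) (X * gact N g ^ k) else 0)"
      using Suc.IH[of k "X * yact N"] Suc.IH[of j "X * gact N g"] Suc.prems j dm_mult[OF Suc.prems(3) yact_dm[OF N]]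
        dm_mult[OF Suc.prems(3) gact_dm[OF N g_closed]] by (simp add: mult.assoc)
    finally show ?case .
  qed
  have iso: "rep_iso H (Jm n ?W) ?M"
  proof (rule Jm_iso[OF T(1) W(1) n0 order_refl])
    show "fst ?M = fst ?W * n" by (simp add: res(2)[OF N])
    show "dm (fst ?M) (fst ?W) ?i" using dm_kr[OF dm_inj[OF n0] dm_idm] by (simp add: res(2)[OF N])
    show "dm (fst ?W) (fst ?M) ?p" using dm_kr[OF dm_prj[OF n1] gact_dm[OF N z]] by (simp add: res(2)[OF N])
    show "gact ?M h * ?i = ?i * C.ga ?W h" if h: "h \<in> carrier G" for h
      using mg_inj[OF V h n0] h gact_dm[OF N h]
      by (simp add: T(2)[OF h] tg_def Jg[OF h] W(2)[OF h] res(2,3)[OF N] kr_mult[OF gact_dm[OF N h]] kr_mult[OF dm_idm] dm_left dm_right)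
    show "?p * gact ?M h = inverse (\<chi> h) ^ (n - 1) *\<^sub>c (C.ga ?W h * ?p)" if h: "h \<in> carrier G" for h
      using sprj_mg[OF V h n1] h zc[OF h]
      by (simp add: T(2)[OF h] tg_def Jg[OF h] W(2)[OF h] res(2,3)[OF N] kr_mult[OF gact_dm[OF N h]] kr_mult[OF gact_dm[OF N z]])
    show "yact ?M ^ n * ?i = 0" "?p * yact ?M ^ n = 0" by (simp_all add: yact_nilp[OF T(1)])
    show "?p * yact ?M ^ (n - 1) * ?i = idm (fst ?W)"
      using key[OF n1 order_refl gact_dm[OF N z]] by (simp add: T(3) mult.assoc zg kr_idm res(2)[OF N] del: One_nat_def)
  qed
  then show ?thesis
    using H.projective_iso[OF Jm_projective[OF W(1)] T(1)] H.rep_iso_sym[OF Jm_rep[OF W(1) order_refl] T(1)] by blast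
qed

text \<open>Every projective module is a retract of some \<open>Jm n V\<close>, and tensoring
  preserves retracts.\<close>

sublocale H: stab H
proof
  fix P M assume P: "projective H P" and M: "is_rep H M"
  note Pr = H.projective_rep[OF P]
  obtain V s r where V: "is_rep KA V" and sr: "s \<in> Hm H P (Jm n V)" "r \<in> Hm H (Jm n V) P" "r * s = idm (fst P)"
    by (rule projective_Jm_retract[OF P])
  note Jr = Jm_rep[OF V order_refl]
  show "projective H (rep_tensor H P M)"
  proof (rule H.projective_retract[OF tensor_Jm_projective_left[OF M V] H_tens(1)[OF Pr M]
      H.Hm_tens[OF Pr M Jr M sr(1) H.Hm_id[OF M]] H.Hm_tens[OF Jr M Pr M sr(2) H.Hm_id[OF M]]])
    show "kr (fst M) (fst M) r (idm (fst M)) * kr (fst M) (fst M) s (idm (fst M)) = idm (fst (rep_tensor H P M))"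
      by (simp add: kr_mult sr(3) kr_idm)
  qed
  show "projective H (rep_tensor H M P)"
  proof (rule H.projective_retract[OF tensor_Jm_projective_right[OF M V] H_tens(1)[OF M Pr]
      H.Hm_tens[OF M Pr M Jr H.Hm_id[OF M] sr(1)] H.Hm_tens[OF M Jr M Pr H.Hm_id[OF M] sr(2)]])
    show "kr (fst P) (fst (Jm n V)) (idm (fst M)) r * kr (fst (Jm n V)) (fst P) (idm (fst M)) s = idm (fst (rep_tensor H M P))"
      by (simp add: kr_mult[OF Hm_dm[OF sr(2)]] sr(3) kr_idm del: fst_Jm)
  qed
qed

end

context datum
begin

section \<open>The layers of the socle\<close>

text \<open>\<open>V\<close> is a copy of the quotient of \<open>ker y \<inter> im y\<^sup>j\<close> by \<open>ker y \<inter> im y\<^sup>j\<^sup>+\<^sup>1\<close>, with the action of \<open>G\<close>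
  twisted by \<open>\<chi>\<^sup>j\<close>; elements of \<open>M\<close> are replaced by matrices with arbitrarily many columns.\<close>

definition soc :: "nat \<Rightarrow> (nat \<times> 'g \<Rightarrow> 'k, 'k) rep \<Rightarrow> ('g \<Rightarrow> 'k, 'k) rep \<Rightarrow> 'k rfm \<Rightarrow> 'k rfm \<Rightarrow> bool" where
  "soc j M V \<iota> \<pi> \<longleftrightarrow> dm (fst M) (fst V) \<iota> \<and> dm (fst V) (fst M) \<pi> \<and>
    (\<forall>h\<in>carrier G. gact M h * \<iota> = inverse (\<chi> h) ^ j *\<^sub>c (\<iota> * C.ga V h)) \<and>
    (\<forall>h\<in>carrier G. \<pi> * gact M h = inverse (\<chi> h) ^ j *\<^sub>c (C.ga V h * \<pi>)) \<and>
    yact M * \<iota> = 0 \<and> (\<exists>Z. dm (fst M) (fst V) Z \<and> \<iota> = yact M ^ j * Z) \<and> \<pi> * \<iota> = idm (fst V) \<and>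
    (\<forall>c X Z. dm (fst M) c X \<longrightarrow> dm (fst M) c Z \<longrightarrow> X = yact M ^ j * Z \<longrightarrow> yact M * X = 0 \<longrightarrow> \<pi> * X = 0 \<longrightarrow>
      (\<exists>Z'. dm (fst M) c Z' \<and> X = yact M ^ Suc j * Z')) \<and>
    (\<forall>c Z. dm (fst M) c Z \<longrightarrow> yact M ^ Suc (Suc j) * Z = 0 \<longrightarrow> \<pi> * (yact M ^ Suc j * Z) = 0)"

lemma soc_im: "soc j M V \<iota> \<pi> \<Longrightarrow> \<exists>Z. dm (fst M) (fst V) Z \<and> \<iota> = yact M ^ j * Z"
  by (simp add: soc_def)

lemma soc_ker: "soc j M V \<iota> \<pi> \<Longrightarrow> dm (fst M) c X \<Longrightarrow> dm (fst M) c Z \<Longrightarrow> X = yact M ^ j * Z \<Longrightarrow>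
    yact M * X = 0 \<Longrightarrow> \<pi> * X = 0 \<Longrightarrow> \<exists>Z'. dm (fst M) c Z' \<and> X = yact M ^ Suc j * Z'"
  unfolding soc_def by (elim conjE) metis

lemma soc_kills: "soc j M V \<iota> \<pi> \<Longrightarrow> dm (fst M) c Z \<Longrightarrow> yact M ^ Suc (Suc j) * Z = 0 \<Longrightarrow>
    \<pi> * (yact M ^ Suc j * Z) = 0"
  unfolding soc_def by (elim conjE) metis

lemma Hm_yact:
  assumes "is_rep H M" "is_rep H N" "f \<in> Hm H M N"
  shows "f * yact M ^ k = yact N ^ k * f"
proof -
  have "f * yact M = yact N * f" using assms by (simp add: Hm_iff)
  then show ?thesis by (induction k) (auto simp: mult.assoc[symmetric], simp add: mult.assoc)
qed

lemma Hm_yact3: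
  assumes "is_rep H M" "is_rep H N" "f \<in> Hm H M N"
  shows "f * (yact M ^ k * X) = yact N ^ k * (f * X)" "f * (yact M * X) = yact N * (f * X)"
  using Hm_yact[OF assms, of k] Hm_yact[OF assms, of 1] by (simp_all add: mult.assoc[symmetric])

lemma Hm_gact: "is_rep H M \<Longrightarrow> is_rep H N \<Longrightarrow> f \<in> Hm H M N \<Longrightarrow> h \<in> carrier G \<Longrightarrow> f * gact M h = gact N h * f"
  by (simp add: Hm_iff)

text \<open>On ker y a map through a projective module lands in im y^(n-1), hence in im y^(j+1),
  which the layer ignores. So f' f induces the identity on the layer of M, and passing through the
  layer of N in between loses only elements of im y^(j+1).\<close>

lemma soc_half:
  assumes M: "is_rep H M" and N: "is_rep H N" and V: "is_rep KA V" and W: "is_rep KA W" and j: "Suc j < n"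
    and s: "soc j M V \<iota> \<pi>" and s': "soc j N W \<iota>' \<pi>'" and f: "f \<in> Hm H M N" and f': "f' \<in> Hm H N M"
    and fp: "H.fproj M M (f' * f - idm (fst M))"
  shows "(\<pi> * f' * \<iota>') * (\<pi>' * f * \<iota>) = idm (fst V)" "\<pi>' * f * \<iota> \<in> Hm KA V W"
proof -
  have d: "dm (fst M) (fst V) \<iota>" "dm (fst V) (fst M) \<pi>" "dm (fst N) (fst W) \<iota>'" "dm (fst W) (fst N) \<pi>'"
    "dm (fst N) (fst M) f" "dm (fst M) (fst N) f'"
    using s s' Hm_dm[OF f] Hm_dm[OF f'] by (auto simp: soc_def)
  obtain Z Z' where Z: "dm (fst M) (fst V) Z" "\<iota> = yact M ^ j * Z" "dm (fst N) (fst W) Z'" "\<iota>' = yact N ^ j * Z'"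
    using soc_im[OF s] soc_im[OF s'] by blast
  have e: "yact M * \<iota> = 0" "yact N * \<iota>' = 0" "\<pi> * \<iota> = idm (fst V)" "\<pi>' * \<iota>' = idm (fst W)"
    using s s' by (auto simp: soc_def)
  note c1 = soc_ker[OF s'] and c2 = soc_kills[OF s]
  note F = Hm_yact3[OF M N f] and F' = Hm_yact3[OF N M f']
  define U where "U = \<pi>' * (f * \<iota>)"
  have U: "dm (fst W) (fst V) U" unfolding U_def by (rule dm_mult[OF d(4) dm_mult[OF d(5,1)]])
  \<comment> \<open>The error of replacing \<open>f * \<iota>\<close> by its class in the layer of
    N. It lies in ker y and im y^j and has class 0, hence lies in im y^(j+1), and its image under
    \<open>f'\<close> is killed by \<pi>.\<close>
  define X where "X = f * \<iota> - \<iota>' * U"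
  have X1: "dm (fst N) (fst V) X" unfolding X_def by (intro dm_diff dm_mult[OF d(5,1)] dm_mult[OF d(3) U])
  have X2: "X = yact N ^ j * (f * Z - Z' * U)"
    by (simp add: X_def Z(2,4) F right_diff_distrib mult.assoc)
  have X3: "dm (fst N) (fst V) (f * Z - Z' * U)" by (intro dm_diff dm_mult[OF d(5) Z(1)] dm_mult[OF Z(3) U])
  have "yact N * (\<iota>' * U) = 0" by (simp add: mult.assoc[symmetric] e(2))
  then have X4: "yact N * X = 0"
    using F(2)[of \<iota>] by (simp add: X_def right_diff_distrib e(1))
  have "\<pi>' * (\<iota>' * U) = U" using U by (simp add: mult.assoc[symmetric] e(4) dm_left)
  then have X5: "\<pi>' * X = 0" by (simp add: X_def right_diff_distrib U_def)
  obtain Z2 where Z2: "dm (fst N) (fst V) Z2" "X = yact N ^ Suc j * Z2"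
    using c1[OF X1 X3 X2 X4 X5] by blast
  have "yact M ^ Suc (Suc j) * (f' * Z2) = f' * (yact N * X)"
    using F'(1)[of "Suc (Suc j)" Z2] by (simp add: Z2(2) mult.assoc)
  then have "\<pi> * (yact M ^ Suc j * (f' * Z2)) = 0"
    using c2[OF dm_mult[OF d(6) Z2(1)]] X4 by simp
  then have pX: "\<pi> * (f' * X) = 0" using F'(1)[of "Suc j" Z2] by (simp add: Z2(2) del: power_Suc)
  obtain P a b where P: "projective H P" "a \<in> Hm H M P" "b \<in> Hm H P M" "f' * f - idm (fst M) = b * a"
    using fp unfolding H.fproj_def by blast
  note Pr = H.projective_rep[OF P(1)]
  have "yact P * (a * \<iota>) = 0" using Hm_yact3(2)[OF M Pr P(2), of \<iota>] e(1) by simp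
  then obtain Z3 where Z3: "dm (fst P) (fst V) Z3" "a * \<iota> = yact P ^ (n - 1) * Z3"
    using projective_kernel[OF P(1) dm_mult[OF Hm_dm[OF P(2)] d(1)]] by blast
  \<comment> \<open>y^(n-1) is split as y^(j+1) times the remaining power, which exists because j +
    1 < n.\<close>
  define Z4 where "Z4 = yact M ^ (n - 1 - Suc j) * (b * Z3)"
  have Z4: "dm (fst M) (fst V) Z4" unfolding Z4_def
    by (intro dm_power_mult yact_dm M dm_mult[OF Hm_dm[OF P(3)] Z3(1)])
  have ba: "b * (a * \<iota>) = yact M ^ Suc j * Z4"
  proof -
    have "n - 1 = Suc j + (n - 1 - Suc j)" using j by simp
    then have "yact M ^ (n - 1) = yact M ^ Suc j * yact M ^ (n - 1 - Suc j)" by (metis power_add)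
    then show ?thesis
      by (simp only: Z3(2) Hm_yact3(1)[OF Pr M P(3)] Z4_def mult.assoc)
  qed
  have "yact M ^ Suc (Suc j) * Z4 = yact M * (b * (a * \<iota>))" by (simp add: ba mult.assoc)
  also have "\<dots> = b * (a * (yact M * \<iota>))"
    by (simp add: Hm_yact3(2)[OF M Pr P(2)] Hm_yact3(2)[OF Pr M P(3)])
  finally have "\<pi> * (b * (a * \<iota>)) = 0" using c2[OF Z4] e(1) by (simp add: ba del: power_Suc)
  then have "\<pi> * ((f' * f - idm (fst M)) * \<iota>) = 0" by (simp add: P(4) mult.assoc)
  then have "\<pi> * (f' * (f * \<iota>)) = idm (fst V)"
    using e(3) d(1) by (simp add: left_diff_distrib right_diff_distrib mult.assoc dm_left)
  moreover have "\<iota>' * U = f * \<iota> - X" by (simp add: X_def)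
  ultimately have "\<pi> * (f' * (\<iota>' * U)) = idm (fst V)" using pX by (simp add: right_diff_distrib)
  then show "(\<pi> * f' * \<iota>') * (\<pi>' * f * \<iota>) = idm (fst V)" by (simp add: U_def mult.assoc)
  have "U * C.ga V h = C.ga W h * U" if h: "h \<in> carrier G" for h
  proof -
    have 1: "gact M h * \<iota> = inverse (\<chi> h) ^ j *\<^sub>c (\<iota> * C.ga V h)" "\<pi>' * gact N h = inverse (\<chi> h) ^ j *\<^sub>c (C.ga W h * \<pi>')"
      using s s' h by (auto simp: soc_def)
    have "\<chi> h ^ j *\<^sub>c (gact M h * \<iota>) = \<iota> * C.ga V h"
      by (simp add: 1(1) chi_inv_cancel[OF h])
    then have "U * C.ga V h = \<chi> h ^ j *\<^sub>c (\<pi>' * ((f * gact M h) * \<iota>))"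
      by (simp add: U_def mult.assoc) (metis scl_mult_right)
    also have "f * gact M h = gact N h * f" by (rule Hm_gact[OF M N f h])
    also have "\<chi> h ^ j *\<^sub>c (\<pi>' * (gact N h * f * \<iota>)) = \<chi> h ^ j *\<^sub>c ((\<pi>' * gact N h) * (f * \<iota>))" by (simp add: mult.assoc)
    also have "\<dots> = C.ga W h * U" by (simp add: 1(2) chi_inv_cancel[OF h] U_def mult.assoc)
    finally show ?thesis .
  qed
  then show "\<pi>' * f * \<iota> \<in> Hm KA V W" using U by (simp add: C.K_hom_iff[OF V W] U_def mult.assoc)
qed

text \<open>\<open>soc_half\<close> applied in both directions. The case M = N shows that the layer
  does not depend on the choice of \<iota> and \<pi>.\<close>

lemma soc_unique:
  assumes "is_rep H M" "is_rep H N" "is_rep KA V" "is_rep KA W" "Suc j < n"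
    "soc j M V \<iota> \<pi>" "soc j N W \<iota>' \<pi>'" "st_iso H M N"
  shows "rep_iso KA V W"
proof -
  obtain f g where fg: "f \<in> Hm H M N" "g \<in> Hm H N M" "H.fproj M M (g * f - idm (fst M))" "H.fproj N N (f * g - idm (fst N))"
    using assms(8) H.st_iso_iff[OF assms(1,2)] unfolding H.st_def by blast
  note 1 = soc_half[OF assms(1-7) fg(1-3)] and 2 = soc_half[OF assms(2,1,4,3,5,7,6) fg(2,1,4)]
  show ?thesis by (rule C.K.rep_isoI[OF assms(3,4) 1(2) 2(2) 1(1) 2(1)])
qed

lemma soc_sum:
  assumes M: "is_rep H M" and N: "is_rep H N" and V: "is_rep KA V" and W: "is_rep KA W"
    and s: "soc j M V \<iota> \<pi>" and s': "soc j N W \<iota>' \<pi>'"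
  shows "\<exists>\<iota> \<pi>. soc j (rep_sum M N) (rep_sum V W) \<iota> \<pi>"
proof -
  let ?S = "rep_sum M N" and ?T = "rep_sum V W"
  note S = H.rep_sum_rep[OF M N] and T = C.K.rep_sum_rep[OF V W]
  obtain i k p q where b: "H.bip ?S M N i k p q" using H.rep_sum_bip'[OF M N] by blast
  obtain a c u v where b': "C.K.bip ?T V W a c u v" using C.K.rep_sum_bip'[OF V W] by blast
  have h: "i \<in> Hm H M ?S" "k \<in> Hm H N ?S" "p \<in> Hm H ?S M" "q \<in> Hm H ?S N"
    and e: "p * i = idm (fst M)" "q * k = idm (fst N)" "p * k = 0" "q * i = 0" "i * p + k * q = idm (fst ?S)"
    using b by (auto simp: H.bip_def)
  have h': "a \<in> Hm KA V ?T" "c \<in> Hm KA W ?T" "u \<in> Hm KA ?T V" "v \<in> Hm KA ?T W"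
    and e': "u * a = idm (fst V)" "v * c = idm (fst W)" "u * c = 0" "v * a = 0" "a * u + c * v = idm (fst ?T)"
    using b' by (auto simp: C.K.bip_def)
  note hd = h[THEN Hm_dm] and hd' = h'[THEN Hm_dm]
  have e3: "p * (i * X) = idm (fst M) * X" "q * (k * X) = idm (fst N) * X" "p * (k * X) = 0" "q * (i * X) = 0"
    "u * (a * X) = idm (fst V) * X" "v * (c * X) = idm (fst W) * X" "u * (c * X) = 0" "v * (a * X) = 0" for X
    by (simp_all add: mult.assoc[symmetric] e e')
  note hY = Hm_yact3[OF M S h(1)] Hm_yact3[OF N S h(2)] Hm_yact3[OF S M h(3)] Hm_yact3[OF S N h(4)]
  note hG = Hm_gact[OF M S h(1)] Hm_gact[OF N S h(2)] Hm_gact[OF S M h(3)] Hm_gact[OF S N h(4)]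
  have kG: "a * C.ga V h = C.ga ?T h * a" "c * C.ga W h = C.ga ?T h * c" "u * C.ga ?T h = C.ga V h * u" "v * C.ga ?T h = C.ga W h * v"
    if "h \<in> carrier G" for h
    using h' that by (simp_all add: C.K_hom_iff V W T)
  have d: "dm (fst M) (fst V) \<iota>" "dm (fst V) (fst M) \<pi>" "dm (fst N) (fst W) \<iota>'" "dm (fst W) (fst N) \<pi>'"
    using s s' by (auto simp: soc_def)
  obtain Z Z' where Z: "dm (fst M) (fst V) Z" "\<iota> = yact M ^ j * Z" "dm (fst N) (fst W) Z'" "\<iota>' = yact N ^ j * Z'"
    using soc_im[OF s] soc_im[OF s'] by blast
  have z: "yact M * \<iota> = 0" "yact N * \<iota>' = 0" "\<pi> * \<iota> = idm (fst V)" "\<pi>' * \<iota>' = idm (fst W)"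
    using s s' by (auto simp: soc_def)
  have z3: "yact M * (\<iota> * X) = 0" "yact N * (\<iota>' * X) = 0" "\<pi> * (\<iota> * X) = idm (fst V) * X" "\<pi>' * (\<iota>' * X) = idm (fst W) * X" for X
    by (simp_all add: mult.assoc[symmetric] z)
  let ?i = "i * (\<iota> * u) + k * (\<iota>' * v)" and ?p = "a * (\<pi> * p) + c * (\<pi>' * q)"
  have "soc j ?S ?T ?i ?p"
    unfolding soc_def
  proof (intro conjI allI impI ballI)
    show "dm (fst ?S) (fst ?T) ?i" "dm (fst ?T) (fst ?S) ?p"
      by (intro dm_add dm_mult[OF hd(1) dm_mult[OF d(1) hd'(3)]] dm_mult[OF hd(2) dm_mult[OF d(3) hd'(4)]]
        dm_mult[OF hd'(1) dm_mult[OF d(2) hd(3)]] dm_mult[OF hd'(2) dm_mult[OF d(4) hd(4)]])+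
    show "yact ?S * ?i = 0" by (simp add: distrib_left hY(2,4)[symmetric] z3)
    show "\<exists>Z. dm (fst ?S) (fst ?T) Z \<and> ?i = yact ?S ^ j * Z"
      by (rule exI[of _ "i * (Z * u) + k * (Z' * v)"])
        (simp add: Z(2,4) distrib_left mult.assoc hY(1,3)[symmetric] dm_add dm_mult[OF hd(1) dm_mult[OF Z(1) hd'(3)]] dm_mult[OF hd(2) dm_mult[OF Z(3) hd'(4)]] del: fst_rep_sum)
    show "?p * ?i = idm (fst ?T)"
      using e'(5) d hd' by (simp add: distrib_left distrib_right mult.assoc e3 z3 dm_left3[OF d(1)] dm_left3[OF d(3)] dm_left[OF hd'(3)] dm_left[OF hd'(4)] del: fst_rep_sum)
    fix h assume hh: "h \<in> carrier G"
    have 1: "gact M h * \<iota> = inverse (\<chi> h) ^ j *\<^sub>c (\<iota> * C.ga V h)" "gact N h * \<iota>' = inverse (\<chi> h) ^ j *\<^sub>c (\<iota>' * C.ga W h)"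
       "\<pi> * gact M h = inverse (\<chi> h) ^ j *\<^sub>c (C.ga V h * \<pi>)" "\<pi>' * gact N h = inverse (\<chi> h) ^ j *\<^sub>c (C.ga W h * \<pi>')"
      using s s' hh by (auto simp: soc_def)
    have "gact ?S h * ?i = i * ((gact M h * \<iota>) * u) + k * ((gact N h * \<iota>') * v)"
      by (simp add: distrib_left mult.assoc[symmetric] hG(1,2)[OF hh, symmetric])
    also have "\<dots> = inverse (\<chi> h) ^ j *\<^sub>c (i * (\<iota> * (C.ga V h * u)) + k * (\<iota>' * (C.ga W h * v)))"
      by (simp add: 1 scl_add mult.assoc)
    also have "\<dots> = inverse (\<chi> h) ^ j *\<^sub>c (?i * C.ga ?T h)"
      by (simp add: kG(3,4)[OF hh, symmetric] distrib_right mult.assoc)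
    finally show "gact ?S h * ?i = inverse (\<chi> h) ^ j *\<^sub>c (?i * C.ga ?T h)" .
    have "?p * gact ?S h = a * ((\<pi> * gact M h) * p) + c * ((\<pi>' * gact N h) * q)"
      by (simp add: distrib_right mult.assoc hG(3,4)[OF hh])
    also have "\<dots> = inverse (\<chi> h) ^ j *\<^sub>c ((a * C.ga V h) * (\<pi> * p) + (c * C.ga W h) * (\<pi>' * q))"
      by (simp add: 1 scl_add mult.assoc)
    also have "\<dots> = inverse (\<chi> h) ^ j *\<^sub>c (C.ga ?T h * ?p)"
      by (simp add: kG(1,2)[OF hh] distrib_left mult.assoc)
    finally show "?p * gact ?S h = inverse (\<chi> h) ^ j *\<^sub>c (C.ga ?T h * ?p)" .
  next
    fix cc X Y assume X: "dm (fst ?S) cc X" "dm (fst ?S) cc Y" "X = yact ?S ^ j * Y" "yact ?S * X = 0" "?p * X = 0"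
    have "u * (?p * X) = \<pi> * (p * X)" "v * (?p * X) = \<pi>' * (q * X)"
      using dm_left3[OF d(2)] dm_left3[OF d(4)] by (simp_all add: distrib_right distrib_left mult.assoc e3)
    then have pX: "\<pi> * (p * X) = 0" "\<pi>' * (q * X) = 0" using X(5) by auto
    have "\<exists>Z1. dm (fst M) cc Z1 \<and> p * X = yact M ^ Suc j * Z1"
    proof -
      have "p * X = yact M ^ j * (p * Y)" "yact M * (p * X) = 0"
        using hY(5)[of j Y] hY(6)[of X] X(4) by (simp_all add: X(3))
      then show ?thesis by (rule soc_ker[OF s dm_mult[OF hd(3) X(1)] dm_mult[OF hd(3) X(2)] _ _ pX(1)])
    qed
    then obtain Z1 where Z1: "dm (fst M) cc Z1" "p * X = yact M ^ Suc j * Z1" by blast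
    have "\<exists>Z2. dm (fst N) cc Z2 \<and> q * X = yact N ^ Suc j * Z2"
    proof -
      have "q * X = yact N ^ j * (q * Y)" "yact N * (q * X) = 0"
        using hY(7)[of j Y] hY(8)[of X] X(4) by (simp_all add: X(3))
      then show ?thesis by (rule soc_ker[OF s' dm_mult[OF hd(4) X(1)] dm_mult[OF hd(4) X(2)] _ _ pX(2)])
    qed
    then obtain Z2 where Z2: "dm (fst N) cc Z2" "q * X = yact N ^ Suc j * Z2" by blast
    have "X = (i * p + k * q) * X" using X(1) by (simp add: e(5) dm_left del: fst_rep_sum)
    also have "\<dots> = i * (p * X) + k * (q * X)" by (simp only: distrib_right mult.assoc)
    also have "\<dots> = yact ?S ^ Suc j * (i * Z1 + k * Z2)"
      by (simp only: Z1(2) Z2(2) hY(1,3) distrib_left)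
    finally show "\<exists>Z'. dm (fst ?S) cc Z' \<and> X = yact ?S ^ Suc j * Z'"
      using dm_add[OF dm_mult[OF hd(1) Z1(1)] dm_mult[OF hd(2) Z2(1)]] by blast
  next
    fix cc Y assume Y: "dm (fst ?S) cc Y" "yact ?S ^ Suc (Suc j) * Y = 0"
    have "\<pi> * (yact M ^ Suc j * (p * Y)) = 0"
    proof -
      have "yact M ^ Suc (Suc j) * (p * Y) = 0" using Y(2) hY(5)[of "Suc (Suc j)" Y] by simp
      then show ?thesis by (rule soc_kills[OF s dm_mult[OF hd(3) Y(1)]])
    qed
    moreover have "\<pi>' * (yact N ^ Suc j * (q * Y)) = 0"
    proof -
      have "yact N ^ Suc (Suc j) * (q * Y) = 0" using Y(2) hY(7)[of "Suc (Suc j)" Y] by simp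
      then show ?thesis by (rule soc_kills[OF s' dm_mult[OF hd(4) Y(1)]])
    qed
    moreover have "?p * (yact ?S ^ Suc j * Y) = a * (\<pi> * (yact M ^ Suc j * (p * Y))) + c * (\<pi>' * (yact N ^ Suc j * (q * Y)))"
      by (simp only: distrib_right mult.assoc hY(5,7))
    ultimately show "?p * (yact ?S ^ Suc j * Y) = 0" by (simp only: mult_zero_right add_0)
  qed
  then show ?thesis by blast
qed

lemma soc_iso:
  assumes M: "is_rep H M" and N: "is_rep H N" and iso: "rep_iso H M N" and s: "soc j N V \<iota> \<pi>"
  shows "\<exists>\<iota> \<pi>. soc j M V \<iota> \<pi>"
proof -
  obtain f g where fg: "f \<in> Hm H M N" "g \<in> Hm H N M" "g * f = idm (fst M)" "f * g = idm (fst N)"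
    using iso H.rep_iso_iff[OF M N] by blast
  note F = Hm_yact3[OF M N fg(1)] and F' = Hm_yact3[OF N M fg(2)]
  note fd = Hm_dm[OF fg(1)] and gd = Hm_dm[OF fg(2)]
  have d: "dm (fst N) (fst V) \<iota>" "dm (fst V) (fst N) \<pi>" using s by (auto simp: soc_def)
  have e: "f * (g * X) = idm (fst N) * X" "g * (f * X) = idm (fst M) * X" for X by (simp_all add: mult.assoc[symmetric] fg)
  obtain Z where Z: "dm (fst N) (fst V) Z" "\<iota> = yact N ^ j * Z" using soc_im[OF s] by blast
  have "soc j M V (g * \<iota>) (\<pi> * f)"
    unfolding soc_def
  proof (intro conjI allI impI ballI)
    show "dm (fst M) (fst V) (g * \<iota>)" "dm (fst V) (fst M) (\<pi> * f)" by (rule dm_mult[OF gd d(1)] dm_mult[OF d(2) fd])+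
    show "yact M * (g * \<iota>) = 0" using s by (simp add: F'(2)[symmetric] soc_def)
    show "\<exists>Z. dm (fst M) (fst V) Z \<and> g * \<iota> = yact M ^ j * Z"
      by (rule exI[of _ "g * Z"]) (simp add: Z(2) F' dm_mult[OF gd Z(1)])
    show "\<pi> * f * (g * \<iota>) = idm (fst V)" using s d(1) by (simp add: mult.assoc e dm_left soc_def)
    fix h assume h: "h \<in> carrier G"
    have 1: "gact N h * \<iota> = inverse (\<chi> h) ^ j *\<^sub>c (\<iota> * C.ga V h)" "\<pi> * gact N h = inverse (\<chi> h) ^ j *\<^sub>c (C.ga V h * \<pi>)"
      using s h by (auto simp: soc_def)
    have "gact M h * (g * \<iota>) = g * (gact N h * \<iota>)"
      using Hm_gact[OF N M fg(2) h] by (simp add: mult.assoc[symmetric])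
    then show "gact M h * (g * \<iota>) = inverse (\<chi> h) ^ j *\<^sub>c (g * \<iota> * C.ga V h)" by (simp add: 1 mult.assoc)
    have "\<pi> * f * gact M h = (\<pi> * gact N h) * f" using Hm_gact[OF M N fg(1) h] by (simp add: mult.assoc)
    then show "\<pi> * f * gact M h = inverse (\<chi> h) ^ j *\<^sub>c (C.ga V h * (\<pi> * f))" by (simp add: 1 mult.assoc)
  next
    fix c X Y assume X: "dm (fst M) c X" "dm (fst M) c Y" "X = yact M ^ j * Y" "yact M * X = 0" "\<pi> * f * X = 0"
    have "f * X = yact N ^ j * (f * Y)" "yact N * (f * X) = 0" "\<pi> * (f * X) = 0"
      using F(1)[of j Y] F(2)[of X] X(4,5) by (simp_all add: X(3) mult.assoc)
    then obtain Z' where Z': "dm (fst N) c Z'" "f * X = yact N ^ Suc j * Z'"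
      using soc_ker[OF s dm_mult[OF fd X(1)] dm_mult[OF fd X(2)]] by blast
    have "X = g * (f * X)" using X(1) by (simp add: e dm_left)
    also have "\<dots> = yact M ^ Suc j * (g * Z')" by (simp only: Z'(2) F'(1))
    finally show "\<exists>Z'. dm (fst M) c Z' \<and> X = yact M ^ Suc j * Z'"
      using dm_mult[OF gd Z'(1)] by blast
  next
    fix c Y assume Y: "dm (fst M) c Y" "yact M ^ Suc (Suc j) * Y = 0"
    have "yact N ^ Suc (Suc j) * (f * Y) = 0" using Y(2) F(1)[of "Suc (Suc j)" Y] by simp
    then have "\<pi> * (yact N ^ Suc j * (f * Y)) = 0" by (rule soc_kills[OF s dm_mult[OF fd Y(1)]])
    then show "\<pi> * f * (yact M ^ Suc j * Y) = 0" by (simp add: mult.assoc F del: power_Suc)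
  qed
  then show ?thesis by blast
qed

lemma soc_zero_dim: "fst M = 0 \<Longrightarrow> fst V = 0 \<Longrightarrow> soc j M V 0 0"
proof -
  have "dm 0 c X \<longleftrightarrow> X = 0" for c and X :: "'k rfm" using dm_0_left by auto
  then show "fst M = 0 \<Longrightarrow> fst V = 0 \<Longrightarrow> soc j M V 0 0" by (auto simp: soc_def)
qed

section \<open>Layers of the modules Jm i V\<close>

lemma prj_mY_pow:
  assumes k: "k < i"
  shows "sprj d i k * mY d i ^ m = (if m \<le> k then sprj d i (k - m) else 0)"
proof (cases "m = 0")
  case False
  show ?thesis
  proof (rule inj_ext[of d d i])
    show "dm d (d * i) (sprj d i k * mY d i ^ m)" by (rule dm_mult_power[OF dm_mY dm_prj[OF k]])
    have "k - m < i" using k by simp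
    then show "dm d (d * i) (if m \<le> k then sprj d i (k - m) else 0 :: 'k rfm)" by (simp add: dm_prj)
    fix j assume "j < i"
    then show "sprj d i k * mY d i ^ m * sinj d i j = (if m \<le> k then sprj d i (k - m) else 0) * sinj d i j"
      using k by (auto simp: mult.assoc mY_pow_inj prj_inj)
  qed
qed simp

text \<open>The coordinate of y X in slot j + 1 is that of X in slot j, so only the last slot can
  survive.\<close>

lemma ker_mY:
  assumes i: "0 < i" and X: "dm (d * i) c X" "mY d i * X = 0"
  shows "X = sinj d i (i - 1) * (sprj d i (i - 1) * X)"
proof (rule prj_ext[OF X(1)])
  have i1: "i - 1 < i" using i by simp
  show "dm (d * i) c (sinj d i (i - 1) * (sprj d i (i - 1) * X))"
    by (rule dm_mult[OF dm_inj[OF i1] dm_mult[OF dm_prj[OF i1] X(1)]])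
  fix j assume j: "j < i"
  show "sprj d i j * X = sprj d i j * (sinj d i (i - 1) * (sprj d i (i - 1) * X))"
  proof (cases "j = i - 1")
    case True
    then show ?thesis using i1 by (simp add: prj_inj3 dm_left3[OF dm_prj] del: One_nat_def)
  next
    case False
    then have "Suc j < i" using j by simp
    then have "sprj d i (Suc j) * mY d i ^ 1 * X = sprj d i j * X" by (subst prj_mY_pow) auto
    then have "sprj d i j * X = 0" using X(2) by (simp add: mult.assoc)
    then show ?thesis using False j by (simp add: prj_inj3 del: One_nat_def)
  qed
qed

lemma mY_pow_top: "mY d i ^ i * Z = 0" if "dm (d * i) c Z" "0 < i"
proof (rule prj_ext[of d i c])
  show "dm (d * i) c (mY d i ^ i * Z)" by (rule dm_power_mult[OF dm_mY that(1)])
  fix j assume "j < i"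
  then show "sprj d i j * (mY d i ^ i * Z) = sprj d i j * 0"
    by (simp add: mult.assoc[symmetric] prj_mY_pow)
qed simp

text \<open>With i + 1 slots the kernel of y is slot i, which y^i reaches while y^(i+1) is 0. The
  twist in \<open>soc\<close> cancels the one of slot i, so the layer is V itself.\<close>

lemma soc_Jm:
  assumes V: "is_rep KA V" and i: "Suc i \<le> n"
  shows "soc i (Jm (Suc i) V) V (sinj (fst V) (Suc i) i) (sprj (fst V) (Suc i) i)"
proof -
  let ?d = "fst V" and ?i = "Suc i"
  note J = gact_Jm[OF V i] yact_Jm[OF V i]
  show ?thesis
    unfolding soc_def fst_Jm
  proof (intro conjI allI impI ballI)
    show "\<exists>Z. dm (?d * ?i) ?d Z \<and> sinj ?d ?i i = yact (Jm ?i V) ^ i * Z"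
      by (rule exI[of _ "sinj ?d ?i 0"]) (simp add: J mY_pow_inj dm_inj del: mult_Suc_right)
    show "\<exists>Z'. dm (?d * ?i) c Z' \<and> X = yact (Jm ?i V) ^ Suc i * Z'"
      if "dm (?d * ?i) c X" "yact (Jm ?i V) * X = 0" "sprj ?d ?i i * X = 0" for c X
    proof -
      have "X = 0" using ker_mY[of ?i ?d c X] that by (simp add: J)
      then show ?thesis by (intro exI[of _ 0]) simp
    qed
    show "sprj ?d ?i i * (yact (Jm ?i V) ^ Suc i * Z) = 0" if "dm (?d * ?i) c Z" for c Z
      using mY_pow_top[OF that] by (simp add: J del: power_Suc)
  qed (auto simp: J dm_inj dm_prj mg_inj[OF V] sprj_mg[OF V] mY_inj prj_inj simp del: mult_Suc_right)
qed

text \<open>For i \<le> j the image of y^j is 0; for i > j + 1 the kernel of y already lies in the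
  image of y^(j+1). The layer vanishes in both cases.\<close>

lemma soc_Jm_other:
  assumes V: "is_rep KA V" and i: "0 < i" "i \<le> n" "i \<noteq> Suc j" and W: "fst W = 0"
  shows "soc j (Jm i V) W 0 0"
proof -
  let ?d = "fst V"
  note J = yact_Jm[OF V i(2)]
  show ?thesis
    unfolding soc_def fst_Jm
  proof (intro conjI allI impI ballI)
    fix c X Z assume X: "dm (?d * i) c X" "dm (?d * i) c Z" "X = yact (Jm i V) ^ j * Z" "yact (Jm i V) * X = 0"
    show "\<exists>Z'. dm (?d * i) c Z' \<and> X = yact (Jm i V) ^ Suc j * Z'"
    proof (cases "i \<le> j")
      case True
      then have "mY ?d i ^ j * Z = mY ?d i ^ i * (mY ?d i ^ (j - i) * Z)"
        by (simp add: mult.assoc[symmetric] power_add[symmetric])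
      then have "X = 0" using X(3) mY_pow_top[OF dm_power_mult[OF dm_mY X(2)] i(1)] by (simp add: J)
      then show ?thesis by (intro exI[of _ 0]) simp
    next
      case False
      then have ij: "i - 1 = Suc j + (i - 1 - Suc j)" using i by simp
      have i1: "i - 1 < i" using i by simp
      have "X = sinj ?d i (i - 1) * (sprj ?d i (i - 1) * X)" using ker_mY[OF i(1) X(1)] X(4) by (simp add: J)
      also have "sinj ?d i (i - 1) = mY ?d i ^ (i - 1) * sinj ?d i 0" using i1 by (subst mY_pow_inj) auto
      also have "mY ?d i ^ (i - 1) = mY ?d i ^ Suc j * mY ?d i ^ (i - 1 - Suc j)"
        unfolding power_add[symmetric] using ij by simp
      finally have "X = yact (Jm i V) ^ Suc j * (mY ?d i ^ (i - 1 - Suc j) * (sinj ?d i 0 * (sprj ?d i (i - 1) * X)))"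
        by (simp only: J mult.assoc)
      moreover have "dm (?d * i) c (mY ?d i ^ (i - 1 - Suc j) * (sinj ?d i 0 * (sprj ?d i (i - 1) * X)))"
        using i by (intro dm_power_mult[OF dm_mY] dm_mult[OF dm_inj dm_mult[OF dm_prj[OF i1] X(1)]]) simp
      ultimately show ?thesis by blast
    qed
  qed (use W in \<open>auto\<close>)
qed

text \<open>Layers are assembled along \<open>H_rep_induct\<close>, so no quotient of subspaces of M
  has to be formed.\<close>

lemma soc_exists:
  assumes "is_rep H M" shows "\<exists>V \<iota> \<pi>. is_rep KA V \<and> soc j M V \<iota> \<pi>"
  using assms
proof (induction M rule: H_rep_induct)
  case (iso M N)
  then show ?case using soc_iso by blast
next
  case (zero M)
  then show ?case using soc_zero_dim[of M C.K.zrep j] C.K.zrep_rep C.K.fst_zrep by blast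
next
  case (jm i V)
  show ?case
  proof (cases "i = Suc j")
    case True
    then show ?thesis using soc_Jm[of V j] jm by blast
  next
    case False
    then show ?thesis using soc_Jm_other[OF jm(3,1,2) False C.K.fst_zrep] C.K.zrep_rep by blast
  qed
next
  case (sum M N)
  then show ?case using soc_sum[OF sum(1,2)] C.K.rep_sum_rep by meson
qed

definition layer :: "nat \<Rightarrow> (nat \<times> 'g \<Rightarrow> 'k, 'k) rep \<Rightarrow> ('g \<Rightarrow> 'k, 'k) rep" where
  "layer j M = (SOME V. is_rep KA V \<and> (\<exists>\<iota> \<pi>. soc j M V \<iota> \<pi>))"

lemma layer: "is_rep H M \<Longrightarrow> is_rep KA (layer j M) \<and> (\<exists>\<iota> \<pi>. soc j M (layer j M) \<iota> \<pi>)"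
  unfolding layer_def by (rule someI_ex) (use soc_exists[of M j] in blast)

lemma layer_iso:
  assumes "is_rep H M" "is_rep KA V" "soc j M V \<iota> \<pi>" "Suc j < n"
  shows "rep_iso KA (layer j M) V"
  using soc_unique[OF assms(1,1) _ assms(2,4) _ assms(3) H.st_iso_refl[OF assms(1)]] layer[OF assms(1)] by blast

lemma layer_st:
  assumes "is_rep H M" "is_rep H N" "st_iso H M N" "Suc j < n"
  shows "rep_iso KA (layer j M) (layer j N)"
  using soc_unique[OF assms(1,2) _ _ assms(4) _ _ assms(3)] layer[OF assms(1)] layer[OF assms(2)] by blast

lemma layer_sum:
  assumes "is_rep H M" "is_rep H N" "Suc j < n"
  shows "rep_iso KA (layer j (rep_sum M N)) (rep_sum (layer j M) (layer j N))"
proof -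
  obtain \<iota> \<pi> \<iota>' \<pi>' where "soc j M (layer j M) \<iota> \<pi>" "soc j N (layer j N) \<iota>' \<pi>'"
    using layer assms by blast
  moreover have "is_rep KA (layer j M)" "is_rep KA (layer j N)" using layer assms by blast+
  ultimately show ?thesis
    using soc_sum[OF assms(1,2)] layer_iso[OF H.rep_sum_rep[OF assms(1,2)] C.K.rep_sum_rep _ assms(3)] by meson
qed

end

context datum
begin

section \<open>Inflation of modules over the group algebra\<close>

definition infl :: "('g \<Rightarrow> 'k, 'k) rep \<Rightarrow> (nat \<times> 'g \<Rightarrow> 'k, 'k) rep" where
  "infl V = mkH (fst V) (C.ga V) 0"

lemma infl:
  assumes V: "is_rep KA V"
  shows "is_rep H (infl V)" "fst (infl V) = fst V" "h \<in> carrier G \<Longrightarrow> gact (infl V) h = C.ga V h" "yact (infl V) = 0"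
proof -
  have "relH (fst V) (C.ga V) 0"
    using n2 by (simp add: relH_def C.ga_dm V C.ga_one C.ga_mult power_0_left)
  from mkH[OF this] show "is_rep H (infl V)" "fst (infl V) = fst V"
    "h \<in> carrier G \<Longrightarrow> gact (infl V) h = C.ga V h" "yact (infl V) = 0"
    by (simp_all add: infl_def)
qed

lemma infl_iso:
  assumes V: "is_rep KA V" and W: "is_rep KA W" and iso: "rep_iso KA V W"
  shows "rep_iso H (infl V) (infl W)"
proof -
  obtain f f' where f: "f \<in> Hm KA V W" "f' \<in> Hm KA W V" "f' * f = idm (fst V)" "f * f' = idm (fst W)"
    using iso C.K.rep_iso_iff[OF V W] by blast
  have "f \<in> Hm H (infl V) (infl W)" "f' \<in> Hm H (infl W) (infl V)"
    using f V W by (auto simp: Hm_iff infl C.K_hom_iff)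
  then show ?thesis using H.rep_isoI[OF infl(1)[OF V] infl(1)[OF W]] f infl(2) V W by simp
qed

lemma infl_sum:
  assumes V: "is_rep KA V" and W: "is_rep KA W"
  shows "rep_iso H (infl (rep_sum V W)) (rep_sum (infl V) (infl W))"
proof (rule H_isoI)
  note S = C.K.rep_sum_rep[OF V W]
  show "is_rep H (infl (rep_sum V W))" by (rule infl(1)[OF S])
  show R: "is_rep H (rep_sum (infl V) (infl W))" by (rule H.rep_sum_rep[OF infl(1)[OF V] infl(1)[OF W]])
  show "fst (infl (rep_sum V W)) = fst (rep_sum (infl V) (infl W))" by (simp add: infl(2) S V W)
  show "gact (infl (rep_sum V W)) h = gact (rep_sum (infl V) (infl W)) h" if h: "h \<in> carrier G" for h
    using C.K.ac_rep_sum[OF V W C.K.bvec_carrier[OF h]] H.ac_rep_sum[OF infl(1)[OF V] infl(1)[OF W] H.bvec_carrier[OF B0[OF h]]] h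
    by (simp add: infl(2,3) S V W C.ga_def[symmetric] gact_def[symmetric])
  show "yact (infl (rep_sum V W)) = yact (rep_sum (infl V) (infl W))"
    using H.ac_rep_sum[OF infl(1)[OF V] infl(1)[OF W] H.bvec_carrier[OF B1]]
    by (simp add: infl(4) S V W yact_def[symmetric] del: One_nat_def)
qed

lemma infl_tens:
  assumes V: "is_rep KA V" and W: "is_rep KA W"
  shows "rep_iso H (infl (rep_tensor KA V W)) (rep_tensor H (infl V) (infl W))"
proof (rule H_isoI)
  note T = C.K_tens[OF V W] and T' = H_tens[OF infl(1)[OF V] infl(1)[OF W]]
  show "is_rep H (infl (rep_tensor KA V W))" "is_rep H (rep_tensor H (infl V) (infl W))"
    by (rule infl(1)[OF T(1)] T'(1))+
  show "fst (infl (rep_tensor KA V W)) = fst (rep_tensor H (infl V) (infl W))"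
    by (simp add: infl(2) T(1) V W)
  show "gact (infl (rep_tensor KA V W)) h = gact (rep_tensor H (infl V) (infl W)) h" if h: "h \<in> carrier G" for h
    using h by (simp add: infl(2,3) T(1) T(2)[OF h] T'(2)[OF h] V W tg_def)
  show "yact (infl (rep_tensor KA V W)) = yact (rep_tensor H (infl V) (infl W))"
    by (simp add: infl(4) T(1) T'(3) V W tY_def)
qed

lemma infl_unit: "rep_iso H (infl (rep_unit KA)) (rep_unit H)"
  by (rule H_isoI) (use infl[OF C.K_unit(1)] H_unit C.K_unit(2) in auto)

section \<open>The modules generated by a single vector\<close>

abbreviation "E \<equiv> rep_unit KA"

definition L :: "nat \<Rightarrow> (nat \<times> 'g \<Rightarrow> 'k, 'k) rep" where "L i = Jm i E"

lemma L_rep: "i \<le> n \<Longrightarrow> is_rep H (L i)" and fst_L [simp]: "fst (L i) = i"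
  and gact_L: "i \<le> n \<Longrightarrow> h \<in> carrier G \<Longrightarrow> gact (L i) h = mg i E h"
  and yact_L: "i \<le> n \<Longrightarrow> yact (L i) = mY (Suc 0) i"
  using Jm_rep[OF C.K_unit(1)] gact_Jm[OF C.K_unit(1)] yact_Jm[OF C.K_unit(1)] by (simp_all add: L_def)

lemma sinj_1: "j < i \<Longrightarrow> sinj (Suc 0) i j = mu j 0" and sprj_1: "j < i \<Longrightarrow> sprj (Suc 0) i j = mu 0 j"
  unfolding sinj_def sprj_def idm_1 by (rule kr_unit_left; simp add: dm_mu)+

lemma ga_E: "h \<in> carrier G \<Longrightarrow> C.ga E h = idm (Suc 0)"
  using C.K_unit(2) by simp

lemma mY_mu: "b < i \<Longrightarrow> mY (Suc 0) i * mu b 0 = (if Suc b < i then mu (Suc b) 0 else 0)"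
  using mY_inj[of b i "Suc 0"] by (simp add: sinj_1)

lemma mg_mu: "b < i \<Longrightarrow> h \<in> carrier G \<Longrightarrow> mg i E h * mu b 0 = inverse (\<chi> h) ^ b *\<^sub>c mu b 0"
  using mg_inj[OF C.K_unit(1), of h b i] by (simp add: sinj_1 ga_E idm_1)

lemma L_1: "rep_iso H (L (Suc 0)) (rep_unit H)"
proof (rule H_isoI)
  have 1: "Suc 0 \<le> n" using n2 by simp
  show "is_rep H (L (Suc 0))" by (rule L_rep[OF 1])
  show "is_rep H (rep_unit H)" by (rule H_unit)
  show "gact (L (Suc 0)) h = gact (rep_unit H) h" if "h \<in> carrier G" for h
    using that by (simp add: gact_L[OF 1] H_unit mg_def sinj_1 sprj_1 ga_E idm_1)
  show "yact (L (Suc 0)) = yact (rep_unit H)" by (simp add: yact_L[OF 1] H_unit mY_def)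
qed simp

text \<open>As y is 0 on the inflation, only 1 tensor y remains of its coproduct, and the two
  actions agree entry by entry. The class of \<open>Jm i V\<close> thus becomes a product.\<close>

lemma infl_tens_L:
  assumes V: "is_rep KA V" and i: "i \<le> n"
  shows "rep_iso H (rep_tensor H (infl V) (L i)) (Jm i V)"
proof (rule H_isoI)
  note T = H_tens[OF infl(1)[OF V] L_rep[OF i]]
  show "is_rep H (rep_tensor H (infl V) (L i))" "is_rep H (Jm i V)" by (rule T(1) Jm_rep[OF V i])+
  show "fst (rep_tensor H (infl V) (L i)) = fst (Jm i V)" by (simp add: infl(2) V)
  show "gact (rep_tensor H (infl V) (L i)) h = gact (Jm i V) h" if h: "h \<in> carrier G" for h
  proof -
    have "sinj (fst V) i j * C.ga V h * sprj (fst V) i j = kr i i (C.ga V h) (mu j j)" if "j < i" for j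
      using that kr_mult[of i "Suc 0" "mu j 0" "idm (fst V)" "Suc 0" "C.ga V h" "mu 0 0"]
        kr_mult[of i "Suc 0" "mu j 0" "C.ga V h" i "idm (fst V)" "mu 0 j"]
      by (simp add: sinj_def sprj_def dm_mu kr_unit_right dm_left[OF C.ga_dm[OF V h]] dm_right[OF C.ga_dm[OF V h]])
    then have "mg i V h = kr i i (C.ga V h) (\<Sum>j<i. inverse (\<chi> h) ^ j *\<^sub>c mu j j)"
      unfolding mg_def kr_sum_right by (intro sum.cong refl) simp
    moreover have "mg i E h = (\<Sum>j<i. inverse (\<chi> h) ^ j *\<^sub>c mu j j)"
      unfolding mg_def by (intro sum.cong refl) (simp add: sinj_1 sprj_1 ga_E[OF h] idm_1)
    ultimately show ?thesis by (simp add: T(2)[OF h] tg_def infl(3)[OF V h] gact_L[OF i h] gact_Jm[OF V i h])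
  qed
  show "yact (rep_tensor H (infl V) (L i)) = yact (Jm i V)"
  proof -
    have "mY (fst V) i = kr i i (idm (fst V)) (mY (Suc 0) i)"
      unfolding mY_def kr_sum_right
      by (intro sum.cong refl) (auto simp: sinj_1 sprj_1, simp add: sinj_def sprj_def kr_mult dm_mu)
    then show ?thesis by (simp add: T(3) tY_def infl(2,4)[OF V] yact_L[OF i] yact_Jm[OF V i])
  qed
qed

text \<open>In this order y acts as y tensor g, so the identification with \<open>Jm 2 V\<close>
  corrects the last slot by g^-1, which is equivariant because g is central. It makes [L 2] commute
  with the classes inflated from KG.\<close>

lemma L2_tens_infl:
  assumes V: "is_rep KA V"
  shows "rep_iso H (Jm 2 V) (rep_tensor H (L 2) (infl V))"
proof (rule Jm_iso)
  note i = n2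
  note T = H_tens[OF L_rep[OF i] infl(1)[OF V]]
  let ?d = "fst V" and ?M = "rep_tensor H (L 2) (infl V)"
  let ?\<iota> = "kr ?d ?d (mu 0 0) (idm ?d)" and ?p = "kr ?d ?d (mu 0 1) (C.ga V (inv g))"
  note gd = C.ga_dm[OF V] and gi = inv_closed[OF g_closed]
  have Y: "tY (L 2) (infl V) = kr ?d ?d (mu 1 0) (C.ga V g)"
  proof -
    have "mY (Suc 0) 2 = mu 1 0" by (simp add: mY_def sinj_1 sprj_1 lessThan_Suc numeral_2_eq_2)
    then show ?thesis by (simp add: tY_def infl[OF V] g_closed yact_L[OF i])
  qed
  have mg2: "mg 2 E h = mu 0 0 + inverse (\<chi> h) *\<^sub>c mu 1 1" if "h \<in> carrier G" for h
    using that by (simp add: mg_def sinj_1 sprj_1 ga_E idm_1 lessThan_Suc numeral_2_eq_2)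
  have Y2: "yact ?M ^ 2 = 0"
    by (simp add: T(3) Y power2_eq_square kr_mult[OF gd[OF g_closed]])
  have gig: "C.ga V (inv g) * C.ga V g = idm ?d"
    using C.ga_mult[OF V gi g_closed] g_closed by (simp add: C.ga_one[OF V])
  have comm: "C.ga V (inv g) * C.ga V h = C.ga V h * C.ga V (inv g)" if h: "h \<in> carrier G" for h
  proof -
    have "inv g \<otimes> h = h \<otimes> inv g"
      using g_central[OF h] g_closed h by (metis inv_closed inv_solve_left inv_solve_right m_assoc m_closed)
    then show ?thesis using C.ga_mult[OF V gi h] C.ga_mult[OF V h gi] by simp
  qed
  show "is_rep H ?M" "is_rep KA V" "0 < (2::nat)" "2 \<le> n" "fst ?M = fst V * 2"
    using T(1) V n2 by (simp_all add: infl(2))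
  show "dm (fst ?M) (fst V) ?\<iota>" "dm (fst V) (fst ?M) ?p"
    using dm_kr[OF dm_mu dm_idm, of 0 2 0 1 ?d] dm_kr[OF dm_mu gd[OF gi], of 0 1 1 2] by (simp_all add: infl(2) V)
  show "gact ?M h * ?\<iota> = ?\<iota> * C.ga V h" if h: "h \<in> carrier G" for h
  proof -
    have "?\<iota> * C.ga V h = ?\<iota> * kr ?d ?d (mu 0 0) (C.ga V h)" by (simp add: kr_unit_left[OF gd[OF h]])
    then show ?thesis
      using h by (simp add: T(2)[OF h] tg_def infl(2,3)[OF V] gact_L[OF i] mg2 kr_mult[OF gd[OF h]] kr_mult[OF dm_idm]
        distrib_right dm_left[OF gd[OF h]] dm_right[OF gd[OF h]])
  qed
  show "?p * gact ?M h = inverse (\<chi> h) ^ (2 - 1) *\<^sub>c (C.ga V h * ?p)" if h: "h \<in> carrier G" for h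
  proof -
    have "C.ga V h * ?p = kr ?d ?d (mu 0 0) (C.ga V h) * ?p" by (simp add: kr_unit_left[OF gd[OF h]])
    then show ?thesis
      using h by (simp add: T(2)[OF h] tg_def infl(2,3)[OF V] gact_L[OF i] mg2 kr_mult[OF gd[OF h]] kr_mult[OF gd[OF gi]]
        distrib_left comm)
  qed
  show "yact ?M ^ 2 * ?\<iota> = 0" "?p * yact ?M ^ 2 = 0" by (simp_all add: Y2)
  have "?p * yact ?M ^ (2 - 1) * ?\<iota> = kr ?d ?d (mu 0 0) (idm ?d)"
    by (simp add: T(3) Y kr_mult[OF gd[OF g_closed]] kr_mult[OF gd[OF gi]] kr_mult[OF dm_idm] mult.assoc dm_right[OF gd[OF g_closed]] gig)
  then show "?p * yact ?M ^ (2 - 1) * ?\<iota> = idm (fst V)" by (simp add: kr_unit_left)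
qed

section \<open>The recursion of the Dickson polynomials\<close>

definition chi1 :: "('g \<Rightarrow> 'k, 'k) rep" where "chi1 = char_rep G (\<lambda>h. inverse (\<chi> h))"

lemma chi1: "is_rep KA chi1" "h \<in> carrier G \<Longrightarrow> C.ga chi1 h = inverse (\<chi> h) *\<^sub>c idm (Suc 0)" "fst chi1 = Suc 0"
proof -
  show f: "fst chi1 = Suc 0" by (simp add: chi1_def char_rep_def)
  have ac: "ac chi1 x = ext (carrier G) (\<lambda>h. inverse (\<chi> h) *\<^sub>c idm (Suc 0)) x" for x
    by (rule rfm_eqI) (auto simp: ac_def chi1_def char_rep_def ent_fm ext_def ent_sum)
  have c: "snd chi1 x \<in> carrier_mat (Suc 0) (Suc 0)" for x by (simp add: chi1_def char_rep_def)
  show "is_rep KA chi1" "h \<in> carrier G \<Longrightarrow> C.ga chi1 h = inverse (\<chi> h) *\<^sub>c idm (Suc 0)"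
    using C.K_repI[of chi1 "\<lambda>h. inverse (\<chi> h) *\<^sub>c idm (Suc 0)"] ac c f by (simp_all add: chi_mult chi_one mult.commute)
qed

text \<open>The quantum integer [m] at q^-1. It arises as the weighted count of the positions, among
  m applications of y, at which y acts on the first factor of L 2 tensor L i.\<close>

definition qs :: "nat \<Rightarrow> 'k" where "qs m = (\<Sum>t<m. inverse q ^ t)"

text \<open>(q^-1 - 1) [m] = q^-m - 1, which is nonzero below the order of q.\<close>

lemma qs_nz:
  assumes "0 < m" "m < n" shows "qs m \<noteq> 0"
proof
  assume "qs m = 0"
  have "(inverse q - 1) * qs m = inverse q ^ m - 1"
    unfolding qs_def by (induction m) (simp_all add: algebra_simps)
  then have "inverse q ^ m = 1" using \<open>qs m = 0\<close> by simp
  then have "q ^ m = 1" by (simp add: power_inverse)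
  then show False using q_lt assms by blast
qed

lemma qs_Suc: "qs (Suc m) = 1 + inverse q * qs m"
  unfolding qs_def sum.lessThan_Suc_shift by (simp add: sum_distrib_left)

lemma slot_ext:
  assumes "dm (d * i) (d' * i') X" "dm (d * i) (d' * i') Y"
    "\<And>k j. k < i \<Longrightarrow> j < i' \<Longrightarrow> sprj d i k * X * sinj d' i' j = sprj d i k * Y * sinj d' i' j"
  shows "X = Y"
proof (rule prj_ext[OF assms(1,2)])
  fix k assume k: "k < i"
  show "sprj d i k * X = sprj d i k * Y"
    by (rule inj_ext[OF dm_mult[OF dm_prj[OF k] assms(1)] dm_mult[OF dm_prj[OF k] assms(2)]]) (rule assms(3)[OF k])
qed

text \<open>The equations make one composite the identity; equality of dimensions gives the
  other.\<close>

lemma rep_sum_iso_of_left_inverse: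
  assumes M: "is_rep H M" and N: "is_rep H N" and P: "is_rep H P" and dim: "fst M = fst N + fst P"
    and h: "a \<in> Hm H N M" "b \<in> Hm H P M" "c \<in> Hm H M N" "d \<in> Hm H M P"
    and e: "c * a = idm (fst N)" "d * b = idm (fst P)" "c * b = 0" "d * a = 0"
  shows "rep_iso H M (rep_sum N P)"
proof -
  note S = H.rep_sum_rep[OF N P]
  obtain i j p q where B: "H.bip (rep_sum N P) N P i j p q" using H.rep_sum_bip'[OF N P] by blast
  have h': "i \<in> Hm H N (rep_sum N P)" "j \<in> Hm H P (rep_sum N P)" "p \<in> Hm H (rep_sum N P) N" "q \<in> Hm H (rep_sum N P) P"
    and e': "i * p + j * q = idm (fst (rep_sum N P))" using B by (auto simp: H.bip_def)
  let ?s = "a * p + b * q" and ?t = "i * c + j * d"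
  have s: "?s \<in> Hm H (rep_sum N P) M" and t: "?t \<in> Hm H M (rep_sum N P)"
    by (intro Hm_add Hm_comp[OF h(1)] Hm_comp[OF h(2)] Hm_comp[OF h'(1)] Hm_comp[OF h'(2)] h h')+
  have e3: "c * (a * X) = idm (fst N) * X" "d * (b * X) = idm (fst P) * X" "c * (b * X) = 0" "d * (a * X) = 0" for X
    by (simp_all add: mult.assoc[symmetric] e)
  have ts: "?t * ?s = idm (fst (rep_sum N P))"
    using e' by (simp add: distrib_left distrib_right mult.assoc e3 dm_left[OF Hm_dm[OF h'(3)]] dm_left[OF Hm_dm[OF h'(4)]] del: fst_rep_sum)
  have "?s * ?t = idm (fst M)"
    using right_inverse_of_left_inverse[of "fst M" ?s ?t] Hm_dm[OF s] Hm_dm[OF t] ts dim by simp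
  then show ?thesis using H.rep_isoI[OF M S t s] ts by blast
qed

section \<open>Decomposition of L 2 tensor L i\<close>

context
  fixes i :: nat assumes i: "2 \<le> i" "i < n"
begin

definition "M2 = rep_tensor H (L 2) (L i)"

text \<open>Basis vectors of L 2 tensor L i. The value 0 for b \<ge> i lets the formulas for the
  powers of y hold without case distinctions.\<close>

definition wz :: "nat \<Rightarrow> nat \<Rightarrow> 'k rfm" where "wz a b = (if b < i then kr i (Suc 0) (mu a 0) (mu b 0) else 0)"
definition vr :: "nat \<Rightarrow> nat \<Rightarrow> 'k rfm" where "vr a b = kr (Suc 0) i (mu 0 a) (mu 0 b)"

lemma in': "i \<le> n" using i by simp

lemma M2_rep: "is_rep H M2" and M2_gact: "h \<in> carrier G \<Longrightarrow> gact M2 h = tg (L 2) (L i) h"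
  and M2_yact: "yact M2 = tY (L 2) (L i)" and fst_M2: "fst M2 = 2 * i"
  unfolding M2_def using H_tens[OF L_rep[OF n2] L_rep[OF in']] by simp_all

lemma dm_wz: "a < 2 \<Longrightarrow> dm (2 * i) (Suc 0) (wz a b)"
  by (simp add: wz_def dm_kr[OF dm_mu dm_mu, of a 2 0 "Suc 0" b i 0 "Suc 0", simplified])

lemma dm_vr: "a < 2 \<Longrightarrow> b < i \<Longrightarrow> dm (Suc 0) (2 * i) (vr a b)"
  using dm_kr[OF dm_mu dm_mu, of 0 "Suc 0" a 2 0 "Suc 0" b i] by (simp add: vr_def)

lemma vr_wz: "b < i \<Longrightarrow> vr a b * wz c d = (if a = c \<and> b = d then idm (Suc 0) else 0)"
  by (simp add: vr_def wz_def kr_mult dm_mu kr_unit_right idm_1)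

lemma wz_ext:
  assumes "dm r (2 * i) X" "dm r (2 * i) Y" "\<And>a b. a < 2 \<Longrightarrow> b < i \<Longrightarrow> X * wz a b = Y * wz a b"
  shows "X = Y"
proof -
  have "idm (2 * i) = (\<Sum>a<2. \<Sum>b<i. wz a b * vr a b)"
  proof -
    have "idm (2 * i) = kr i i (\<Sum>a<2. mu a a) (\<Sum>b<i. mu b b)" by (simp only: idm_sum_mu[of 2, symmetric] idm_sum_mu[of i, symmetric] kr_idm)
    also have "\<dots> = (\<Sum>a<2. \<Sum>b<i. kr i i (mu a a) (mu b b))" by (simp only: kr_sum_left, simp only: kr_sum_right)
    also have "\<dots> = (\<Sum>a<2. \<Sum>b<i. wz a b * vr a b)"
      by (intro sum.cong refl) (simp add: wz_def vr_def kr_mult dm_mu)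
    finally show ?thesis .
  qed
  then have "X * idm (2 * i) = Y * idm (2 * i)"
    using assms(3) by (simp add: sum_distrib_left mult.assoc[symmetric])
  then show ?thesis using assms(1,2) by (simp add: dm_right)
qed

lemma Y_wz0: "yact M2 * wz 0 b = inverse q ^ b *\<^sub>c wz (Suc 0) b + wz 0 (Suc b)"
  and Y_wz1: "yact M2 * wz (Suc 0) b = wz (Suc 0) (Suc b)"
proof -
  have d: "dm i i (gact (L i) g)" "dm i i (yact (L i))" using gact_dm[OF L_rep[OF in'] g_closed] yact_dm[OF L_rep[OF in']] by simp_all
  have e: "(idm 2 * mu (Suc 0) 0 :: 'k rfm) = mu (Suc 0) 0" "(idm 2 * mu 0 0 :: 'k rfm) = mu 0 0" by simp_all
  show "yact M2 * wz 0 b = inverse q ^ b *\<^sub>c wz (Suc 0) b + wz 0 (Suc b)"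
    using mY_mu[of 0 2]
    by (simp add: wz_def M2_yact tY_def distrib_right kr_mult[OF d(1)] kr_mult[OF d(2)])
      (simp add: yact_L[OF n2] yact_L[OF in'] gact_L[OF in' g_closed] mY_mu mg_mu g_closed q_def)
  show "yact M2 * wz (Suc 0) b = wz (Suc 0) (Suc b)"
    using mY_mu[of "Suc 0" 2]
    by (simp add: wz_def M2_yact tY_def distrib_right kr_mult[OF d(1)] kr_mult[OF d(2)])
      (simp add: yact_L[OF n2] yact_L[OF in'] gact_L[OF in' g_closed] mY_mu mg_mu g_closed q_def)
qed

lemma Ypow_wz1: "yact M2 ^ s * wz (Suc 0) b = wz (Suc 0) (b + s)"
  by (induction s) (simp_all add: mult.assoc Y_wz1)

text \<open>As y^2 = 0 on L 2, y acts on the first factor at most once. Summing over the moment when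
  it does, weighted by the action of g on the degree reached, gives [s]. At s = 0 the truncated
  index b + s - 1 is harmless because [0] = 0.\<close>

lemma Ypow_wz0: "yact M2 ^ s * wz 0 b = wz 0 (b + s) + (inverse q ^ b * qs s) *\<^sub>c wz (Suc 0) (b + s - 1)"
proof (induction s)
  case (Suc s)
  have e: "(inverse q ^ b * qs s) *\<^sub>c wz (Suc 0) (Suc (b + s - 1)) = (inverse q ^ b * qs s) *\<^sub>c wz (Suc 0) (b + s)"
    by (cases s) (simp_all add: qs_def)
  have "yact M2 ^ Suc s * wz 0 b = yact M2 * (yact M2 ^ s * wz 0 b)" by (simp add: mult.assoc)
  also have "\<dots> = inverse q ^ (b + s) *\<^sub>c wz (Suc 0) (b + s) + wz 0 (Suc (b + s)) + (inverse q ^ b * qs s) *\<^sub>c wz (Suc 0) (Suc (b + s - 1))"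
    by (simp only: Suc distrib_left Y_wz0 Y_wz1 scl_mult_right)
  also have "\<dots> = wz 0 (b + Suc s) + (inverse q ^ b * qs (Suc s)) *\<^sub>c wz (Suc 0) (b + Suc s - 1)"
    unfolding e by (simp add: qs_def power_add distrib_left scl_add_left)
  finally show ?case .
qed (simp add: qs_def)

lemma g_wz: "h \<in> carrier G \<Longrightarrow> a < 2 \<Longrightarrow> gact M2 h * wz a b = inverse (\<chi> h) ^ (a + b) *\<^sub>c wz a b"
proof -
  assume h: "h \<in> carrier G" and a: "a < 2"
  have d: "dm i i (gact (L i) h)" using gact_dm[OF L_rep[OF in'] h] by simp
  show ?thesis
    using a h mg_mu[of a 2 h]
    by (simp add: wz_def M2_gact tg_def kr_mult[OF d]) (simp add: gact_L[OF n2] gact_L[OF in'] mg_mu power_add mult.commute)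
qed

lemma vr_g: "h \<in> carrier G \<Longrightarrow> a < 2 \<Longrightarrow> b < i \<Longrightarrow> vr a b * gact M2 h = inverse (\<chi> h) ^ (a + b) *\<^sub>c vr a b"
proof (rule wz_ext[of "Suc 0"])
  assume h: "h \<in> carrier G" and ab: "a < 2" "b < i"
  show "dm (Suc 0) (2 * i) (vr a b * gact M2 h)" using dm_mult[OF dm_vr[OF ab] gact_dm[OF M2_rep h, unfolded fst_M2]] .
  show "dm (Suc 0) (2 * i) (inverse (\<chi> h) ^ (a + b) *\<^sub>c vr a b)" using dm_vr[OF ab] by blast
  fix c d :: nat assume "c < 2" "d < i"
  then show "vr a b * gact M2 h * wz c d = (inverse (\<chi> h) ^ (a + b) *\<^sub>c vr a b) * wz c d"
    using h ab by (simp add: mult.assoc g_wz vr_wz)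
qed

text \<open>\<open>w1\<close> generates a copy of \<open>L (i + 1)\<close>, and \<open>w2\<close>, of degree \<open>1\<close>, is chosen to be killed by \<open>y\<^sup>i\<^sup>-\<^sup>1\<close>;
  \<open>p1\<close> and \<open>p2\<close> are the functionals dual to \<open>y\<^sup>i w1\<close> and \<open>y\<^sup>i\<^sup>-\<^sup>2 w2\<close>.\<close>

definition c' where "c' = - inverse (qs i - 1)"
definition "w1 = wz 0 0"
definition "w2 = c' *\<^sub>c wz 0 1 + wz 1 0"
definition "p1 = inverse (qs i) *\<^sub>c vr 1 (i - 1)"
definition "p2 = inverse (1 - c') *\<^sub>c (vr 1 (i - 2) - qs (i - 1) *\<^sub>c vr 0 (i - 1))"

text \<open>The last equation is the condition for y^(i-1) w2 = 0. It is solvable because [i] - 1 =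
  q^-1 [i-1] is nonzero, and 1 - c' = [i] / ([i] - 1) is the value that \<open>p2\<close> has to be
  divided by.\<close>

lemma qs_facts: "qs i \<noteq> 0" "qs i - 1 \<noteq> 0" "1 - c' \<noteq> 0" "c' * (qs i - 1) + 1 = 0"
proof -
  show nz: "qs i \<noteq> 0" using qs_nz i by simp
  obtain m where m: "i = Suc m" "0 < m" "m < n" using i by (cases i) auto
  show nz': "qs i - 1 \<noteq> 0" using qs_Suc[of m] qs_nz[OF m(2,3)] q_nz m(1) by simp
  show "c' * (qs i - 1) + 1 = 0" using nz' by (simp add: c'_def)
  show "1 - c' \<noteq> 0" using nz nz' by (simp add: c'_def field_simps)
qed

lemma Yw1: "yact M2 ^ s * w1 = wz 0 s + qs s *\<^sub>c wz 1 (s - 1)"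
  by (simp add: w1_def Ypow_wz0)

lemma Yw2: "yact M2 ^ s * w2 = c' *\<^sub>c wz 0 (Suc s) + (c' * (qs (Suc s) - 1) + 1) *\<^sub>c wz 1 s"
proof -
  have "inverse q * qs s = qs (Suc s) - 1" by (simp add: qs_Suc)
  then show ?thesis
    by (simp add: w2_def distrib_left Ypow_wz0 Ypow_wz1 scl_add scl_add_left)
qed

lemma i_less: "i - 1 < i" "i - 2 < i" "i - 2 \<noteq> i - 1" "Suc (i - 2) = i - 1" "Suc (i - 1) = i" "0 < i"
  using i by auto

text \<open>The combination in \<open>p2\<close> is the one that cancels on y^(i-1) w1 = wz 0 (i-1)
  + [i-1] wz 1 (i-2); the remaining values are read off from the dual basis.\<close>

lemma pw: "p1 * (yact M2 ^ s * w1) = (if s = i then idm (Suc 0) else 0)" "p1 * (yact M2 ^ s * w2) = 0"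
    "p2 * (yact M2 ^ s * w1) = 0" "p2 * (yact M2 ^ s * w2) = (if s = i - 2 then idm (Suc 0) else 0)"
proof -
  have q0: "qs 0 = 0" by (simp add: qs_def)
  show "p1 * (yact M2 ^ s * w1) = (if s = i then idm (Suc 0) else 0)"
    unfolding p1_def Yw1 using qs_facts i i_less by (cases s) (auto simp: distrib_left vr_wz q0)
  show "p1 * (yact M2 ^ s * w2) = 0"
    unfolding p1_def Yw2 using qs_facts i_less by (auto simp: distrib_left vr_wz)
  show "p2 * (yact M2 ^ s * w1) = 0"
    unfolding p2_def Yw1 using i_less by (cases s) (auto simp: distrib_left left_diff_distrib vr_wz q0 mult.commute)
  show "p2 * (yact M2 ^ s * w2) = (if s = i - 2 then idm (Suc 0) else 0)"
  proof (cases "s = i - 2")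
    case True
    have "p2 * (yact M2 ^ s * w2) = (inverse (1 - c') * (c' * (qs (i - 1) - 1) + 1 - qs (i - 1) * c')) *\<^sub>c idm (Suc 0)"
      unfolding p2_def Yw2 using i_less True
      by (simp add: distrib_left left_diff_distrib vr_wz scl_diff scl_diff_left scl_add_left algebra_simps)
    also have "c' * (qs (i - 1) - 1) + 1 - qs (i - 1) * c' = 1 - c'" by (simp add: algebra_simps)
    finally show ?thesis using left_inverse[OF qs_facts(3)] True by simp
  next
    case False
    then show ?thesis unfolding p2_def Yw2 using i_less by (simp add: distrib_left left_diff_distrib vr_wz)
  qed
qed

lemma dm_wp: "dm (fst M2) (Suc 0) w1" "dm (fst M2) (Suc 0) w2" "dm (Suc 0) (fst M2) p1" "dm (Suc 0) (fst M2) p2"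
  unfolding w1_def w2_def p1_def p2_def fst_M2 using i_less by (intro dm_add dm_scl dm_diff dm_wz dm_vr; simp)+

lemma p2_Y: "p2 * yact M2 ^ (i - 1) = 0"
proof (rule wz_ext[of "Suc 0"])
  show "dm (Suc 0) (2 * i) (p2 * yact M2 ^ (i - 1))"
    using dm_mult_power[OF yact_dm[OF M2_rep] dm_wp(4)] by (simp add: fst_M2)
  fix a b :: nat assume ab: "a < 2" "b < i"
  then consider "a = Suc 0" | "a = 0" "b = 0" | "a = 0" "0 < b" by linarith
  then show "p2 * yact M2 ^ (i - 1) * wz a b = 0 * wz a b"
  proof cases
    case 1
    then show ?thesis using i_less i
      by (auto simp: p2_def mult.assoc Ypow_wz1 left_diff_distrib vr_wz)
  next
    case 2
    have "i - 1 - 1 = i - 2" by simp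
    then show ?thesis using i_less 2
      by (simp add: p2_def mult.assoc Ypow_wz0 distrib_left left_diff_distrib vr_wz del: One_nat_def)
  next
    case 3
    then have "i - 2 \<noteq> b + (i - 1) - 1" "i - 1 \<noteq> b + (i - 1)" using i by auto
    then show ?thesis using i_less 3
      by (simp add: p2_def mult.assoc Ypow_wz0 distrib_left left_diff_distrib vr_wz del: One_nat_def)
  qed
qed simp

lemma p1_Y: "p1 * yact M2 ^ (i + 1) = 0"
proof (rule wz_ext[of "Suc 0"])
  show "dm (Suc 0) (2 * i) (p1 * yact M2 ^ (i + 1))"
    using dm_mult_power[OF yact_dm[OF M2_rep] dm_wp(3)] unfolding fst_M2 .
  fix a b :: nat assume ab: "a < 2" "b < i"
  then consider "a = Suc 0" | "a = 0" by linarith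
  then show "p1 * yact M2 ^ (i + 1) * wz a b = 0 * wz a b"
    by cases (simp_all only: mult.assoc Ypow_wz1 Ypow_wz0, simp_all add: wz_def)
qed simp

text \<open>The chains of w1 and w2 have lengths i + 1 and i - 1, which add up to 2 i, so the
  relations \<open>pw\<close> suffice. Since w2 has degree 1, where G acts by \<chi>^-1, its chain
  carries the twist \<open>chi1\<close>.\<close>

theorem L2_tens_L: "rep_iso H (rep_tensor H (L 2) (L i)) (rep_sum (L (i + 1)) (Jm (i - 1) chi1))"
proof -
  note E = C.K_unit(1) and X = chi1(1)
  have le: "i + 1 \<le> n" "i - 1 \<le> n" using i by auto
  have fE: "fst E = Suc 0" by simp
  let ?a = "intoM (i + 1) M2 (Suc 0) w1" and ?b = "intoM (i - 1) M2 (Suc 0) w2"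
  let ?c = "ontoM (i + 1) M2 (Suc 0) p1" and ?d = "ontoM (i - 1) M2 (Suc 0) p2"
  have one: "w * idm (Suc 0) = w" if "dm (fst M2) (Suc 0) w" for w using that by (rule dm_right)
  have one': "idm (Suc 0) * w = w" if "dm (Suc 0) (fst M2) w" for w using that by (rule dm_left)
  have a: "?a \<in> Hm H (L (i + 1)) M2" unfolding L_def
  proof (rule intoM_Hm[OF M2_rep E le(1), unfolded fE])
    show "gact M2 h * w1 = w1 * C.ga E h" if "h \<in> carrier G" for h
      using that one[OF dm_wp(1)] by (simp add: ga_E) (simp add: w1_def g_wz)
    show "yact M2 ^ (i + 1) * w1 = 0" by (simp only: Yw1) (simp add: wz_def)
  qed (rule dm_wp)
  have b: "?b \<in> Hm H (Jm (i - 1) chi1) M2"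
  proof (rule intoM_Hm[OF M2_rep X le(2), unfolded chi1(3)])
    show "gact M2 h * w2 = w2 * C.ga chi1 h" if "h \<in> carrier G" for h
      using that one[OF dm_wp(2)] by (simp add: chi1(2)) (simp add: w2_def distrib_left g_wz scl_add mult.commute)
    have "yact M2 ^ (i - 1) * w2 = 0" using qs_facts(4) i_less by (simp only: Yw2) (simp add: wz_def)
    then show "yact M2 ^ (i - 1) * w2 = 0" .
  qed (rule dm_wp)
  have c: "?c \<in> Hm H M2 (L (i + 1))" unfolding L_def
  proof (rule ontoM_Hm[OF M2_rep E le(1), unfolded fE])
    show "p1 * gact M2 h = inverse (\<chi> h) ^ (i + 1 - 1) *\<^sub>c (C.ga E h * p1)" if "h \<in> carrier G" for h
      using that one'[OF dm_wp(3)] i_less by (simp add: ga_E) (simp add: p1_def vr_g mult.commute)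
  qed (rule dm_wp p1_Y)+
  have d: "?d \<in> Hm H M2 (Jm (i - 1) chi1)"
  proof (rule ontoM_Hm[OF M2_rep X le(2), unfolded chi1(3)])
    fix h assume h: "h \<in> carrier G"
    have "p2 * gact M2 h = inverse (\<chi> h) ^ (i - 1) *\<^sub>c p2"
      using h i_less by (simp add: p2_def left_diff_distrib vr_g scl_diff mult.commute mult.left_commute)
    moreover have "inverse (\<chi> h) ^ (i - 1) = inverse (\<chi> h) ^ (i - 1 - 1) * inverse (\<chi> h)"
      using i by (metis Suc_diff_Suc diff_diff_left less_le_trans mult.commute one_add_one power_Suc power_one_right Suc_1 Suc_le_lessD zero_less_diff plus_1_eq_Suc)
    ultimately show "p2 * gact M2 h = inverse (\<chi> h) ^ (i - 1 - 1) *\<^sub>c (C.ga chi1 h * p2)"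
      using one'[OF dm_wp(4)] by (simp add: chi1(2)[OF h])
  qed (rule dm_wp p2_Y)+
  have da: "dm (fst M2) (Suc 0 * (i + 1)) ?a" "dm (fst M2) (Suc 0 * (i - 1)) ?b"
    "dm (Suc 0 * (i + 1)) (fst M2) ?c" "dm (Suc 0 * (i - 1)) (fst M2) ?d"
    using Hm_dm[OF a] Hm_dm[OF b] Hm_dm[OF c] Hm_dm[OF d] by (simp_all add: chi1(3))
  \<comment> \<open>The component from slot j to slot k is p1 y^(i-k+j) w1, which by
    \<open>pw\<close> is the identity for j = k and 0 otherwise.\<close>
  have ca: "?c * ?a = idm (Suc 0 * (i + 1))"
  proof (rule slot_ext[OF dm_mult[OF da(3,1)] dm_idm])
    fix k j assume kj: "k < i + 1" "j < i + 1"
    show "sprj (Suc 0) (i + 1) k * (?c * ?a) * sinj (Suc 0) (i + 1) j =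
      sprj (Suc 0) (i + 1) k * idm (Suc 0 * (i + 1)) * sinj (Suc 0) (i + 1) j"
      unfolding prj_onto_into_inj[OF dm_wp(1,3) kj(2,1)] dm_right[OF dm_prj[OF kj(1)]] prj_inj[OF kj(1)] 
      unfolding mult.assoc pw
      using kj by auto
  qed
  have db: "?d * ?b = idm (Suc 0 * (i - 1))"
  proof (rule slot_ext[OF dm_mult[OF da(4,2)] dm_idm])
    fix k j assume kj: "k < i - 1" "j < i - 1"
    show "sprj (Suc 0) (i - 1) k * (?d * ?b) * sinj (Suc 0) (i - 1) j =
      sprj (Suc 0) (i - 1) k * idm (Suc 0 * (i - 1)) * sinj (Suc 0) (i - 1) j"
      unfolding prj_onto_into_inj[OF dm_wp(2,4) kj(2,1)] dm_right[OF dm_prj[OF kj(1)]] prj_inj[OF kj(1)] 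
      unfolding mult.assoc pw
      using kj by auto
  qed
  have cb: "?c * ?b = 0"
  proof (rule slot_ext[OF dm_mult[OF da(3,2)] dm_0])
    fix k j assume kj: "k < i + 1" "j < i - 1"
    show "sprj (Suc 0) (i + 1) k * (?c * ?b) * sinj (Suc 0) (i - 1) j = sprj (Suc 0) (i + 1) k * 0 * sinj (Suc 0) (i - 1) j"
      unfolding prj_onto_into_inj[OF dm_wp(2,3) kj(2,1)] unfolding mult.assoc pw by simp
  qed
  have da': "?d * ?a = 0"
  proof (rule slot_ext[OF dm_mult[OF da(4,1)] dm_0])
    fix k j assume kj: "k < i - 1" "j < i + 1"
    show "sprj (Suc 0) (i - 1) k * (?d * ?a) * sinj (Suc 0) (i + 1) j = sprj (Suc 0) (i - 1) k * 0 * sinj (Suc 0) (i + 1) j"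
      unfolding prj_onto_into_inj[OF dm_wp(1,4) kj(2,1)] unfolding mult.assoc pw by simp
  qed
  have "rep_iso H M2 (rep_sum (L (i + 1)) (Jm (i - 1) chi1))"
    by (rule rep_sum_iso_of_left_inverse[OF M2_rep L_rep[OF le(1)] Jm_rep[OF X le(2)] _ a b c d])
      (use ca db cb da' i in \<open>simp_all add: fst_M2 chi1(3)\<close>)
  then show ?thesis by (simp add: M2_def)
qed

end

end

section \<open>The presentation of the stable Green ring\<close>

lemma additive_map:
  assumes "abelian_group A" "abelian_group B" "h \<in> carrier A \<rightarrow> carrier B"
    and add: "\<And>x y. x \<in> carrier A \<Longrightarrow> y \<in> carrier A \<Longrightarrow> h (x \<oplus>\<^bsub>A\<^esub> y) = h x \<oplus>\<^bsub>B\<^esub> h y"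
  shows "h \<zero>\<^bsub>A\<^esub> = \<zero>\<^bsub>B\<^esub>"
    "x \<in> carrier A \<Longrightarrow> y \<in> carrier A \<Longrightarrow> h (x \<ominus>\<^bsub>A\<^esub> y) = h x \<ominus>\<^bsub>B\<^esub> h y"
proof -
  interpret A: abelian_group A by fact
  interpret B: abelian_group B by fact
  interpret h: abelian_group_hom A B h
    by (rule abelian_group_homI[OF assms(1,2)], intro group_hom.intro group_hom_axioms.intro A.a_group B.a_group homI)
      (use assms(3) add in auto)
  show "h \<zero>\<^bsub>A\<^esub> = \<zero>\<^bsub>B\<^esub>" by (rule h.hom_zero)
  show "x \<in> carrier A \<Longrightarrow> y \<in> carrier A \<Longrightarrow> h (x \<ominus>\<^bsub>A\<^esub> y) = h x \<ominus>\<^bsub>B\<^esub> h y"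
    by (simp add: a_minus_def)
qed

context ring
begin

lemma commute_closed:
  assumes "a \<in> carrier R" "b \<in> carrier R" "c \<in> carrier R" "a \<otimes> c = c \<otimes> a" "b \<otimes> c = c \<otimes> b"
  shows "(a \<oplus> b) \<otimes> c = c \<otimes> (a \<oplus> b)" "(a \<ominus> b) \<otimes> c = c \<otimes> (a \<ominus> b)" "(a \<otimes> b) \<otimes> c = c \<otimes> (a \<otimes> b)"
proof -
  show "(a \<oplus> b) \<otimes> c = c \<otimes> (a \<oplus> b)" using assms by (simp add: l_distr r_distr)
  show "(a \<ominus> b) \<otimes> c = c \<otimes> (a \<ominus> b)" using assms by (simp add: a_minus_def l_distr r_distr l_minus r_minus)
  have "(a \<otimes> b) \<otimes> c = a \<otimes> (c \<otimes> b)" using assms by (simp add: m_assoc)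
  also have "\<dots> = c \<otimes> (a \<otimes> b)" using assms by (simp add: m_assoc[symmetric])
  finally show "(a \<otimes> b) \<otimes> c = c \<otimes> (a \<otimes> b)" .
qed

end

lemma (in green) G_cringI:
  assumes comm: "\<And>M N. is_rep A M \<Longrightarrow> is_rep A N \<Longrightarrow> gc M \<otimes>\<^bsub>\<Gamma>\<^esub> gc N = gc N \<otimes>\<^bsub>\<Gamma>\<^esub> gc M"
  shows "cring \<Gamma>"
proof -
  interpret ring \<Gamma> by (rule ring_G)
  have 1: "x \<otimes>\<^bsub>\<Gamma>\<^esub> gc N = gc N \<otimes>\<^bsub>\<Gamma>\<^esub> x" if "x \<in> carrier \<Gamma>" "is_rep A N" for x N
    using that(1)
  proof (induction x rule: G_induct)
    case (diff a b)
    then show ?case using commute_closed(2)[OF diff(1,2) gc_closed[OF that(2)]] by blast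
  qed (use that(2) comm in auto)
  have "y \<otimes>\<^bsub>\<Gamma>\<^esub> x = x \<otimes>\<^bsub>\<Gamma>\<^esub> y" if "x \<in> carrier \<Gamma>" "y \<in> carrier \<Gamma>" for x y
    using that(2)
  proof (induction y rule: G_induct)
    case (gc M)
    then show ?case using 1[OF that(1)] by simp
  next
    case (diff a b)
    then show ?case using commute_closed(2)[OF diff(1,2) that(1)] by blast
  qed (use that(1) in auto)
  then show ?thesis by unfold_locales auto
qed

section \<open>Polynomials spanned by Dickson polynomials\<close>

lemma dickson_closed:
  assumes "ring P" "a \<in> carrier P" "x \<in> carrier P"
  shows "dickson P i a x \<in> carrier P"
proof -
  interpret ring P by fact
  have "dickson P i a x \<in> carrier P \<and> dickson P (Suc i) a x \<in> carrier P"
  proof (induction i)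
    case (Suc i)
    then show ?case using assms by (cases i) auto
  qed simp
  then show ?thesis by simp
qed

lemma dickson_step:
  assumes "ring P" "a \<in> carrier P" "x \<in> carrier P" "2 \<le> i"
  shows "x \<otimes>\<^bsub>P\<^esub> dickson P i a x = dickson P (Suc i) a x \<oplus>\<^bsub>P\<^esub> a \<otimes>\<^bsub>P\<^esub> dickson P (i - 1) a x"
proof -
  interpret ring P by fact
  note c = dickson_closed[OF assms(1-3)]
  obtain j where j: "i = Suc (Suc j)" using assms(4) by (metis add_2_eq_Suc le_Suc_ex)
  have "x \<otimes>\<^bsub>P\<^esub> dickson P (Suc (Suc j)) a x = x \<otimes>\<^bsub>P\<^esub> dickson P (Suc (Suc j)) a x
      \<ominus>\<^bsub>P\<^esub> a \<otimes>\<^bsub>P\<^esub> dickson P (Suc j) a x \<oplus>\<^bsub>P\<^esub> a \<otimes>\<^bsub>P\<^esub> dickson P (Suc j) a x"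
    using c[of "Suc (Suc j)"] c[of "Suc j"] assms(2,3)
    by (simp add: a_minus_def a_assoc l_neg del: dickson.simps)
  then show ?thesis by (simp add: j)
qed

text \<open>Since \<open>x F\<^sub>i = F\<^sub>i\<^sub>+\<^sub>1 + a F\<^sub>i\<^sub>-\<^sub>1\<close>, the polynomials \<open>F\<^sub>1, \<dots>, F\<^sub>n\<^sub>-\<^sub>1\<close> together with the multiples
  of \<open>F\<^sub>n\<close> span the polynomial ring.\<close>

lemma dickson_span:
  fixes R (structure) and P n a
  defines "P \<equiv> UP R" and "F \<equiv> \<lambda>i. dickson (UP R) i (up_ring.monom (UP R) a 0) (up_ring.monom (UP R) \<one>\<^bsub>R\<^esub> 1)"
  assumes R: "cring R" and a: "a \<in> carrier R" and n: "2 \<le> n" and p: "p \<in> carrier P"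
    and add: "\<And>p q. p \<in> carrier P \<Longrightarrow> q \<in> carrier P \<Longrightarrow> W p \<Longrightarrow> W q \<Longrightarrow> W (p \<oplus>\<^bsub>P\<^esub> q)"
    and base: "\<And>r i. r \<in> carrier R \<Longrightarrow> 1 \<le> i \<Longrightarrow> i < n \<Longrightarrow> W (up_ring.monom P r 0 \<otimes>\<^bsub>P\<^esub> F i)"
    and top: "\<And>q. q \<in> carrier P \<Longrightarrow> W (q \<otimes>\<^bsub>P\<^esub> F n)"
  shows "W p"
proof -
  interpret UP_cring R P by (intro UP_cring.intro R) (rule P_def)
  let ?A = "up_ring.monom P a 0" and ?X = "up_ring.monom P \<one> 1"
  have AX: "?A \<in> carrier P" "?X \<in> carrier P" using a by auto
  have F_def': "F i = dickson P i ?A ?X" for i by (simp add: F_def P_def)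
  have Fc: "F i \<in> carrier P" for i unfolding F_def' by (rule dickson_closed[OF P.ring_axioms AX])
  \<comment> \<open>Induction on the power of X for all i at once: a factor X leads from i to i + 1
    and i - 1. At i = n the term is a multiple of F_n, and at i = 1 the factor X gives F_2
    alone.\<close>
  have step: "W (up_ring.monom P r k \<otimes>\<^bsub>P\<^esub> F i)" if "r \<in> carrier R" "1 \<le> i" "i \<le> n" for r k i
    using that
  proof (induction k arbitrary: r i)
    case 0
    then show ?case using base[of r i] top[of "up_ring.monom P r 0"] by (cases "i = n") auto
  next
    case (Suc k)
    note r = \<open>r \<in> carrier R\<close>
    show ?case
    proof (cases "i = n")
      case True
      then show ?thesis using top[of "up_ring.monom P r (Suc k)"] r by simp
    next
      case False
      then have i: "i < n" using Suc.prems by simp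
      have "up_ring.monom P r (Suc k) = up_ring.monom P r k \<otimes>\<^bsub>P\<^esub> ?X"
        using monom_mult[of r \<one> k 1] r by simp
      then have e: "up_ring.monom P r (Suc k) \<otimes>\<^bsub>P\<^esub> F i = up_ring.monom P r k \<otimes>\<^bsub>P\<^esub> (?X \<otimes>\<^bsub>P\<^esub> F i)"
        using AX r Fc by (simp add: P.m_assoc)
      show ?thesis
      proof (cases "i = 1")
        case True
        then have "?X \<otimes>\<^bsub>P\<^esub> F i = F 2" using AX by (simp add: F_def' numeral_2_eq_2)
        then show ?thesis using e Suc.IH[of r 2] r n by simp
      next
        case False
        then have i2: "2 \<le> i" using Suc.prems by simp
        have "?X \<otimes>\<^bsub>P\<^esub> F i = F (Suc i) \<oplus>\<^bsub>P\<^esub> ?A \<otimes>\<^bsub>P\<^esub> F (i - 1)"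
          unfolding F_def' by (rule dickson_step[OF P.ring_axioms AX i2])
        then have "up_ring.monom P r (Suc k) \<otimes>\<^bsub>P\<^esub> F i =
            up_ring.monom P r k \<otimes>\<^bsub>P\<^esub> F (Suc i) \<oplus>\<^bsub>P\<^esub> (up_ring.monom P r k \<otimes>\<^bsub>P\<^esub> ?A) \<otimes>\<^bsub>P\<^esub> F (i - 1)"
          using e r AX Fc by (simp add: P.r_distr P.m_assoc)
        also have "up_ring.monom P r k \<otimes>\<^bsub>P\<^esub> ?A = up_ring.monom P (r \<otimes> a) k"
          using monom_mult[of r a k 0] r a by simp
        finally have e2: "up_ring.monom P r (Suc k) \<otimes>\<^bsub>P\<^esub> F i =
            up_ring.monom P r k \<otimes>\<^bsub>P\<^esub> F (Suc i) \<oplus>\<^bsub>P\<^esub> up_ring.monom P (r \<otimes> a) k \<otimes>\<^bsub>P\<^esub> F (i - 1)" .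
        show ?thesis unfolding e2
          by (rule add) (use Suc.IH[of r "Suc i"] Suc.IH[of "r \<otimes> a" "i - 1"] r a i i2 Fc in auto)
      qed
    qed
  qed
  \<comment> \<open>F_1 = 1, so the case i = 1 yields all monomials.\<close>
  have mono: "W (up_ring.monom P r k)" if "r \<in> carrier R" for r k
    using step[OF that, of 1 k] n that by (simp add: F_def')
  have "W (\<Oplus>\<^bsub>P\<^esub> i \<in> {..m}. up_ring.monom P (f i) i)" if "\<And>i. f i \<in> carrier R" for f and m :: nat
  proof (induction m)
    case 0
    then show ?case using mono that by simp
  next
    case (Suc m)
    have "(\<Oplus>\<^bsub>P\<^esub> i \<in> {..Suc m}. up_ring.monom P (f i) i) = up_ring.monom P (f (Suc m)) (Suc m) \<oplus>\<^bsub>P\<^esub> (\<Oplus>\<^bsub>P\<^esub> i \<in> {..m}. up_ring.monom P (f i) i)"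
      using that by (intro P.finsum_Suc) auto
    then show ?case using Suc mono[OF that] add that by (simp add: P.finsum_closed)
  qed
  from this[of "up_ring.coeff P p" "deg R p"] show ?thesis using up_repr[OF p] p by simp
qed

section \<open>The stable Green ring as a quotient of r(KG)[z]\<close>

context datum
begin

sublocale Q: green KA "rep_iso KA" by (rule C.K.green_iso)

abbreviation "RR \<equiv> Q.\<Gamma>"
abbreviation "SS \<equiv> H.T.\<Gamma>"

lemma RR_cring: "cring RR"
  by (rule Q.G_cringI)
    (simp add: Q.gc_tens[symmetric] Q.gc_iso[OF C.K_tens(1) C.K_tens(1) C.rep_tensor_comm])

text \<open>Inflation along the projection of H to KG with y sent to 0 respects direct sums, tensor
  products and the unit.\<close>

lemma infl_hom_ex: "\<exists>h. h \<in> Ring.ring_hom RR SS \<and> (\<forall>V. is_rep KA V \<longrightarrow> h (Q.gc V) = H.T.gc (infl V))"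
proof (rule Q.G_ring_universal[OF H.T.ring_G, of "\<lambda>V. H.T.gc (infl V)"])
  show "H.T.gc (infl V) \<in> carrier SS" if "is_rep KA V" for V
    by (rule H.T.gc_closed[OF infl(1)[OF that]])
  show "H.T.gc (infl V) = H.T.gc (infl W)" if "is_rep KA V" "is_rep KA W" "rep_iso KA V W" for V W
    by (rule H.T.gc_iso[OF infl(1) infl(1) infl_iso]) fact+
  show "H.T.gc (infl (rep_sum V W)) = H.T.gc (infl V) \<oplus>\<^bsub>SS\<^esub> H.T.gc (infl W)" if "is_rep KA V" "is_rep KA W" for V W
    using H.T.gc_iso[OF infl(1)[OF C.K.rep_sum_rep[OF that]] H.rep_sum_rep[OF infl(1)[OF that(1)] infl(1)[OF that(2)]] infl_sum[OF that]]
      H.T.gc_sum[OF infl(1)[OF that(1)] infl(1)[OF that(2)]] by simp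
  show "H.T.gc (infl (rep_tensor KA V W)) = H.T.gc (infl V) \<otimes>\<^bsub>SS\<^esub> H.T.gc (infl W)" if "is_rep KA V" "is_rep KA W" for V W
    using H.T.gc_iso[OF infl(1)[OF C.K_tens(1)[OF that]] H_tens(1)[OF infl(1)[OF that(1)] infl(1)[OF that(2)]] infl_tens[OF that]]
      H.T.gc_tens[OF infl(1)[OF that(1)] infl(1)[OF that(2)]] by simp
  show "H.T.gc (infl E) = \<one>\<^bsub>SS\<^esub>"
    using H.T.gc_iso[OF infl(1)[OF C.K_unit(1)] H_unit(1) infl_unit] H.T.gc_unit by simp
  fix h assume "h \<in> Ring.ring_hom RR SS" "\<And>V. is_rep KA V \<Longrightarrow> h (Q.gc V) = H.T.gc (infl V)"
  then show ?thesis by blast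
qed

definition ih where "ih = (SOME h. h \<in> Ring.ring_hom RR SS \<and> (\<forall>V. is_rep KA V \<longrightarrow> h (Q.gc V) = H.T.gc (infl V)))"

lemma ih: "ih \<in> Ring.ring_hom RR SS" and ih_gc: "is_rep KA V \<Longrightarrow> ih (Q.gc V) = H.T.gc (infl V)"
  using someI_ex[OF infl_hom_ex] unfolding ih_def by blast+

lemma gc_Jm:
  assumes "is_rep KA V" "i \<le> n"
  shows "H.T.gc (Jm i V) = H.T.gc (infl V) \<otimes>\<^bsub>SS\<^esub> H.T.gc (L i)"
  using H.T.gc_iso[OF H_tens(1)[OF infl(1)[OF assms(1)] L_rep[OF assms(2)]] Jm_rep[OF assms] infl_tens_L[OF assms]]
    H.T.gc_tens[OF infl(1)[OF assms(1)] L_rep[OF assms(2)]] by simp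

lemma gc_L1: "H.T.gc (L (Suc 0)) = \<one>\<^bsub>SS\<^esub>"
  using H.T.gc_iso[OF L_rep H_unit(1) L_1] H.T.gc_unit n2 by simp

lemma gc_rec:
  assumes "2 \<le> i" "i < n"
  shows "H.T.gc (L 2) \<otimes>\<^bsub>SS\<^esub> H.T.gc (L i) = H.T.gc (L (Suc i)) \<oplus>\<^bsub>SS\<^esub> H.T.gc (infl chi1) \<otimes>\<^bsub>SS\<^esub> H.T.gc (L (i - 1))"
proof -
  have le: "i \<le> n" "i + 1 \<le> n" "i - 1 \<le> n" using assms by auto
  note r = L_rep[OF n2] L_rep[OF le(1)] L_rep[OF le(2)] Jm_rep[OF chi1(1) le(3)]
  have "H.T.gc (L 2) \<otimes>\<^bsub>SS\<^esub> H.T.gc (L i) = H.T.gc (rep_tensor H (L 2) (L i))"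
    by (rule H.T.gc_tens[OF r(1,2), symmetric])
  also have "\<dots> = H.T.gc (rep_sum (L (i + 1)) (Jm (i - 1) chi1))"
    by (rule H.T.gc_iso[OF H_tens(1)[OF r(1,2)] H.rep_sum_rep[OF r(3,4)] L2_tens_L[OF assms]])
  also have "\<dots> = H.T.gc (L (i + 1)) \<oplus>\<^bsub>SS\<^esub> H.T.gc (Jm (i - 1) chi1)"
    by (rule H.T.gc_sum[OF r(3,4)])
  finally show ?thesis using gc_Jm[OF chi1(1) le(3)] by simp
qed

text \<open>Together with the recursion this is the relation F_n(a, z) = 0.\<close>

lemma gc_Ln: "H.T.gc (L n) = \<zero>\<^bsub>SS\<^esub>"
  unfolding L_def by (rule H.T_projective_zero[OF Jm_projective[OF C.K_unit(1)]])

lemma gc_L_step: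
  assumes "2 \<le> i" "i < n"
  shows "H.T.gc (L (Suc i)) = H.T.gc (L 2) \<otimes>\<^bsub>SS\<^esub> H.T.gc (L i) \<ominus>\<^bsub>SS\<^esub> H.T.gc (infl chi1) \<otimes>\<^bsub>SS\<^esub> H.T.gc (L (i - 1))"
proof -
  interpret S: ring SS by (rule H.T.ring_G)
  have c: "H.T.gc (L (Suc i)) \<in> carrier SS" "H.T.gc (infl chi1) \<otimes>\<^bsub>SS\<^esub> H.T.gc (L (i - 1)) \<in> carrier SS"
    using assms by (auto intro!: S.m_closed H.T.gc_closed L_rep infl(1) chi1(1))
  show ?thesis unfolding gc_rec[OF assms] a_minus_def
    using c by (simp add: S.a_assoc S.r_neg)
qed

lemma L_induct [consumes 2, case_names one two step]:
  assumes "1 \<le> i" "i \<le> n" "P (Suc 0)" "P 2"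
    and step: "\<And>i. 2 \<le> i \<Longrightarrow> i < n \<Longrightarrow> P i \<Longrightarrow> P (i - 1) \<Longrightarrow> P (Suc i)"
  shows "P i"
  using assms(1,2)
proof (induction i rule: less_induct)
  case (less i)
  consider "i = 1" | "i = 2" | "3 \<le> i" using less.prems by linarith
  then show ?case
  proof cases
    case 3
    then have "P (Suc (i - 1))" using less.prems by (intro step less.IH) auto
    then show ?thesis using 3 by simp
  qed (use assms(3,4) in auto)
qed

text \<open>Evaluation of polynomials at [L 2] requires a commutative target. Inflated classes
  commute with each other and with [L 2]. By the recursion every [L i] is a polynomial in [L 2] and
  the class of \<open>chi1\<close>, so it commutes with whatever commutes with these two.\<close>

lemma SS_cring: "cring SS"
proof (rule H.T.G_cringI)
  interpret S: ring SS by (rule H.T.ring_G)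
  interpret R: cring RR by (rule RR_cring)
  let ?c = "\<lambda>x y. x \<otimes>\<^bsub>SS\<^esub> y = y \<otimes>\<^bsub>SS\<^esub> x"
  let ?g = "H.T.gc"
  note Vc = H.T.gc_closed[OF infl(1)] and Lc = H.T.gc_closed[OF L_rep]
  have VW: "?c (?g (infl V)) (?g (infl W))" if "is_rep KA V" "is_rep KA W" for V W
    using ring_hom_mult[OF ih Q.gc_closed[OF that(1)] Q.gc_closed[OF that(2)]]
      ring_hom_mult[OF ih Q.gc_closed[OF that(2)] Q.gc_closed[OF that(1)]]
      R.m_comm[OF Q.gc_closed[OF that(1)] Q.gc_closed[OF that(2)]] that by (simp add: ih_gc)
  have VL2: "?c (?g (L 2)) (?g (infl V))" if V: "is_rep KA V" for V
    using H.T.gc_iso[OF Jm_rep[OF V n2] H_tens(1)[OF L_rep[OF n2] infl(1)[OF V]] L2_tens_infl[OF V]]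
      H.T.gc_tens[OF L_rep[OF n2] infl(1)[OF V]] gc_Jm[OF V n2] by simp
  have Lx: "?c (?g (L i)) x" if "x \<in> carrier SS" "?c (?g (L 2)) x" "?c (?g (infl chi1)) x" "1 \<le> i" "i \<le> n" for x i
    using that(4,5)
  proof (induction i rule: L_induct)
    case one
    then show ?case using that(1) by (simp add: gc_L1)
  next
    case (step i)
    then have le: "i \<le> n" "i - 1 \<le> n" by auto
    show ?case unfolding gc_L_step[OF step(1,2)]
      by (intro S.commute_closed S.m_closed Lc n2 le Vc chi1(1) that(1-3) step(3,4))
  qed (rule that(2))
  have LV: "?c (?g (L i)) (?g (infl V))" if "is_rep KA V" "1 \<le> i" "i \<le> n" for i V
    by (rule Lx[OF Vc[OF that(1)] VL2[OF that(1)] VW[OF chi1(1) that(1)] that(2,3)])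
  have L2L: "?c (?g (L i)) (?g (L 2))" if "1 \<le> i" "i \<le> n" for i
    by (rule Lx[OF Lc[OF n2] refl VL2[OF chi1(1), symmetric] that])
  have LL: "?c (?g (L i)) (?g (L j))" if "1 \<le> i" "i \<le> n" "1 \<le> j" "j \<le> n" for i j
    by (rule Lx[OF Lc[OF that(4)] L2L[OF that(3,4), symmetric] LV[OF chi1(1) that(3,4), symmetric] that(1,2)])
  have JJ: "?c (?g (Jm i V)) (?g (Jm j W))" if "1 \<le> i" "i \<le> n" "is_rep KA V" "1 \<le> j" "j \<le> n" "is_rep KA W" for i j V W
    unfolding gc_Jm[OF that(3,2)] gc_Jm[OF that(6,5)]
  proof (rule S.commute_closed(3))
    note c = Vc[OF that(3)] Lc[OF that(2)] Vc[OF that(6)] Lc[OF that(5)]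
    show "?c (?g (infl V)) (?g (infl W) \<otimes>\<^bsub>SS\<^esub> ?g (L j))"
      by (rule S.commute_closed(3)[OF c(3,4,1), symmetric]) (rule VW[OF that(6,3)] LV[OF that(3,4,5)])+
    show "?c (?g (L i)) (?g (infl W) \<otimes>\<^bsub>SS\<^esub> ?g (L j))"
      by (rule S.commute_closed(3)[OF c(3,4,2), symmetric]) (rule LV[OF that(6,1,2), symmetric] LL[OF that(4,5,1,2)])+
  qed (intro S.m_closed Vc Lc that)+
  have all: "?c (?g M) x" if x: "x \<in> carrier SS" "\<And>i V. 1 \<le> i \<Longrightarrow> i \<le> n \<Longrightarrow> is_rep KA V \<Longrightarrow> ?c (?g (Jm i V)) x"
    and "is_rep H M" for x M
    using that(3)
  proof (induction M rule: H_rep_induct)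
    case (iso M N)
    then show ?case using H.T.gc_iso[OF iso(1-3)] by simp
  next
    case (zero M)
    then show ?case using H.T.gc_zero_dim[OF zero] x(1) by simp
  next
    case (jm i V)
    then show ?case using x(2)[of i V] by simp
  next
    case (sum M N)
    show ?case unfolding H.T.gc_sum[OF sum(1,2)]
      by (rule S.commute_closed(1)[OF H.T.gc_closed[OF sum(1)] H.T.gc_closed[OF sum(2)] x(1) sum(3,4)])
  qed
  fix M N assume M: "is_rep H M" and N: "is_rep H N"
  have "?c (?g N) (?g (Jm i V))" if "1 \<le> i" "i \<le> n" "is_rep KA V" for i V
    by (rule all[OF H.T.gc_closed[OF Jm_rep[OF that(3,2)]] JJ[OF _ _ _ that] N])
  then show "?c (?g M) (?g N)" by (intro all[OF H.T.gc_closed[OF N] _ M]) (rule sym)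
qed

definition FF where
  "FF i = dickson (UP RR) i (up_ring.monom (UP RR) (Q.gc chi1) 0) (up_ring.monom (UP RR) \<one>\<^bsub>RR\<^esub> 1)"

lemma gc_layer_Jm:
  assumes V: "is_rep KA V" and i: "0 < i" "i \<le> n" and j: "Suc j < n"
  shows "Q.gc (layer j (Jm i V)) = (if i = Suc j then Q.gc V else \<zero>\<^bsub>RR\<^esub>)"
proof -
  note J = Jm_rep[OF V i(2)]
  have l: "is_rep KA (layer j (Jm i V))" using layer[OF J] by blast
  show ?thesis
  proof (cases "i = Suc j")
    case True
    have "rep_iso KA (layer j (Jm i V)) V"
      by (rule layer_iso[OF J V _ j]) (use soc_Jm[OF V, of j] i True in blast)
    then show ?thesis using Q.gc_iso[OF l V] True by simp
  next
    case False
    have "rep_iso KA (layer j (Jm i V)) C.K.zrep"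
      by (rule layer_iso[OF J C.K.zrep_rep soc_Jm_other[OF V i False C.K.fst_zrep] j])
    then show ?thesis using Q.gc_iso[OF l C.K.zrep_rep] Q.gc_zero_dim[OF C.K.zrep_rep C.K.fst_zrep] False by simp
  qed
qed

text \<open>Evaluation \<Phi> at [L 2] is onto by \<open>H_rep_induct\<close>. Its kernel is bounded
  by an additive map \<open>w\<close> in the opposite direction, which sends [M] to the residue
  class of the sum of [layer j M] F_(j+1): \<open>w\<close> after \<Phi> is the residue map.\<close>

theorem SS_iso: "SS \<simeq> UP RR Quot (Idl\<^bsub>UP RR\<^esub> {FF n})"
proof -
  interpret R: cring RR by (rule RR_cring)
  interpret S: cring SS by (rule SS_cring)
  interpret U: UP_pre_univ_prop RR SS ih "UP RR" by (rule UP_pre_univ_propI[OF RR_cring SS_cring ih])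
  let ?P = "UP RR" and ?g = "H.T.gc"
  let ?m = "up_ring.monom ?P"
  let ?A = "?m (Q.gc chi1) 0" and ?X = "?m \<one>\<^bsub>RR\<^esub> 1"
  have ac: "Q.gc chi1 \<in> carrier RR" by (rule Q.gc_closed[OF chi1(1)])
  have zc: "?g (L 2) \<in> carrier SS" by (rule H.T.gc_closed[OF L_rep[OF n2]])
  have Ac: "?A \<in> carrier ?P" and Xc: "?X \<in> carrier ?P"
    by (rule U.monom_closed[OF ac], rule U.monom_closed[OF R.one_closed])
  have Fc: "FF i \<in> carrier ?P" for i unfolding FF_def by (rule dickson_closed[OF U.P.ring_axioms Ac Xc])
  have cc: "?m r 0 \<in> carrier ?P" if "r \<in> carrier RR" for r by (rule U.monom_closed[OF that])
  define \<Phi> where "\<Phi> = eval RR SS ih (?g (L 2))"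
  have \<Phi>: "\<Phi> \<in> Ring.ring_hom ?P SS" unfolding \<Phi>_def by (rule U.eval_ring_hom[OF zc])
  interpret \<Phi>: ring_hom_ring ?P SS \<Phi> by (rule ring_hom_ringI2[OF U.P.ring_axioms S.ring_axioms \<Phi>])
  have \<Phi>c: "\<Phi> (?m r 0) = ih r" if "r \<in> carrier RR" for r unfolding \<Phi>_def by (rule U.eval_const[OF zc that])
  have \<Phi>X: "\<Phi> ?X = ?g (L 2)" unfolding \<Phi>_def by (rule U.eval_monom1[OF zc])
  have \<Phi>A: "\<Phi> ?A = ?g (infl chi1)" using \<Phi>c[OF ac] ih_gc[OF chi1(1)] by (rule trans)
  have \<Phi>F: "\<Phi> (FF i) = ?g (L i)" if "1 \<le> i" "i \<le> n" for i
    using that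
  proof (induction i rule: L_induct)
    case one
    have "FF (Suc 0) = \<one>\<^bsub>?P\<^esub>" by (simp only: FF_def dickson.simps)
    then show ?case using \<Phi>.hom_one gc_L1 by simp
  next
    case two
    have "FF 2 = ?X" by (simp only: FF_def numeral_2_eq_2 dickson.simps)
    then show ?case using \<Phi>X by simp
  next
    case (step i)
    obtain j where j: "i = Suc (Suc j)" using step(1) by (metis add_2_eq_Suc le_Suc_ex)
    have "FF (Suc i) = ?X \<otimes>\<^bsub>?P\<^esub> FF i \<ominus>\<^bsub>?P\<^esub> ?A \<otimes>\<^bsub>?P\<^esub> FF (i - 1)"
      unfolding FF_def j diff_Suc_1 by (rule dickson.simps(4))
    then have "\<Phi> (FF (Suc i)) = \<Phi> ?X \<otimes>\<^bsub>SS\<^esub> \<Phi> (FF i) \<ominus>\<^bsub>SS\<^esub> \<Phi> ?A \<otimes>\<^bsub>SS\<^esub> \<Phi> (FF (i - 1))"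
      unfolding a_minus_def
      by (simp only: \<Phi>.hom_add \<Phi>.hom_mult \<Phi>.hom_a_inv U.P.m_closed U.P.a_inv_closed Ac Xc Fc)
    then show ?case unfolding \<Phi>X \<Phi>A step(3,4) gc_L_step[OF step(1,2)] .
  qed
  have \<Phi>J: "\<Phi> (?m (Q.gc V) 0 \<otimes>\<^bsub>?P\<^esub> FF i) = ?g (Jm i V)" if "is_rep KA V" "1 \<le> i" "i \<le> n" for V i
    using \<Phi>.hom_mult[OF cc[OF Q.gc_closed[OF that(1)]] Fc[of i]]
    unfolding \<Phi>c[OF Q.gc_closed[OF that(1)]] ih_gc[OF that(1)] \<Phi>F[OF that(2,3)] gc_Jm[OF that(1,3)] .
  have img: "\<exists>p\<in>carrier ?P. \<Phi> p = ?g M" if "is_rep H M" for M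
    using that
  proof (induction M rule: H_rep_induct)
    case (iso M N)
    then show ?case using H.T.gc_iso[OF iso(1-3)] by simp
  next
    case (zero M)
    then show ?case using H.T.gc_zero_dim[OF zero] \<Phi>.hom_zero U.P.zero_closed by metis
  next
    case (jm i V)
    then show ?case using \<Phi>J[of V i] U.P.m_closed[OF cc[OF Q.gc_closed[OF jm(3)]] Fc[of i]] by force
  next
    case (sum M N)
    then obtain p q where pq: "p \<in> carrier ?P" "\<Phi> p = ?g M" "q \<in> carrier ?P" "\<Phi> q = ?g N" by blast
    show ?case unfolding H.T.gc_sum[OF sum(1,2)] pq(2,4)[symmetric]
      using \<Phi>.hom_add[OF pq(1,3)] U.P.a_closed[OF pq(1,3)] by metis
  qed
  have surj: "\<Phi> ` carrier ?P = carrier SS"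
  proof
    show "\<Phi> ` carrier ?P \<subseteq> carrier SS" using \<Phi>.hom_closed by blast
    have "\<exists>p\<in>carrier ?P. \<Phi> p = x" if "x \<in> carrier SS" for x
      using that
    proof (induction x rule: H.T.G_induct)
      case zero
      show ?case using \<Phi>.hom_zero U.P.zero_closed by metis
    next
      case (gc M)
      then show ?case by (rule img)
    next
      case (diff a b)
      then obtain p q where pq: "p \<in> carrier ?P" "\<Phi> p = a" "q \<in> carrier ?P" "\<Phi> q = b" by blast
      have "\<Phi> (p \<oplus>\<^bsub>?P\<^esub> (\<ominus>\<^bsub>?P\<^esub> q)) = a \<ominus>\<^bsub>SS\<^esub> b"
        unfolding a_minus_def pq(2,4)[symmetric]
        by (simp only: \<Phi>.hom_add \<Phi>.hom_a_inv U.P.a_inv_closed pq(1,3))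
      then show ?case using U.P.a_closed[OF pq(1) U.P.a_inv_closed[OF pq(3)]] by blast
    qed
    then show "carrier SS \<subseteq> \<Phi> ` carrier ?P" by blast
  qed
  define J where "J = Idl\<^bsub>?P\<^esub> {FF n}"
  have idJ: "ideal J ?P" unfolding J_def by (rule U.P.genideal_ideal) (use Fc in blast)
  have FnJ: "FF n \<in> J" unfolding J_def using U.P.genideal_self[of "{FF n}"] Fc by blast
  interpret J: ideal J ?P by (rule idJ)
  interpret B: ring "?P Quot J" by (rule J.quotient_is_ring)
  interpret p: ring_hom_ring ?P "?P Quot J" "(+>\<^bsub>?P\<^esub>) J" by (rule J.rcos_ring_hom_ring)
  let ?p = "\<lambda>x. J +>\<^bsub>?P\<^esub> x"
  have Q0: "\<zero>\<^bsub>?P Quot J\<^esub> = J" unfolding FactRing_def by simp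
  have pJ: "?p x = \<zero>\<^bsub>?P Quot J\<^esub>" if "x \<in> J" for x
    unfolding Q0 by (rule J.a_rcos_const[OF that])
  define t where "t r j = ?p (?m r 0 \<otimes>\<^bsub>?P\<^esub> FF (Suc j))" for r j
  have tc: "t r j \<in> carrier (?P Quot J)" if "r \<in> carrier RR" for r j
    unfolding t_def by (rule p.hom_closed[OF U.P.m_closed[OF cc[OF that] Fc]])
  have tadd: "t (r \<oplus>\<^bsub>RR\<^esub> s) j = t r j \<oplus>\<^bsub>?P Quot J\<^esub> t s j" if "r \<in> carrier RR" "s \<in> carrier RR" for r s j
    unfolding t_def U.monom_add[OF that] U.P.l_distr[OF cc[OF that(1)] cc[OF that(2)] Fc]
    by (rule p.hom_add[OF U.P.m_closed[OF cc[OF that(1)] Fc] U.P.m_closed[OF cc[OF that(2)] Fc]])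
  have tmap: "(\<lambda>r. t r j) \<in> carrier RR \<rightarrow> carrier (?P Quot J)" for j using tc by blast
  have t0: "t \<zero>\<^bsub>RR\<^esub> j = \<zero>\<^bsub>?P Quot J\<^esub>" for j
    by (rule additive_map(1)[OF R.abelian_group_axioms B.abelian_group_axioms tmap tadd])
  have tdiff: "t (r \<ominus>\<^bsub>RR\<^esub> s) j = t r j \<ominus>\<^bsub>?P Quot J\<^esub> t s j"
    if "r \<in> carrier RR" "s \<in> carrier RR" for r s j
    by (rule additive_map(2)[OF R.abelian_group_axioms B.abelian_group_axioms tmap tadd that])
  \<comment> \<open>The layers with j < n - 1 belong to F_1, ..., F_(n-1). Layer n - 1 is left out:
    it is nonzero for projectives such as L n and hence no stable invariant.\<close>
  define f where "f M = finsum (?P Quot J) (\<lambda>j. t (Q.gc (layer j M)) j) {..<n - 1}" for M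
  have lc: "Q.gc (layer j M) \<in> carrier RR" if "is_rep H M" for j M
    by (rule Q.gc_closed) (use layer[OF that] in blast)
  have lt: "(\<lambda>j. t (Q.gc (layer j M)) j) \<in> {..<n - 1} \<rightarrow> carrier (?P Quot J)" if "is_rep H M" for M
    using tc[OF lc[OF that]] by blast
  obtain w where w: "w \<in> carrier SS \<rightarrow> carrier (?P Quot J)"
    "\<And>x y. x \<in> carrier SS \<Longrightarrow> y \<in> carrier SS \<Longrightarrow> w (x \<oplus>\<^bsub>SS\<^esub> y) = w x \<oplus>\<^bsub>?P Quot J\<^esub> w y"
    "\<And>M. is_rep H M \<Longrightarrow> w (?g M) = f M"
  proof (rule H.T.G_universal[OF B.abelian_group_axioms, of f])
    show "f M \<in> carrier (?P Quot J)" if "is_rep H M" for M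
      unfolding f_def by (rule B.finsum_closed[OF lt[OF that]])
    show "f M = f N" if "is_rep H M" "is_rep H N" "st_iso H M N" for M N
      unfolding f_def
    proof (rule B.finsum_cong'[OF refl lt[OF that(2)]])
      fix j assume "j \<in> {..<n - 1}"
      then have j: "Suc j < n" by auto
      have "Q.gc (layer j M) = Q.gc (layer j N)"
        by (rule Q.gc_iso[OF _ _ layer_st[OF that j]]) (use layer that in blast)+
      then show "t (Q.gc (layer j M)) j = t (Q.gc (layer j N)) j" by (rule arg_cong)
    qed
    show "f (rep_sum M N) = f M \<oplus>\<^bsub>?P Quot J\<^esub> f N" if "is_rep H M" "is_rep H N" for M N
      unfolding f_def B.finsum_addf[OF lt[OF that(1)] lt[OF that(2)], symmetric]
    proof (rule B.finsum_cong'[OF refl])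
      show "(\<lambda>j. t (Q.gc (layer j M)) j \<oplus>\<^bsub>?P Quot J\<^esub> t (Q.gc (layer j N)) j) \<in> {..<n - 1} \<rightarrow> carrier (?P Quot J)"
        using B.a_closed[OF tc[OF lc[OF that(1)]] tc[OF lc[OF that(2)]]] by blast
      fix j assume "j \<in> {..<n - 1}"
      then have j: "Suc j < n" by auto
      have l: "is_rep KA (layer j M)" "is_rep KA (layer j N)" "is_rep KA (layer j (rep_sum M N))"
        using layer that H.rep_sum_rep[OF that] by blast+
      have "Q.gc (layer j (rep_sum M N)) = Q.gc (layer j M) \<oplus>\<^bsub>RR\<^esub> Q.gc (layer j N)"
        using Q.gc_iso[OF l(3) C.K.rep_sum_rep[OF l(1,2)] layer_sum[OF that j]] Q.gc_sum[OF l(1,2)] by (rule trans)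
      then show "t (Q.gc (layer j (rep_sum M N))) j = t (Q.gc (layer j M)) j \<oplus>\<^bsub>?P Quot J\<^esub> t (Q.gc (layer j N)) j"
        using tadd[OF lc[OF that(1)] lc[OF that(2)]] by (rule ssubst)
    qed
    fix w assume "w \<in> carrier SS \<rightarrow> carrier (?P Quot J)"
      "\<And>x y. x \<in> carrier SS \<Longrightarrow> y \<in> carrier SS \<Longrightarrow> w (x \<oplus>\<^bsub>SS\<^esub> y) = w x \<oplus>\<^bsub>?P Quot J\<^esub> w y"
      "\<And>M. is_rep H M \<Longrightarrow> w (?g M) = f M"
    then show thesis by (rule that)
  qed
  have w0: "w \<zero>\<^bsub>SS\<^esub> = \<zero>\<^bsub>?P Quot J\<^esub>"
    by (rule additive_map(1)[OF S.abelian_group_axioms B.abelian_group_axioms w(1,2)])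
  have wdiff: "w (x \<ominus>\<^bsub>SS\<^esub> y) = w x \<ominus>\<^bsub>?P Quot J\<^esub> w y"
    if "x \<in> carrier SS" "y \<in> carrier SS" for x y
    by (rule additive_map(2)[OF S.abelian_group_axioms B.abelian_group_axioms w(1,2) that])
  have fJ: "f (Jm i V) = t (Q.gc V) (i - 1)" if V: "is_rep KA V" and i: "1 \<le> i" "i < n" for V i
  proof -
    have i': "0 < i" "i \<le> n" "i - 1 \<in> {..<n - 1}" using i by auto
    have "f (Jm i V) = finsum (?P Quot J) (\<lambda>j. if i - 1 = j then t (Q.gc V) j else \<zero>\<^bsub>?P Quot J\<^esub>) {..<n - 1}"
      unfolding f_def
    proof (rule B.finsum_cong'[OF refl])
      show "(\<lambda>j. if i - 1 = j then t (Q.gc V) j else \<zero>\<^bsub>?P Quot J\<^esub>) \<in> {..<n - 1} \<rightarrow> carrier (?P Quot J)"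
        using tc[OF Q.gc_closed[OF V]] B.zero_closed by (intro funcsetI) (simp only: split: if_split, blast)
      fix j assume "j \<in> {..<n - 1}"
      then have j: "Suc j < n" by auto
      have e: "i = Suc j \<longleftrightarrow> i - 1 = j" using i by auto
      show "t (Q.gc (layer j (Jm i V))) j = (if i - 1 = j then t (Q.gc V) j else \<zero>\<^bsub>?P Quot J\<^esub>)"
        unfolding gc_layer_Jm[OF V i'(1,2) j] e by (cases "i - 1 = j") (simp_all only: simp_thms if_True if_False t0)
    qed
    also have "\<dots> = t (Q.gc V) (i - 1)"
      by (rule B.finsum_singleton[OF i'(3)]) (use tc[OF Q.gc_closed[OF V]] in blast)+
    finally show ?thesis .
  qed
  \<comment> \<open>By \<open>dickson_span\<close> it is enough to treat r F_i with i < n, where the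
    layers return the coefficient r, and multiples of F_n, where both sides are 0.\<close>
  have w\<Phi>: "w (\<Phi> x) = ?p x" if "x \<in> carrier ?P" for x
  proof (rule dickson_span[OF RR_cring ac n2 that])
    fix r i assume r: "r \<in> carrier RR" and i: "1 \<le> i" "i < n"
    have Li: "?g (L i) \<in> carrier SS" by (rule H.T.gc_closed[OF L_rep]) (use i in simp)
    have "w (ih r \<otimes>\<^bsub>SS\<^esub> ?g (L i)) = t r (i - 1)"
      using r
    proof (induction r rule: Q.G_induct)
      case zero
      show ?case unfolding \<Phi>c[OF R.zero_closed, symmetric] U.monom_zero \<Phi>.hom_zero S.l_null[OF Li]
        by (rule trans[OF w0 t0[symmetric]])
    next
      case (gc V)
      show ?case using w(3)[OF Jm_rep[OF gc]] fJ[OF gc i] i unfolding ih_gc[OF gc]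
        by (simp only: gc_Jm[OF gc] less_imp_le)
    next
      case (diff a b)
      have ab: "ih a \<in> carrier SS" "ih b \<in> carrier SS" using ring_hom_closed[OF ih] diff(1,2) by blast+
      have "ih (a \<ominus>\<^bsub>RR\<^esub> b) = ih a \<ominus>\<^bsub>SS\<^esub> ih b"
        by (rule additive_map(2)[OF R.abelian_group_axioms S.abelian_group_axioms _ ring_hom_add[OF ih] diff(1,2)])
          (use ring_hom_closed[OF ih] in blast)
      then have "w (ih (a \<ominus>\<^bsub>RR\<^esub> b) \<otimes>\<^bsub>SS\<^esub> ?g (L i)) = w (ih a \<otimes>\<^bsub>SS\<^esub> ?g (L i)) \<ominus>\<^bsub>?P Quot J\<^esub> w (ih b \<otimes>\<^bsub>SS\<^esub> ?g (L i))"
        using ring_diff_distr(2)[OF S.ring_axioms ab Li] wdiff[OF S.m_closed[OF ab(1) Li] S.m_closed[OF ab(2) Li]] by (simp only:)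
      then show ?case unfolding diff(3,4) tdiff[OF diff(1,2)] .
    qed
    moreover have "\<Phi> (?m r 0 \<otimes>\<^bsub>?P\<^esub> FF i) = ih r \<otimes>\<^bsub>SS\<^esub> ?g (L i)"
      using \<Phi>.hom_mult[OF cc[OF r] Fc] i unfolding \<Phi>c[OF r] by (simp only: \<Phi>F less_imp_le)
    moreover have "Suc (i - 1) = i" using i by simp
    ultimately show "w (\<Phi> (?m r 0 \<otimes>\<^bsub>?P\<^esub> dickson ?P i ?A ?X)) = ?p (?m r 0 \<otimes>\<^bsub>?P\<^esub> dickson ?P i ?A ?X)"
      unfolding FF_def[symmetric] t_def by (simp only:)
  next
    fix q assume q: "q \<in> carrier ?P"
    have "1 \<le> n" using n2 by simp
    then have "\<Phi> (q \<otimes>\<^bsub>?P\<^esub> FF n) = \<zero>\<^bsub>SS\<^esub>"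
      using \<Phi>.hom_mult[OF q Fc] \<Phi>F[OF _ order_refl] S.r_null[OF \<Phi>.hom_closed[OF q]] by (simp only: gc_Ln)
    moreover have "?p (q \<otimes>\<^bsub>?P\<^esub> FF n) = \<zero>\<^bsub>?P Quot J\<^esub>" by (rule pJ[OF J.I_l_closed[OF FnJ q]])
    ultimately show "w (\<Phi> (q \<otimes>\<^bsub>?P\<^esub> dickson ?P n ?A ?X)) = ?p (q \<otimes>\<^bsub>?P\<^esub> dickson ?P n ?A ?X)"
      unfolding FF_def[symmetric] using w0 by (simp only:)
  next
    fix x y assume xy: "x \<in> carrier ?P" "y \<in> carrier ?P" "w (\<Phi> x) = ?p x" "w (\<Phi> y) = ?p y"
    show "w (\<Phi> (x \<oplus>\<^bsub>?P\<^esub> y)) = ?p (x \<oplus>\<^bsub>?P\<^esub> y)"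
      unfolding \<Phi>.hom_add[OF xy(1,2)] w(2)[OF \<Phi>.hom_closed[OF xy(1)] \<Phi>.hom_closed[OF xy(2)]] xy(3,4)
      by (rule p.hom_add[OF xy(1,2), symmetric])
  qed
  have "a_kernel ?P SS \<Phi> = J"
  proof
    show "a_kernel ?P SS \<Phi> \<subseteq> J"
    proof
      fix x assume "x \<in> a_kernel ?P SS \<Phi>"
      then have x: "x \<in> carrier ?P" "\<Phi> x = \<zero>\<^bsub>SS\<^esub>" unfolding a_kernel_def' by blast+
      have "?p x = J" using w\<Phi>[OF x(1)] unfolding x(2) w0 Q0 by (rule sym)
      with J.a_rcos_self[OF x(1)] show "x \<in> J" by (rule subst[rotated])
    qed
    have "1 \<le> n" using n2 by simp
    then have "FF n \<in> a_kernel ?P SS \<Phi>"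
      unfolding a_kernel_def' using Fc \<Phi>F[OF _ order_refl] gc_Ln by (intro CollectI conjI) (simp_all only:)
    then show "J \<subseteq> a_kernel ?P SS \<Phi>"
      unfolding J_def by (intro U.P.genideal_minimal[OF \<Phi>.kernel_is_ideal]) blast
  qed
  then have "?P Quot J \<simeq> SS" using \<Phi>.FactRing_iso[OF surj] by (simp only:)
  then show ?thesis unfolding J_def[symmetric] by (rule ring_iso_sym[OF J.quotient_is_ring])
qed

end

theorem proposition6p1:
  fixes G :: "('g, 'm) monoid_scheme" (structure)
    and \<chi> :: "'g \<Rightarrow> 'k::{alg_closed_field, field_char_0}"
    and g :: 'g and n :: nat
  assumes "group G" and "finite (carrier G)"
    and "g \<in> carrier G" and "\<forall>h\<in>carrier G. g \<otimes> h = h \<otimes> g"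
    and "\<chi> \<in> hom G (units_of (class_ring :: 'k ring))"
    and "n = group.ord (units_of (class_ring :: 'k ring)) (\<chi> g)" and "n \<ge> 2"
  defines "H \<equiv> datum_hopf G \<chi> g n"
    and "R \<equiv> green_ring (group_alg G :: ('k, 'g) hopf)"
    and "a \<equiv> green_class (group_alg G) (char_rep G (\<lambda>h. inverse (\<chi> h)))"
  shows "stable_green_ring H \<simeq> green_ring H Quot proj_ideal H \<and>
         stable_green_ring H \<simeq>
           UP R Quot (Idl\<^bsub>UP R\<^esub>
             {dickson (UP R) n (up_ring.monom (UP R) a 0) (up_ring.monom (UP R) \<one>\<^bsub>R\<^esub> 1)})"
proof -
  interpret D: datum G \<chi> g n
    using assms(1-7) by (intro datum.intro fin_group.intro fin_group_axioms.intro datum_axioms.intro) auto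
  have H: "H = D.H" by (simp add: H_def D.H_def)
  have R: "R = D.RR" by (simp add: R_def green_ring_def)
  have a: "a = D.Q.gc D.chi1"
    by (simp add: a_def green_class_def D.Q.gc_def D.chi1_def)
  have "stable_green_ring H = D.SS" by (simp add: H stable_green_ring_def)
  then show ?thesis
    using D.H.stable_green_ring_iso D.SS_iso unfolding H R a D.FF_def by simp
qed

end
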